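(* Let $T>0$, let $\omega\subset(0,1)$ be a nonempty open set, and let $a_1,a_2$ be the coefficients described in the context. There exist positive constants $h_0$, $C$ and $C_1$, independent of $h$ and of the final datum, such that for every $N\in\mathbb{N}$ with $h=1/(N+1)\le h_0$ and every $z_T\in L^2_{\mathcal{F}_T}(\Omega;L^2_h(\mathcal{M}))$, the solution $(z,Z)$ of the backward stochastic semi-discrete parabolic equation $$\begin{cases} dz+D_h^2z\,dt=-(a_1z+a_2Z)\,dt+Z\,dB(t), & (x,t)\in\mathcal{M}\times(0,T),\\ z(0,t)=z(1,t)=0, & t\in(0,T),\\ z(x,T)=z_T(x), & x\in\mathcal{M},\end{cases}$$ satisfies $$\mathbb{E}\int_{\mathcal{M}}|z(0)|^2\le C\Big(\mathbb{E}\int_0^T\int_{\mathcal{M}}|Z|^2\,dt+\mathbb{E}\int_0^T\int_{\omega\cap\mathcal{M}}|z|^2\,dt+e^{-C_1/h}\,\mathbb{E}\int_{\mathcal{M}}|z_T|^2\Big).$$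
   Context: **Probability.** $(\Omega,\mathcal{F},\{\mathcal{F}_t\}_{t\ge0},\mathcal{P})$ is a complete filtered probability space carrying a one-dimensional standard Brownian motion $B(\cdot)$, and $\{\mathcal{F}_t\}$ is the natural filtration of $B$ augmented by the $\mathcal{P}$-null sets. For a Banach space $\mathcal{H}$: $L^2_{\mathcal{F}_T}(\Omega;\mathcal{H})$ is the space of $\mathcal{F}_T$-measurable $\mathcal{H}$-valued random variables with finite second moment; $L^2_{\mathbb{F}}(0,T;\mathcal{H})$ is the space of $\mathcal{H}$-valued adapted processes $X$ with $\mathbb{E}|X|^2_{L^2(0,T;\mathcal{H})}<\infty$; $L^2_{\mathbb{F}}(\Omega;C([0,T];\mathcal{H}))$ is the space of adapted continuous processes with $\mathbb{E}|X|^2_{C([0,T];\mathcal{H})}<\infty$; $L^\infty_{\mathbb{F}}(0,T;\mathcal{H})$ is the space of adapted essentially bounded processes. A solution of the backward equation is a pair $(z,Z)\in L^2_{\mathbb{F}}(\Omega;C([0,T];L^2_h(\mathcal{M})))\times L^2_{\mathbb{F}}(0,T;L^2_h(\mathcal{M}))$ ($z$ being extended by $0$ at $x=0,1$). **Mesh.** For $N\in\mathbb{N}$, $h=1/(N+1)$, $x_i=ih$ ($i=0,\dots,N+1$), and $\mathcal{M}=\{x_1,\dots,x_N\}$. For a function $z$ on $\{x_0,\dots,x_{N+1}\}$, $D_h^2z(x_i)=h^{-2}\big(z(x_{i+1})-2z(x_i)+z(x_{i-1})\big)$ for $x_i\in\mathcal{M}$. For a finite set $\mathcal{W}$ of mesh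 points, $\int_{\mathcal{W}}u:=h\sum_{x\in\mathcal{W}}u(x)$, and $L^2_h(\mathcal{W})$ is the space of real functions on $\mathcal{W}$ with inner product $\int_{\mathcal{W}}uv$. In particular $\int_{\omega\cap\mathcal{M}}u=h\sum_{x\in\mathcal{M}\cap\omega}u(x)$. **Coefficients.** $a_1,a_2\in L^\infty_{\mathbb{F}}(0,T;L^\infty(0,1))$, sampled at the mesh points, so that the norms $|a_j|_{L^\infty_{\mathbb{F}}(0,T;L^\infty_h(\mathcal{M}))}$ ($L^\infty_h(\mathcal{M})$ being the real functions on $\mathcal{M}$ with the max norm) are bounded uniformly in $h$. The constants may depend on $T$, $\omega$ and this uniform bound. *)

theory Defs
  imports "HOL-Probability.Probability"
begin

section \<open>Brownian motion and its augmented natural filtration\<close>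

definition brownian_filtration :: "'a measure \<Rightarrow> (real \<Rightarrow> 'a \<Rightarrow> real) \<Rightarrow> real \<Rightarrow> 'a measure" where
  "brownian_filtration M B t = sigma (space M)
     ((\<Union>s\<in>{0..t}. {B s -` A \<inter> space M | A. A \<in> sets borel}) \<union> null_sets M)"

locale brownian_space = prob_space M + complete_measure M for M :: "'a measure" +
  fixes B :: "real \<Rightarrow> 'a \<Rightarrow> real"
  assumes B_measurable: "\<And>t. 0 \<le> t \<Longrightarrow> B t \<in> borel_measurable M"
    and B_0: "AE w in M. B 0 w = 0"
    and B_continuous: "AE w in M. continuous_on {0..} (\<lambda>t. B t w)"
    and B_indep_increments:
      "\<And>(n::nat) (t :: nat \<Rightarrow> real). 0 \<le> t 0 \<Longrightarrow> (\<And>i. i < n \<Longrightarrow> t i < t (Suc i)) \<Longrightarrow>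
        indep_vars (\<lambda>_. borel) (\<lambda>i w. B (t (Suc i)) w - B (t i) w) {..<n}"
    and B_normal_increments:
      "\<And>s t. 0 \<le> s \<Longrightarrow> s < t \<Longrightarrow>
        distributed M lborel (\<lambda>w. B t w - B s w) (\<lambda>x. ennreal (normal_density 0 (sqrt (t - s)) x))"

lemma (in brownian_space) filtration_brownian: "filtration (space M) (brownian_filtration M B)"
proof
  show "space (brownian_filtration M B t) = space M" for t
    unfolding brownian_filtration_def
    by (rule space_measure_of) (auto dest: sets.sets_into_space)
  have sets_eq: "sets (brownian_filtration M B t) = sigma_sets (space M)
     ((\<Union>s\<in>{0..t}. {B s -` A \<inter> space M | A. A \<in> sets borel}) \<union> null_sets M)" for t
    unfolding brownian_filtration_def
    by (rule sets_measure_of) (auto dest: sets.sets_into_space)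
  show "sets (brownian_filtration M B s) \<subseteq> sets (brownian_filtration M B t)" if "s \<le> t" for s t
    unfolding sets_eq by (rule sigma_sets_mono') (use that in force)
qed

lemma (in brownian_space) sets_brownian_filtration:
  "sets (brownian_filtration M B t) \<subseteq> sets M"
proof -
  have "sets (brownian_filtration M B t) = sigma_sets (space M)
     ((\<Union>s\<in>{0..t}. {B s -` A \<inter> space M | A. A \<in> sets borel}) \<union> null_sets M)"
    unfolding brownian_filtration_def
    by (rule sets_measure_of) (auto dest: sets.sets_into_space)
  also have "\<dots> \<subseteq> sets M"
    by (rule sets.sigma_sets_subset) (auto intro: measurable_sets[OF B_measurable])
  finally show ?thesis .
qed


section \<open>Mesh functions\<close>

text \<open>A mesh function is represented by a function on the reals; only its values at the points
  \<open>0, h, 2h, \<dots>, 1\<close> matter.\<close>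

definition mesh_size :: "nat \<Rightarrow> real" where
  "mesh_size N = 1 / (real N + 1)"

definition mesh :: "nat \<Rightarrow> real set" where
  "mesh N = (\<lambda>i. real i * mesh_size N) ` {1..N}"

definition mesh_D2 :: "nat \<Rightarrow> (real \<Rightarrow> real) \<Rightarrow> real \<Rightarrow> real" where
  "mesh_D2 N u x = (u (x + mesh_size N) - 2 * u x + u (x - mesh_size N)) / (mesh_size N)\<^sup>2"

definition mesh_integral :: "nat \<Rightarrow> real set \<Rightarrow> (real \<Rightarrow> real) \<Rightarrow> real" where
  "mesh_integral N W u = mesh_size N * (\<Sum>x\<in>W. u x)"


section \<open>Spaces of random variables and processes\<close>

text \<open>A random variable \<open>X\<close> with values in the mesh functions is written \<open>X w x\<close>, a process
  \<open>X t w x\<close>, where \<open>w\<close> is the sample point. All spaces consist of representatives rather than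
  equivalence classes. Because \<open>L\<^sup>2_h\<close> is finite-dimensional, measurability is required
  componentwise.\<close>

definition adapted_process ::
  "'a measure \<Rightarrow> (real \<Rightarrow> 'a measure) \<Rightarrow> real \<Rightarrow> (real \<Rightarrow> 'a \<Rightarrow> real) \<Rightarrow> bool" where
  "adapted_process M F T X \<longleftrightarrow>
     (\<lambda>(t, w). X t w) \<in> borel_measurable (restrict_space lborel {0..T} \<Otimes>\<^sub>M M) \<and>
     (\<forall>t\<in>{0..T}. X t \<in> borel_measurable (F t))"

definition L2_rv :: "'a measure \<Rightarrow> 'a measure \<Rightarrow> nat \<Rightarrow> ('a \<Rightarrow> real \<Rightarrow> real) \<Rightarrow> bool" where
  "L2_rv M G N X \<longleftrightarrow>
     (\<forall>x\<in>mesh N. (\<lambda>w. X w x) \<in> borel_measurable G) \<and>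
     (\<integral>\<^sup>+w. ennreal (mesh_integral N (mesh N) (\<lambda>x. (X w x)\<^sup>2)) \<partial>M) < \<infinity>"

definition L2_process ::
  "'a measure \<Rightarrow> (real \<Rightarrow> 'a measure) \<Rightarrow> real \<Rightarrow> nat \<Rightarrow> (real \<Rightarrow> 'a \<Rightarrow> real \<Rightarrow> real) \<Rightarrow> bool" where
  "L2_process M F T N X \<longleftrightarrow>
     (\<forall>x\<in>mesh N. adapted_process M F T (\<lambda>t w. X t w x)) \<and>
     (\<integral>\<^sup>+w. (\<integral>\<^sup>+t\<in>{0..T}. ennreal (mesh_integral N (mesh N) (\<lambda>x. (X t w x)\<^sup>2)) \<partial>lborel) \<partial>M) < \<infinity>"

definition L2_continuous_process ::
  "'a measure \<Rightarrow> (real \<Rightarrow> 'a measure) \<Rightarrow> real \<Rightarrow> nat \<Rightarrow> (real \<Rightarrow> 'a \<Rightarrow> real \<Rightarrow> real) \<Rightarrow> bool" where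
  "L2_continuous_process M F T N X \<longleftrightarrow>
     (\<forall>x\<in>mesh N. adapted_process M F T (\<lambda>t w. X t w x)) \<and>
     (AE w in M. \<forall>x\<in>mesh N. continuous_on {0..T} (\<lambda>t. X t w x)) \<and>
     (\<integral>\<^sup>+w. (SUP t\<in>{0..T}. ennreal (mesh_integral N (mesh N) (\<lambda>x. (X t w x)\<^sup>2))) \<partial>M) < \<infinity>"

text \<open>Point values of an element of \<open>L\<^sup>\<infinity>(0,1)\<close> are not defined, so sampling refers to a fixed
  representative \<open>a t w x\<close>. Since an essential bound on \<open>(0,1)\<close> says nothing about the values at
  the countably many mesh points, the bound on the sampled coefficient, uniform over all meshes,
  is a separate predicate.\<close>

definition Linf_coefficient ::
  "'a measure \<Rightarrow> (real \<Rightarrow> 'a measure) \<Rightarrow> real \<Rightarrow> (real \<Rightarrow> 'a \<Rightarrow> real \<Rightarrow> real) \<Rightarrow> bool" where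
  "Linf_coefficient M F T a \<longleftrightarrow>
     (\<lambda>((t, w), x). a t w x) \<in> borel_measurable
        ((restrict_space lborel {0..T} \<Otimes>\<^sub>M M) \<Otimes>\<^sub>M restrict_space lborel {0<..<1}) \<and>
     (\<forall>t\<in>{0..T}. (\<lambda>(w, x). a t w x) \<in> borel_measurable (F t \<Otimes>\<^sub>M restrict_space lborel {0<..<1})) \<and>
     (\<exists>c. AE ((t, w), x) in (restrict_space lborel {0..T} \<Otimes>\<^sub>M M) \<Otimes>\<^sub>M restrict_space lborel {0<..<1}.
        \<bar>a t w x\<bar> \<le> c)"

definition mesh_coefficient_bound ::
  "'a measure \<Rightarrow> real \<Rightarrow> real \<Rightarrow> (real \<Rightarrow> 'a \<Rightarrow> real \<Rightarrow> real) \<Rightarrow> bool" where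
  "mesh_coefficient_bound M T K a \<longleftrightarrow>
     (\<forall>N. AE (t, w) in restrict_space lborel {0..T} \<Otimes>\<^sub>M M. \<forall>x\<in>mesh N. \<bar>a t w x\<bar> \<le> K)"


section \<open>The Ito integral\<close>

text \<open>\<open>(n, \<tau>, \<xi>)\<close> encodes the simple process equal to \<open>\<xi> i\<close> on \<open>(\<tau> i, \<tau> (i + 1)]\<close>, \<open>i < n\<close>.\<close>

definition simple_integrand ::
  "(real \<Rightarrow> 'a measure) \<Rightarrow> real \<Rightarrow> nat \<Rightarrow> (nat \<Rightarrow> real) \<Rightarrow> (nat \<Rightarrow> 'a \<Rightarrow> real) \<Rightarrow> bool" where
  "simple_integrand F T n \<tau> \<xi> \<longleftrightarrow>
     0 \<le> \<tau> 0 \<and> (\<forall>i<n. \<tau> i \<le> \<tau> (Suc i)) \<and> \<tau> n \<le> T \<and>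
     (\<forall>i<n. \<xi> i \<in> borel_measurable (F (\<tau> i)) \<and> (\<exists>c. \<forall>w\<in>space (F (\<tau> i)). \<bar>\<xi> i w\<bar> \<le> c))"

definition simple_process ::
  "nat \<Rightarrow> (nat \<Rightarrow> real) \<Rightarrow> (nat \<Rightarrow> 'a \<Rightarrow> real) \<Rightarrow> real \<Rightarrow> 'a \<Rightarrow> real" where
  "simple_process n \<tau> \<xi> t w = (\<Sum>i<n. \<xi> i w * indicator {\<tau> i<..\<tau> (Suc i)} t)"

definition simple_ito_integral ::
  "(real \<Rightarrow> 'a \<Rightarrow> real) \<Rightarrow> nat \<Rightarrow> (nat \<Rightarrow> real) \<Rightarrow> (nat \<Rightarrow> 'a \<Rightarrow> real) \<Rightarrow> real \<Rightarrow> 'a \<Rightarrow> real" where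
  "simple_ito_integral B n \<tau> \<xi> t w =
     (\<Sum>i<n. \<xi> i w * (B (min t (\<tau> (Suc i))) w - B (min t (\<tau> i)) w))"

text \<open>\<open>J\<close> is a version of \<open>t \<mapsto> \<integral>\<^sub>0\<^sup>t Y dB\<close> on \<open>[0,T]\<close>; by the Ito isometry each \<open>J t\<close> is determined
  almost surely by \<open>Y\<close>.\<close>

definition is_ito_integral ::
  "'a measure \<Rightarrow> (real \<Rightarrow> 'a measure) \<Rightarrow> (real \<Rightarrow> 'a \<Rightarrow> real) \<Rightarrow> real \<Rightarrow>
   (real \<Rightarrow> 'a \<Rightarrow> real) \<Rightarrow> (real \<Rightarrow> 'a \<Rightarrow> real) \<Rightarrow> bool" where
  "is_ito_integral M F B T Y J \<longleftrightarrow>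
     (\<forall>t\<in>{0..T}. J t \<in> borel_measurable M) \<and>
     (\<exists>n \<tau> \<xi>. (\<forall>k::nat. simple_integrand F T (n k) (\<tau> k) (\<xi> k)) \<and>
        (\<lambda>k. \<integral>\<^sup>+w. (\<integral>\<^sup>+t\<in>{0..T}. ennreal ((simple_process (n k) (\<tau> k) (\<xi> k) t w - Y t w)\<^sup>2) \<partial>lborel) \<partial>M)
          \<longlonglongrightarrow> 0 \<and>
        (\<forall>t\<in>{0..T}.
          (\<lambda>k. \<integral>\<^sup>+w. ennreal ((simple_ito_integral B (n k) (\<tau> k) (\<xi> k) t w - J t w)\<^sup>2) \<partial>M) \<longlonglongrightarrow> 0))"


section \<open>The backward semi-discrete equation\<close>

text \<open>The stochastic differential equation is understood in integrated form.\<close>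

definition backward_solution ::
  "'a measure \<Rightarrow> (real \<Rightarrow> 'a measure) \<Rightarrow> (real \<Rightarrow> 'a \<Rightarrow> real) \<Rightarrow> real \<Rightarrow> nat \<Rightarrow>
   (real \<Rightarrow> 'a \<Rightarrow> real \<Rightarrow> real) \<Rightarrow> (real \<Rightarrow> 'a \<Rightarrow> real \<Rightarrow> real) \<Rightarrow> ('a \<Rightarrow> real \<Rightarrow> real) \<Rightarrow>
   (real \<Rightarrow> 'a \<Rightarrow> real \<Rightarrow> real) \<Rightarrow> (real \<Rightarrow> 'a \<Rightarrow> real \<Rightarrow> real) \<Rightarrow> bool" where
  "backward_solution M F B T N a1 a2 zT z Z \<longleftrightarrow>
     L2_continuous_process M F T N z \<and>
     L2_process M F T N Z \<and>
     (\<forall>t\<in>{0..T}. \<forall>w\<in>space M. z t w 0 = 0 \<and> z t w 1 = 0) \<and>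
     (\<forall>x\<in>mesh N. \<exists>J. is_ito_integral M F B T (\<lambda>t w. Z t w x) J \<and>
        (\<forall>t\<in>{0..T}. AE w in M.
           z t w x = z 0 w x
             - (LINT s:{0..t}|lborel. mesh_D2 N (z s w) x + a1 s w x * z s w x + a2 s w x * Z s w x)
             + J t w)) \<and>
     (\<forall>x\<in>mesh N. AE w in M. z T w x = zT w x)"

end

theory Submission
  imports Defs
begin

text \<open>
  The stochastic problem is reduced to a pathwise one. Let \<open>J(t) = z(t) - z(0) + \<integral>\<^sub>0\<^sup>t (D\<^sub>h\<^sup>2 z + a\<^sub>1 z + a\<^sub>2 Z) ds\<close>
  be the Ito integral of \<open>Z\<close>, and let \<open>q\<close> be the (non-adapted) solution of \<open>dq + D\<^sub>h\<^sup>2 q dt = dJ\<close>,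
  \<open>q(T) = 0\<close>, that is \<open>q(t) = - \<integral>\<^sub>t\<^sup>T e\<^bsup>(s - t) D\<^esup> dJ(s)\<close> with \<open>D = D\<^sub>h\<^sup>2\<close>. Expanding in the discrete sine basis
  and integrating by parts, the Ito isometry gives \<open>E|q(t)|\<^sup>2 \<le> 64 E \<integral> |Z|\<^sup>2\<close> uniformly in \<open>t\<close> and \<open>h\<close>.
  The difference \<open>p = z - q\<close> solves, path by path, the deterministic backward heat equation
  \<open>p' + D\<^sub>h\<^sup>2 p + a\<^sub>1 p = - (a\<^sub>1 q + a\<^sub>2 Z)\<close> with \<open>p(T) = z(T)\<close>.

  For that equation a semi-discrete Carleman estimate is proved with the weight \<open>exp (\<sigma>(t) \<psi>(x))\<close>, where
  \<open>\<psi>(x) = (1 + x)\<^sup>2/2 - 3\<close> is convex, increasing and negative, and \<open>\<sigma>(t) = 1 / (h + c t (T - t))\<close>. Since \<open>\<psi>\<close> is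
  quadratic, the commutator of the symmetric and antisymmetric parts of the conjugated difference operator can be
  computed exactly, without expansion in \<open>h\<close>. At \<open>t = 0, T\<close> one has \<open>\<sigma> = 1/h\<close>, which produces the remainder
  \<open>e\<^bsup>-1/h\<^esup>\<close>. The mesh is cut at an interval inside \<open>\<omega>\<close>: the part on the left is treated directly, the part on
  the right by reflection, and the gradient terms of the cutoff are absorbed by a Caccioppoli estimate.
\<close>

section \<open>Absolutely continuous functions\<close>

text \<open>The reduction is made so that no Ito formula is ever applied to \<open>z\<close>: the
  noise enters only through second moments of \<open>q\<close>, and \<open>p\<close> is then an
  absolutely continuous path for which the ordinary product rule suffices. Both \<open>q\<close> and
  \<open>p\<close> look into the future, which is harmless because nothing is integrated against
  \<open>B\<close> afterwards. Since \<open>Z\<close> is merely square integrable in time,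
  \<open>p\<close> has a density but no derivative at every time; hence the integral form
  \<open>has_primitive\<close>. Two constraints shape the Carleman part. Hyperbolic functions of
  \<open>\<sigma> h\<close> must stay bounded, so \<open>\<sigma>\<close> cannot blow up at the end
  times and boundary terms survive there; they become the exponentially small remainder. And since
  \<open>\<psi>\<close> increases, the boundary term at the right end has the wrong sign, so the
  function must vanish near 1; hence one cutoff for each side and the reflection. The part of the
  remainder that sits at time 0 is carried to time \<open>T\<close> by the energy estimate.\<close>

definition has_primitive :: "real \<Rightarrow> (real \<Rightarrow> real) \<Rightarrow> (real \<Rightarrow> real) \<Rightarrow> bool" where
  "has_primitive T U u \<longleftrightarrow> set_integrable lborel {0..T} U \<and>
     (\<forall>t\<in>{0..T}. u t = u 0 + (LINT s:{0..t}|lborel. U s))"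

lemma has_primitive_integrable: "has_primitive T U u \<Longrightarrow> set_integrable lborel {0..T} U"
  unfolding has_primitive_def by blast

lemma has_primitive_integrable_sub:
  "has_primitive T U u \<Longrightarrow> t \<le> T \<Longrightarrow> set_integrable lborel {0..t} U"
  by (rule set_integrable_subset[OF has_primitive_integrable]) auto

lemma has_primitive_eq:
  "has_primitive T U u \<Longrightarrow> 0 \<le> t \<Longrightarrow> t \<le> T \<Longrightarrow> u t = u 0 + (LINT s:{0..t}|lborel. U s)"
  unfolding has_primitive_def by (meson atLeastAtMost_iff)

lemma has_primitive_continuous:
  assumes "has_primitive T U u" shows "continuous_on {0..T} u"
proof -
  have I: "set_integrable lebesgue {0..T} U"
    using has_primitive_integrable[OF assms] unfolding set_integrable_def
    by (simp add: integrable_completion)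
  have "U integrable_on {0..T}" using I by (rule set_lebesgue_integral_eq_integral)
  then have "continuous_on {0..T} (\<lambda>t. u 0 + integral {0..t} U)"
    by (intro continuous_intros indefinite_integral_continuous_1)
  moreover have "u 0 + integral {0..t} U = u t" if t: "t \<in> {0..T}" for t
  proof -
    have "set_integrable lborel {0..t} U" using has_primitive_integrable_sub[OF assms] t by auto
    from set_borel_integral_eq_integral(2)[OF this] show ?thesis
      using has_primitive_eq[OF assms, of t] t by simp
  qed
  ultimately show ?thesis by (metis (no_types, lifting) continuous_on_cong)
qed

lemma has_primitive_cong:
  assumes "has_primitive T U u" "T \<ge> 0" "\<And>t. t \<in> {0..T} \<Longrightarrow> u t = v t"
    "\<And>t. t \<in> {0..T} \<Longrightarrow> U t = V t"
  shows "has_primitive T V v"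
proof -
  have "set_integrable lborel {0..T} V"
    using assms(1) unfolding has_primitive_def
    by (metis (no_types, lifting) assms(4) set_integrable_cong)
  moreover have "v t = v 0 + (LINT s:{0..t}|lborel. V s)" if "t \<in> {0..T}" for t
  proof -
    have "(LINT s:{0..t}|lborel. V s) = (LINT s:{0..t}|lborel. U s)"
      using that assms(4) by (intro set_lebesgue_integral_cong) auto
    then show ?thesis using has_primitive_eq[OF assms(1), of t] that assms(2,3) by auto
  qed
  ultimately show ?thesis unfolding has_primitive_def by blast
qed

lemma has_primitive_add:
  assumes "has_primitive T U u" "has_primitive T V v"
  shows "has_primitive T (\<lambda>t. U t + V t) (\<lambda>t. u t + v t)"
  unfolding has_primitive_def
proof (intro conjI ballI)
  show "set_integrable lborel {0..T} (\<lambda>t. U t + V t)"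
    using assms has_primitive_integrable by (intro set_integral_add) auto
  fix t assume t: "t \<in> {0..T}"
  have "(LINT s:{0..t}|lborel. U s + V s) = (LINT s:{0..t}|lborel. U s) + (LINT s:{0..t}|lborel. V s)"
    using assms t by (intro set_integral_add has_primitive_integrable_sub) auto
  then show "u t + v t = u 0 + v 0 + (LINT s:{0..t}|lborel. U s + V s)"
    using has_primitive_eq[OF assms(1), of t] has_primitive_eq[OF assms(2), of t] t by auto
qed

lemma has_primitive_const: "has_primitive T (\<lambda>_. 0) (\<lambda>_. c)"
  by (simp add: has_primitive_def set_integrable_def)

lemma has_primitive_sum:
  assumes "finite I" "\<And>i. i \<in> I \<Longrightarrow> has_primitive T (U i) (u i)"
  shows "has_primitive T (\<lambda>t. \<Sum>i\<in>I. U i t) (\<lambda>t. \<Sum>i\<in>I. u i t)"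
  using assms by (induction rule: finite_induct) (auto intro: has_primitive_const has_primitive_add)

lemma has_primitive_cmult:
  assumes "has_primitive T U u" shows "has_primitive T (\<lambda>t. c * U t) (\<lambda>t. c * u t)"
  unfolding has_primitive_def
proof (intro conjI ballI)
  show "set_integrable lborel {0..T} (\<lambda>t. c * U t)"
    using has_primitive_integrable[OF assms] by simp
  fix t assume "t \<in> {0..T}"
  then show "c * u t = c * u 0 + (LINT s:{0..t}|lborel. c * U s)"
    using has_primitive_eq[OF assms, of t] by (simp add: distrib_left)
qed

lemma has_primitive_C1:
  assumes "\<And>t. t \<in> {0..T} \<Longrightarrow> (u has_real_derivative U t) (at t within {0..T})"
    and "continuous_on {0..T} U"
  shows "has_primitive T U u"
  unfolding has_primitive_def
proof (intro conjI ballI)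
  show I: "set_integrable lborel {0..T} U"
    unfolding set_integrable_def using borel_integrable_compact[OF compact_Icc assms(2)] by simp
  fix t assume t: "t \<in> {0..T}"
  have "(U has_integral (u t - u 0)) {0..t}"
  proof (rule fundamental_theorem_of_calculus)
    show "0 \<le> t" using t by simp
    fix x assume x: "x \<in> {0..t}"
    have "(u has_real_derivative U x) (at x within {0..t})"
      by (rule DERIV_subset[OF assms(1)]) (use x t in auto)
    then show "(u has_vector_derivative U x) (at x within {0..t})"
      by (simp add: has_real_derivative_iff_has_vector_derivative)
  qed
  moreover have "set_integrable lborel {0..t} U" by (rule set_integrable_subset[OF I]) (use t in auto)
  ultimately show "u t = u 0 + (LINT s:{0..t}|lborel. U s)"
    by (simp add: set_borel_integral_eq_integral(2) integral_unique)
qed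

section \<open>Products of absolutely continuous functions\<close>

lemma set_integrable_continuous_mult:
  fixes f g :: "real \<Rightarrow> real"
  assumes "set_integrable lborel {0..T} f" "continuous_on {0..T} g"
  shows "set_integrable lborel {0..T} (\<lambda>t. f t * g t)"
proof -
  have "bounded (g ` {0..T})" using assms(2) by (intro compact_imp_bounded compact_continuous_image) auto
  then obtain c where "\<forall>x\<in>g ` {0..T}. norm x \<le> c" unfolding bounded_iff by blast
  then have c: "\<bar>g t\<bar> \<le> c" if "t \<in> {0..T}" for t using that by auto
  have m: "(\<lambda>t. indicator {0..T} t *\<^sub>R g t) \<in> borel_measurable borel"
    using assms(2) by (intro borel_measurable_continuous_on_indicator) auto
  have f: "(\<lambda>t. indicator {0..T} t *\<^sub>R f t) \<in> borel_measurable borel"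
    using assms(1) unfolding set_integrable_def by auto
  have e: "(\<lambda>t. indicator {0..T} t *\<^sub>R (f t * g t)) = (\<lambda>t. (indicator {0..T} t *\<^sub>R f t) * (indicator {0..T} t *\<^sub>R g t))"
    by (auto simp: indicator_def)
  show ?thesis unfolding set_integrable_def
  proof (rule Bochner_Integration.integrable_bound)
    show "integrable lborel (\<lambda>t. c * (indicator {0..T} t *\<^sub>R f t))"
      using assms(1) unfolding set_integrable_def by auto
    show "(\<lambda>t. indicator {0..T} t *\<^sub>R (f t * g t)) \<in> borel_measurable lborel"
      unfolding e using m f by measurable
    show "AE t in lborel. norm (indicator {0..T} t *\<^sub>R (f t * g t)) \<le> norm (c * (indicator {0..T} t *\<^sub>R f t))"
    proof (intro AE_I2)
      fix t show "norm (indicator {0..T} t *\<^sub>R (f t * g t)) \<le> norm (c * (indicator {0..T} t *\<^sub>R f t))"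
        using c[of t] by (auto simp: indicator_def abs_mult mult.commute[of "\<bar>f t\<bar>"] intro!: mult_right_mono)
    qed
  qed
qed

text \<open>The densities are only integrable, so the product rule comes from Fubini: the product of
  the two increments is an integral over the square, and each triangle below or above the diagonal
  integrates to one of the two terms. Truncating the densities to \<open>{0..t}\<close> lets
  everything run over the whole plane.\<close>

lemma has_primitive_mult:
  assumes u: "has_primitive T U u" and v: "has_primitive T V v"
  shows "has_primitive T (\<lambda>t. U t * v t + V t * u t) (\<lambda>t. u t * v t)"
  unfolding has_primitive_def
proof (intro conjI ballI)
  have I1: "set_integrable lborel {0..T} (\<lambda>t. U t * v t)"
    by (rule set_integrable_continuous_mult[OF has_primitive_integrable[OF u] has_primitive_continuous[OF v]])
  have I2: "set_integrable lborel {0..T} (\<lambda>t. V t * u t)"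
    by (rule set_integrable_continuous_mult[OF has_primitive_integrable[OF v] has_primitive_continuous[OF u]])
  show I: "set_integrable lborel {0..T} (\<lambda>t. U t * v t + V t * u t)"
    using I1 I2 by (rule set_integral_add)
  fix t assume t: "t \<in> {0..T}"
  define a where "a s = indicator {0..t} s * U s" for s
  define b where "b s = indicator {0..t} s * V s" for s
  have ia: "integrable lborel a" and ib: "integrable lborel b"
    using has_primitive_integrable_sub[OF u, of t] has_primitive_integrable_sub[OF v, of t] t
    unfolding a_def b_def set_integrable_def by auto
  have u': "u s = u 0 + (\<integral>r. indicator {0..s} r * a r \<partial>lborel)"
    and v': "v s = v 0 + (\<integral>r. indicator {0..s} r * b r \<partial>lborel)" if "s \<in> {0..t}" for s
  proof -
    have "(\<lambda>r. indicator {0..s} r * a r) = (\<lambda>r. indicator {0..s} r * U r)"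
       "(\<lambda>r. indicator {0..s} r * b r) = (\<lambda>r. indicator {0..s} r * V r)"
      using that by (auto simp: a_def b_def indicator_def)
    then show "u s = u 0 + (\<integral>r. indicator {0..s} r * a r \<partial>lborel)"
      "v s = v 0 + (\<integral>r. indicator {0..s} r * b r \<partial>lborel)"
      using has_primitive_eq[OF u, of s] has_primitive_eq[OF v, of s] that t
      by (auto simp: set_lebesgue_integral_def)
  qed
  have [measurable]: "a \<in> borel_measurable borel" "b \<in> borel_measurable borel" using ia ib by auto
  have ab: "integrable (lborel \<Otimes>\<^sub>M lborel) (\<lambda>(s, r). a s * b r)"
    by (rule lborel_pair.Fubini_integrable) (use ia ib in \<open>auto simp: abs_mult\<close>)
  have ab1: "integrable (lborel \<Otimes>\<^sub>M lborel) (\<lambda>(s, r). (if r \<le> s then a s * b r else 0))"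
  proof (rule Bochner_Integration.integrable_bound[OF ab])
    show "(\<lambda>(s, r). (if r \<le> s then a s * b r else 0)) \<in> borel_measurable (lborel \<Otimes>\<^sub>M lborel)" by measurable
  qed (auto split: prod.splits)
  have ab2: "integrable (lborel \<Otimes>\<^sub>M lborel) (\<lambda>(s, r). (if r \<le> s then 0 else a s * b r))"
  proof (rule Bochner_Integration.integrable_bound[OF ab])
    show "(\<lambda>(s, r). (if r \<le> s then 0 else a s * b r)) \<in> borel_measurable (lborel \<Otimes>\<^sub>M lborel)" by measurable
  qed (auto split: prod.splits)
  have "(u t - u 0) * (v t - v 0) = (\<integral>s. a s \<partial>lborel) * (\<integral>r. b r \<partial>lborel)"
  proof -
    have "(\<lambda>r. indicator {0..t} r * a r) = a" "(\<lambda>r. indicator {0..t} r * b r) = b"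
      by (auto simp: a_def b_def indicator_def)
    then show ?thesis using u'[of t] v'[of t] t by auto
  qed
  also have "\<dots> = (\<integral>x. (case x of (s, r) \<Rightarrow> a s * b r) \<partial>(lborel \<Otimes>\<^sub>M lborel))"
    using lborel_pair.integral_fst[OF ab] by simp
  \<comment> \<open>The square is cut along its diagonal; the diagonal itself belongs to the first
    triangle.\<close>
  also have "\<dots> = (\<integral>x. (case x of (s, r) \<Rightarrow> (if r \<le> s then a s * b r else 0)) + (case x of (s, r) \<Rightarrow> (if r \<le> s then 0 else a s * b r)) \<partial>(lborel \<Otimes>\<^sub>M lborel))"
    by (intro Bochner_Integration.integral_cong) auto
  also have "\<dots> = (\<integral>x. (case x of (s, r) \<Rightarrow> (if r \<le> s then a s * b r else 0)) \<partial>(lborel \<Otimes>\<^sub>M lborel))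
     + (\<integral>x. (case x of (s, r) \<Rightarrow> (if r \<le> s then 0 else a s * b r)) \<partial>(lborel \<Otimes>\<^sub>M lborel))"
    by (rule Bochner_Integration.integral_add[OF ab1 ab2])
  also have "(\<integral>x. (case x of (s, r) \<Rightarrow> (if r \<le> s then a s * b r else 0)) \<partial>(lborel \<Otimes>\<^sub>M lborel))
      = (\<integral>s. a s * (v s - v 0) \<partial>lborel)"
  proof -
    have "(\<integral>x. (case x of (s, r) \<Rightarrow> (if r \<le> s then a s * b r else 0)) \<partial>(lborel \<Otimes>\<^sub>M lborel))
      = (\<integral>s. (\<integral>r. (if r \<le> s then a s * b r else 0) \<partial>lborel) \<partial>lborel)"
      using lborel_pair.integral_fst[OF ab1] by simp
    also have "\<dots> = (\<integral>s. a s * (v s - v 0) \<partial>lborel)"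
    proof (rule Bochner_Integration.integral_cong[OF refl])
      fix s
      show "(\<integral>r. (if r \<le> s then a s * b r else 0) \<partial>lborel) = a s * (v s - v 0)"
      proof (cases "s \<in> {0..t}")
        case True
        have "(\<integral>r. (if r \<le> s then a s * b r else 0) \<partial>lborel) = (\<integral>r. a s * (indicator {0..s} r * b r) \<partial>lborel)"
          by (intro Bochner_Integration.integral_cong) (auto simp: b_def indicator_def)
        then show ?thesis using v'[OF True] by simp
      qed (auto simp: a_def cong: if_cong)
    qed
    finally show ?thesis .
  qed
  also have "(\<integral>x. (case x of (s, r) \<Rightarrow> (if r \<le> s then 0 else a s * b r)) \<partial>(lborel \<Otimes>\<^sub>M lborel))
      = (\<integral>s. b s * (u s - u 0) \<partial>lborel)"
  proof -
    have "(\<integral>x. (case x of (s, r) \<Rightarrow> (if r \<le> s then 0 else a s * b r)) \<partial>(lborel \<Otimes>\<^sub>M lborel))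
      = (\<integral>r. (\<integral>s. (if r \<le> s then 0 else a s * b r) \<partial>lborel) \<partial>lborel)"
      using lborel_pair.integral_snd[of "\<lambda>s r. (if r \<le> s then 0 else a s * b r)"] ab2 by simp
    also have "\<dots> = (\<integral>s. b s * (u s - u 0) \<partial>lborel)"
    proof (rule Bochner_Integration.integral_cong[OF refl])
      fix r
      show "(\<integral>s. (if r \<le> s then 0 else a s * b r) \<partial>lborel) = b r * (u r - u 0)"
      proof (cases "r \<in> {0..t}")
        case True
        \<comment> \<open>The triangle gives the half-open range \<open>s < r\<close>, while
          \<open>u r\<close> is an integral over the closed interval; the endpoint is a null
          set.\<close>
        have "(\<integral>s. (if r \<le> s then 0 else a s * b r) \<partial>lborel) = (\<integral>s. b r * (indicator {0..r} s * a s) \<partial>lborel)"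
        proof (rule integral_cong_AE)
          show "AE s in lborel. (if r \<le> s then 0 else a s * b r) = b r * (indicator {0..r} s * a s)"
            using AE_lborel_singleton[of r] by eventually_elim (auto simp: a_def indicator_def)
        qed simp_all
        then show ?thesis using u'[OF True] by simp
      qed (auto simp: b_def cong: if_cong)
    qed
    finally show ?thesis .
  qed
  also have "(\<integral>s. a s * (v s - v 0) \<partial>lborel) = (LINT s:{0..t}|lborel. U s * v s) - v 0 * (u t - u 0)"
  proof -
    have 1: "set_integrable lborel {0..t} (\<lambda>s. U s * v s)" 
      by (rule set_integrable_subset[OF I1]) (use t in auto)
    have "(\<integral>s. a s * (v s - v 0) \<partial>lborel) = (\<integral>s. indicator {0..t} s *\<^sub>R (U s * v s) - v 0 * a s \<partial>lborel)"
      by (intro Bochner_Integration.integral_cong) (auto simp: a_def algebra_simps)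
    also have "\<dots> = (LINT s:{0..t}|lborel. U s * v s) - v 0 * (\<integral>s. a s \<partial>lborel)"
      using 1 ia unfolding set_lebesgue_integral_def set_integrable_def by (subst Bochner_Integration.integral_diff) auto
    also have "(\<integral>s. a s \<partial>lborel) = u t - u 0"
      using has_primitive_eq[OF u, of t] t by (auto simp: a_def set_lebesgue_integral_def)
    finally show ?thesis .
  qed
  also have "(\<integral>s. b s * (u s - u 0) \<partial>lborel) = (LINT s:{0..t}|lborel. V s * u s) - u 0 * (v t - v 0)"
  proof -
    have 1: "set_integrable lborel {0..t} (\<lambda>s. V s * u s)" 
      by (rule set_integrable_subset[OF I2]) (use t in auto)
    have "(\<integral>s. b s * (u s - u 0) \<partial>lborel) = (\<integral>s. indicator {0..t} s *\<^sub>R (V s * u s) - u 0 * b s \<partial>lborel)"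
      by (intro Bochner_Integration.integral_cong) (auto simp: b_def algebra_simps)
    also have "\<dots> = (LINT s:{0..t}|lborel. V s * u s) - u 0 * (\<integral>s. b s \<partial>lborel)"
      using 1 ib unfolding set_lebesgue_integral_def set_integrable_def by (subst Bochner_Integration.integral_diff) auto
    also have "(\<integral>s. b s \<partial>lborel) = v t - v 0"
      using has_primitive_eq[OF v, of t] t by (auto simp: b_def set_lebesgue_integral_def)
    finally show ?thesis .
  qed
  finally have "(u t - u 0) * (v t - v 0) = (LINT s:{0..t}|lborel. U s * v s) + (LINT s:{0..t}|lborel. V s * u s)
     - v 0 * (u t - u 0) - u 0 * (v t - v 0)" by simp
  moreover have "(LINT s:{0..t}|lborel. U s * v s + V s * u s) = (LINT s:{0..t}|lborel. U s * v s) + (LINT s:{0..t}|lborel. V s * u s)"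
    by (intro set_integral_add set_integrable_subset[OF I1] set_integrable_subset[OF I2]) (use t in auto)
  ultimately show "u t * v t = u 0 * v 0 + (LINT s:{0..t}|lborel. U s * v s + V s * u s)"
    by (simp add: algebra_simps)
qed

section \<open>Discrete Carleman identities\<close>

text \<open>Abel summation with its boundary terms kept, since they vanish for different reasons: in
  the commutator \<open>f\<close> is zero at both ends, in the Caccioppoli estimate \<open>a\<close>
  is.\<close>

lemma sum_weighted_difference:
  fixes a f :: "nat \<Rightarrow> real"
  shows "(\<Sum>i=1..N. a i * (f i - f (i - 1)))
    = (\<Sum>i=0..N. (a i - a (Suc i)) * f i) + a (Suc N) * f N - a 0 * f 0"
  by (induction N) (auto simp: algebra_simps)

lemma sum_shift_symmetric:
  fixes c v w :: "nat \<Rightarrow> real"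
  assumes "v 0 = 0" "v (Suc N) = 0"
  shows "(\<Sum>i=1..N. v i * (c i * w (Suc i) + c (i - 1) * w (i - 1)))
    = (\<Sum>i=0..N. c i * (v i * w (Suc i) + w i * v (Suc i)))"
proof -
  have "(\<Sum>i=1..N. v i * (c i * w (Suc i) + c (i - 1) * w (i - 1)))
    = (\<Sum>i=0..N. c i * (v i * w (Suc i) + w i * v (Suc i))) - c 0 * v 0 * w 1 - c N * w N * v (Suc N)"
    by (induction N) (auto simp: algebra_simps)
  then show ?thesis using assms by simp
qed

lemma sum_shift_squares:
  fixes g v :: "nat \<Rightarrow> real"
  shows "(\<Sum>i=1..N. g i * (v (Suc i))\<^sup>2 - g (i - 1) * (v (i - 1))\<^sup>2)
    = (\<Sum>i=1..N. (g (i - 1) - g i) * (v i)\<^sup>2) + g N * (v (Suc N))\<^sup>2 + g N * (v N)\<^sup>2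
      - g 0 * (v 1)\<^sup>2 - g 0 * (v 0)\<^sup>2"
  by (induction N) (auto simp: algebra_simps)

lemma sum_neighbours_le:
  fixes v :: "nat \<Rightarrow> real"
  assumes "v 0 = 0" "v (Suc N) = 0"
  shows "(\<Sum>i=0..N. \<bar>v i * v (Suc i)\<bar>) \<le> (\<Sum>i=1..N. (v i)\<^sup>2)"
proof -
  have "\<bar>v i * v (Suc i)\<bar> \<le> ((v i)\<^sup>2 + (v (Suc i))\<^sup>2) / 2" for i
    using sum_squares_bound[of "\<bar>v i\<bar>" "\<bar>v (Suc i)\<bar>"] by (simp add: abs_mult)
  then have "(\<Sum>i=0..N. \<bar>v i * v (Suc i)\<bar>) \<le> (\<Sum>i=0..N. ((v i)\<^sup>2 + (v (Suc i))\<^sup>2) / 2)"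
    by (intro sum_mono) auto
  also have "\<dots> = (\<Sum>i=1..N. (v i)\<^sup>2) + (v 0)\<^sup>2 / 2 + (v (Suc N))\<^sup>2 / 2"
    by (induction N) (auto simp: field_simps)
  finally show ?thesis using assms by simp
qed

lemma sum_second_neighbours_le:
  fixes v :: "nat \<Rightarrow> real"
  assumes "v 0 = 0" "v (Suc N) = 0"
  shows "(\<Sum>i=1..N. v (Suc i) * v (i - 1)) \<le> (\<Sum>i=1..N. (v i)\<^sup>2)"
proof -
  have "v (Suc i) * v (i - 1) \<le> ((v (Suc i))\<^sup>2 + (v (i - 1))\<^sup>2) / 2" for i
    using sum_squares_bound[of "v (Suc i)" "v (i - 1)"] by simp
  then have "(\<Sum>i=1..N. v (Suc i) * v (i - 1)) \<le> (\<Sum>i=1..N. ((v (Suc i))\<^sup>2 + (v (i - 1))\<^sup>2) / 2)"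
    by (intro sum_mono) auto
  also have "\<dots> = (\<Sum>i=1..N. (v i)\<^sup>2) + ((v (Suc N))\<^sup>2 - (v N)\<^sup>2 - (v 1)\<^sup>2 + (v 0)\<^sup>2) / 2"
    by (induction N) (auto simp: field_simps)
  also have "\<dots> \<le> (\<Sum>i=1..N. (v i)\<^sup>2)"
    using assms by (simp add: field_simps)
  finally show ?thesis .
qed

section \<open>Elementary bounds for exponential and hyperbolic functions\<close>

lemma exp_le_9:
  fixes x :: real
  assumes "x \<le> 2" shows "exp x \<le> 9"
proof -
  have "exp x \<le> exp (1 + 1)" using assms by simp
  also have "\<dots> = exp 1 * exp (1::real)" by (rule exp_add)
  also have "\<dots> \<le> 3 * 3" using exp_le by (intro mult_mono) auto
  finally show ?thesis by simp
qed

lemma square_sum3_le: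
  fixes x y z :: real
  shows "(x + y + z)\<^sup>2 \<le> 3 * (x\<^sup>2 + y\<^sup>2 + z\<^sup>2)"
proof -
  have "3 * (x\<^sup>2 + y\<^sup>2 + z\<^sup>2) - (x + y + z)\<^sup>2 = (x - y)\<^sup>2 + (y - z)\<^sup>2 + (x - z)\<^sup>2"
    by (simp add: power2_eq_square algebra_simps)
  then show ?thesis using zero_le_power2[of "x-y"] zero_le_power2[of "y-z"] zero_le_power2[of "x-z"] by linarith
qed

text \<open>The range up to 2 is where the weight increments live: they are at most
  \<open>2 * \<sigma> * h\<close>, and \<open>\<sigma> * h \<le> 1\<close>.\<close>

lemma sinh_le_linear:
  fixes x :: real
  assumes "0 \<le> x" "x \<le> 2"
  shows "sinh x \<le> 9 * x"
proof -
  have e1: "exp x \<le> 9" by (rule exp_le_9[OF assms(2)])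
  have "1 - x \<le> exp (- x)" using exp_ge_add_one_self[of "-x"] by simp
  then have "(1 - x) * exp x \<le> exp (-x) * exp x" by (intro mult_right_mono) auto
  then have "exp x - 1 \<le> x * exp x" by (simp add: algebra_simps flip: exp_add)
  also have "\<dots> \<le> x * 9" using e1 assms by (intro mult_left_mono) auto
  finally have "exp x - 1 \<le> 9 * x" by simp
  moreover have "1 - exp (- x) \<le> x" using exp_ge_add_one_self[of "-x"] by simp
  ultimately show ?thesis using assms by (simp add: sinh_field_def)
qed

lemma sinh_ge_self:
  fixes x :: real
  assumes "0 \<le> x"
  shows "x \<le> sinh x"
proof -
  have "sinh 0 - 0 \<le> sinh x - x"
  proof (rule DERIV_nonneg_imp_nondecreasing[OF assms])
    fix y :: real
    show "\<exists>d. ((\<lambda>y. sinh y - y) has_real_derivative d) (at y) \<and> 0 \<le> d"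
      by (rule exI[of _ "cosh y - 1"]) (auto intro!: derivative_eq_intros simp: cosh_real_ge_1)
  qed
  then show ?thesis by simp
qed

text \<open>By the half-angle formula \<open>cosh x - 1\<close> is twice the square of
  \<open>sinh (x / 2)\<close>, which dominates \<open>x / 2\<close> in absolute value.\<close>

lemma cosh_ge_quadratic:
  fixes x :: real
  shows "cosh x \<ge> 1 + x\<^sup>2 / 2"
proof -
  have 1: "cosh x = 1 + 2 * (sinh \<bar>x / 2\<bar>)\<^sup>2"
    using cosh_double_cosh[of "x/2"] cosh_square_eq[of "x/2"] by (simp add: abs_if)
  have "(\<bar>x / 2\<bar>)\<^sup>2 \<le> (sinh \<bar>x/2\<bar>)\<^sup>2"
    by (intro power_mono sinh_ge_self) auto
  then show ?thesis using 1 by (simp add: power_divide)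
qed

lemma sum_neighbour_products_bound:
  fixes v b :: "nat \<Rightarrow> real"
  assumes "v 0 = 0" "v (Suc N) = 0" "\<And>i. i \<le> N \<Longrightarrow> \<bar>b i\<bar> \<le> c"
  shows "\<bar>\<Sum>i=0..N. b i * (v i * v (Suc i))\<bar> \<le> c * (\<Sum>i=1..N. (v i)\<^sup>2)"
proof -
  have c: "0 \<le> c" using assms(3)[of 0] by simp
  have "\<bar>\<Sum>i=0..N. b i * (v i * v (Suc i))\<bar> \<le> (\<Sum>i=0..N. c * \<bar>v i * v (Suc i)\<bar>)"
    by (rule order_trans[OF sum_abs]) (auto intro!: sum_mono mult_right_mono assms(3) simp: abs_mult)
  also have "\<dots> \<le> c * (\<Sum>i=1..N. (v i)\<^sup>2)"
    using sum_neighbours_le[OF assms(1,2)] c by (simp add: mult_left_mono flip: sum_distrib_left)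
  finally show ?thesis .
qed

text \<open>After summation by parts the claim is an inequality for each edge separately. With
  \<open>\<eta>\<close> constant the last sum drops out and the dissipativity of the Dirichlet
  difference operator remains, which is how the energy estimate uses it.\<close>

lemma caccioppoli_sum:
  fixes \<eta> p :: "nat \<Rightarrow> real"
  assumes "p 0 = 0" "p (Suc N) = 0"
  shows "(\<Sum>i=1..N. (\<eta> i)\<^sup>2 * p i * (p (Suc i) - 2 * p i + p (i - 1)))
    \<le> - (\<Sum>i=0..N. ((\<eta> i)\<^sup>2 + (\<eta> (Suc i))\<^sup>2) * (p (Suc i) - p i)\<^sup>2) / 4
      + (\<Sum>i=0..N. (\<eta> (Suc i) - \<eta> i)\<^sup>2 * ((p i)\<^sup>2 + (p (Suc i))\<^sup>2))"
proof -
  define d where "d i = p (Suc i) - p i" for i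
  have "(\<eta> i)\<^sup>2 * p i * (p (Suc i) - 2 * p i + p (i - 1)) = ((\<eta> i)\<^sup>2 * p i) * (d i - d (i - 1))"
    if "i \<in> {1..N}" for i using that by (cases i) (auto simp: d_def algebra_simps)
  then have "(\<Sum>i=1..N. (\<eta> i)\<^sup>2 * p i * (p (Suc i) - 2 * p i + p (i - 1)))
    = (\<Sum>i=1..N. ((\<eta> i)\<^sup>2 * p i) * (d i - d (i - 1)))" by (intro sum.cong) auto
  also have "\<dots> = (\<Sum>i=0..N. ((\<eta> i)\<^sup>2 * p i - (\<eta> (Suc i))\<^sup>2 * p (Suc i)) * d i)"
    using sum_weighted_difference[of "\<lambda>i. (\<eta> i)\<^sup>2 * p i" d N] assms by simp
  also have "\<dots> \<le> (\<Sum>i=0..N. - (((\<eta> i)\<^sup>2 + (\<eta> (Suc i))\<^sup>2) * (d i)\<^sup>2) / 4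
      + (\<eta> (Suc i) - \<eta> i)\<^sup>2 * ((p i)\<^sup>2 + (p (Suc i))\<^sup>2))"
  proof (rule sum_mono)
    fix i
    have "(a\<^sup>2 * x - b\<^sup>2 * y) * (y - x) \<le> - ((a\<^sup>2 + b\<^sup>2) * (y - x)\<^sup>2) / 4 + (b - a)\<^sup>2 * (x\<^sup>2 + y\<^sup>2)" for a b x y :: real
    proof -
      \<comment> \<open>The gap between the two sides is an explicit sum of three squares.\<close>
      have "- ((a\<^sup>2 + b\<^sup>2) * (y - x)\<^sup>2) / 4 + (b - a)\<^sup>2 * (x\<^sup>2 + y\<^sup>2) - (a\<^sup>2 * x - b\<^sup>2 * y) * (y - x)
        = ((a + b) * (y - x) / 2 + (b - a) * (x + y))\<^sup>2 / 2 + (a - b)\<^sup>2 * (y - x)\<^sup>2 / 8 + (b - a)\<^sup>2 * (x - y)\<^sup>2 / 2"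
        by (simp add: power2_eq_square field_simps)
      moreover have "\<dots> \<ge> 0" by simp
      ultimately show ?thesis by linarith
    qed
    then show "((\<eta> i)\<^sup>2 * p i - (\<eta> (Suc i))\<^sup>2 * p (Suc i)) * d i
      \<le> - (((\<eta> i)\<^sup>2 + (\<eta> (Suc i))\<^sup>2) * (d i)\<^sup>2) / 4 + (\<eta> (Suc i) - \<eta> i)\<^sup>2 * ((p i)\<^sup>2 + (p (Suc i))\<^sup>2)"
      unfolding d_def .
  qed
  also have "\<dots> = - (\<Sum>i=0..N. ((\<eta> i)\<^sup>2 + (\<eta> (Suc i))\<^sup>2) * (d i)\<^sup>2) / 4
      + (\<Sum>i=0..N. (\<eta> (Suc i) - \<eta> i)\<^sup>2 * ((p i)\<^sup>2 + (p (Suc i))\<^sup>2))"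
    by (simp add: sum.distrib sum_divide_distrib sum_negf sum_subtractf)
  finally show ?thesis unfolding d_def .
qed

text \<open>At a fixed time, \<open>v = e\<^bsup>\<sigma>\<psi>\<^esup> u\<close> is the conjugated unknown and \<open>\<tau>\<close> stands for the derivative of
  \<open>\<sigma>\<close>. The conjugated operator \<open>e\<^bsup>\<sigma>\<psi>\<^esup> D\<^sub>h\<^sup>2 e\<^bsup>-\<sigma>\<psi>\<^esup> - \<tau> \<psi>\<close> is the sum of its symmetric part \<open>S\<close> and its antisymmetric
  part \<open>A\<close>.\<close>

locale carleman_point =
  fixes N :: nat and h \<sigma> \<tau> :: real and \<psi> v :: "nat \<Rightarrow> real"
  assumes h: "0 < h" and Nh: "real (Suc N) * h = 1"
    and psi: "\<And>i. \<psi> i = (1 + real i * h)\<^sup>2 / 2 - 3"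
    and sigma: "0 < \<sigma>" "\<sigma> * h \<le> 1"
    and v0: "v 0 = 0" and vN: "v N = 0" and vN1: "v (Suc N) = 0"
begin

definition "\<delta> i = \<sigma> * (\<psi> (Suc i) - \<psi> i)"
definition "S i = (cosh (\<delta> i) * v (Suc i) + cosh (\<delta> (i - 1)) * v (i - 1) - 2 * v i) / h\<^sup>2 - \<tau> * \<psi> i * v i"
definition "A i = (- sinh (\<delta> i) * v (Suc i) + sinh (\<delta> (i - 1)) * v (i - 1)) / h\<^sup>2"
abbreviation "V \<equiv> (\<Sum>i=1..N. (v i)\<^sup>2)"

lemma node_le: "i \<le> Suc N \<Longrightarrow> real i * h \<le> 1"
  using Nh h by (metis mult_right_mono less_eq_real_def of_nat_mono)

lemma psi_bounds: assumes "i \<le> Suc N" shows "-5/2 \<le> \<psi> i" "\<psi> i \<le> -1"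
proof -
  have "1 \<le> 1 + real i * h" "1 + real i * h \<le> 2" using node_le[OF assms] h by auto
  then have "1\<^sup>2 \<le> (1 + real i * h)\<^sup>2" "(1 + real i * h)\<^sup>2 \<le> 2\<^sup>2" by (intro power_mono; simp)+
  then show "-5/2 \<le> \<psi> i" "\<psi> i \<le> -1" by (auto simp: psi)
qed

lemma psi_diff: "\<psi> (Suc i) - \<psi> i = h * (1 + real i * h + h / 2)"
  by (simp add: psi power2_eq_square algebra_simps add_divide_distrib)

lemma psi_diff_bounds: assumes "i \<le> N" shows "0 \<le> \<psi> (Suc i) - \<psi> i" "\<psi> (Suc i) - \<psi> i \<le> 2 * h"
proof -
  have "real i * h + h \<le> 1" using node_le[of "Suc i"] assms by (simp add: algebra_simps)
  then show "\<psi> (Suc i) - \<psi> i \<le> 2 * h" unfolding psi_diff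
    using h mult_left_mono[of "1 + real i * h + h / 2" 2 h] by (simp add: mult.commute)
  show "0 \<le> \<psi> (Suc i) - \<psi> i" unfolding psi_diff using h by simp
qed

lemma delta_nonneg: "0 \<le> \<delta> i"
  unfolding \<delta>_def psi_diff using h sigma by simp

lemma delta_le: assumes "i \<le> N" shows "\<delta> i \<le> 2 * \<sigma> * h"
  unfolding \<delta>_def using mult_left_mono[OF psi_diff_bounds(2)[OF assms], of \<sigma>] sigma by simp

lemma sinh_delta: assumes "i \<le> N" shows "0 \<le> sinh (\<delta> i)" "sinh (\<delta> i) \<le> 18 * \<sigma> * h"
  using sinh_le_linear[of "\<delta> i"] delta_le[OF assms] delta_nonneg[of i] sigma by auto

lemma delta_second_difference: "i \<ge> 1 \<Longrightarrow> \<delta> i - \<delta> (i - 1) = \<sigma> * h\<^sup>2"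
  unfolding \<delta>_def by (cases i) (simp_all add: psi power2_eq_square algebra_simps add_divide_distrib)

lemma delta_sum: "i \<ge> 1 \<Longrightarrow> 2 * \<sigma> * h \<le> \<delta> i + \<delta> (i - 1)"
proof -
  assume "i \<ge> 1"
  then have "\<delta> i + \<delta> (i - 1) = 2 * \<sigma> * h + 2 * \<sigma> * h * (real i * h)"
    unfolding \<delta>_def by (cases i) (simp_all add: psi power2_eq_square algebra_simps add_divide_distrib)
  then show ?thesis using h sigma by simp
qed

text \<open>The second difference of \<open>\<psi>\<close> is constant, so both coefficients of the commutator contain the
  same factor \<open>sinh (\<sigma> h\<^sup>2)\<close>, and the diagonal wins by \<open>cosh (\<delta> i + \<delta> (i - 1)) - 1\<close>.\<close>

lemma commutator_lower_bound:
  "2 * (\<Sum>i=1..N. S i * A i) \<ge> (4 * \<sigma> ^ 3 - 72 * \<sigma> * \<bar>\<tau>\<bar>) * V"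
proof -
  define P where "P i = cosh (\<delta> i) * v (Suc i) + cosh (\<delta> (i - 1)) * v (i - 1) - 2 * v i" for i
  define R where "R i = sinh (\<delta> i) * v (Suc i) - sinh (\<delta> (i - 1)) * v (i - 1)" for i
  define g where "g i = cosh (\<delta> i) * sinh (\<delta> i)" for i
  define f where "f i = sinh (\<delta> i) * (v i * v (Suc i))" for i
  define k where "k = sinh (\<sigma> * h\<^sup>2)"
  have k: "k \<ge> \<sigma> * h\<^sup>2" unfolding k_def using sigma h by (intro sinh_ge_self) simp
  have vR: "v i * R i = f i - f (i - 1)" if "i \<in> {1..N}" for i
    using that by (cases i) (auto simp: R_def f_def algebra_simps)
  have f0: "f 0 = 0" "f N = 0" by (auto simp: f_def v0 vN1)
  have sum_vR: "(\<Sum>i=1..N. v i * R i) = 0"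
    using sum_weighted_difference[of "\<lambda>_. 1" f N] f0 vR by simp
  have sum_pvR: "(\<Sum>i=1..N. \<psi> i * (v i * R i)) = (\<Sum>i=0..N. (\<psi> i - \<psi> (Suc i)) * f i)"
    using sum_weighted_difference[of \<psi> f N] f0 vR by simp
  \<comment> \<open>The pure squares have shifted coefficients and will telescope into a difference
    of \<open>g\<close>; the mixed coefficient is \<open>sinh\<close> of the second difference of
    the weight, the constant \<open>k\<close>.\<close>
  have PR: "P i * R i = (g i * (v (Suc i))\<^sup>2 - g (i - 1) * (v (i - 1))\<^sup>2)
      + k * (v (Suc i) * v (i - 1)) - 2 * (v i * R i)" if "i \<in> {1..N}" for i
  proof -
    have "k = sinh (\<delta> i - \<delta> (i - 1))" using delta_second_difference[of i] that by (simp add: k_def)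
    also have "\<dots> = sinh (\<delta> i) * cosh (\<delta> (i - 1)) - cosh (\<delta> i) * sinh (\<delta> (i - 1))"
      by (rule sinh_diff)
    finally have k': "k = sinh (\<delta> i) * cosh (\<delta> (i - 1)) - cosh (\<delta> i) * sinh (\<delta> (i - 1))" .
    show ?thesis unfolding k' P_def R_def g_def by (simp add: power2_eq_square algebra_simps)
  qed
  have gdiff: "g (i - 1) - g i \<le> - k * (1 + 2 * \<sigma>\<^sup>2 * h\<^sup>2)" if "i \<in> {1..N}" for i
  proof -
    have "g i - g (i - 1) = cosh (\<delta> i + \<delta> (i - 1)) * sinh (\<delta> i - \<delta> (i - 1))"
    proof -
      have "cosh (a + b) * sinh (a - b) = cosh a * sinh a * (cosh b ^ 2 - sinh b ^ 2) - cosh b * sinh b * (cosh a ^ 2 - sinh a ^ 2)" for a b :: real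
        by (simp add: cosh_add sinh_diff power2_eq_square algebra_simps)
      then show ?thesis by (simp add: g_def cosh_square_eq)
    qed
    also have "\<dots> = cosh (\<delta> i + \<delta> (i - 1)) * k"
      using delta_second_difference[of i] that by (simp add: k_def)
    also have "\<dots> \<ge> (1 + 2 * \<sigma>\<^sup>2 * h\<^sup>2) * k"
    proof (rule mult_right_mono)
      have "(2 * \<sigma> * h)\<^sup>2 \<le> (\<delta> i + \<delta> (i - 1))\<^sup>2"
        using delta_sum[of i] that sigma h by (intro power_mono) auto
      then show "1 + 2 * \<sigma>\<^sup>2 * h\<^sup>2 \<le> cosh (\<delta> i + \<delta> (i - 1))"
        using cosh_ge_quadratic[of "\<delta> i + \<delta> (i - 1)"] by (simp add: power_mult_distrib)
      show "0 \<le> k" using k sigma h by (meson mult_nonneg_nonneg less_eq_real_def order_trans zero_le_power2)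
    qed
    finally show ?thesis by (simp add: mult.commute)
  qed
  have k0: "0 \<le> k" using k sigma h by (meson mult_nonneg_nonneg less_eq_real_def order_trans zero_le_power2)
  have "(\<Sum>i=1..N. P i * R i) = (\<Sum>i=1..N. (g i * (v (Suc i))\<^sup>2 - g (i - 1) * (v (i - 1))\<^sup>2)
      + k * (v (Suc i) * v (i - 1)) - 2 * (v i * R i))"
    by (intro sum.cong refl PR) 
  also have "\<dots> = (\<Sum>i=1..N. g i * (v (Suc i))\<^sup>2 - g (i - 1) * (v (i - 1))\<^sup>2)
      + k * (\<Sum>i=1..N. v (Suc i) * v (i - 1)) - 2 * (\<Sum>i=1..N. v i * R i)"
    by (simp add: sum.distrib sum_subtractf sum_distrib_left)
  \<comment> \<open>An upper bound is wanted, so the boundary contribution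
    \<open>g N * (v N)\<^sup>2\<close> would have the wrong sign; it disappears because
    \<open>v N = 0\<close>. The contribution at the left end, \<open>- g 0 * (v 1)\<^sup>2\<close>,
    has the right sign and is discarded below.\<close>
  also have "\<dots> = (\<Sum>i=1..N. (g (i - 1) - g i) * (v i)\<^sup>2) - g 0 * (v 1)\<^sup>2 + k * (\<Sum>i=1..N. v (Suc i) * v (i - 1))"
    unfolding sum_shift_squares sum_vR by (simp add: v0 vN vN1)
  also have "\<dots> \<le> (\<Sum>i=1..N. - k * (1 + 2 * \<sigma>\<^sup>2 * h\<^sup>2) * (v i)\<^sup>2) + k * V"
  proof -
    have "(\<Sum>i=1..N. (g (i - 1) - g i) * (v i)\<^sup>2) \<le> (\<Sum>i=1..N. - k * (1 + 2 * \<sigma>\<^sup>2 * h\<^sup>2) * (v i)\<^sup>2)"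
      by (intro sum_mono mult_right_mono gdiff) auto
    moreover have "0 \<le> g 0 * (v 1)\<^sup>2" using delta_nonneg[of 0] by (simp add: g_def)
    moreover have "k * (\<Sum>i=1..N. v (Suc i) * v (i - 1)) \<le> k * V"
      by (intro mult_left_mono sum_second_neighbours_le v0 vN1 k0)
    ultimately show ?thesis by linarith
  qed
  \<comment> \<open>The 1 in the diagonal coefficient is spent exactly on the mixed products; only
    the quadratic part of \<open>cosh\<close> survives. With
    \<open>k \<ge> \<sigma> * h\<^sup>2\<close> it is of order \<open>\<sigma> ^ 3 * h ^ 4\<close>,
    and the power of \<open>h\<close> cancels the two factors \<open>1 / h\<^sup>2\<close> of
    \<open>S\<close> and \<open>A\<close>.\<close>
  also have "\<dots> = - (k * (2 * \<sigma>\<^sup>2 * h\<^sup>2 * V))"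
    unfolding sum_distrib_left[symmetric] by (simp add: algebra_simps)
  also have "\<dots> \<le> - (\<sigma> * h\<^sup>2 * (2 * \<sigma>\<^sup>2 * h\<^sup>2 * V))"
    using k by (simp add: mult_right_mono sum_nonneg)
  finally have main: "(\<Sum>i=1..N. P i * R i) \<le> - (2 * \<sigma> ^ 3 * h ^ 4 * V)"
    by (simp add: power2_eq_square eval_nat_numeral algebra_simps)
  have "\<bar>\<Sum>i=0..N. (\<psi> i - \<psi> (Suc i)) * f i\<bar> \<le> (36 * \<sigma> * h\<^sup>2) * V"
  proof -
    have "\<bar>\<Sum>i=0..N. ((\<psi> i - \<psi> (Suc i)) * sinh (\<delta> i)) * (v i * v (Suc i))\<bar> \<le> (36 * \<sigma> * h\<^sup>2) * V"
    proof (rule sum_neighbour_products_bound[OF v0 vN1])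
      fix i assume i: "i \<le> N"
      \<comment> \<open>Both factors are of order \<open>h\<close>, which compensates the single
        \<open>1 / h\<^sup>2\<close> left in front of the \<open>\<tau>\<close> term.\<close>
      have "\<bar>\<psi> i - \<psi> (Suc i)\<bar> * \<bar>sinh (\<delta> i)\<bar> \<le> (2 * h) * (18 * \<sigma> * h)"
        using psi_diff_bounds[OF i] sinh_delta[OF i] h by (intro mult_mono) auto
      then show "\<bar>(\<psi> i - \<psi> (Suc i)) * sinh (\<delta> i)\<bar> \<le> 36 * \<sigma> * h\<^sup>2"
        by (simp add: abs_mult power2_eq_square ac_simps)
    qed
    then show ?thesis by (simp add: f_def algebra_simps)
  qed
  then have "\<bar>\<tau> * (\<Sum>i=0..N. (\<psi> i - \<psi> (Suc i)) * f i)\<bar> \<le> \<bar>\<tau>\<bar> * ((36 * \<sigma> * h\<^sup>2) * V)"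
    unfolding abs_mult by (intro mult_left_mono) auto
  then have err: "\<tau> * (\<Sum>i=1..N. \<psi> i * (v i * R i)) \<ge> - (\<bar>\<tau>\<bar> * ((36 * \<sigma> * h\<^sup>2) * V))"
    unfolding sum_pvR by linarith
  have "S i * A i = - (P i * R i) / h ^ 4 + \<tau> * (\<psi> i * (v i * R i)) / h\<^sup>2" for i
  proof -
    have "S i = P i / h\<^sup>2 - \<tau> * \<psi> i * v i" "A i = - (R i / h\<^sup>2)"
      by (simp_all add: S_def A_def P_def R_def divide_simps)
    then have "S i * A i = (P i / h\<^sup>2 - \<tau> * \<psi> i * v i) * - (R i / h\<^sup>2)" by simp
    also have "\<dots> = - (P i * R i) / h ^ 4 + \<tau> * (\<psi> i * (v i * R i)) / h\<^sup>2"
      using h by (simp add: field_simps power_numeral_reduce)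
    finally show ?thesis .
  qed
  then have "(\<Sum>i=1..N. S i * A i) = - (\<Sum>i=1..N. P i * R i) / h ^ 4 + \<tau> * (\<Sum>i=1..N. \<psi> i * (v i * R i)) / h\<^sup>2"
    by (simp add: sum.distrib sum_distrib_left sum_divide_distrib sum_negf sum_subtractf)
  also have "\<dots> \<ge> (2 * \<sigma> ^ 3 * h ^ 4 * V) / h ^ 4 + - (\<bar>\<tau>\<bar> * ((36 * \<sigma> * h\<^sup>2) * V)) / h\<^sup>2"
    using main err by (intro add_mono divide_right_mono) auto
  also have "(2 * \<sigma> ^ 3 * h ^ 4 * V) / h ^ 4 + - (\<bar>\<tau>\<bar> * ((36 * \<sigma> * h\<^sup>2) * V)) / h\<^sup>2 = 2 * \<sigma> ^ 3 * V - 36 * \<sigma> * \<bar>\<tau>\<bar> * V"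
    using h by (simp add: field_simps)
  finally show ?thesis by (simp add: algebra_simps)
qed

text \<open>If \<open>w\<close> is the time derivative of \<open>v\<close> and
  \<open>\<tau>'\<close> that of \<open>\<tau>\<close>, the left side is the time derivative of the
  quadratic form \<open>\<Sum>i. S i * v i\<close>. The part with \<open>w\<close> is twice the
  pairing of \<open>S\<close> with \<open>w\<close>, in which the equation turns \<open>w\<close>
  into \<open>- (S + A + F)\<close> and produces the commutator; the part where time falls on the
  coefficients of \<open>S\<close> is an error of size
  \<open>\<sigma> * \<bar>\<tau>\<bar> + \<bar>\<tau>'\<bar>\<close>.\<close>

lemma energy_derivative_bound:
  assumes eq: "\<And>i. i \<in> {1..N} \<Longrightarrow> - w i = S i + A i + F i"
    and w0: "w 0 = 0" and wN1: "w (Suc N) = 0"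
  shows "(\<Sum>i=0..N. 2 / h\<^sup>2 * (sinh (\<delta> i) * (\<tau> * (\<psi> (Suc i) - \<psi> i)) * (v i * v (Suc i))
            + cosh (\<delta> i) * (v i * w (Suc i) + w i * v (Suc i))))
       - (\<Sum>i=1..N. 2 * (2 / h\<^sup>2 + \<tau> * \<psi> i) * (v i * w i) + \<tau>' * \<psi> i * (v i)\<^sup>2)
     \<le> - (4 * \<sigma> ^ 3 - 144 * \<sigma> * \<bar>\<tau>\<bar> - 3 * \<bar>\<tau>'\<bar>) * V + (\<Sum>i=1..N. (F i)\<^sup>2) / 2" (is "?Q \<le> _")
proof -
  have S1: "2 * (\<Sum>i=1..N. S i * w i) = (\<Sum>i=0..N. 2 / h\<^sup>2 * (cosh (\<delta> i) * (v i * w (Suc i) + w i * v (Suc i))))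
     - (\<Sum>i=1..N. 2 * (2 / h\<^sup>2 + \<tau> * \<psi> i) * (v i * w i))"
  proof -
    have "2 * (S i * w i) = 2 / h\<^sup>2 * (w i * (cosh (\<delta> i) * v (Suc i) + cosh (\<delta> (i - 1)) * v (i - 1)))
       - 2 * (2 / h\<^sup>2 + \<tau> * \<psi> i) * (v i * w i)" for i
      unfolding S_def using h by (simp add: field_simps)
    then have "2 * (\<Sum>i=1..N. S i * w i) = 2 / h\<^sup>2 * (\<Sum>i=1..N. w i * (cosh (\<delta> i) * v (Suc i) + cosh (\<delta> (i - 1)) * v (i - 1)))
       - (\<Sum>i=1..N. 2 * (2 / h\<^sup>2 + \<tau> * \<psi> i) * (v i * w i))"
      by (simp add: sum_distrib_left sum_subtractf)
    also have "(\<Sum>i=1..N. w i * (cosh (\<delta> i) * v (Suc i) + cosh (\<delta> (i - 1)) * v (i - 1)))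
      = (\<Sum>i=0..N. cosh (\<delta> i) * (v i * w (Suc i) + w i * v (Suc i)))"
      unfolding sum_shift_symmetric[of w N "\<lambda>i. cosh (\<delta> i)" v, OF w0 wN1] by (simp add: add.commute)
    finally show ?thesis by (simp add: sum_distrib_left)
  qed
  have S2: "\<bar>\<Sum>i=0..N. (2 / h\<^sup>2 * sinh (\<delta> i) * (\<tau> * (\<psi> (Suc i) - \<psi> i))) * (v i * v (Suc i))\<bar> \<le> (72 * \<sigma> * \<bar>\<tau>\<bar>) * V"
  proof (rule sum_neighbour_products_bound[OF v0 vN1])
    fix i assume i: "i \<le> N"
    have "\<bar>\<psi> (Suc i) - \<psi> i\<bar> * \<bar>sinh (\<delta> i)\<bar> \<le> (2 * h) * (18 * \<sigma> * h)"
      using psi_diff_bounds[OF i] sinh_delta[OF i] h by (intro mult_mono) auto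
    then have "2 * \<bar>\<tau>\<bar> / h\<^sup>2 * (\<bar>\<psi> (Suc i) - \<psi> i\<bar> * \<bar>sinh (\<delta> i)\<bar>) \<le> 2 * \<bar>\<tau>\<bar> / h\<^sup>2 * ((2 * h) * (18 * \<sigma> * h))"
      by (intro mult_left_mono) auto
    also have "\<dots> = 72 * \<sigma> * \<bar>\<tau>\<bar>" using h by (simp add: power2_eq_square)
    finally show "\<bar>2 / h\<^sup>2 * sinh (\<delta> i) * (\<tau> * (\<psi> (Suc i) - \<psi> i))\<bar> \<le> 72 * \<sigma> * \<bar>\<tau>\<bar>"
      by (simp add: abs_mult ac_simps)
  qed
  have S3: "\<bar>\<Sum>i=1..N. \<tau>' * \<psi> i * (v i)\<^sup>2\<bar> \<le> 3 * \<bar>\<tau>'\<bar> * V"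
  proof -
    have "\<bar>\<Sum>i=1..N. \<tau>' * \<psi> i * (v i)\<^sup>2\<bar> \<le> (\<Sum>i=1..N. 3 * \<bar>\<tau>'\<bar> * (v i)\<^sup>2)"
    proof (rule order_trans[OF sum_abs], rule sum_mono)
      fix i assume i: "i \<in> {1..N}"
      have "\<bar>\<tau>'\<bar> * \<bar>\<psi> i\<bar> \<le> \<bar>\<tau>'\<bar> * 3" using psi_bounds[of i] i by (intro mult_left_mono) auto
      then show "\<bar>\<tau>' * \<psi> i * (v i)\<^sup>2\<bar> \<le> 3 * \<bar>\<tau>'\<bar> * (v i)\<^sup>2"
        unfolding abs_mult by (simp add: mult_right_mono mult.commute)
    qed
    then show ?thesis by (simp add: sum_distrib_left)
  qed
  have "2 * (\<Sum>i=1..N. S i * w i) \<le> - (2 * (\<Sum>i=1..N. S i * A i)) + (\<Sum>i=1..N. (F i)\<^sup>2) / 2"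
  proof -
    have "2 * (S i * w i) \<le> - 2 * (S i * A i) + (F i)\<^sup>2 / 2" if i: "i \<in> {1..N}" for i
    proof -
      have w: "w i = - (S i + A i + F i)" using eq[OF i] by simp
      \<comment> \<open>Completing the square spends the whole term
        \<open>- 2 * (S i)\<^sup>2\<close> on the source, so that none of \<open>S\<close> has to be
        estimated.\<close>
      have "0 \<le> (2 * S i + F i)\<^sup>2 / 2" by simp
      then show ?thesis unfolding w by (simp add: power2_eq_square algebra_simps)
    qed
    then have "(\<Sum>i=1..N. 2 * (S i * w i)) \<le> (\<Sum>i=1..N. - 2 * (S i * A i) + (F i)\<^sup>2 / 2)"
      by (rule sum_mono)
    then show ?thesis by (simp add: sum.distrib sum_distrib_left sum_divide_distrib sum_negf sum_subtractf)
  qed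
  moreover have "?Q = 2 * (\<Sum>i=1..N. S i * w i)
     + (\<Sum>i=0..N. (2 / h\<^sup>2 * sinh (\<delta> i) * (\<tau> * (\<psi> (Suc i) - \<psi> i))) * (v i * v (Suc i)))
     - (\<Sum>i=1..N. \<tau>' * \<psi> i * (v i)\<^sup>2)"
    unfolding S1 by (simp add: sum.distrib distrib_left mult.assoc)
  ultimately show ?thesis using commutator_lower_bound S2 S3 by (simp add: algebra_simps abs_le_iff)
qed

text \<open>Needed only at the two end times, where the quadratic form appears as a boundary term
  and a loss of \<open>1 / h\<^sup>2\<close> is affordable.\<close>

lemma energy_abs_bound:
  "\<bar>(\<Sum>i=0..N. 2 / h\<^sup>2 * (cosh (\<delta> i) * (v i * v (Suc i)))) - (\<Sum>i=1..N. (2 / h\<^sup>2 + \<tau> * \<psi> i) * (v i)\<^sup>2)\<bar>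
     \<le> (22 / h\<^sup>2 + 3 * \<bar>\<tau>\<bar>) * V"
proof -
  have 1: "\<bar>\<Sum>i=0..N. (2 / h\<^sup>2 * cosh (\<delta> i)) * (v i * v (Suc i))\<bar> \<le> (20 / h\<^sup>2) * V"
  proof (rule sum_neighbour_products_bound[OF v0 vN1])
    fix i assume i: "i \<le> N"
    have d: "\<delta> i \<le> 2" using delta_le[OF i] sigma by linarith
    have "cosh (\<delta> i) \<le> 10"
    proof -
      have "exp (\<delta> i) \<le> 9" by (rule exp_le_9[OF d])
      moreover have "exp (- \<delta> i) \<le> 1" using delta_nonneg[of i] by simp
      ultimately have "exp (\<delta> i) + exp (- \<delta> i) \<le> 10" by linarith
      then show ?thesis by (simp add: cosh_field_def)
    qed
    then have "2 / h\<^sup>2 * cosh (\<delta> i) \<le> 2 / h\<^sup>2 * 10" by (intro mult_left_mono) auto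
    then show "\<bar>2 / h\<^sup>2 * cosh (\<delta> i)\<bar> \<le> 20 / h\<^sup>2" by (simp add: abs_mult)
  qed
  have 2: "\<bar>\<Sum>i=1..N. (2 / h\<^sup>2 + \<tau> * \<psi> i) * (v i)\<^sup>2\<bar> \<le> (2 / h\<^sup>2 + 3 * \<bar>\<tau>\<bar>) * V"
  proof -
    have "\<bar>\<Sum>i=1..N. (2 / h\<^sup>2 + \<tau> * \<psi> i) * (v i)\<^sup>2\<bar> \<le> (\<Sum>i=1..N. (2 / h\<^sup>2 + 3 * \<bar>\<tau>\<bar>) * (v i)\<^sup>2)"
    proof (rule order_trans[OF sum_abs], rule sum_mono)
      fix i assume i: "i \<in> {1..N}"
      have "\<bar>\<tau>\<bar> * \<bar>\<psi> i\<bar> \<le> \<bar>\<tau>\<bar> * 3" using psi_bounds[of i] i by (intro mult_left_mono) auto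
      then have "\<bar>2 / h\<^sup>2 + \<tau> * \<psi> i\<bar> \<le> 2 / h\<^sup>2 + 3 * \<bar>\<tau>\<bar>"
        by (intro order_trans[OF abs_triangle_ineq] add_mono) (auto simp: abs_mult mult.commute)
      then show "\<bar>(2 / h\<^sup>2 + \<tau> * \<psi> i) * (v i)\<^sup>2\<bar> \<le> (2 / h\<^sup>2 + 3 * \<bar>\<tau>\<bar>) * (v i)\<^sup>2"
        unfolding abs_mult by (simp add: mult_right_mono)
    qed
    then show ?thesis by (simp add: sum_distrib_left)
  qed
  have "\<bar>(\<Sum>i=0..N. (2 / h\<^sup>2 * cosh (\<delta> i)) * (v i * v (Suc i))) - (\<Sum>i=1..N. (2 / h\<^sup>2 + \<tau> * \<psi> i) * (v i)\<^sup>2)\<bar>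
    \<le> (20 / h\<^sup>2) * V + (2 / h\<^sup>2 + 3 * \<bar>\<tau>\<bar>) * V"
    using 1 2 by linarith
  also have "\<dots> = (22 / h\<^sup>2 + 3 * \<bar>\<tau>\<bar>) * V" by (simp add: algebra_simps add_divide_distrib flip: distrib_right)
  finally show ?thesis by (simp add: mult.assoc)
qed

end

section \<open>The weighted estimate\<close>

definition laplacian :: "real \<Rightarrow> (nat \<Rightarrow> real) \<Rightarrow> nat \<Rightarrow> real" where
  "laplacian h p i = (p (Suc i) - 2 * p i + p (i - 1)) / h\<^sup>2"

text \<open>The lower-order terms are known only through a pointwise bound. This lets one locale
  serve the equation for \<open>p\<close>, where the contributions of \<open>q\<close> and
  \<open>Z\<close> are hidden in \<open>f\<close>, and makes the hypotheses invariant under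
  reflection of the mesh.\<close>

locale backward_heat =
  fixes N :: nat and h T K :: real and p G f :: "nat \<Rightarrow> real \<Rightarrow> real"
  assumes h_pos: "0 < h" and Nh: "real (Suc N) * h = 1" and T_pos: "0 < T" and K_nonneg: "0 \<le> K"
    and p_0: "\<And>t. p 0 t = 0" and p_N: "\<And>t. p (Suc N) t = 0"
    and p_eq: "\<And>i. i \<in> {1..N} \<Longrightarrow> has_primitive T (\<lambda>t. - (laplacian h (\<lambda>j. p j t) i + G i t)) (p i)"
    and G_bound: "\<And>i t. i \<in> {1..N} \<Longrightarrow> t \<in> {0..T} \<Longrightarrow> \<bar>G i t\<bar> \<le> K * \<bar>p i t\<bar> + f i t"
    and f_nonneg: "\<And>i t. 0 \<le> f i t"
    and f_L2: "\<And>i. i \<in> {1..N} \<Longrightarrow> set_integrable lborel {0..T} (\<lambda>t. (f i t)\<^sup>2)"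

lemma has_primitive_le:
  assumes u: "has_primitive T U u" and T: "0 \<le> T"
    and a: "set_integrable lborel {0..T} a" and b: "set_integrable lborel {0..T} b"
    and le: "\<And>t. t \<in> {0..T} \<Longrightarrow> U t \<le> b t - a t"
  shows "(LINT t:{0..T}|lborel. a t) \<le> (LINT t:{0..T}|lborel. b t) + u 0 - u T"
proof -
  have "u T - u 0 = (LINT t:{0..T}|lborel. U t)" using has_primitive_eq[OF u, of T] T by simp
  also have "\<dots> \<le> (LINT t:{0..T}|lborel. b t - a t)"
    by (intro set_integral_mono has_primitive_integrable[OF u] set_integral_diff a b le)
  also have "\<dots> = (LINT t:{0..T}|lborel. b t) - (LINT t:{0..T}|lborel. a t)"
    by (rule set_integral_diff[OF b a])
  finally show ?thesis by simp
qed

lemma set_integrable_continuous: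
  fixes g :: "real \<Rightarrow> real"
  assumes "continuous_on {a..b} g" shows "set_integrable lborel {a..b} g"
  unfolding set_integrable_def using borel_integrable_compact[OF compact_Icc assms] by simp

lemma set_integrable_sum:
  fixes u :: "'i \<Rightarrow> real \<Rightarrow> real"
  assumes "\<And>i. i \<in> S \<Longrightarrow> set_integrable lborel X (u i)"
  shows "set_integrable lborel X (\<lambda>t. \<Sum>i\<in>S. u i t)"
proof -
  have "integrable lborel (\<lambda>t. \<Sum>i\<in>S. indicator X t *\<^sub>R u i t)"
    using assms unfolding set_integrable_def by (intro Bochner_Integration.integrable_sum) auto
  then show ?thesis unfolding set_integrable_def by (simp add: sum_distrib_left)
qed

lemma has_primitive_restrict:
  "has_primitive T U u \<Longrightarrow> t \<le> T \<Longrightarrow> has_primitive t U u"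
  using has_primitive_integrable_sub[of T U u t] unfolding has_primitive_def by (meson atLeastAtMost_iff order_trans)

section \<open>Energy of the backward equation\<close>

context backward_heat
begin

definition "P t = (\<Sum>i=1..N. (p i t)\<^sup>2)"
definition "Fs t = (\<Sum>i=1..N. (f i t)\<^sup>2)"

lemma p_primitive: 
  assumes "i \<le> Suc N"
  shows "has_primitive T (\<lambda>t. if i \<in> {1..N} then - (laplacian h (\<lambda>j. p j t) i + G i t) else 0) (p i)"
proof (cases "i \<in> {1..N}")
  case False
  then have "p i = (\<lambda>_. 0)" using assms p_0 p_N by (cases "i = 0") (auto simp: not_less_eq_eq le_Suc_eq)
  then show ?thesis using False by (auto intro: has_primitive_const)
qed (use p_eq in auto)

lemma P_nonneg: "0 \<le> P t" unfolding P_def by (simp add: sum_nonneg)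
lemma Fs_nonneg: "0 \<le> Fs t" unfolding Fs_def by (simp add: sum_nonneg)

lemma p_cont: "i \<le> Suc N \<Longrightarrow> continuous_on {0..T} (p i)"
  by (rule has_primitive_continuous[OF p_primitive])

lemma P_cont: "continuous_on {0..T} P"
  unfolding P_def by (intro continuous_intros p_cont) auto

lemma Fs_integrable: "set_integrable lborel {0..T} Fs"
  unfolding Fs_def by (intro set_integrable_sum f_L2)

text \<open>Gronwall in the direction in which the equation dissipates: up to the source,
  \<open>exp (l * t) * P t\<close> does not decrease in \<open>t\<close>. So the value at time 0 is
  controlled by any later one, with a constant that does not see \<open>h\<close>.\<close>

lemma energy_estimate:
  assumes t: "t \<in> {0..T}"
  shows "P 0 \<le> exp ((2 * K + 1) * T) * (P t + (LINT s:{0..T}|lborel. Fs s))"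
proof -
  define l where "l = 2 * K + 1"
  have l: "0 \<le> l" using K_nonneg by (simp add: l_def)
  define g where "g i s = (if i \<in> {1..N} then - (laplacian h (\<lambda>j. p j s) i + G i s) else 0)" for i s
  have e: "has_primitive T (\<lambda>s. l * exp (l * s)) (\<lambda>s. exp (l * s))"
    by (rule has_primitive_C1) (auto intro!: derivative_eq_intros continuous_intros)
  have "has_primitive T (\<lambda>s. (l * exp (l * s)) * (\<Sum>i=1..N. p i s * p i s) + (\<Sum>i=1..N. g i s * p i s + g i s * p i s) * exp (l * s))
     (\<lambda>s. exp (l * s) * (\<Sum>i=1..N. p i s * p i s))"
    unfolding g_def by (intro has_primitive_mult e has_primitive_sum p_primitive) auto
  then have R: "has_primitive t (\<lambda>s. (l * exp (l * s)) * (\<Sum>i=1..N. p i s * p i s) + (\<Sum>i=1..N. g i s * p i s + g i s * p i s) * exp (l * s))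
     (\<lambda>s. exp (l * s) * (\<Sum>i=1..N. p i s * p i s))" (is "has_primitive t ?R _")
    by (rule has_primitive_restrict) (use t in auto)
  have bound: "0 - exp (l * T) * Fs s \<le> ?R s" if s: "s \<in> {0..t}" for s
  proof -
    have sT: "s \<in> {0..T}" using s t by auto
    have 1: "(\<Sum>i=1..N. p i s * laplacian h (\<lambda>j. p j s) i) \<le> 0"
    proof -
      have "(\<Sum>i=1..N. p i s * laplacian h (\<lambda>j. p j s) i) 
         = (\<Sum>i=1..N. 1\<^sup>2 * p i s * (p (Suc i) s - 2 * p i s + p (i - 1) s)) / h\<^sup>2"
        by (simp add: laplacian_def sum_divide_distrib)
      also have "\<dots> \<le> (- (\<Sum>i=0..N. (1\<^sup>2 + 1\<^sup>2) * (p (Suc i) s - p i s)\<^sup>2) / 4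
          + (\<Sum>i=0..N. (1 - 1)\<^sup>2 * ((p i s)\<^sup>2 + (p (Suc i) s)\<^sup>2))) / h\<^sup>2"
        by (intro divide_right_mono caccioppoli_sum[of "\<lambda>i. p i s" N "\<lambda>_. 1"] p_0 p_N) auto
      also have "\<dots> \<le> 0" by (intro divide_nonpos_nonneg) (auto intro!: sum_nonneg)
      finally show ?thesis .
    qed
    have 2: "(\<Sum>i=1..N. p i s * G i s) \<le> (\<Sum>i=1..N. (K + 1/2) * (p i s * p i s) + (f i s)\<^sup>2 / 2)"
    proof (rule sum_mono)
      fix i assume i: "i \<in> {1..N}"
      have "p i s * G i s \<le> \<bar>p i s\<bar> * (K * \<bar>p i s\<bar> + f i s)"
        using mult_left_mono[OF G_bound[OF i sT], of "\<bar>p i s\<bar>"] abs_le_D1[of "p i s * G i s"]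
        by (simp add: abs_mult)
      also have "\<dots> \<le> (K + 1/2) * (p i s * p i s) + (f i s)\<^sup>2 / 2"
        using sum_squares_bound[of "\<bar>p i s\<bar>" "f i s"] by (simp add: power2_eq_square algebra_simps abs_mult_self_eq)
      finally show "p i s * G i s \<le> (K + 1/2) * (p i s * p i s) + (f i s)\<^sup>2 / 2" .
    qed
    have 3: "(\<Sum>i=1..N. g i s * p i s + g i s * p i s) =
       - 2 * (\<Sum>i=1..N. p i s * laplacian h (\<lambda>j. p j s) i) - 2 * (\<Sum>i=1..N. p i s * G i s)"
      unfolding sum_distrib_left sum_subtractf[symmetric] by (intro sum.cong) (auto simp: g_def algebra_simps)
    have 4: "(\<Sum>i=1..N. (K + 1/2) * (p i s * p i s) + (f i s)\<^sup>2 / 2) = (K + 1/2) * (\<Sum>i=1..N. p i s * p i s) + Fs s / 2"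
      by (simp add: Fs_def sum.distrib sum_distrib_left sum_divide_distrib)
    have "(\<Sum>i=1..N. g i s * p i s + g i s * p i s) \<ge> - (l * (\<Sum>i=1..N. p i s * p i s)) - Fs s"
      using 1 2 unfolding 3 4 l_def by (simp add: algebra_simps)
    then have "(- (l * (\<Sum>i=1..N. p i s * p i s)) - Fs s) * exp (l * s) \<le> (\<Sum>i=1..N. g i s * p i s + g i s * p i s) * exp (l * s)"
      by (intro mult_right_mono) auto
    moreover have "Fs s * exp (l * s) \<le> Fs s * exp (l * T)"
      using Fs_nonneg s t l by (intro mult_left_mono) (auto intro!: mult_left_mono)
    ultimately show ?thesis by (simp add: algebra_simps)
  qed
  have Fi: "set_integrable lborel {0..t} Fs"
    by (rule set_integrable_subset[OF Fs_integrable]) (use t in auto)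
  have R': "has_primitive t (\<lambda>s. (-1) * ?R s) (\<lambda>s. (-1) * (exp (l * s) * (\<Sum>i=1..N. p i s * p i s)))"
    by (rule has_primitive_cmult[OF R])
  have "(LINT s:{0..t}|lborel. 0::real) \<le> (LINT s:{0..t}|lborel. exp (l * T) * Fs s) 
     + (-1) * (exp (l * 0) * (\<Sum>i=1..N. p i 0 * p i 0)) - (-1) * (exp (l * t) * (\<Sum>i=1..N. p i t * p i t))"
  proof (rule has_primitive_le[OF R'])
    fix s assume "s \<in> {0..t}"
    from bound[OF this] show "- 1 * ?R s \<le> exp (l * T) * Fs s - 0" unfolding mult_minus_left mult_1 by linarith
  next
    show "set_integrable lborel {0..t} (\<lambda>s. exp (l * T) * Fs s)" using Fi by (rule set_integrable_mult_right)
  qed (use t in \<open>auto simp: set_integrable_def\<close>)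
  then have "P 0 \<le> exp (l * T) * (LINT s:{0..t}|lborel. Fs s) + exp (l * t) * P t"
    by (simp add: P_def power2_eq_square)
  also have "\<dots> \<le> exp (l * T) * (LINT s:{0..T}|lborel. Fs s) + exp (l * T) * P t"
  proof (intro add_mono mult_left_mono mult_right_mono)
    show "(LINT s:{0..t}|lborel. Fs s) \<le> (LINT s:{0..T}|lborel. Fs s)"
      using t Fs_nonneg Fs_integrable Fi unfolding set_lebesgue_integral_def set_integrable_def
      by (intro integral_mono) (auto simp: indicator_def)
  qed (use t l P_nonneg in \<open>auto intro!: mult_left_mono\<close>)
  finally show ?thesis by (simp add: l_def distrib_left)
qed

end

text \<open>The scales around \<open>m\<close> are nested so that a neighbouring node never leaves
  the next one: \<open>\<kappa>\<close> varies within \<open>2 * r\<close>, \<open>\<eta>\<close> is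
  1 there and vanishes beyond \<open>3 * r\<close>, and the observation reaches to
  \<open>4 * r\<close>, with \<open>h \<le> r\<close>. The smallness of \<open>c\<close> is tuned
  for absorption into \<open>\<sigma> ^ 3\<close>: \<open>c1\<close> and \<open>c2\<close> control
  the time derivatives of the weight, \<open>c3\<close> makes \<open>\<sigma>\<close> large compared
  with the coefficient bound \<open>K\<close>.\<close>

locale carleman_left = backward_heat +
  fixes c r m \<Lambda> :: real and \<kappa> \<eta> :: "nat \<Rightarrow> real"
  assumes r_pos: "0 < r" and h_le_r: "h \<le> r" and h_le_1: "h \<le> 1" and Lam: "0 \<le> \<Lambda>"
    and kappa_range: "\<And>i. i \<le> Suc N \<Longrightarrow> 0 \<le> \<kappa> i \<and> \<kappa> i \<le> 1" and kappa_N: "\<kappa> N = 0"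
    and kappa_const: "\<And>i. i \<in> {1..N} \<Longrightarrow> \<bar>real i * h - m\<bar> > 2 * r \<Longrightarrow> \<kappa> (Suc i) = \<kappa> i \<and> \<kappa> (i - 1) = \<kappa> i"
    and kappa_lip: "\<And>i. i \<le> N \<Longrightarrow> \<bar>\<kappa> (Suc i) - \<kappa> i\<bar> \<le> \<Lambda> * h"
    and kappa_lip2: "\<And>i. i \<in> {1..N} \<Longrightarrow> \<bar>\<kappa> (Suc i) - 2 * \<kappa> i + \<kappa> (i - 1)\<bar> \<le> \<Lambda> * h\<^sup>2"
    and eta_range: "\<And>i. 0 \<le> \<eta> i \<and> \<eta> i \<le> 1"
    and eta_1: "\<And>i. \<bar>real i * h - m\<bar> \<le> 2 * r \<Longrightarrow> \<eta> i = 1"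
    and eta_0: "\<And>i. \<bar>real i * h - m\<bar> \<ge> 3 * r \<Longrightarrow> \<eta> i = 0"
    and eta_lip: "\<And>i. \<bar>\<eta> (Suc i) - \<eta> i\<bar> \<le> \<Lambda> * h"
    and c_pos: "0 < c" and c1: "c * T \<le> 1/1000" and c2: "c \<le> 1/100"
    and c3: "(h + c * T\<^sup>2 / 4) * (1 + 2 * K\<^sup>2) \<le> 1"
begin

definition "\<omega> = {i\<in>{1..N}. \<bar>real i * h - m\<bar> \<le> 4 * r}"
definition "P\<omega> t = (\<Sum>i\<in>\<omega>. (p i t)\<^sup>2)"
text \<open>The added \<open>h\<close> caps the usual singular weight
  \<open>1 / (t * (T - t))\<close> at \<open>1 / h\<close>, which is what
  \<open>\<sigma> t * h \<le> 1\<close> expresses.\<close>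

definition "\<rho> t = h + c * t * (T - t)"
definition "\<sigma> t = 1 / \<rho> t"
definition "\<tau> t = - c * (T - 2 * t) * (\<sigma> t)\<^sup>2"
definition "\<tau>' t = 2 * c\<^sup>2 * (T - 2 * t)\<^sup>2 * (\<sigma> t) ^ 3 + 2 * c * (\<sigma> t)\<^sup>2"
text \<open>The shift by 3 puts the values between -5/2 and -1. The upper end makes the weight at
  most \<open>exp (- \<sigma> t)\<close>; the lower end determines the cost of removing the weight
  in the middle of the time interval.\<close>

definition "\<psi> i = (1 + real i * h)\<^sup>2 / 2 - 3"
definition "E i t = exp (\<sigma> t * \<psi> i)"
definition "v i t = E i t * \<kappa> i * p i t"
text \<open>The commutator of the second difference with multiplication by \<open>\<kappa>\<close>,
  applied to \<open>p\<close>.\<close>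

definition "cm i t = ((\<kappa> (Suc i) - \<kappa> i) * p (Suc i) t + (\<kappa> (i - 1) - \<kappa> i) * p (i - 1) t) / h\<^sup>2"
definition "F i t = E i t * (\<kappa> i * G i t - cm i t)"
text \<open>The density of \<open>v\<close>: the first term comes from differentiating the weight,
  the second from the equation.\<close>

definition "w i t = (if i \<in> {1..N} then \<tau> t * \<psi> i * v i t - E i t * \<kappa> i * (laplacian h (\<lambda>j. p j t) i + G i t) else 0)"
definition "\<delta> i t = \<sigma> t * (\<psi> (Suc i) - \<psi> i)"
text \<open>The quadratic form of the symmetric part, \<open>\<Sum>i. S i * v i\<close>, after the
  two neighbour terms have been merged edge by edge.\<close>

definition "Q t = (\<Sum>i=0..N. 2 / h\<^sup>2 * (cosh (\<delta> i t) * (v i t * v (Suc i) t)))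
    - (\<Sum>i=1..N. (2 / h\<^sup>2 + \<tau> t * \<psi> i) * (v i t)\<^sup>2)"
definition "V t = (\<Sum>i=1..N. (v i t)\<^sup>2)"
definition "Q' t = (\<Sum>i=0..N. 2 / h\<^sup>2 * (sinh (\<delta> i t) * (\<tau> t * (\<psi> (Suc i) - \<psi> i)) * (v i t * v (Suc i) t)
            + cosh (\<delta> i t) * (v i t * w (Suc i) t + w i t * v (Suc i) t)))
       - (\<Sum>i=1..N. 2 * (2 / h\<^sup>2 + \<tau> t * \<psi> i) * (v i t * w i t) + \<tau>' t * \<psi> i * (v i t)\<^sup>2)"
text \<open>A bound for the squared weight that does not depend on the node. The Caccioppoli
  estimate uses it in place of the true weight, so that no space derivative of the weight appears
  there.\<close>

definition "\<xi> t = exp (- 2 * \<sigma> t)"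
definition "Y t = \<xi> t * (\<Sum>i=1..N. (\<eta> i)\<^sup>2 * (p i t * p i t))"
definition "Y' t = -2 * \<tau> t * \<xi> t * (\<Sum>i=1..N. (\<eta> i)\<^sup>2 * (p i t * p i t))
    - 2 * \<xi> t * (\<Sum>i=1..N. (\<eta> i)\<^sup>2 * p i t * (laplacian h (\<lambda>j. p j t) i + G i t))"
definition "W t = (\<Sum>i=0..N. ((\<eta> i)\<^sup>2 + (\<eta> (Suc i))\<^sup>2) * ((p (Suc i) t - p i t) / h)\<^sup>2)"

section \<open>Size and regularity of the time weight\<close>

lemma rho_bounds:
  assumes "t \<in> {0..T}" shows "0 < \<rho> t" "\<rho> t \<le> h + c * T\<^sup>2 / 4" "h \<le> \<rho> t"
proof -
  have "0 \<le> c * t * (T - t)" using assms c_pos by auto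
  then show "0 < \<rho> t" "h \<le> \<rho> t" using h_pos by (auto simp: \<rho>_def)
  have "t * (T - t) = T\<^sup>2 / 4 - (t - T / 2)\<^sup>2" by (simp add: power2_eq_square field_simps)
  then have "t * (T - t) \<le> T\<^sup>2 / 4" by simp
  from mult_left_mono[OF this, of c] show "\<rho> t \<le> h + c * T\<^sup>2 / 4" using c_pos by (simp add: \<rho>_def mult.assoc)
qed

lemma sigma_pos: "t \<in> {0..T} \<Longrightarrow> 0 < \<sigma> t" using rho_bounds by (simp add: \<sigma>_def)

lemma sigma_ge: assumes "t \<in> {0..T}" shows "1 + 2 * K\<^sup>2 \<le> \<sigma> t"
proof -
  have "\<rho> t * (1 + 2 * K\<^sup>2) \<le> (h + c * T\<^sup>2 / 4) * (1 + 2 * K\<^sup>2)"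
    using rho_bounds[OF assms] by (intro mult_right_mono) auto
  then have "\<rho> t * (1 + 2 * K\<^sup>2) \<le> 1" using c3 by linarith
  then show ?thesis using rho_bounds[OF assms] by (simp add: \<sigma>_def field_simps)
qed

lemma sigma_ge_1: "t \<in> {0..T} \<Longrightarrow> 1 \<le> \<sigma> t"
  using sigma_ge[of t] zero_le_power2[of K] by linarith

lemma sigma_h: "t \<in> {0..T} \<Longrightarrow> \<sigma> t * h \<le> 1"
  using rho_bounds[of t] by (simp add: \<sigma>_def field_simps)

lemma tau_bound: assumes "t \<in> {0..T}" shows "\<bar>\<tau> t\<bar> \<le> (\<sigma> t)\<^sup>2 / 1000"
proof -
  have "c * \<bar>T - 2 * t\<bar> \<le> c * T" using assms c_pos by (intro mult_left_mono) auto
  then have "c * \<bar>T - 2 * t\<bar> \<le> 1 / 1000" using c1 by linarith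
  then have "c * \<bar>T - 2 * t\<bar> * (\<sigma> t)\<^sup>2 \<le> 1 / 1000 * (\<sigma> t)\<^sup>2" by (intro mult_right_mono) auto
  then show ?thesis using c_pos by (simp add: \<tau>_def abs_mult)
qed

lemma tau'_bound: assumes "t \<in> {0..T}" shows "\<bar>\<tau>' t\<bar> \<le> (\<sigma> t) ^ 3 / 10"
proof -
  have s: "1 \<le> \<sigma> t" using sigma_ge_1[OF assms] .
  have "c * \<bar>T - 2 * t\<bar> \<le> c * T" using assms c_pos by (intro mult_left_mono) auto
  then have "c * \<bar>T - 2 * t\<bar> \<le> 1 / 1000" using c1 by linarith
  then have "(c * \<bar>T - 2 * t\<bar>)\<^sup>2 \<le> (1 / 1000)\<^sup>2" using c_pos by (intro power_mono) auto
  then have "c\<^sup>2 * (T - 2 * t)\<^sup>2 \<le> 1 / 1000" by (simp add: power_mult_distrib power_divide)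
  then have 1: "2 * (c\<^sup>2 * (T - 2 * t)\<^sup>2) * (\<sigma> t) ^ 3 \<le> 2 * (1 / 1000) * (\<sigma> t) ^ 3"
    using s by (intro mult_right_mono mult_left_mono) auto
  have "2 * c * (\<sigma> t)\<^sup>2 \<le> 2 * (1 / 100) * (\<sigma> t) ^ 3"
    using c2 c_pos s by (intro mult_mono power_increasing) auto
  moreover have "0 \<le> \<tau>' t" unfolding \<tau>'_def using c_pos s by auto
  moreover have "\<tau>' t = 2 * (c\<^sup>2 * (T - 2 * t)\<^sup>2) * (\<sigma> t) ^ 3 + 2 * c * (\<sigma> t)\<^sup>2"
    by (simp add: \<tau>'_def mult.assoc)
  moreover have "0 \<le> (\<sigma> t) ^ 3" using s by simp
  ultimately show ?thesis using 1 by linarith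
qed

lemma sigma_deriv: assumes "t \<in> {0..T}"
  shows "(\<sigma> has_real_derivative \<tau> t) (at t within S)"
  unfolding \<sigma>_def \<rho>_def using rho_bounds(1)[OF assms] 
  by (auto intro!: derivative_eq_intros simp: \<rho>_def \<tau>_def \<sigma>_def field_simps power2_eq_square)

lemma tau_deriv: assumes "t \<in> {0..T}"
  shows "(\<tau> has_real_derivative \<tau>' t) (at t within S)"
proof -
  have "((\<lambda>t. - c * (T - 2 * t) * (\<sigma> t)\<^sup>2) has_real_derivative \<tau>' t) (at t within S)"
    by (auto intro!: derivative_eq_intros sigma_deriv[OF assms] 
        simp: \<tau>'_def \<tau>_def power2_eq_square power3_eq_cube algebra_simps)
  then show ?thesis unfolding \<tau>_def .
qed

lemma sigma_cont: "continuous_on {0..T} \<sigma>"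
  using sigma_deriv DERIV_continuous_on by blast
lemma tau_cont: "continuous_on {0..T} \<tau>"
  using tau_deriv DERIV_continuous_on by blast
lemma tau'_cont: "continuous_on {0..T} \<tau>'"
  unfolding \<tau>'_def by (intro continuous_intros sigma_cont)

section \<open>Densities of the weighted functionals\<close>

lemma E_primitive: "has_primitive T (\<lambda>t. \<tau> t * \<psi> i * E i t) (E i)"
  unfolding E_def by (rule has_primitive_C1)
   (auto intro!: derivative_eq_intros sigma_deriv continuous_intros sigma_cont tau_cont)

lemma cosh_primitive:
  "has_primitive T (\<lambda>t. sinh (\<delta> i t) * (\<tau> t * (\<psi> (Suc i) - \<psi> i))) (\<lambda>t. cosh (\<delta> i t))"
  unfolding \<delta>_def by (rule has_primitive_C1)
   (auto intro!: derivative_eq_intros sigma_deriv continuous_intros sigma_cont tau_cont)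

lemma xi_primitive: "has_primitive T (\<lambda>t. -2 * \<tau> t * \<xi> t) \<xi>"
  unfolding \<xi>_def by (rule has_primitive_C1)
   (auto intro!: derivative_eq_intros sigma_deriv continuous_intros sigma_cont tau_cont)

lemma tau_psi_primitive: "has_primitive T (\<lambda>t. \<tau>' t * \<psi> i) (\<lambda>t. 2 / h\<^sup>2 + \<tau> t * \<psi> i)"
  by (rule has_primitive_C1)
   (auto intro!: derivative_eq_intros tau_deriv continuous_intros tau'_cont)

lemma v_primitive: 
  assumes "i \<le> Suc N" shows "has_primitive T (w i) (v i)"
proof -
  have "has_primitive T (\<lambda>t. \<kappa> i * ((\<tau> t * \<psi> i * E i t) * p i t + 
      (if i \<in> {1..N} then - (laplacian h (\<lambda>j. p j t) i + G i t) else 0) * E i t)) (\<lambda>t. \<kappa> i * (E i t * p i t))"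
    by (intro has_primitive_cmult has_primitive_mult E_primitive p_primitive assms)
  then show ?thesis
  proof (rule has_primitive_cong)
    fix t assume t: "t \<in> {0..T}"
    show "\<kappa> i * (E i t * p i t) = v i t" by (simp add: v_def)
    show "\<kappa> i * ((\<tau> t * \<psi> i * E i t) * p i t + 
      (if i \<in> {1..N} then - (laplacian h (\<lambda>j. p j t) i + G i t) else 0) * E i t) = w i t"
    proof (cases "i \<in> {1..N}")
      case False
      then have "p i t = 0" using assms p_0 p_N by (cases "i = 0") (auto simp: not_less_eq_eq le_Suc_eq)
      then show ?thesis using False by (auto simp: w_def)
    qed (auto simp: w_def v_def algebra_simps)
  qed (use T_pos in auto)
qed

lemma Q_primitive: "has_primitive T Q' Q"
proof -
  let ?a = "\<lambda>i t. 2 / h\<^sup>2 * ((sinh (\<delta> i t) * (\<tau> t * (\<psi> (Suc i) - \<psi> i))) * (v i t * v (Suc i) t)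
     + (w i t * v (Suc i) t + w (Suc i) t * v i t) * cosh (\<delta> i t))"
  let ?b = "\<lambda>i t. (\<tau>' t * \<psi> i) * (v i t * v i t) + (w i t * v i t + w i t * v i t) * (2 / h\<^sup>2 + \<tau> t * \<psi> i)"
  have "has_primitive T (\<lambda>t. (\<Sum>i=0..N. ?a i t) + (-1) * (\<Sum>i=1..N. ?b i t))
     (\<lambda>t. (\<Sum>i=0..N. 2 / h\<^sup>2 * (cosh (\<delta> i t) * (v i t * v (Suc i) t)))
        + (-1) * (\<Sum>i=1..N. (2 / h\<^sup>2 + \<tau> t * \<psi> i) * (v i t * v i t)))"
    by (intro has_primitive_add has_primitive_cmult has_primitive_sum has_primitive_mult 
       cosh_primitive tau_psi_primitive v_primitive) auto
  then show ?thesis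
    by (rule has_primitive_cong) (use T_pos in \<open>auto simp: Q_def Q'_def power2_eq_square algebra_simps
       intro!: sum.cong arg_cong2[where f="(-)"]\<close>)
qed

lemma Y_primitive: "has_primitive T Y' Y"
proof -
  have "has_primitive T (\<lambda>t. (-2 * \<tau> t * \<xi> t) * (\<Sum>i=1..N. (\<eta> i)\<^sup>2 * (p i t * p i t)) +
      (\<Sum>i=1..N. (\<eta> i)\<^sup>2 * ((if i \<in> {1..N} then - (laplacian h (\<lambda>j. p j t) i + G i t) else 0) * p i t
        + (if i \<in> {1..N} then - (laplacian h (\<lambda>j. p j t) i + G i t) else 0) * p i t)) * \<xi> t) Y"
    unfolding Y_def
    by (intro has_primitive_mult xi_primitive has_primitive_sum has_primitive_cmult p_primitive) auto
  then show ?thesis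
    by (rule has_primitive_cong) (use T_pos in \<open>auto simp: Y'_def sum_distrib_left sum_distrib_right algebra_simps
       simp flip: sum.distrib sum_negf intro!: sum.cong\<close>)
qed

lemma psi_le: assumes "i \<in> {1..N}" shows "-5/2 \<le> \<psi> i" "\<psi> i \<le> -1"
proof -
  have "real i * h \<le> real (Suc N) * h" using assms h_pos by (intro mult_right_mono) auto
  then have "real i * h \<le> 1" unfolding Nh .
  then have "1 \<le> 1 + real i * h" "1 + real i * h \<le> 2" using h_pos by auto
  then have "1\<^sup>2 \<le> (1 + real i * h)\<^sup>2" "(1 + real i * h)\<^sup>2 \<le> 2\<^sup>2" by (intro power_mono; simp)+
  then show "-5/2 \<le> \<psi> i" "\<psi> i \<le> -1" by (auto simp: \<psi>_def)
qed

lemma xi_bounds: "t \<in> {0..T} \<Longrightarrow> 0 < \<xi> t \<and> \<xi> t \<le> 1"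
  using sigma_pos[of t] by (simp add: \<xi>_def)

lemma E_sq_le: assumes "t \<in> {0..T}" "i \<in> {1..N}" shows "(E i t)\<^sup>2 \<le> \<xi> t"
proof -
  have "\<sigma> t * \<psi> i \<le> \<sigma> t * (- 1)"
    by (rule mult_left_mono[OF psi_le(2)[OF assms(2)]]) (rule less_imp_le[OF sigma_pos[OF assms(1)]])
  then have "2 * (\<sigma> t * \<psi> i) \<le> - 2 * \<sigma> t" by linarith
  then have "exp (2 * (\<sigma> t * \<psi> i)) \<le> exp (- 2 * \<sigma> t)" by (simp only: exp_le_cancel_iff)
  then show ?thesis unfolding E_def \<xi>_def exp_double .
qed

lemma E_le_1: assumes "t \<in> {0..T}" "i \<in> {1..N}" shows "0 \<le> E i t" "E i t \<le> 1"
proof -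
  have "\<sigma> t * \<psi> i \<le> 0"
    by (rule mult_nonneg_nonpos) (use psi_le(2)[OF assms(2)] sigma_pos[OF assms(1)] in linarith)+
  then show "0 \<le> E i t" "E i t \<le> 1" by (simp_all add: E_def)
qed

lemma V_le: assumes "t \<in> {0..T}" shows "V t \<le> \<xi> t * P t"
  unfolding V_def P_def sum_distrib_left
proof (rule sum_mono)
  fix i assume i: "i \<in> {1..N}"
  have "(v i t)\<^sup>2 = (E i t)\<^sup>2 * (\<kappa> i)\<^sup>2 * (p i t)\<^sup>2" by (simp add: v_def power_mult_distrib)
  also have "\<dots> \<le> \<xi> t * 1 * (p i t)\<^sup>2"
    using E_sq_le[OF assms i] kappa_range[of i] i xi_bounds[OF assms]
    by (intro mult_right_mono mult_mono power_le_one) auto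
  finally show "(v i t)\<^sup>2 \<le> \<xi> t * (p i t)\<^sup>2" by simp
qed

lemma Pw_nonneg: "0 \<le> P\<omega> t" unfolding P\<omega>_def by (simp add: sum_nonneg)

text \<open>The commutator lives only where \<open>\<kappa>\<close> varies. There
  \<open>\<eta> = 1\<close>, so its first-order part is controlled by the localised gradient
  \<open>W\<close>, and its zeroth-order part by the observation. Each edge is counted from both of
  its ends, which doubles the 3 from the square of a sum of three terms.\<close>

lemma weighted_commutator_bound:
  assumes t: "t \<in> {0..T}"
  shows "(\<Sum>i=1..N. (E i t * cm i t)\<^sup>2) \<le> 6 * \<Lambda>\<^sup>2 * \<xi> t * W t + 3 * \<Lambda>\<^sup>2 * P\<omega> t"
proof -
  define D where "D i = ((\<eta> i)\<^sup>2 + (\<eta> (Suc i))\<^sup>2) * ((p (Suc i) t - p i t) / h)\<^sup>2" for i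
  define a where "a i = (if i \<in> \<omega> then (p i t)\<^sup>2 else 0)" for i
  have D0: "0 \<le> D i" for i by (simp add: D_def)
  have xi: "0 < \<xi> t" "\<xi> t \<le> 1" using xi_bounds[OF t] by auto
  have "(E i t * cm i t)\<^sup>2 \<le> \<xi> t * (3 * \<Lambda>\<^sup>2) * (D i + D (i - 1)) + 3 * \<Lambda>\<^sup>2 * a i" if i: "i \<in> {1..N}" for i
  proof (cases "\<bar>real i * h - m\<bar> > 2 * r")
    case True
    then have "cm i t = 0" using kappa_const[OF i] by (simp add: cm_def)
    then show ?thesis using D0 xi by (simp add: a_def)
  next
    case False
    obtain j where j: "i = Suc j" using i by (cases i) auto
    have iw: "i \<in> \<omega>" using False i r_pos by (auto simp: \<omega>_def)
    have eta: "\<eta> i = 1" using eta_1 False by simp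
    let ?d = "(p (Suc i) t - p i t) / h" and ?e = "(p i t - p (i - 1) t) / h"
    let ?A = "(\<kappa> (Suc i) - \<kappa> i) / h" and ?B = "(\<kappa> i - \<kappa> (i - 1)) / h"
    let ?C = "(\<kappa> (Suc i) - 2 * \<kappa> i + \<kappa> (i - 1)) / h\<^sup>2"
    \<comment> \<open>Discrete Leibniz rule: differences of \<open>\<kappa>\<close> times
      differences of \<open>p\<close>, plus the second difference of \<open>\<kappa>\<close> times
      \<open>p\<close>. Only in this form are the negative powers of \<open>h\<close>
      absorbed.\<close>
    have "cm i t = ?A * ?d + ?B * ?e + ?C * p i t"
      using h_pos unfolding cm_def by (simp add: field_simps power2_eq_square)
    then have "(cm i t)\<^sup>2 \<le> 3 * ((?A * ?d)\<^sup>2 + (?B * ?e)\<^sup>2 + (?C * p i t)\<^sup>2)"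
      using square_sum3_le by presburger
    also have "\<dots> \<le> 3 * (\<Lambda>\<^sup>2 * ?d\<^sup>2 + \<Lambda>\<^sup>2 * ?e\<^sup>2 + \<Lambda>\<^sup>2 * (p i t)\<^sup>2)"
    proof -
      have "\<bar>?A\<bar> \<le> \<Lambda>" using kappa_lip[of i] i h_pos by (simp add: field_simps)
      moreover have "\<bar>?B\<bar> \<le> \<Lambda>" using kappa_lip[of j] i j h_pos by (simp add: field_simps)
      moreover have "\<bar>?C\<bar> \<le> \<Lambda>" using kappa_lip2[of i] i h_pos by (simp add: field_simps)
      moreover have "y\<^sup>2 \<le> \<Lambda>\<^sup>2" if "\<bar>y\<bar> \<le> \<Lambda>" for y using that Lam by (simp add: abs_le_square_iff[symmetric])
      ultimately have "?A\<^sup>2 \<le> \<Lambda>\<^sup>2" "?B\<^sup>2 \<le> \<Lambda>\<^sup>2" "?C\<^sup>2 \<le> \<Lambda>\<^sup>2" by blast+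
      then show ?thesis unfolding power_mult_distrib 
        by (intro mult_left_mono add_mono mult_right_mono) auto
    qed
    finally have cm: "(cm i t)\<^sup>2 \<le> 3 * \<Lambda>\<^sup>2 * (?d\<^sup>2 + ?e\<^sup>2) + 3 * \<Lambda>\<^sup>2 * a i"
      using iw by (simp add: a_def algebra_simps)
    have dD: "?d\<^sup>2 \<le> D i"
    proof -
      have "1 * ?d\<^sup>2 \<le> ((\<eta> i)\<^sup>2 + (\<eta> (Suc i))\<^sup>2) * ?d\<^sup>2"
        using eta by (intro mult_right_mono) auto
      then show ?thesis by (simp add: D_def)
    qed
    have eD: "?e\<^sup>2 \<le> D (i - 1)"
    proof -
      have "1 * ?e\<^sup>2 \<le> ((\<eta> j)\<^sup>2 + (\<eta> (Suc j))\<^sup>2) * ?e\<^sup>2"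
        using eta j by (intro mult_right_mono) auto
      then show ?thesis by (simp add: D_def j)
    qed
    have "(E i t * cm i t)\<^sup>2 = (E i t)\<^sup>2 * (cm i t)\<^sup>2" by (simp add: power_mult_distrib)
    also have "\<dots> \<le> \<xi> t * (3 * \<Lambda>\<^sup>2 * (D i + D (i - 1)) + 3 * \<Lambda>\<^sup>2 * a i)"
    proof (rule mult_mono[OF E_sq_le[OF t i]])
      have "3 * \<Lambda>\<^sup>2 * (?d\<^sup>2 + ?e\<^sup>2) \<le> 3 * \<Lambda>\<^sup>2 * (D i + D (i - 1))"
        using dD eD by (intro mult_left_mono add_mono) auto
      then show "(cm i t)\<^sup>2 \<le> 3 * \<Lambda>\<^sup>2 * (D i + D (i - 1)) + 3 * \<Lambda>\<^sup>2 * a i" using cm by linarith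
    qed (use xi in auto)
    also have "\<dots> \<le> \<xi> t * (3 * \<Lambda>\<^sup>2) * (D i + D (i - 1)) + 1 * (3 * \<Lambda>\<^sup>2 * a i)"
      unfolding distrib_left using xi by (intro add_mono mult_right_mono) (auto simp: a_def mult.assoc)
    finally show ?thesis by simp
  qed
  then have "(\<Sum>i=1..N. (E i t * cm i t)\<^sup>2) \<le> (\<Sum>i=1..N. \<xi> t * (3 * \<Lambda>\<^sup>2) * (D i + D (i - 1)) + 3 * \<Lambda>\<^sup>2 * a i)"
    by (rule sum_mono)
  also have "\<dots> = \<xi> t * (3 * \<Lambda>\<^sup>2) * ((\<Sum>i=1..N. D i) + (\<Sum>i=1..N. D (i - 1))) + 3 * \<Lambda>\<^sup>2 * (\<Sum>i=1..N. a i)"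
    by (simp add: sum.distrib sum_distrib_left distrib_left)
  also have "\<dots> \<le> \<xi> t * (3 * \<Lambda>\<^sup>2) * (W t + W t) + 3 * \<Lambda>\<^sup>2 * P\<omega> t"
  proof (intro add_mono mult_left_mono)
    have W: "W t = (\<Sum>i=0..N. D i)" by (simp add: W_def D_def)
    show "(\<Sum>i=1..N. D i) \<le> W t" unfolding W by (rule sum_mono2) (auto simp: D0)
    have "(\<Sum>i=1..N. D (i - 1)) = (\<Sum>i=0..N. D i) - D N" by (induction N) auto
    then show "(\<Sum>i=1..N. D (i - 1)) \<le> W t" unfolding W using D0[of N] by simp
    show "(\<Sum>i=1..N. a i) \<le> P\<omega> t" unfolding P\<omega>_def a_def
      by (subst sum.mono_neutral_cong_right[where T="{1..N}" and S=\<omega>]) (auto simp: \<omega>_def)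
  qed (use xi in auto)
  finally show ?thesis by (simp add: algebra_simps)
qed

text \<open>The commutator gain must swallow both the time derivatives of the weight and the
  zeroth-order coefficients. What the cutoff produces cannot be swallowed and stays on the right, in
  part as a gradient.\<close>

lemma Q'_bound:
  assumes t: "t \<in> {0..T}"
  shows "Q' t \<le> - ((\<sigma> t) ^ 3 * V t) + 3/2 * Fs t + 9 * \<Lambda>\<^sup>2 * \<xi> t * W t + 9/2 * \<Lambda>\<^sup>2 * P\<omega> t"
proof -
  interpret cp: carleman_point N h "\<sigma> t" "\<tau> t" \<psi> "\<lambda>i. v i t"
    using h_pos Nh sigma_pos[OF t] sigma_h[OF t] kappa_N p_0 p_N
    by unfold_locales (auto simp: \<psi>_def v_def)
  have d: "cp.\<delta> i = \<delta> i t" for i by (simp add: cp.\<delta>_def \<delta>_def)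
  have eq: "- w i t = cp.S i + cp.A i + F i t" if i: "i \<in> {1..N}" for i
  proof -
    obtain j where j: "i = Suc j" using i by (cases i) auto
    \<comment> \<open>\<open>cosh \<mp> sinh\<close> is the exponential of the weight increment,
      which carries the weight of a neighbour back to the node \<open>i\<close>. This identifies
      \<open>S + A\<close> with the conjugated operator.\<close>
    have e1: "(cosh (\<delta> i t) - sinh (\<delta> i t)) * E (Suc i) t = E i t"
      by (simp add: cosh_minus_sinh E_def \<delta>_def algebra_simps flip: exp_add)
    have e2: "(cosh (\<delta> j t) + sinh (\<delta> j t)) * E j t = E i t"
      by (simp add: cosh_plus_sinh E_def \<delta>_def j algebra_simps flip: exp_add)
    have "cp.S i + cp.A i = ((cosh (\<delta> i t) - sinh (\<delta> i t)) * v (Suc i) t + (cosh (\<delta> j t) + sinh (\<delta> j t)) * v j t - 2 * v i t) / h\<^sup>2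
        - \<tau> t * \<psi> i * v i t"
      unfolding cp.S_def cp.A_def d by (simp add: j algebra_simps add_divide_distrib diff_divide_distrib)
    also have "\<dots> = (((cosh (\<delta> i t) - sinh (\<delta> i t)) * E (Suc i) t) * \<kappa> (Suc i) * p (Suc i) t
        + ((cosh (\<delta> j t) + sinh (\<delta> j t)) * E j t) * \<kappa> j * p j t - 2 * v i t) / h\<^sup>2 - \<tau> t * \<psi> i * v i t"
      by (simp add: v_def mult.assoc)
    also have "\<dots> = E i t * (\<kappa> (Suc i) * p (Suc i) t + \<kappa> j * p j t - 2 * \<kappa> i * p i t) / h\<^sup>2 - \<tau> t * \<psi> i * v i t"
      unfolding e1 e2 by (simp add: v_def algebra_simps)
    finally have SA: "cp.S i + cp.A i = E i t * (\<kappa> (Suc i) * p (Suc i) t + \<kappa> j * p j t - 2 * \<kappa> i * p i t) / h\<^sup>2 - \<tau> t * \<psi> i * v i t" .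
    have "E i t * \<kappa> i * (laplacian h (\<lambda>j. p j t) i + G i t) - \<tau> t * \<psi> i * v i t = 
       (E i t * (\<kappa> (Suc i) * p (Suc i) t + \<kappa> j * p j t - 2 * \<kappa> i * p i t) / h\<^sup>2 - \<tau> t * \<psi> i * v i t) + F i t"
      unfolding laplacian_def F_def cm_def using h_pos by (simp add: j field_simps)
    then show ?thesis using i SA by (simp add: w_def)
  qed
  have "Q' t \<le> - (4 * \<sigma> t ^ 3 - 144 * \<sigma> t * \<bar>\<tau> t\<bar> - 3 * \<bar>\<tau>' t\<bar>) * V t + (\<Sum>i=1..N. (F i t)\<^sup>2) / 2"
    using cp.energy_derivative_bound[of "\<lambda>i. w i t" "\<lambda>i. F i t" "\<tau>' t", OF eq] 
    unfolding d Q'_def V_def by (simp add: w_def)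
  also have "(\<Sum>i=1..N. (F i t)\<^sup>2) \<le> (\<Sum>i=1..N. 3 * (K\<^sup>2 * (v i t)\<^sup>2 + (f i t)\<^sup>2 + (E i t * cm i t)\<^sup>2))"
  proof (rule sum_mono)
    fix i assume i: "i \<in> {1..N}"
    have "\<bar>E i t * \<kappa> i * G i t\<bar> \<le> E i t * \<kappa> i * (K * \<bar>p i t\<bar> + f i t)"
      using E_le_1[OF t i] kappa_range[of i] i G_bound[OF i t] by (auto simp: abs_mult intro!: mult_left_mono)
    also have "\<dots> \<le> K * \<bar>v i t\<bar> + 1 * f i t"
    proof -
      have "E i t * \<kappa> i * f i t \<le> 1 * f i t"
        using E_le_1[OF t i] kappa_range[of i] i f_nonneg by (intro mult_right_mono mult_le_one) auto
      moreover have "E i t * \<kappa> i * (K * \<bar>p i t\<bar>) = K * \<bar>v i t\<bar>"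
        using E_le_1[OF t i] kappa_range[of i] i by (simp add: v_def abs_mult)
      ultimately show ?thesis unfolding distrib_left by linarith
    qed
    finally have g: "\<bar>E i t * \<kappa> i * G i t\<bar> \<le> K * \<bar>v i t\<bar> + f i t" by simp
    have "\<bar>F i t\<bar> \<le> \<bar>K * \<bar>v i t\<bar> + f i t + \<bar>E i t * cm i t\<bar>\<bar>"
    proof -
      have "F i t = E i t * \<kappa> i * G i t - E i t * cm i t" by (simp add: F_def algebra_simps)
      then have "\<bar>F i t\<bar> \<le> \<bar>E i t * \<kappa> i * G i t\<bar> + \<bar>E i t * cm i t\<bar>" by linarith
      then show ?thesis using g by linarith
    qed
    then have "(F i t)\<^sup>2 \<le> (K * \<bar>v i t\<bar> + f i t + \<bar>E i t * cm i t\<bar>)\<^sup>2" by (simp add: abs_le_square_iff)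
    also have "\<dots> \<le> 3 * ((K * \<bar>v i t\<bar>)\<^sup>2 + (f i t)\<^sup>2 + \<bar>E i t * cm i t\<bar>\<^sup>2)"
      by (rule square_sum3_le)
    finally show "(F i t)\<^sup>2 \<le> 3 * (K\<^sup>2 * (v i t)\<^sup>2 + (f i t)\<^sup>2 + (E i t * cm i t)\<^sup>2)"
      by (simp add: power_mult_distrib)
  qed
  also have "\<dots> = 3 * K\<^sup>2 * V t + 3 * Fs t + 3 * (\<Sum>i=1..N. (E i t * cm i t)\<^sup>2)"
    by (simp add: V_def Fs_def sum.distrib sum_distrib_left distrib_left mult.assoc)
  also have "\<dots> \<le> 3 * K\<^sup>2 * V t + 3 * Fs t + 3 * (6 * \<Lambda>\<^sup>2 * \<xi> t * W t + 3 * \<Lambda>\<^sup>2 * P\<omega> t)"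
    using weighted_commutator_bound[OF t] by simp
  finally have Q: "Q' t \<le> - (4 * \<sigma> t ^ 3 - 144 * \<sigma> t * \<bar>\<tau> t\<bar> - 3 * \<bar>\<tau>' t\<bar>) * V t 
     + (3 * K\<^sup>2 * V t + 3 * Fs t + 3 * (6 * \<Lambda>\<^sup>2 * \<xi> t * W t + 3 * \<Lambda>\<^sup>2 * P\<omega> t)) / 2"
    by simp
  have s1: "1 \<le> \<sigma> t" by (rule sigma_ge_1[OF t])
  have a: "144 * \<sigma> t * \<bar>\<tau> t\<bar> \<le> 144 * \<sigma> t * ((\<sigma> t)\<^sup>2 / 1000)"
    using tau_bound[OF t] s1 by (intro mult_left_mono) auto
  have b: "144 * \<sigma> t * ((\<sigma> t)\<^sup>2 / 1000) = 144/1000 * \<sigma> t ^ 3" by (simp add: power2_eq_square power3_eq_cube)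
  have "1 + 2 * K\<^sup>2 \<le> \<sigma> t" by (rule sigma_ge[OF t])
  moreover have "\<sigma> t \<le> \<sigma> t ^ 3" using power_increasing[of 1 3 "\<sigma> t"] s1 by simp
  \<comment> \<open>The losses are 144/1000 and 3/10 of \<open>\<sigma> ^ 3\<close> from the time
    weight and at most 3/4 of it from \<open>K\<close>, since
    \<open>1 + 2 * K\<^sup>2 \<le> \<sigma>\<close>; out of 4 more than 1 is left.\<close>
  ultimately have "(\<sigma> t) ^ 3 \<le> 4 * \<sigma> t ^ 3 - 144 * \<sigma> t * \<bar>\<tau> t\<bar> - 3 * \<bar>\<tau>' t\<bar> - 3/2 * K\<^sup>2"
    using a tau'_bound[OF t] unfolding b by linarith
  then have "(\<sigma> t) ^ 3 * V t \<le> (4 * \<sigma> t ^ 3 - 144 * \<sigma> t * \<bar>\<tau> t\<bar> - 3 * \<bar>\<tau>' t\<bar> - 3/2 * K\<^sup>2) * V t"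
    by (intro mult_right_mono) (auto simp: V_def sum_nonneg)
  then have "(\<sigma> t) ^ 3 * V t \<le> (4 * \<sigma> t ^ 3 - 144 * \<sigma> t * \<bar>\<tau> t\<bar> - 3 * \<bar>\<tau>' t\<bar>) * V t - 3/2 * K\<^sup>2 * V t"
    by (simp only: left_diff_distrib)
  moreover have "(3 * K\<^sup>2 * V t + 3 * Fs t + 3 * (6 * \<Lambda>\<^sup>2 * \<xi> t * W t + 3 * \<Lambda>\<^sup>2 * P\<omega> t)) / 2
    = 3/2 * K\<^sup>2 * V t + 3/2 * Fs t + 9 * \<Lambda>\<^sup>2 * \<xi> t * W t + 9/2 * \<Lambda>\<^sup>2 * P\<omega> t"
    by (simp add: field_simps)
  ultimately show ?thesis using Q by linarith
qed

text \<open>In the backward equation the dissipation makes the local energy grow in time, so the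
  gradient appears with a positive sign in the derivative of \<open>Y\<close>. Subtracting a
  multiple of \<open>Y\<close> from \<open>Q\<close> can therefore remove the gradient left by the
  cutoff.\<close>

lemma Y'_bound:
  assumes t: "t \<in> {0..T}"
  shows "Y' t \<ge> \<xi> t * W t / 2 - (2 + 4 * \<Lambda>\<^sup>2 + 2 * K) * P\<omega> t - Fs t"
proof -
  have xi: "0 < \<xi> t" "\<xi> t \<le> 1" using xi_bounds[OF t] by auto
  define a where "a i = (if i \<in> \<omega> then (p i t)\<^sup>2 else 0)" for i
  have a0: "0 \<le> a i" for i by (simp add: a_def)
  have suma: "(\<Sum>i=1..N. a i) = P\<omega> t" unfolding P\<omega>_def a_def
    by (subst sum.mono_neutral_cong_right[where T="{1..N}" and S=\<omega>]) (auto simp: \<omega>_def)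
  have eta_w: "(\<eta> i)\<^sup>2 * (p i t)\<^sup>2 \<le> a i" if "i \<in> {1..N}" for i
    using eta_0[of i] eta_range[of i] that r_pos by (auto simp: a_def \<omega>_def intro!: mult_left_le_one_le power_le_one)
  have S: "0 \<le> (\<Sum>i=1..N. (\<eta> i)\<^sup>2 * (p i t * p i t))" "(\<Sum>i=1..N. (\<eta> i)\<^sup>2 * (p i t * p i t)) \<le> P\<omega> t"
    using sum_mono[OF eta_w, of "{1..N}" "\<lambda>x. x"] suma by (auto simp: power2_eq_square intro!: sum_nonneg)
  have I1: "2 * \<tau> t * \<xi> t * (\<Sum>i=1..N. (\<eta> i)\<^sup>2 * (p i t * p i t)) \<le> P\<omega> t"
  proof -
    \<comment> \<open>The time derivative of \<open>\<xi>\<close> costs a factor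
      \<open>\<sigma>\<^sup>2\<close>, which the exponential smallness of \<open>\<xi>\<close>
      itself pays for.\<close>
    have "\<sigma> t \<le> exp (\<sigma> t)" using exp_ge_add_one_self[of "\<sigma> t"] by linarith
    then have "(\<sigma> t)\<^sup>2 \<le> (exp (\<sigma> t))\<^sup>2" using sigma_pos[OF t] by (intro power_mono) auto
    also have "(exp (\<sigma> t))\<^sup>2 = 1 / \<xi> t" by (simp add: \<xi>_def exp_minus exp_double inverse_eq_divide)
    finally have "(\<sigma> t)\<^sup>2 * \<xi> t \<le> 1" using xi by (simp add: field_simps)
    moreover have "2 * \<tau> t * \<xi> t \<le> (\<sigma> t)\<^sup>2 * \<xi> t"
      using tau_bound[OF t] xi zero_le_power2[of "\<sigma> t"] by (intro mult_right_mono) auto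
    ultimately have "2 * \<tau> t * \<xi> t \<le> 1" by linarith
    then have "2 * \<tau> t * \<xi> t * (\<Sum>i=1..N. (\<eta> i)\<^sup>2 * (p i t * p i t)) \<le> 1 * (\<Sum>i=1..N. (\<eta> i)\<^sup>2 * (p i t * p i t))"
      using S by (intro mult_right_mono) auto
    then show ?thesis using S by simp
  qed
  have I2: "(\<Sum>i=1..N. (\<eta> i)\<^sup>2 * p i t * laplacian h (\<lambda>j. p j t) i) \<le> - W t / 4 + 2 * \<Lambda>\<^sup>2 * P\<omega> t"
  proof -
    have "(\<Sum>i=1..N. (\<eta> i)\<^sup>2 * p i t * laplacian h (\<lambda>j. p j t) i)
       = (\<Sum>i=1..N. (\<eta> i)\<^sup>2 * p i t * (p (Suc i) t - 2 * p i t + p (i - 1) t)) / h\<^sup>2"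
      by (simp add: laplacian_def sum_divide_distrib)
    also have "\<dots> \<le> (- (\<Sum>i=0..N. ((\<eta> i)\<^sup>2 + (\<eta> (Suc i))\<^sup>2) * (p (Suc i) t - p i t)\<^sup>2) / 4
      + (\<Sum>i=0..N. (\<eta> (Suc i) - \<eta> i)\<^sup>2 * ((p i t)\<^sup>2 + (p (Suc i) t)\<^sup>2))) / h\<^sup>2"
      by (intro divide_right_mono caccioppoli_sum p_0 p_N) auto
    also have "\<dots> = - W t / 4 + (\<Sum>i=0..N. (\<eta> (Suc i) - \<eta> i)\<^sup>2 * ((p i t)\<^sup>2 + (p (Suc i) t)\<^sup>2)) / h\<^sup>2"
      
    proof -
      have "W t = (\<Sum>i=0..N. ((\<eta> i)\<^sup>2 + (\<eta> (Suc i))\<^sup>2) * (p (Suc i) t - p i t)\<^sup>2) / h\<^sup>2"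
        by (simp add: W_def power_divide sum_divide_distrib)
      then show ?thesis by (simp add: add_divide_distrib diff_divide_distrib)
    qed
    also have "(\<Sum>i=0..N. (\<eta> (Suc i) - \<eta> i)\<^sup>2 * ((p i t)\<^sup>2 + (p (Suc i) t)\<^sup>2)) \<le> (\<Sum>i=0..N. (\<Lambda> * h)\<^sup>2 * (a i + a (Suc i)))"
    proof (rule sum_mono)
      fix i assume i: "i \<in> {0..N}"
      show "(\<eta> (Suc i) - \<eta> i)\<^sup>2 * ((p i t)\<^sup>2 + (p (Suc i) t)\<^sup>2) \<le> (\<Lambda> * h)\<^sup>2 * (a i + a (Suc i))"
      proof (cases "\<eta> (Suc i) = \<eta> i")
        case True then show ?thesis using a0 by simp
      next
        case False
        \<comment> \<open>An edge on which \<open>\<eta>\<close> changes has an end closer than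
          \<open>3 * r\<close> to \<open>m\<close>; as \<open>h \<le> r\<close>, both ends lie in
          the observed zone.\<close>
        then have "\<bar>real i * h - m\<bar> < 3 * r \<or> \<bar>real (Suc i) * h - m\<bar> < 3 * r"
          using eta_0[of i] eta_0[of "Suc i"] by force
        moreover have "\<bar>real (Suc i) * h - real i * h\<bar> \<le> r" using h_le_r h_pos by (simp add: algebra_simps)
        ultimately have near: "\<bar>real i * h - m\<bar> \<le> 4 * r" "\<bar>real (Suc i) * h - m\<bar> \<le> 4 * r" by linarith+
        have "(p i t)\<^sup>2 = a i" using near i p_0 by (cases "i = 0") (auto simp: a_def \<omega>_def)
        moreover have "(p (Suc i) t)\<^sup>2 = a (Suc i)" using near i p_N by (cases "i = N") (auto simp: a_def \<omega>_def)
        moreover have "(\<eta> (Suc i) - \<eta> i)\<^sup>2 \<le> (\<Lambda> * h)\<^sup>2"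
          using eta_lip[of i] Lam h_pos by (simp add: abs_le_square_iff[symmetric])
        ultimately show ?thesis using a0 by (simp add: mult_right_mono)
      qed
    qed
    also have "(\<Sum>i=0..N. (\<Lambda> * h)\<^sup>2 * (a i + a (Suc i))) = (\<Lambda> * h)\<^sup>2 * (2 * P\<omega> t)"
    proof -
      have "a 0 = 0" "a (Suc N) = 0" by (auto simp: a_def \<omega>_def)
      have "(\<Sum>i=0..N. a i + a (Suc i)) = 2 * (\<Sum>i=1..N. a i) + a 0 + a (Suc N)" by (induction N) auto
      then show ?thesis using suma \<open>a 0 = 0\<close> \<open>a (Suc N) = 0\<close> by (simp flip: sum_distrib_left)
    qed
    finally show ?thesis using h_pos by (simp add: power_mult_distrib divide_right_mono)
  qed
  have I3: "(\<Sum>i=1..N. (\<eta> i)\<^sup>2 * p i t * G i t) \<le> (K + 1/2) * P\<omega> t + Fs t / 2"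
  proof -
    have "(\<eta> i)\<^sup>2 * p i t * G i t \<le> (K + 1/2) * a i + (f i t)\<^sup>2 / 2" if i: "i \<in> {1..N}" for i
    proof (cases "i \<in> \<omega>")
      case False
      then have "\<eta> i = 0" using i r_pos by (intro eta_0) (auto simp: \<omega>_def)
      then show ?thesis using a0 K_nonneg by simp
    next
      case True
      have "p i t * G i t \<le> \<bar>p i t\<bar> * (K * \<bar>p i t\<bar> + f i t)"
        using G_bound[OF i t] mult_left_mono[OF G_bound[OF i t], of "\<bar>p i t\<bar>"] abs_le_D1[of "p i t * G i t"]
        by (simp add: abs_mult)
      also have "\<dots> \<le> (K + 1/2) * (p i t)\<^sup>2 + (f i t)\<^sup>2 / 2"
        using sum_squares_bound[of "\<bar>p i t\<bar>" "f i t"] by (simp add: power2_eq_square algebra_simps abs_mult_self_eq)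
      finally have *: "p i t * G i t \<le> (K + 1/2) * (p i t)\<^sup>2 + (f i t)\<^sup>2 / 2" .
      then have "(\<eta> i)\<^sup>2 * (p i t * G i t) \<le> (\<eta> i)\<^sup>2 * ((K + 1/2) * (p i t)\<^sup>2 + (f i t)\<^sup>2 / 2)"
        by (intro mult_left_mono) auto
      also have "\<dots> \<le> 1 * ((K + 1/2) * (p i t)\<^sup>2 + (f i t)\<^sup>2 / 2)"
        using eta_range[of i] K_nonneg by (intro mult_right_mono power_le_one) auto
      finally show ?thesis using True by (simp add: a_def mult.assoc)
    qed
    then have "(\<Sum>i=1..N. (\<eta> i)\<^sup>2 * p i t * G i t) \<le> (\<Sum>i=1..N. (K + 1/2) * a i + (f i t)\<^sup>2 / 2)"
      by (rule sum_mono)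
    also have "\<dots> = (K + 1/2) * P\<omega> t + Fs t / 2"
      using suma by (simp add: sum.distrib Fs_def flip: sum_distrib_left sum_divide_distrib)
    finally show ?thesis .
  qed
  have "Y' t = - (2 * \<tau> t * \<xi> t * (\<Sum>i=1..N. (\<eta> i)\<^sup>2 * (p i t * p i t)))
     - \<xi> t * (2 * (\<Sum>i=1..N. (\<eta> i)\<^sup>2 * p i t * laplacian h (\<lambda>j. p j t) i))
     - \<xi> t * (2 * (\<Sum>i=1..N. (\<eta> i)\<^sup>2 * p i t * G i t))"
    by (simp add: Y'_def distrib_left sum.distrib algebra_simps)
  moreover have "\<xi> t * (2 * (\<Sum>i=1..N. (\<eta> i)\<^sup>2 * p i t * laplacian h (\<lambda>j. p j t) i))
      \<le> - (\<xi> t * W t / 2) + 4 * \<Lambda>\<^sup>2 * P\<omega> t"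
  proof -
    have "\<xi> t * (2 * (\<Sum>i=1..N. (\<eta> i)\<^sup>2 * p i t * laplacian h (\<lambda>j. p j t) i)) \<le> \<xi> t * (- W t / 2 + 4 * \<Lambda>\<^sup>2 * P\<omega> t)"
      using I2 xi by (intro mult_left_mono) auto
    also have "\<dots> = - (\<xi> t * W t / 2) + \<xi> t * (4 * \<Lambda>\<^sup>2 * P\<omega> t)" by (simp add: right_diff_distrib)
    also have "\<dots> \<le> - (\<xi> t * W t / 2) + 1 * (4 * \<Lambda>\<^sup>2 * P\<omega> t)"
      using xi Pw_nonneg by (intro add_left_mono mult_right_mono) auto
    finally show ?thesis by simp
  qed
  moreover have "\<xi> t * (2 * (\<Sum>i=1..N. (\<eta> i)\<^sup>2 * p i t * G i t)) \<le> (2 * K + 1) * P\<omega> t + Fs t"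
  proof -
    have "\<xi> t * (2 * (\<Sum>i=1..N. (\<eta> i)\<^sup>2 * p i t * G i t)) \<le> \<xi> t * ((2 * K + 1) * P\<omega> t + Fs t)"
      using I3 xi by (intro mult_left_mono) (auto simp: algebra_simps)
    also have "\<dots> \<le> 1 * ((2 * K + 1) * P\<omega> t + Fs t)"
      using xi Pw_nonneg K_nonneg by (intro mult_right_mono) (auto simp: Fs_def intro!: sum_nonneg add_nonneg_nonneg)
    finally show ?thesis by simp
  qed
  ultimately show ?thesis using I1 by (simp add: algebra_simps)
qed

lemma V_cont: "continuous_on {0..T} V"
  unfolding V_def by (intro continuous_intros has_primitive_continuous[OF v_primitive]) auto

lemma Pw_cont: "continuous_on {0..T} P\<omega>"
  unfolding P\<omega>_def by (intro continuous_intros p_cont) (auto simp: \<omega>_def)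

text \<open>The multiple \<open>18 * \<Lambda>\<^sup>2\<close> of \<open>Y\<close> is fixed by the
  gradient terms: half of it must equal the coefficient \<open>9 * \<Lambda>\<^sup>2\<close> in the
  bound for \<open>Q'\<close>. The values of \<open>Q\<close> and \<open>Y\<close> at the end times
  have no sign and are estimated in absolute value.\<close>

lemma weighted_estimate:
  "(LINT t:{0..T}|lborel. (\<sigma> t) ^ 3 * V t)
    \<le> (2 + 18 * \<Lambda>\<^sup>2) * (LINT t:{0..T}|lborel. Fs t)
      + (5 * \<Lambda>\<^sup>2 + 18 * \<Lambda>\<^sup>2 * (2 + 4 * \<Lambda>\<^sup>2 + 2 * K)) * (LINT t:{0..T}|lborel. P\<omega> t)
      + 100 * (1 + \<Lambda>\<^sup>2) * exp (- 1 / h) * (P 0 + P T)"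
proof -
  let ?A = "2 + 18 * \<Lambda>\<^sup>2" and ?B = "5 * \<Lambda>\<^sup>2 + 18 * \<Lambda>\<^sup>2 * (2 + 4 * \<Lambda>\<^sup>2 + 2 * K)"
  \<comment> \<open>the gradient term of \<open>Y\<close> absorbs the gradient produced by the cutoff \<open>\<kappa>\<close> in \<open>Q\<close>\<close>
  define \<Phi> where "\<Phi> t = Q t + (- 18 * \<Lambda>\<^sup>2) * Y t" for t
  have Phi: "has_primitive T (\<lambda>t. Q' t + (- 18 * \<Lambda>\<^sup>2) * Y' t) \<Phi>"
    unfolding \<Phi>_def by (intro has_primitive_add Q_primitive has_primitive_cmult Y_primitive)
  have Pi: "set_integrable lborel {0..T} P\<omega>" by (rule set_integrable_continuous[OF Pw_cont])
  have "(LINT t:{0..T}|lborel. (\<sigma> t) ^ 3 * V t) \<le> (LINT t:{0..T}|lborel. ?A * Fs t + ?B * P\<omega> t) + \<Phi> 0 - \<Phi> T"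
  proof (rule has_primitive_le[OF Phi])
    show "0 \<le> T" using T_pos by simp
    show "set_integrable lborel {0..T} (\<lambda>t. (\<sigma> t) ^ 3 * V t)"
      by (intro set_integrable_continuous continuous_intros sigma_cont V_cont)
    show "set_integrable lborel {0..T} (\<lambda>t. ?A * Fs t + ?B * P\<omega> t)"
      using Fs_integrable Pi by (intro set_integral_add) auto
    fix t assume t: "t \<in> {0..T}"
    have "18 * \<Lambda>\<^sup>2 * (\<xi> t * W t / 2 - (2 + 4 * \<Lambda>\<^sup>2 + 2 * K) * P\<omega> t - Fs t) \<le> 18 * \<Lambda>\<^sup>2 * Y' t"
      by (intro mult_left_mono Y'_bound t) auto
    then have "18 * \<Lambda>\<^sup>2 * Y' t \<ge> 9 * \<Lambda>\<^sup>2 * \<xi> t * W t - 18 * \<Lambda>\<^sup>2 * (2 + 4 * \<Lambda>\<^sup>2 + 2 * K) * P\<omega> t - 18 * \<Lambda>\<^sup>2 * Fs t"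
      by (simp add: right_diff_distrib mult.assoc)
    moreover have "?B * P\<omega> t = 5 * \<Lambda>\<^sup>2 * P\<omega> t + 18 * \<Lambda>\<^sup>2 * (2 + 4 * \<Lambda>\<^sup>2 + 2 * K) * P\<omega> t"
      by (simp add: distrib_right)
    moreover have "?A * Fs t = 2 * Fs t + 18 * \<Lambda>\<^sup>2 * Fs t" by (simp add: distrib_right)
    moreover have "9 / 2 * \<Lambda>\<^sup>2 * P\<omega> t \<le> 5 * \<Lambda>\<^sup>2 * P\<omega> t" using Pw_nonneg[of t] by (intro mult_right_mono) auto
    ultimately show "Q' t + (- 18 * \<Lambda>\<^sup>2) * Y' t \<le> ?A * Fs t + ?B * P\<omega> t - (\<sigma> t) ^ 3 * V t"
      using Q'_bound[OF t] Fs_nonneg[of t] by (simp only: mult_minus_left)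
  qed
  also have "(LINT t:{0..T}|lborel. ?A * Fs t + ?B * P\<omega> t) = ?A * (LINT t:{0..T}|lborel. Fs t) + ?B * (LINT t:{0..T}|lborel. P\<omega> t)"
    using Fs_integrable Pi by (subst set_integral_add) auto
  finally have main: "(LINT t:{0..T}|lborel. (\<sigma> t) ^ 3 * V t) 
     \<le> ?A * (LINT t:{0..T}|lborel. Fs t) + ?B * (LINT t:{0..T}|lborel. P\<omega> t) + \<bar>\<Phi> 0\<bar> + \<bar>\<Phi> T\<bar>" by linarith
  \<comment> \<open>When \<open>\<sigma> t = 1 / h\<close>, the factor \<open>\<xi> t\<close> is
    \<open>exp (- 1 / h)\<close> twice: one copy pays for the \<open>1 / h\<^sup>2\<close> in the
    quadratic form, the other is the remainder of the theorem.\<close>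
  have Phi_end: "\<bar>\<Phi> t\<bar> \<le> 100 * (1 + \<Lambda>\<^sup>2) * exp (- 1 / h) * P t" if t: "t \<in> {0..T}" "\<rho> t = h" for t
  proof -
    interpret cp: carleman_point N h "\<sigma> t" "\<tau> t" \<psi> "\<lambda>i. v i t"
      using h_pos Nh sigma_pos[OF t(1)] sigma_h[OF t(1)] kappa_N p_0 p_N
      by unfold_locales (auto simp: \<psi>_def v_def)
    have d: "cp.\<delta> i = \<delta> i t" for i by (simp add: cp.\<delta>_def \<delta>_def)
    have s: "\<sigma> t = 1 / h" using t by (simp add: \<sigma>_def)
    have xi: "\<xi> t = exp (- 1 / h) * exp (- 1 / h)" unfolding \<xi>_def s by (simp flip: exp_add)
    have h2: "\<xi> t / h\<^sup>2 \<le> 2 * exp (- 1 / h)"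
    proof -
      define y where "y = 1 / h"
      have "0 \<le> y" using h_pos by (simp add: y_def)
      then have "y\<^sup>2 \<le> 2 * exp y" using exp_lower_Taylor_quadratic[of y] by linarith
      then have "1 / h\<^sup>2 \<le> 2 * exp (1 / h)" by (simp add: y_def power_divide)
      then have "exp (- 1 / h) * (exp (- 1 / h) * (1 / h\<^sup>2)) \<le> exp (- 1 / h) * (exp (- 1 / h) * (2 * exp (1 / h)))"
        by (intro mult_left_mono) auto
      also have "exp (- 1 / h) * (2 * exp (1 / h)) = 2" by (simp add: exp_minus flip: exp_add)
      finally show ?thesis by (simp add: xi mult.assoc)
    qed
    have V0: "0 \<le> V t" by (simp add: V_def sum_nonneg)
    have "\<bar>Q t\<bar> \<le> (22 / h\<^sup>2 + 3 * \<bar>\<tau> t\<bar>) * V t"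
      using cp.energy_abs_bound unfolding d Q_def V_def .
    also have "\<dots> \<le> (25 / h\<^sup>2) * (\<xi> t * P t)"
    proof (rule mult_mono)
      have "\<bar>\<tau> t\<bar> \<le> 1 / h\<^sup>2" using tau_bound[OF t(1)] h_pos by (simp add: s power_divide field_simps)
      then show "22 / h\<^sup>2 + 3 * \<bar>\<tau> t\<bar> \<le> 25 / h\<^sup>2" by linarith
    qed (use V_le[OF t(1)] V0 in auto)
    finally have 1: "\<bar>Q t\<bar> \<le> 25 * (\<xi> t / h\<^sup>2 * P t)" by simp
    have 2: "\<bar>Y t\<bar> \<le> \<xi> t / h\<^sup>2 * P t"
    proof -
      have "0 \<le> (\<Sum>i=1..N. (\<eta> i)\<^sup>2 * (p i t * p i t))" by (intro sum_nonneg) auto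
      moreover have "(\<Sum>i=1..N. (\<eta> i)\<^sup>2 * (p i t * p i t)) \<le> P t" unfolding P_def power2_eq_square[of "p _ t"]
        using eta_range by (intro sum_mono mult_left_le_one_le power_le_one) auto
      ultimately have "\<bar>Y t\<bar> \<le> \<xi> t * P t" using xi_bounds[OF t(1)] by (simp add: Y_def abs_mult)
      also have "\<dots> \<le> \<xi> t / h\<^sup>2 * P t" using xi_bounds[OF t(1)] h_pos h_le_1 P_nonneg
        by (intro mult_right_mono) (auto simp: field_simps mult_left_le power_le_one)
      finally show ?thesis .
    qed
    have "\<bar>\<Phi> t\<bar> \<le> \<bar>Q t\<bar> + 18 * \<Lambda>\<^sup>2 * \<bar>Y t\<bar>"
      unfolding \<Phi>_def by (rule order_trans[OF abs_triangle_ineq]) (simp add: abs_mult)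
    also have "\<dots> \<le> 25 * (\<xi> t / h\<^sup>2 * P t) + 18 * \<Lambda>\<^sup>2 * (\<xi> t / h\<^sup>2 * P t)"
      using 1 2 by (intro add_mono mult_left_mono) auto
    also have "\<dots> = (25 + 18 * \<Lambda>\<^sup>2) * (\<xi> t / h\<^sup>2 * P t)" by (simp add: algebra_simps)
    also have "\<dots> \<le> (50 + 50 * \<Lambda>\<^sup>2) * ((2 * exp (- 1 / h)) * P t)"
      using h2 P_nonneg[of t] xi_bounds[OF t(1)] by (intro mult_mono) auto
    finally show ?thesis by (simp add: algebra_simps)
  qed
  have "\<rho> 0 = h" "\<rho> T = h" by (auto simp: \<rho>_def)
  then have "\<bar>\<Phi> 0\<bar> + \<bar>\<Phi> T\<bar> \<le> 100 * (1 + \<Lambda>\<^sup>2) * exp (- 1 / h) * (P 0 + P T)"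
    using Phi_end[of 0] Phi_end[of T] T_pos by (simp add: distrib_left)
  then show ?thesis using main by linarith
qed

text \<open>In the middle third \<open>t * (T - t) \<ge> 2 * T\<^sup>2 / 9\<close>, hence
  \<open>\<sigma> \<le> 9 / (2 * c * T\<^sup>2)\<close> independently of \<open>h\<close>. With
  \<open>\<psi> \<ge> -5/2\<close> the inverse squared weight is at most the exponential of 5 times
  that bound, which is where the 45 comes from.\<close>

lemma unweighted_estimate:
  "(LINT t:{T/3..2*T/3}|lborel. (\<Sum>i | i \<in> {1..N} \<and> \<kappa> i = 1. (p i t)\<^sup>2))
    \<le> exp (45 / (2 * c * T\<^sup>2)) * (LINT t:{0..T}|lborel. (\<sigma> t) ^ 3 * V t)"
proof -
  have c1: "continuous_on {0..T} (\<lambda>t. (\<sigma> t) ^ 3 * V t)"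
    by (intro continuous_intros sigma_cont V_cont)
  have sub: "{T/3..2*T/3} \<subseteq> {0..T}" using T_pos by auto
  have pt: "(\<Sum>i | i \<in> {1..N} \<and> \<kappa> i = 1. (p i t)\<^sup>2) \<le> exp (45 / (2 * c * T\<^sup>2)) * ((\<sigma> t) ^ 3 * V t)" if t: "t \<in> {T/3..2*T/3}" for t
  proof -
    have t0: "t \<in> {0..T}" using t sub by auto
    have "0 \<le> (t - T/3) * (2*T/3 - t)" using t by (intro mult_nonneg_nonneg) auto
    also have "\<dots> = t * (T - t) - 2 * T\<^sup>2 / 9" by (simp add: field_simps power2_eq_square)
    finally have "2 * T\<^sup>2 / 9 \<le> t * (T - t)" by simp
    then have "c * (2 * T\<^sup>2 / 9) \<le> c * (t * (T - t))" using c_pos by (intro mult_left_mono) auto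
    then have "c * (2 * T\<^sup>2 / 9) \<le> \<rho> t" using h_pos by (simp add: \<rho>_def mult.assoc)
    then have s: "\<sigma> t \<le> 9 / (2 * c * T\<^sup>2)" unfolding \<sigma>_def using rho_bounds[OF t0] c_pos T_pos
      by (simp add: field_simps)
    have "(p i t)\<^sup>2 \<le> exp (45 / (2 * c * T\<^sup>2)) * (v i t)\<^sup>2" if i: "i \<in> {1..N}" "\<kappa> i = 1" for i
    proof -
      have "\<sigma> t * (-5/2) \<le> \<sigma> t * \<psi> i" 
        by (rule mult_left_mono[OF psi_le(1)[OF i(1)]]) (rule less_imp_le[OF sigma_pos[OF t0]])
      then have "0 \<le> 45 / (2 * c * T\<^sup>2) + 2 * (\<sigma> t * \<psi> i)" using s by (simp add: field_simps)
      then have "1 \<le> exp (45 / (2 * c * T\<^sup>2) + 2 * (\<sigma> t * \<psi> i))" by simp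
      also have "\<dots> = exp (45 / (2 * c * T\<^sup>2)) * (E i t)\<^sup>2" unfolding exp_add exp_double E_def ..
      finally have "1 * (p i t)\<^sup>2 \<le> (exp (45 / (2 * c * T\<^sup>2)) * (E i t)\<^sup>2) * (p i t)\<^sup>2" by (intro mult_right_mono) auto
      then show ?thesis using i by (simp add: v_def power_mult_distrib mult.assoc)
    qed
    then have "(\<Sum>i | i \<in> {1..N} \<and> \<kappa> i = 1. (p i t)\<^sup>2) \<le> (\<Sum>i | i \<in> {1..N} \<and> \<kappa> i = 1. exp (45 / (2 * c * T\<^sup>2)) * (v i t)\<^sup>2)"
      by (intro sum_mono) auto
    also have "\<dots> \<le> (\<Sum>i=1..N. exp (45 / (2 * c * T\<^sup>2)) * (v i t)\<^sup>2)" by (intro sum_mono2) auto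
    also have "\<dots> = exp (45 / (2 * c * T\<^sup>2)) * (1 * V t)" by (simp add: V_def sum_distrib_left)
    also have "\<dots> \<le> exp (45 / (2 * c * T\<^sup>2)) * ((\<sigma> t) ^ 3 * V t)"
      using sigma_ge_1[OF t0] by (intro mult_left_mono mult_right_mono) (auto simp: V_def sum_nonneg)
    finally show ?thesis .
  qed
  have "(LINT t:{T/3..2*T/3}|lborel. (\<Sum>i | i \<in> {1..N} \<and> \<kappa> i = 1. (p i t)\<^sup>2))
     \<le> (LINT t:{T/3..2*T/3}|lborel. exp (45 / (2 * c * T\<^sup>2)) * ((\<sigma> t) ^ 3 * V t))"
  proof (rule set_integral_mono[OF _ _ pt])
    show "set_integrable lborel {T/3..2*T/3} (\<lambda>t. \<Sum>i | i \<in> {1..N} \<and> \<kappa> i = 1. (p i t)\<^sup>2)"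
      by (intro set_integrable_continuous continuous_intros continuous_on_subset[OF p_cont sub]) auto
    show "set_integrable lborel {T/3..2*T/3} (\<lambda>t. exp (45 / (2 * c * T\<^sup>2)) * ((\<sigma> t) ^ 3 * V t))"
      by (rule set_integrable_continuous) (intro continuous_intros continuous_on_subset[OF sigma_cont sub] continuous_on_subset[OF V_cont sub])
  qed
  also have "\<dots> = exp (45 / (2 * c * T\<^sup>2)) * (LINT t:{T/3..2*T/3}|lborel. (\<sigma> t) ^ 3 * V t)" by simp
  also have "\<dots> \<le> exp (45 / (2 * c * T\<^sup>2)) * (LINT t:{0..T}|lborel. (\<sigma> t) ^ 3 * V t)"
  proof (rule mult_left_mono)
    have i: "set_integrable lborel {0..T} (\<lambda>t. (\<sigma> t) ^ 3 * V t)" by (rule set_integrable_continuous[OF c1])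
    moreover have "set_integrable lborel {T/3..2*T/3} (\<lambda>t. (\<sigma> t) ^ 3 * V t)"
      by (rule set_integrable_subset[OF i _ sub]) auto
    moreover have "0 \<le> (\<sigma> t) ^ 3 * V t" if "t \<in> {0..T}" for t
      using sigma_pos[OF that] by (auto simp: V_def intro!: mult_nonneg_nonneg sum_nonneg)
    ultimately show "(LINT t:{T/3..2*T/3}|lborel. (\<sigma> t) ^ 3 * V t) \<le> (LINT t:{0..T}|lborel. (\<sigma> t) ^ 3 * V t)"
      unfolding set_lebesgue_integral_def set_integrable_def using sub
      by (intro integral_mono) (auto simp: indicator_def)
  qed auto
  finally show ?thesis .
qed

end

section \<open>Observability of the deterministic equation\<close>

text \<open>A quadratic spline falling from 1 to 0 on the interval from -1 to 1: minus its
  derivative is the hat function. Bounded second differences are all that the commutator needs, and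
  the truncated squares allow them to be estimated one summand at a time.\<close>

definition cutoff :: "real \<Rightarrow> real" where
  "cutoff y = 1 - ((max 0 (y + 1))\<^sup>2 - 2 * (max 0 y)\<^sup>2 + (max 0 (y - 1))\<^sup>2) / 2"

lemma cutoff_low: "y \<le> -1 \<Longrightarrow> cutoff y = 1"
  by (simp add: cutoff_def max_def)

lemma cutoff_high: "1 \<le> y \<Longrightarrow> cutoff y = 0"
  by (simp add: cutoff_def max_def power2_eq_square field_simps)

lemma cutoff_range: "0 \<le> cutoff y" "cutoff y \<le> 1"
proof -
  consider "y \<le> -1" | "-1 \<le> y \<and> y \<le> 0" | "0 \<le> y \<and> y \<le> 1" | "1 \<le> y" by linarith
  then have "0 \<le> cutoff y \<and> cutoff y \<le> 1"
  proof cases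
    case 1 then show ?thesis by (simp add: cutoff_low)
  next
    case 4 then show ?thesis by (simp add: cutoff_high)
  next
    case 2
    then have "cutoff y = 1 - (y + 1)\<^sup>2 / 2" by (simp add: cutoff_def max_def)
    moreover have "(y + 1)\<^sup>2 \<le> 1" using 2 by (intro power_le_one) auto
    ultimately show ?thesis by simp
  next
    case 3
    then have "cutoff y = (1 - y)\<^sup>2 / 2" by (auto simp: cutoff_def max_def power2_eq_square field_simps)
    moreover have "(1 - y)\<^sup>2 \<le> 1" using 3 by (intro power_le_one) auto
    ultimately show ?thesis using zero_le_power2[of "1 - y"] by linarith
  qed
  then show "0 \<le> cutoff y" "cutoff y \<le> 1" by auto
qed

text \<open>The growth in \<open>\<bar>y\<bar>\<close> is an artefact of treating the three
  truncated squares separately. It costs nothing here, because the rescaled nodes satisfy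
  \<open>\<bar>y\<bar> \<le> 1 / r\<close>.\<close>

lemma cutoff_diff:
  assumes "0 \<le> k" "k \<le> 1"
  shows "\<bar>cutoff (y + k) - cutoff y\<bar> \<le> k * (4 * \<bar>y\<bar> + 4)"
proof -
  have q: "\<bar>(max 0 (a + k))\<^sup>2 - (max 0 a)\<^sup>2\<bar> \<le> k * (2 * \<bar>a\<bar> + k)" for a :: real
  proof -
    have "(max 0 (a + k))\<^sup>2 - (max 0 a)\<^sup>2 = (max 0 (a + k) - max 0 a) * (max 0 (a + k) + max 0 a)"
      by (simp add: power2_eq_square algebra_simps)
    also have "\<bar>\<dots>\<bar> \<le> k * (2 * \<bar>a\<bar> + k)"
      unfolding abs_mult using assms by (intro mult_mono) (auto simp: max_def)
    finally show ?thesis .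
  qed
  have "k * (2 * \<bar>y + 1\<bar> + k) \<le> k * (2 * \<bar>y\<bar> + 3)" "k * (2 * \<bar>y - 1\<bar> + k) \<le> k * (2 * \<bar>y\<bar> + 3)"
     "k * (2 * \<bar>y\<bar> + k) \<le> k * (2 * \<bar>y\<bar> + 1)"
  proof -
    have "2 * \<bar>y + 1\<bar> + k \<le> 2 * \<bar>y\<bar> + 3" "2 * \<bar>y - 1\<bar> + k \<le> 2 * \<bar>y\<bar> + 3" "2 * \<bar>y\<bar> + k \<le> 2 * \<bar>y\<bar> + 1"
      using assms abs_triangle_ineq[of y 1] abs_triangle_ineq4[of y 1] by auto
    then show "k * (2 * \<bar>y + 1\<bar> + k) \<le> k * (2 * \<bar>y\<bar> + 3)" "k * (2 * \<bar>y - 1\<bar> + k) \<le> k * (2 * \<bar>y\<bar> + 3)"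
      "k * (2 * \<bar>y\<bar> + k) \<le> k * (2 * \<bar>y\<bar> + 1)" using assms by (auto intro: mult_left_mono)
  qed
  then have "\<bar>(max 0 (y + 1 + k))\<^sup>2 - (max 0 (y + 1))\<^sup>2\<bar> \<le> k * (2 * \<bar>y\<bar> + 3)"
    "\<bar>(max 0 (y - 1 + k))\<^sup>2 - (max 0 (y - 1))\<^sup>2\<bar> \<le> k * (2 * \<bar>y\<bar> + 3)"
    "\<bar>(max 0 (y + k))\<^sup>2 - (max 0 y)\<^sup>2\<bar> \<le> k * (2 * \<bar>y\<bar> + 1)"
    using q[of "y + 1"] q[of "y - 1"] q[of y] by linarith+
  moreover have "k * (4 * \<bar>y\<bar> + 4) = (k * (2 * \<bar>y\<bar> + 3) + k * (2 * \<bar>y\<bar> + 3) + 2 * (k * (2 * \<bar>y\<bar> + 1))) / 2"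
    by (simp add: algebra_simps)
  moreover have "y + k + 1 = y + 1 + k" "y + k - 1 = y - 1 + k" by auto
  ultimately show ?thesis unfolding cutoff_def by argo
qed

text \<open>Each truncated square is convex with second derivative at most 2, so its second
  difference lies between 0 and \<open>2 * k\<^sup>2\<close>.\<close>

lemma cutoff_second_diff:
  assumes "0 \<le> k"
  shows "\<bar>cutoff (y + k) - 2 * cutoff y + cutoff (y - k)\<bar> \<le> 4 * k\<^sup>2"
proof -
  have q: "0 \<le> (max 0 (a + k))\<^sup>2 - 2 * (max 0 a)\<^sup>2 + (max 0 (a - k))\<^sup>2 \<and>
    (max 0 (a + k))\<^sup>2 - 2 * (max 0 a)\<^sup>2 + (max 0 (a - k))\<^sup>2 \<le> 2 * k\<^sup>2" for a :: real
  proof -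
    consider "a + k \<le> 0" | "0 \<le> a + k \<and> a \<le> 0" | "0 \<le> a \<and> a - k \<le> 0" | "0 \<le> a - k" by linarith
    then show ?thesis
    proof cases
      case 1
      then have "max 0 (a + k) = 0" "max 0 a = 0" "max 0 (a - k) = 0" using assms by auto
      then show ?thesis by simp
    next
      case 2
      then have e: "(max 0 (a + k))\<^sup>2 - 2 * (max 0 a)\<^sup>2 + (max 0 (a - k))\<^sup>2 = (a + k)\<^sup>2"
        using assms by (auto simp: max_def)
      have "(a + k)\<^sup>2 \<le> k\<^sup>2" using 2 assms by (intro power_mono) auto
      then show ?thesis unfolding e using zero_le_power2[of k] zero_le_power2[of "a+k"] by linarith
    next
      case 3
      then have e: "(max 0 (a + k))\<^sup>2 - 2 * (max 0 a)\<^sup>2 + (max 0 (a - k))\<^sup>2 = 2 * k\<^sup>2 - (a - k)\<^sup>2"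
        using assms by (auto simp: max_def power2_eq_square algebra_simps)
      have "(a - k)\<^sup>2 \<le> k\<^sup>2" using 3 assms by (simp add: abs_le_square_iff[symmetric])
      then show ?thesis unfolding e using zero_le_power2[of k] zero_le_power2[of "a-k"] by linarith
    next
      case 4
      then have "(max 0 (a + k))\<^sup>2 - 2 * (max 0 a)\<^sup>2 + (max 0 (a - k))\<^sup>2 = 2 * k\<^sup>2"
        using assms by (auto simp: max_def power2_eq_square algebra_simps)
      then show ?thesis by simp
    qed
  qed
  have "y + k + 1 = (y + 1) + k" "y + k - 1 = (y - 1) + k" "y - k + 1 = (y + 1) - k" "y - k - 1 = (y - 1) - k" by auto
  then show ?thesis unfolding cutoff_def using q[of "y+1"] q[of "y-1"] q[of y] by argo
qed

text \<open>Only Lipschitz, because the Caccioppoli estimate involves nothing but first differences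
  of its cutoff.\<close>

definition bump :: "real \<Rightarrow> real" where "bump y = max 0 (min 1 (3 - \<bar>y\<bar>))"

lemma bump_diff: "0 \<le> k \<Longrightarrow> \<bar>bump (y + k) - bump y\<bar> \<le> k"
  unfolding bump_def by linarith

text \<open>All parameters of the weight have to be chosen from \<open>T\<close>, \<open>K\<close>,
  \<open>r\<close> and \<open>m\<close> alone before the mesh is given; that is what makes the
  constant uniform in \<open>h\<close>. The value of \<open>p\<close> at time 0 is still on the
  right side at this stage.\<close>

lemma backward_heat_left:
  assumes T: "0 < T" and K: "0 \<le> K" and r: "0 < r" and m: "0 < m" "m + 4 * r < 1"
  shows "\<exists>C>0. \<exists>h0>0. \<forall>N h p G f. backward_heat N h T K p G f \<longrightarrow> h \<le> h0 \<longrightarrow>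
    (LINT t:{T/3..2*T/3}|lborel. (\<Sum>i | i \<in> {1..N} \<and> real i * h \<le> m - r. (p i t)\<^sup>2))
     \<le> C * ((LINT t:{0..T}|lborel. (\<Sum>i=1..N. (f i t)\<^sup>2))
        + (LINT t:{0..T}|lborel. (\<Sum>i | i \<in> {1..N} \<and> \<bar>real i * h - m\<bar> \<le> 4 * r. (p i t)\<^sup>2))
        + exp (- 1 / h) * ((\<Sum>i=1..N. (p i 0)\<^sup>2) + (\<Sum>i=1..N. (p i T)\<^sup>2)))"
proof -
  define s0 where "s0 = 1 + 2 * K\<^sup>2"
  have s0: "1 \<le> s0" by (simp add: s0_def)
  \<comment> \<open>The third entry of the minimum gives
    \<open>c * T\<^sup>2 / 4 * s0 \<le> 1/2\<close>; the choice of \<open>h0\<close> gives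
    \<open>h * s0 \<le> 1/2\<close>. Together they yield the lower bound on
    \<open>\<sigma>\<close>.\<close>
  define c where "c = min (1/100) (min (1 / (1000 * T)) (2 / (T\<^sup>2 * s0)))"
  define h0 where "h0 = min r (1 / (2 * s0))"
  \<comment> \<open>Large enough for all three cutoff bounds at once:
    \<open>4 / r\<^sup>2 + 4 / r\<close> for first differences of \<open>\<kappa>\<close>,
    \<open>4 / r\<^sup>2\<close> for second ones, \<open>1 / r\<close> for
    \<open>\<eta>\<close>.\<close>
  define \<Lambda> where "\<Lambda> = 10 / r\<^sup>2 + 10 / r"
  have c: "0 < c" "c * T \<le> 1/1000" "c \<le> 1/100" "c * T\<^sup>2 / 4 * s0 \<le> 1/2"
  proof -
    show "0 < c" using T s0 by (simp add: c_def)
    have "c * T \<le> 1 / (1000 * T) * T" using T by (intro mult_right_mono) (auto simp: c_def)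
    then show "c * T \<le> 1/1000" using T by simp
    show "c \<le> 1/100" by (simp add: c_def)
    have "c * (T\<^sup>2 / 4 * s0) \<le> 2 / (T\<^sup>2 * s0) * (T\<^sup>2 / 4 * s0)" using T s0 by (intro mult_right_mono) (auto simp: c_def)
    also have "\<dots> = 1/2" using T s0 by simp
    finally show "c * T\<^sup>2 / 4 * s0 \<le> 1/2" by (simp add: mult.assoc)
  qed
  have L: "0 \<le> \<Lambda>" using r by (simp add: \<Lambda>_def)
  define e where "e = exp (45 / (2 * c * T\<^sup>2))"
  define D where "D = (2 + 18 * \<Lambda>\<^sup>2) + (5 * \<Lambda>\<^sup>2 + 18 * \<Lambda>\<^sup>2 * (2 + 4 * \<Lambda>\<^sup>2 + 2 * K)) + 100 * (1 + \<Lambda>\<^sup>2)"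
  have pos: "0 \<le> 5 * \<Lambda>\<^sup>2 + 18 * \<Lambda>\<^sup>2 * (2 + 4 * \<Lambda>\<^sup>2 + 2 * K)" using K by auto
  have D: "0 < D" unfolding D_def using pos by (intro add_pos_nonneg add_pos_nonneg) (auto intro: add_pos_nonneg)
  have h0: "0 < h0" using r s0 by (simp add: h0_def)
  show ?thesis
  proof (rule exI[of _ "e * D"], intro conjI, goal_cases)
    case 1 show ?case using D by (simp add: e_def)
  next
    case 2 show ?case
    proof (rule exI[of _ h0], intro conjI h0 allI impI)
      fix N h p G f assume bh: "backward_heat N h T K p G f" and hh: "h \<le> h0"
      interpret backward_heat N h T K p G f by (rule bh)
      define \<kappa> where "\<kappa> i = cutoff ((real i * h - m) / r)" for i :: nat
      define \<eta> where "\<eta> i = bump ((real i * h - m) / r)" for i :: nat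
      have hr: "h \<le> r" and hs: "h * s0 \<le> 1/2"
        using hh s0 by (auto simp: h0_def field_simps)
      have h1: "h \<le> 1" using hr m r by linarith
      have k: "0 \<le> h / r" "h / r \<le> 1" using h_pos r hr by auto
      have step: "(real (Suc i) * h - m) / r = (real i * h - m) / r + h / r" for i
        by (simp add: algebra_simps add_divide_distrib diff_divide_distrib)
      have stepm: "(real (i - 1) * h - m) / r = (real i * h - m) / r - h / r" if "1 \<le> i" for i
        using that by (cases i) (auto simp: algebra_simps add_divide_distrib diff_divide_distrib)
      have "h * s0 + c * T\<^sup>2 / 4 * s0 \<le> 1" using hs c by linarith
      then have c3: "(h + c * T\<^sup>2 / 4) * (1 + 2 * K\<^sup>2) \<le> 1" by (simp add: s0_def[symmetric] distrib_right)
      interpret carleman_left N h T K p G f c r m \<Lambda> \<kappa> \<eta>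
      proof unfold_locales
        show "0 < r" "h \<le> r" "h \<le> 1" "0 \<le> \<Lambda>" "0 < c" "c * T \<le> 1/1000" "c \<le> 1/100"
          "(h + c * T\<^sup>2 / 4) * (1 + 2 * K\<^sup>2) \<le> 1"
          using r hr h1 L c c3 by auto
        show "0 \<le> \<kappa> i \<and> \<kappa> i \<le> 1" for i using cutoff_range by (simp add: \<kappa>_def)
        \<comment> \<open>The last interior node is at \<open>1 - h\<close>, beyond
          \<open>m + r\<close> because \<open>m + 4 * r < 1\<close> and \<open>h \<le> r\<close>; so
          the cutoff already vanishes there.\<close>
        have "real N * h = 1 - h" using Nh by (simp add: algebra_simps)
        then show "\<kappa> N = 0" unfolding \<kappa>_def using r hr m by (intro cutoff_high) (auto simp: field_simps)
        show "0 \<le> \<eta> i \<and> \<eta> i \<le> 1" for i by (simp add: \<eta>_def bump_def)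
        show "\<eta> i = 1" if "\<bar>real i * h - m\<bar> \<le> 2 * r" for i
        proof -
          have "\<bar>(real i * h - m) / r\<bar> \<le> 2" using that r by (simp add: field_simps)
          then show ?thesis by (simp add: \<eta>_def bump_def)
        qed
        show "\<eta> i = 0" if "\<bar>real i * h - m\<bar> \<ge> 3 * r" for i
        proof -
          have "\<bar>(real i * h - m) / r\<bar> \<ge> 3" using that r by (simp add: field_simps)
          then show ?thesis by (simp add: \<eta>_def bump_def)
        qed
        show "\<bar>\<eta> (Suc i) - \<eta> i\<bar> \<le> \<Lambda> * h" for i
        proof -
          have "\<bar>\<eta> (Suc i) - \<eta> i\<bar> \<le> h / r" unfolding \<eta>_def step by (rule bump_diff[OF k(1)])
          also have "\<dots> = (1 / r) * h" by simp
          also have "\<dots> \<le> \<Lambda> * h" unfolding \<Lambda>_def using r h_pos by (intro mult_right_mono) (auto intro!: add_increasing divide_right_mono)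
          finally show ?thesis .
        qed
        show "\<kappa> (Suc i) = \<kappa> i \<and> \<kappa> (i - 1) = \<kappa> i" if "i \<in> {1..N}" "\<bar>real i * h - m\<bar> > 2 * r" for i
        proof (cases "real i * h > m")
          case True
          then have "(real i * h - m) / r \<ge> 2" using that r by (simp add: field_simps)
          then show ?thesis unfolding \<kappa>_def step using stepm[of i] that k by (simp add: cutoff_high)
        next
          case False
          then have "(real i * h - m) / r \<le> -2" using that r by (simp add: field_simps)
          then show ?thesis unfolding \<kappa>_def step using stepm[of i] that k by (simp add: cutoff_low)
        qed
        show "\<bar>\<kappa> (Suc i) - \<kappa> i\<bar> \<le> \<Lambda> * h" if "i \<le> N" for i
        proof -
          let ?y = "(real i * h - m) / r"
          have "real i * h \<le> real (Suc N) * h" using that h_pos by (intro mult_right_mono) auto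
          then have "real i * h \<le> 1" unfolding Nh .
          moreover have "0 \<le> real i * h" using h_pos by simp
          ultimately have "\<bar>real i * h - m\<bar> \<le> 1" using m r by linarith
          then have y: "\<bar>?y\<bar> \<le> 1 / r" using r by (simp add: divide_right_mono)
          have "\<bar>\<kappa> (Suc i) - \<kappa> i\<bar> \<le> h / r * (4 * \<bar>?y\<bar> + 4)"
            unfolding \<kappa>_def step by (rule cutoff_diff[OF k])
          also have "\<dots> \<le> h / r * (4 * (1 / r) + 4)" using y k by (intro mult_left_mono) auto
          also have "\<dots> = h * (4 / r\<^sup>2 + 4 / r)" by (simp add: power2_eq_square distrib_left)
          also have "\<dots> \<le> h * \<Lambda>" unfolding \<Lambda>_def using h_pos r by (intro mult_left_mono add_mono divide_right_mono) auto
          finally show ?thesis by (simp add: mult.commute)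
        qed
        show "\<bar>\<kappa> (Suc i) - 2 * \<kappa> i + \<kappa> (i - 1)\<bar> \<le> \<Lambda> * h\<^sup>2" if "i \<in> {1..N}" for i
        proof -
          have "\<bar>\<kappa> (Suc i) - 2 * \<kappa> i + \<kappa> (i - 1)\<bar> \<le> 4 * (h / r)\<^sup>2"
            unfolding \<kappa>_def step using stepm[of i] that cutoff_second_diff[OF k(1)] by simp
          also have "\<dots> = (4 / r\<^sup>2) * h\<^sup>2" by (simp add: power_divide)
          also have "\<dots> \<le> \<Lambda> * h\<^sup>2" unfolding \<Lambda>_def using r 
            by (intro mult_right_mono) (auto intro!: add_increasing2 divide_right_mono)
          finally show ?thesis .
        qed
      qed
      have k1: "\<kappa> i = 1" if "real i * h \<le> m - r" for i
        unfolding \<kappa>_def using that r by (intro cutoff_low) (simp add: field_simps)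
      let ?F = "LINT t:{0..T}|lborel. Fs t" and ?W = "LINT t:{0..T}|lborel. P\<omega> t"
      have nn: "0 \<le> ?F" "0 \<le> ?W"
        using Fs_nonneg Pw_nonneg by (auto simp: set_lebesgue_integral_def intro!: integral_nonneg)
      have "(LINT t:{T/3..2*T/3}|lborel. (\<Sum>i | i \<in> {1..N} \<and> real i * h \<le> m - r. (p i t)\<^sup>2))
         \<le> (LINT t:{T/3..2*T/3}|lborel. (\<Sum>i | i \<in> {1..N} \<and> \<kappa> i = 1. (p i t)\<^sup>2))"
      proof (rule set_integral_mono)
        show "set_integrable lborel {T/3..2*T/3} (\<lambda>t. \<Sum>i | i \<in> {1..N} \<and> real i * h \<le> m - r. (p i t)\<^sup>2)"
          "set_integrable lborel {T/3..2*T/3} (\<lambda>t. \<Sum>i | i \<in> {1..N} \<and> \<kappa> i = 1. (p i t)\<^sup>2)"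
          by (intro set_integrable_continuous continuous_intros continuous_on_subset[OF p_cont]; use T in auto)+
      qed (auto intro!: sum_mono2 simp: k1)
      also have "\<dots> \<le> e * (LINT t:{0..T}|lborel. (\<sigma> t) ^ 3 * V t)"
        unfolding e_def by (rule unweighted_estimate)
      also have "\<dots> \<le> e * ((2 + 18 * \<Lambda>\<^sup>2) * ?F
          + (5 * \<Lambda>\<^sup>2 + 18 * \<Lambda>\<^sup>2 * (2 + 4 * \<Lambda>\<^sup>2 + 2 * K)) * ?W
          + 100 * (1 + \<Lambda>\<^sup>2) * (exp (- 1 / h) * (P 0 + P T)))"
        using weighted_estimate by (intro mult_left_mono) (auto simp: e_def mult.assoc)
      also have "\<dots> \<le> e * (D * ?F + D * ?W + D * (exp (- 1 / h) * (P 0 + P T)))"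
      proof (intro mult_left_mono add_mono mult_right_mono)
        have "0 \<le> \<Lambda>\<^sup>2" "0 \<le> 2 + 18 * \<Lambda>\<^sup>2" "0 \<le> 100 * (1 + \<Lambda>\<^sup>2)" by simp_all
        then show "2 + 18 * \<Lambda>\<^sup>2 \<le> D" "5 * \<Lambda>\<^sup>2 + 18 * \<Lambda>\<^sup>2 * (2 + 4 * \<Lambda>\<^sup>2 + 2 * K) \<le> D"
          "100 * (1 + \<Lambda>\<^sup>2) \<le> D" unfolding D_def using pos by linarith+
      qed (use nn P_nonneg in \<open>auto simp: e_def\<close>)
      also have "\<dots> = e * D * (?F + ?W + exp (- 1 / h) * (P 0 + P T))" by (simp add: algebra_simps)
      finally show "(LINT t:{T/3..2*T/3}|lborel. (\<Sum>i | i \<in> {1..N} \<and> real i * h \<le> m - r. (p i t)\<^sup>2))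
        \<le> e * D * ((LINT t:{0..T}|lborel. (\<Sum>i=1..N. (f i t)\<^sup>2))
        + (LINT t:{0..T}|lborel. (\<Sum>i | i \<in> {1..N} \<and> \<bar>real i * h - m\<bar> \<le> 4 * r. (p i t)\<^sup>2))
        + exp (- 1 / h) * ((\<Sum>i=1..N. (p i 0)\<^sup>2) + (\<Sum>i=1..N. (p i T)\<^sup>2)))"
        by (simp add: P_def Fs_def P\<omega>_def \<omega>_def)
    qed
  qed
qed

section \<open>Reflection and gluing of the two sides\<close>

lemma sum_union_le:
  fixes g :: "nat \<Rightarrow> real"
  assumes "finite A" "finite B" "\<And>i. 0 \<le> g i"
  shows "sum g (A \<union> B) \<le> sum g A + sum g B"
  using sum.union_inter[OF assms(1,2), of g] sum_nonneg[of "A \<inter> B" g] assms(3) by simp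

lemma sum_reflect:
  fixes g :: "nat \<Rightarrow> real"
  shows "(\<Sum>i | i \<in> {1..N} \<and> S (Suc N - i). g (Suc N - i)) = (\<Sum>i | i \<in> {1..N} \<and> S i. g i)"
  by (rule sum.reindex_bij_witness[of _ "\<lambda>i. Suc N - i" "\<lambda>i. Suc N - i"]) auto

lemma backward_heat_reflect:
  assumes "backward_heat N h T K p G f"
  shows "backward_heat N h T K (\<lambda>i. p (Suc N - i)) (\<lambda>i. G (Suc N - i)) (\<lambda>i. f (Suc N - i))"
proof -
  interpret backward_heat N h T K p G f by (rule assms)
  show ?thesis
  proof unfold_locales
    show "p (Suc N - 0) t = 0" "p (Suc N - Suc N) t = 0" for t using p_0 p_N by auto
    fix i assume i: "i \<in> {1..N}"
    then have e: "Suc N - Suc i = (Suc N - i) - 1" "Suc N - (i - 1) = Suc (Suc N - i)" "Suc N - i \<in> {1..N}" by auto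
    have "laplacian h (\<lambda>j. p (Suc N - j) t) i = laplacian h (\<lambda>j. p j t) (Suc N - i)" for t
      unfolding laplacian_def e by simp
    then show "has_primitive T (\<lambda>t. - (laplacian h (\<lambda>j. p (Suc N - j) t) i + G (Suc N - i) t)) (p (Suc N - i))"
      using p_eq[OF e(3)] by simp
    show "\<bar>G (Suc N - i) t\<bar> \<le> K * \<bar>p (Suc N - i) t\<bar> + f (Suc N - i) t" if "t \<in> {0..T}" for t
      using G_bound[OF e(3) that] .
    show "set_integrable lborel {0..T} (\<lambda>t. (f (Suc N - i) t)\<^sup>2)" using f_L2[OF e(3)] .
  qed (use h_pos Nh T_pos K_nonneg f_nonneg in auto)
qed

text \<open>The two one-sided estimates and the observation bound the time average of the energy
  over the middle third. Averaging the energy estimate over the same third turns this into a bound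
  at time 0.\<close>

theorem backward_heat_observability:
  assumes T: "0 < T" and K: "0 \<le> K" and r: "0 < r" and m: "0 < m - 4 * r" "m + 4 * r < 1"
  shows "\<exists>C>0. \<exists>h0>0. \<forall>N h p G f. backward_heat N h T K p G f \<longrightarrow> h \<le> h0 \<longrightarrow>
    (\<Sum>i=1..N. (p i 0)\<^sup>2)
     \<le> C * ((LINT t:{0..T}|lborel. (\<Sum>i=1..N. (f i t)\<^sup>2))
        + (LINT t:{0..T}|lborel. (\<Sum>i | i \<in> {1..N} \<and> \<bar>real i * h - m\<bar> \<le> 4 * r. (p i t)\<^sup>2))
        + exp (- 1 / h) * (\<Sum>i=1..N. (p i T)\<^sup>2))"
proof -
  obtain CL hL where CL: "CL > 0" "hL > 0" and left: "\<And>N h p G f. backward_heat N h T K p G f \<Longrightarrow> h \<le> hL \<Longrightarrow>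
    (LINT t:{T/3..2*T/3}|lborel. (\<Sum>i | i \<in> {1..N} \<and> real i * h \<le> m - r. (p i t)\<^sup>2))
     \<le> CL * ((LINT t:{0..T}|lborel. (\<Sum>i=1..N. (f i t)\<^sup>2))
        + (LINT t:{0..T}|lborel. (\<Sum>i | i \<in> {1..N} \<and> \<bar>real i * h - m\<bar> \<le> 4 * r. (p i t)\<^sup>2))
        + exp (- 1 / h) * ((\<Sum>i=1..N. (p i 0)\<^sup>2) + (\<Sum>i=1..N. (p i T)\<^sup>2)))"
    using backward_heat_left[OF T K r, of m] m r by auto
  obtain CR hR where CR: "CR > 0" "hR > 0" and right: "\<And>N h p G f. backward_heat N h T K p G f \<Longrightarrow> h \<le> hR \<Longrightarrow>
    (LINT t:{T/3..2*T/3}|lborel. (\<Sum>i | i \<in> {1..N} \<and> real i * h \<le> (1 - m) - r. (p i t)\<^sup>2))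
     \<le> CR * ((LINT t:{0..T}|lborel. (\<Sum>i=1..N. (f i t)\<^sup>2))
        + (LINT t:{0..T}|lborel. (\<Sum>i | i \<in> {1..N} \<and> \<bar>real i * h - (1 - m)\<bar> \<le> 4 * r. (p i t)\<^sup>2))
        + exp (- 1 / h) * ((\<Sum>i=1..N. (p i 0)\<^sup>2) + (\<Sum>i=1..N. (p i T)\<^sup>2)))"
    using backward_heat_left[OF T K r, of "1 - m"] m r by auto
  define e where "e = exp ((2 * K + 1) * T)"
  \<comment> \<open>One summand for each side of \<open>m\<close>, and 1 for the nodes that are
    observed directly.\<close>
  define D where "D = CL + CR + 1"
  define C where "C = 3 / T * e * (D * (2 + e) + T / 3)"
  have e1: "1 \<le> e" using K T by (simp add: e_def)
  have D1: "1 \<le> D" using CL CR by (simp add: D_def)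
  have C: "0 < C" unfolding C_def using e1 D1 T by (intro mult_pos_pos add_pos_pos) auto
  show ?thesis
  proof (rule exI[of _ C], intro conjI C, rule exI[of _ "min hL hR"], intro conjI allI impI)
    show "0 < min hL hR" using CL CR by simp
    fix N h p G f assume bh: "backward_heat N h T K p G f" and hh: "h \<le> min hL hR"
    interpret backward_heat N h T K p G f by (rule bh)
    define w where "w t = (\<Sum>i | i \<in> {1..N} \<and> \<bar>real i * h - m\<bar> \<le> 4 * r. (p i t)\<^sup>2)" for t
    let ?x = "exp (- 1 / h)"
    let ?F = "LINT t:{0..T}|lborel. Fs t" and ?W = "LINT t:{0..T}|lborel. w t"
    let ?I = "{T/3..2*T/3}"
    have sub: "?I \<subseteq> {0..T}" using T by auto
    have w0: "0 \<le> w t" for t by (simp add: w_def sum_nonneg)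
    have w_cont: "continuous_on {0..T} w" unfolding w_def by (intro continuous_intros p_cont) auto
    have nn: "0 \<le> ?F" "0 \<le> ?W"
      using Fs_nonneg w0 by (auto simp: set_lebesgue_integral_def intro!: integral_nonneg)
    have x: "0 < ?x" "?x \<le> 1" using h_pos by auto
    define lf where "lf t = (\<Sum>i | i \<in> {1..N} \<and> real i * h \<le> m - r. (p i t)\<^sup>2)" for t
    define rt where "rt t = (\<Sum>i | i \<in> {1..N} \<and> m + r \<le> real i * h. (p i t)\<^sup>2)" for t
    have L: "(LINT t:?I|lborel. lf t) \<le> CL * (?F + ?W + ?x * (P 0 + P T))"
      using left[OF bh] hh unfolding lf_def w_def P_def Fs_def by simp
    have R: "(LINT t:?I|lborel. rt t) \<le> CR * (?F + ?W + ?x * (P 0 + P T))"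
    proof -
      have c: "real (Suc N - i) * h = 1 - real i * h" if "i \<le> Suc N" for i
      proof -
        have "real (Suc N - i) * h = real (Suc N) * h - real i * h" using that by (simp add: of_nat_diff left_diff_distrib)
        then show ?thesis unfolding Nh .
      qed
      have s1: "(\<Sum>i | i \<in> {1..N} \<and> real i * h \<le> (1 - m) - r. (p (Suc N - i) t)\<^sup>2) = rt t" for t
      proof -
        have "{i. i \<in> {1..N} \<and> real i * h \<le> (1 - m) - r} = {i. i \<in> {1..N} \<and> m + r \<le> real (Suc N - i) * h}"
          using c by auto
        then show ?thesis unfolding rt_def using sum_reflect[where N=N and S="\<lambda>i. m + r \<le> real i * h" and g="\<lambda>i. (p i t)\<^sup>2"] by simp
      qed
      have s2: "(\<Sum>i | i \<in> {1..N} \<and> \<bar>real i * h - (1 - m)\<bar> \<le> 4 * r. (p (Suc N - i) t)\<^sup>2) = w t" for t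
      proof -
        have "{i. i \<in> {1..N} \<and> \<bar>real i * h - (1 - m)\<bar> \<le> 4 * r} = {i. i \<in> {1..N} \<and> \<bar>real (Suc N - i) * h - m\<bar> \<le> 4 * r}"
          using c by (auto simp: abs_minus_commute)
        then show ?thesis unfolding w_def using sum_reflect[where N=N and S="\<lambda>i. \<bar>real i * h - m\<bar> \<le> 4 * r" and g="\<lambda>i. (p i t)\<^sup>2"] by simp
      qed
      have s3: "(\<Sum>i=1..N. g (Suc N - i)) = (\<Sum>i=1..N. g i)" for g :: "nat \<Rightarrow> real"
        by (rule sum.reindex_bij_witness[of _ "\<lambda>i. Suc N - i" "\<lambda>i. Suc N - i"]) auto
      have s4: "(\<Sum>i=1..N. (p (Suc N - i) t)\<^sup>2) = P t" "(\<Sum>i=1..N. (f (Suc N - i) t)\<^sup>2) = Fs t" for t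
        using s3[of "\<lambda>i. (p i t)\<^sup>2"] s3[of "\<lambda>i. (f i t)\<^sup>2"] by (simp_all add: P_def Fs_def)
      show ?thesis using right[OF backward_heat_reflect[OF bh]] hh unfolding s1 s2 s4 by simp
    qed
    have ci: "set_integrable lborel ?I g" if "continuous_on {0..T} g" for g :: "real \<Rightarrow> real"
      by (rule set_integrable_continuous[OF continuous_on_subset[OF that sub]])
    have lfi: "set_integrable lborel ?I lf" unfolding lf_def by (intro ci continuous_intros p_cont) auto
    have rti: "set_integrable lborel ?I rt" unfolding rt_def by (intro ci continuous_intros p_cont) auto
    have wi: "set_integrable lborel ?I w" by (rule ci[OF w_cont])
    have PI: "(LINT t:?I|lborel. P t) \<le> D * (?F + ?W + ?x * (P 0 + P T))"
    proof -
      have "(LINT t:?I|lborel. P t) \<le> (LINT t:?I|lborel. lf t + rt t + w t)"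
      proof (rule set_integral_mono[OF ci[OF P_cont]])
        show "set_integrable lborel ?I (\<lambda>t. lf t + rt t + w t)" by (intro set_integral_add lfi rti wi)
        fix t
        let ?A = "{i. i \<in> {1..N} \<and> real i * h \<le> m - r}" and ?B = "{i. i \<in> {1..N} \<and> m + r \<le> real i * h}"
          and ?C = "{i. i \<in> {1..N} \<and> \<bar>real i * h - m\<bar> \<le> 4 * r}"
        \<comment> \<open>The zones up to \<open>m - r\<close>, from \<open>m + r\<close>, and
          within \<open>4 * r\<close> of \<open>m\<close> cover the mesh with overlap, so nothing is
          lost in the transition region of the cutoff.\<close>
        have "P t \<le> (\<Sum>i\<in>?A \<union> ?B \<union> ?C. (p i t)\<^sup>2)" unfolding P_def using r by (intro sum_mono2) auto
        also have "\<dots> \<le> (\<Sum>i\<in>?A \<union> ?B. (p i t)\<^sup>2) + w t" unfolding w_def by (intro sum_union_le) auto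
        also have "(\<Sum>i\<in>?A \<union> ?B. (p i t)\<^sup>2) \<le> lf t + rt t" unfolding lf_def rt_def by (intro sum_union_le) auto
        finally show "P t \<le> lf t + rt t + w t" by simp
      qed
      also have "\<dots> = (LINT t:?I|lborel. lf t) + (LINT t:?I|lborel. rt t) + (LINT t:?I|lborel. w t)"
        using lfi rti wi by (simp add: set_integral_add)
      also have "(LINT t:?I|lborel. w t) \<le> ?W"
        using w0 wi set_integrable_continuous[OF w_cont] sub unfolding set_lebesgue_integral_def set_integrable_def
        by (intro integral_mono) (auto simp: indicator_def)
      also have "?W \<le> 1 * (?F + ?W + ?x * (P 0 + P T))" using nn x P_nonneg by auto
      finally show ?thesis using L R by (simp add: D_def distrib_right)
    qed
    have P0: "P 0 \<le> e * (P T + ?F)" unfolding e_def using energy_estimate[of T] T by simp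
    \<comment> \<open>The energy at time 0 is removed from the remainder not by smallness of
      \<open>exp (- 1 / h)\<close> but by the energy estimate; in the source term the exponential is
      simply bounded by 1.\<close>
    have "?x * (P 0 + P T) \<le> ?x * ((1 + e) * (P T + ?F))"
      using P0 nn x by (intro mult_left_mono) (auto simp: algebra_simps)
    also have "\<dots> \<le> (1 + e) * (?x * P T + ?F)"
      using nn x e1 mult_right_mono[OF x(2) nn(1)] by (simp add: algebra_simps mult_left_mono add_mono)
    finally have xP: "?x * (P 0 + P T) \<le> (1 + e) * (?x * P T + ?F)" .
    have "T / 3 * P 0 = (LINT t:?I|lborel. P 0)" using T by (simp add: set_lebesgue_integral_def)
    also have "\<dots> \<le> (LINT t:?I|lborel. e * (P t + ?F))"
    proof (rule set_integral_mono)
      show "set_integrable lborel ?I (\<lambda>t. e * (P t + ?F))" by (intro ci continuous_intros P_cont)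
      show "P 0 \<le> e * (P t + ?F)" if "t \<in> ?I" for t
        unfolding e_def using energy_estimate[of t] that sub by auto
    qed (rule ci, intro continuous_intros)
    also have "\<dots> = e * ((LINT t:?I|lborel. P t) + T / 3 * ?F)"
    proof -
      have "(LINT t:?I|lborel. P t + ?F) = (LINT t:?I|lborel. P t) + (LINT t:?I|lborel. ?F)"
        by (rule set_integral_add[OF ci[OF P_cont]]) (rule ci, intro continuous_intros)
      moreover have "(LINT t:?I|lborel. ?F) = T / 3 * ?F" using T by (simp add: set_lebesgue_integral_def)
      ultimately show ?thesis by simp
    qed
    also have "\<dots> \<le> e * (D * (?F + ?W + (1 + e) * (?x * P T + ?F)) + T / 3 * ?F)"
    proof (intro mult_left_mono add_right_mono)
      have "D * (?F + ?W + ?x * (P 0 + P T)) \<le> D * (?F + ?W + (1 + e) * (?x * P T + ?F))"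
        using xP D1 by (intro mult_left_mono add_left_mono) auto
      then show "(LINT t:?I|lborel. P t) \<le> D * (?F + ?W + (1 + e) * (?x * P T + ?F))" using PI by linarith
    qed (use e1 in auto)
    also have "\<dots> \<le> e * ((D * (2 + e) + T / 3) * (?F + ?W + ?x * P T))"
    proof (rule mult_left_mono)
      have a: "0 \<le> ?x * P T" using x P_nonneg by simp
      have "?F + ?W + (1 + e) * (?x * P T + ?F) \<le> (2 + e) * (?F + ?W + ?x * P T)"
        using nn a e1 by (simp add: algebra_simps add_mono)
      then have "D * (?F + ?W + (1 + e) * (?x * P T + ?F)) \<le> D * ((2 + e) * (?F + ?W + ?x * P T))"
        using D1 by (intro mult_left_mono) auto
      moreover have "T / 3 * ?F \<le> T / 3 * (?F + ?W + ?x * P T)" using nn a T by (intro mult_left_mono) auto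
      ultimately show "D * (?F + ?W + (1 + e) * (?x * P T + ?F)) + T / 3 * ?F \<le> (D * (2 + e) + T / 3) * (?F + ?W + ?x * P T)"
        unfolding distrib_right mult.assoc by linarith
    qed (use e1 in auto)
    finally have "P 0 \<le> C * (?F + ?W + ?x * P T)" using T by (simp add: C_def field_simps)
    then show "(\<Sum>i=1..N. (p i 0)\<^sup>2)
     \<le> C * ((LINT t:{0..T}|lborel. (\<Sum>i=1..N. (f i t)\<^sup>2))
        + (LINT t:{0..T}|lborel. (\<Sum>i | i \<in> {1..N} \<and> \<bar>real i * h - m\<bar> \<le> 4 * r. (p i t)\<^sup>2))
        + exp (- 1 / h) * (\<Sum>i=1..N. (p i T)\<^sup>2))"
      by (simp add: P_def Fs_def w_def)
  qed
qed

section \<open>Brownian increments\<close>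

text \<open>Independence of increments is given for a single increasing sequence of times. With this
  partition every observation time in \<open>R\<close> is a node, so the past values of
  \<open>B\<close> are partial sums of the first \<open>n\<close> increments, and the future
  increment from \<open>s\<close> to \<open>t\<close> is the last one.\<close>

lemma finite_set_increasing_enumeration:
  fixes R :: "real set"
  assumes "finite R" "R \<subseteq> {0..s}" "0 \<le> s" "s < t"
  obtains n :: nat and \<tau> :: "nat \<Rightarrow> real" where
    "\<tau> 0 = 0" "\<forall>i\<le>n. \<tau> i < \<tau> (Suc i)" "\<tau> n = s" "\<tau> (Suc n) = t" "R \<subseteq> \<tau> ` {..n}"
proof -
  define S where "S = insert 0 (insert s R)"
  have S: "finite S" "S \<noteq> {}" using assms by (auto simp: S_def)
  define xs where "xs = sorted_list_of_set S"
  have xs: "sorted_wrt (<) xs" "set xs = S" "xs \<noteq> []" using S by (auto simp: xs_def)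
  define n where "n = length xs - 1"
  have len: "length xs = Suc n" using xs(3) by (cases xs) (auto simp: n_def)
  define \<tau> where "\<tau> i = (if i \<le> n then xs ! i else t)" for i
  have mono: "xs ! i < xs ! j" if "i < j" "j \<le> n" for i j
    using sorted_wrt_nth_less[OF xs(1) that(1)] that len by simp
  have in_S: "xs ! i \<in> {0..s}" if "i \<le> n" for i
    using that len xs(2) assms nth_mem[of i xs] by (auto simp: S_def)
  have ex: "\<exists>j\<le>n. xs ! j = x" if "x \<in> S" for x
    using that xs(2) len by (metis in_set_conv_nth less_Suc_eq_le)
  show ?thesis
  proof (rule that[of \<tau> n])
    obtain j where j: "j \<le> n" "xs ! j = 0" using ex[of 0] by (auto simp: S_def)
    then show "\<tau> 0 = 0" using mono[of 0 j] in_S[of 0] by (cases "j = 0") (auto simp: \<tau>_def)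
    obtain k where k: "k \<le> n" "xs ! k = s" using ex[of s] by (auto simp: S_def)
    then show ns: "\<tau> n = s" using mono[of k n] in_S[of n] by (cases "k = n") (auto simp: \<tau>_def)
    have "\<tau> i < \<tau> (Suc i)" if "i \<le> n" for i
      using that mono[of i "Suc i"] in_S[of i] assms by (auto simp: \<tau>_def)
    then show "\<forall>i\<le>n. \<tau> i < \<tau> (Suc i)" by blast
    show "\<tau> (Suc n) = t" by (simp add: \<tau>_def)
    show "R \<subseteq> \<tau> ` {..n}"
    proof
      fix x assume "x \<in> R"
      then obtain j where "j \<le> n" "xs ! j = x" using ex[of x] by (auto simp: S_def)
      then show "x \<in> \<tau> ` {..n}" by (auto simp: \<tau>_def image_iff)
    qed
  qed
qed

context brownian_space
begin

lemma space_brownian_filtration [simp]: "space (brownian_filtration M B t) = space M"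
  unfolding brownian_filtration_def by (rule space_measure_of) (auto dest: sets.sets_into_space)

lemma sets_brownian_filtration_eq:
  "sets (brownian_filtration M B t) = sigma_sets (space M)
     ((\<Union>s\<in>{0..t}. {B s -` A \<inter> space M | A. A \<in> sets borel}) \<union> null_sets M)"
  unfolding brownian_filtration_def by (rule sets_measure_of) (auto dest: sets.sets_into_space)

lemma brownian_filtration_mono:
  assumes "s \<le> t" "X \<in> borel_measurable (brownian_filtration M B s)"
  shows "X \<in> borel_measurable (brownian_filtration M B t)"
proof -
  interpret filtration "space M" "brownian_filtration M B" by (rule filtration_brownian)
  show ?thesis using assms sets_F_mono[OF assms(1)] by (auto simp: measurable_def)
qed

lemma brownian_filtration_measurable:
  assumes "X \<in> borel_measurable (brownian_filtration M B t)"
  shows "X \<in> borel_measurable M"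
  using assms sets_brownian_filtration[of t] by (auto simp: measurable_def)

lemma B_adapted:
  assumes "0 \<le> s" "s \<le> t"
  shows "B s \<in> borel_measurable (brownian_filtration M B t)"
proof (rule measurableI)
  fix A :: "real set" assume "A \<in> sets borel"
  then show "B s -` A \<inter> space (brownian_filtration M B t) \<in> sets (brownian_filtration M B t)"
    unfolding sets_brownian_filtration_eq space_brownian_filtration using assms
    by (intro sigma_sets.Basic) auto
qed simp

text \<open>Events about finitely many past times. Together with the null sets they form an
  intersection-stable generator of the augmented filtration, on which independence can be checked by
  hand.\<close>

definition cylinder_sets :: "real \<Rightarrow> 'a set set" where
  "cylinder_sets s = {{w \<in> space M. \<forall>r\<in>R. B r w \<in> A r} | R A. finite R \<and> R \<subseteq> {0..s} \<and> (\<forall>r. A r \<in> sets borel)}"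

lemma cylinder_setsI:
  assumes "E = {w \<in> space M. \<forall>r\<in>R. B r w \<in> A r}" "finite R" "R \<subseteq> {0..s}" "\<forall>r. A r \<in> sets borel"
  shows "E \<in> cylinder_sets s"
  unfolding cylinder_sets_def using assms by (intro CollectI exI[of _ R] exI[of _ A] conjI)

lemma cylinder_setsE:
  assumes "E \<in> cylinder_sets s"
  obtains R A where "E = {w \<in> space M. \<forall>r\<in>R. B r w \<in> A r}" "finite R" "R \<subseteq> {0..s}" "\<forall>r. A r \<in> sets borel"
  using assms unfolding cylinder_sets_def by (elim CollectE exE conjE) (rule that)

lemma cylinder_sets_events: 
  assumes "E \<in> cylinder_sets s" shows "E \<in> events"
proof -
  obtain R A where E: "E = {w \<in> space M. \<forall>r\<in>R. B r w \<in> A r}" "finite R" "R \<subseteq> {0..s}" "\<forall>r. A r \<in> sets borel"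
    by (rule cylinder_setsE[OF assms])
  have "{w \<in> space M. B r w \<in> A r} \<in> events" if "r \<in> R" for r
    using measurable_sets[OF B_measurable[of r], of "A r"] E that by (auto simp: vimage_def Int_def conj_commute)
  then show ?thesis unfolding E(1) using E(2) by (intro sets.sets_Collect_finite_All) auto
qed

text \<open>The event is rewritten through the first \<open>n\<close> increments of a suitable
  partition, and these are jointly independent of the last one.\<close>

lemma cylinder_increment_prob:
  assumes E: "E \<in> cylinder_sets s" and s: "0 \<le> s" "s < t" and C: "C \<in> sets borel"
  shows "prob (E \<inter> ((\<lambda>w. B t w - B s w) -` C \<inter> space M)) = prob E * prob ((\<lambda>w. B t w - B s w) -` C \<inter> space M)"
proof -
  obtain R A where E': "E = {w \<in> space M. \<forall>r\<in>R. B r w \<in> A r}" "finite R" "R \<subseteq> {0..s}" "\<forall>r. A r \<in> sets borel"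
    by (rule cylinder_setsE[OF E])
  obtain n \<tau> where \<tau>: "\<tau> 0 = 0" "\<forall>i\<le>n. \<tau> i < \<tau> (Suc i)" "\<tau> n = s" "\<tau> (Suc n) = t" "R \<subseteq> \<tau> ` {..n}"
    by (rule finite_set_increasing_enumeration[OF E'(2,3) s])
  define X where "X i w = B (\<tau> (Suc i)) w - B (\<tau> i) w" for i :: nat and w
  have ind: "indep_vars (\<lambda>_. borel) X {..<Suc n}"
    unfolding X_def by (rule B_indep_increments) (simp_all add: \<tau>(1,2))
  have "\<forall>r\<in>R. \<exists>j\<le>n. \<tau> j = r" using \<tau>(5) by auto
  then obtain j where j: "\<And>r. r \<in> R \<Longrightarrow> j r \<le> n \<and> \<tau> (j r) = r" by metis
  let ?P = "PiM {..<n} (\<lambda>_. borel :: real measure)" and ?Q = "PiM {n} (\<lambda>_. borel :: real measure)"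
  let ?x = "\<lambda>w. restrict (\<lambda>i. X i w) {..<n}" and ?y = "\<lambda>w. restrict (\<lambda>i. X i w) {n}"
  have iv: "indep_var ?P ?x ?Q ?y" by (rule indep_var_restrict[OF ind]) auto
  define Xa where "Xa = {f \<in> space ?P. \<forall>r\<in>R. (\<Sum>i<j r. f i) \<in> A r}"
  define Xb where "Xb = {f \<in> space ?Q. f n \<in> C}"
  have Xa: "Xa \<in> sets ?P" unfolding Xa_def
  proof (rule sets.sets_Collect_finite_All[OF _ E'(2)])
    fix r assume r: "r \<in> R"
    have "(\<lambda>f. \<Sum>i<j r. f i) \<in> borel_measurable ?P"
      using j[OF r] by (intro borel_measurable_sum measurable_component_singleton) auto
    from measurable_sets[OF this E'(4)[rule_format, of r]]
    show "{f \<in> space ?P. (\<Sum>i<j r. f i) \<in> A r} \<in> sets ?P" by (simp add: vimage_def Int_def conj_commute)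
  qed
  have Xb: "Xb \<in> sets ?Q"
  proof -
    have "(\<lambda>f. f n) \<in> borel_measurable ?Q" by (intro measurable_component_singleton) auto
    from measurable_sets[OF this C] show ?thesis by (simp add: Xb_def vimage_def Int_def conj_commute)
  qed
  have prod: "prob ((\<lambda>w. (?x w, ?y w)) -` (Xa \<times> Xb) \<inter> space M) = prob (?x -` Xa \<inter> space M) * prob (?y -` Xb \<inter> space M)"
    by (rule indep_varD[OF iv Xa Xb])
  have y: "?y -` Xb \<inter> space M = (\<lambda>w. B t w - B s w) -` C \<inter> space M"
    using \<tau> by (auto simp: Xb_def X_def space_PiM)
  have tele: "(\<Sum>i<k. X i w) = B (\<tau> k) w - B 0 w" for k w
    by (induction k) (auto simp: X_def \<tau>(1))
  have sumx: "(\<Sum>i<j r. ?x w i) = B r w - B 0 w" if "r \<in> R" for r w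
  proof -
    have "(\<Sum>i<j r. ?x w i) = (\<Sum>i<j r. X i w)" using j[OF that] by (intro sum.cong) auto
    then show ?thesis using j[OF that] by (simp add: tele)
  qed
  have mx: "?x -` Xa \<inter> space M \<in> events" "?y -` Xb \<inter> space M \<in> events"
    using iv Xa Xb by (auto simp: indep_var_eq intro: measurable_sets)
  \<comment> \<open>The increments recover \<open>B r\<close> only up to \<open>B 0\<close>, which
    is 0 almost surely and not everywhere; the two events therefore agree up to a null set.\<close>
  have ae: "AE w in M. (w \<in> ?x -` Xa \<inter> space M) = (w \<in> E)"
    using B_0 by eventually_elim (auto simp: Xa_def E'(1) sumx space_PiM simp del: restrict_apply)
  have pE: "prob (?x -` Xa \<inter> space M) = prob E"
    using ae mx cylinder_sets_events[OF E] by (intro finite_measure_eq_AE) auto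
  have "prob ((\<lambda>w. (?x w, ?y w)) -` (Xa \<times> Xb) \<inter> space M) = prob (E \<inter> (?y -` Xb \<inter> space M))"
  proof (rule finite_measure_eq_AE)
    have "(\<lambda>w. (?x w, ?y w)) -` (Xa \<times> Xb) \<inter> space M = (?x -` Xa \<inter> space M) \<inter> (?y -` Xb \<inter> space M)" by auto
    then show "(\<lambda>w. (?x w, ?y w)) -` (Xa \<times> Xb) \<inter> space M \<in> events" using mx by auto
    show "E \<inter> (?y -` Xb \<inter> space M) \<in> events" using mx cylinder_sets_events[OF E] by auto
    show "AE w in M. (w \<in> (\<lambda>w. (?x w, ?y w)) -` (Xa \<times> Xb) \<inter> space M) = (w \<in> E \<inter> (?y -` Xb \<inter> space M))"
      using ae by eventually_elim auto
  qed
  then show ?thesis using prod pE unfolding y by simp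
qed

text \<open>Independence extends from the cylinders to the augmented filtration by the monotone
  class argument for intersection-stable generators. Adding the null sets to the generator preserves
  stability, and a null set is independent of everything, so the augmentation needs no separate
  treatment.\<close>

lemma indep_increment:
  assumes X: "X \<in> borel_measurable (brownian_filtration M B s)" and s: "0 \<le> s" "s < t"
  shows "indep_var borel X borel (\<lambda>w. B t w - B s w)"
proof -
  let ?D = "\<lambda>w. B t w - B s w"
  let ?H = "{?D -` C \<inter> space M | C. C \<in> sets borel}"
  have D: "?D \<in> borel_measurable M" using B_measurable s by (intro borel_measurable_diff) auto
  have ind: "indep_set (cylinder_sets s \<union> null_sets M) ?H"
  proof (rule indep_setI)
    show "cylinder_sets s \<union> null_sets M \<subseteq> events" using cylinder_sets_events by auto
    show "?H \<subseteq> events" using measurable_sets[OF D] by auto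
    fix a b assume a: "a \<in> cylinder_sets s \<union> null_sets M" and "b \<in> ?H"
    then obtain C where C: "b = ?D -` C \<inter> space M" "C \<in> sets borel" by auto
    then have b: "b \<in> events" using measurable_sets[OF D] by auto
    show "prob (a \<inter> b) = prob a * prob b"
    proof (cases "a \<in> cylinder_sets s")
      case True
      then show ?thesis using cylinder_increment_prob[OF True s C(2)] C by simp
    next
      case False
      then have "a \<in> null_sets M" using a by simp
      moreover from this b have "a \<inter> b \<in> null_sets M" by (rule null_set_Int2)
      ultimately show ?thesis by (simp add: measure_eq_0_null_sets)
    qed
  qed
  have st1: "Int_stable (cylinder_sets s \<union> null_sets M)"
  proof (rule Int_stableI)
    fix a b assume ab: "a \<in> cylinder_sets s \<union> null_sets M" "b \<in> cylinder_sets s \<union> null_sets M"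
    show "a \<inter> b \<in> cylinder_sets s \<union> null_sets M"
    proof (cases "a \<in> cylinder_sets s \<and> b \<in> cylinder_sets s")
      case True
      obtain R A where a: "a = {w \<in> space M. \<forall>r\<in>R. B r w \<in> A r}" "finite R" "R \<subseteq> {0..s}" "\<forall>r. A r \<in> sets borel"
        by (rule cylinder_setsE[OF conjunct1[OF True]])
      obtain R' A' where b: "b = {w \<in> space M. \<forall>r\<in>R'. B r w \<in> A' r}" "finite R'" "R' \<subseteq> {0..s}" "\<forall>r. A' r \<in> sets borel"
        by (rule cylinder_setsE[OF conjunct2[OF True]])
      have "a \<inter> b = {w \<in> space M. \<forall>r\<in>R \<union> R'. B r w \<in> (if r \<in> R then A r else UNIV) \<inter> (if r \<in> R' then A' r else UNIV)}"
        unfolding a(1) b(1) by auto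
      moreover have "finite (R \<union> R')" "R \<union> R' \<subseteq> {0..s}" 
        "\<forall>r. (if r \<in> R then A r else UNIV) \<inter> (if r \<in> R' then A' r else UNIV) \<in> sets borel"
        using a(2-4) b(2-4) by (simp_all add: sets.Int)
      ultimately have "a \<inter> b \<in> cylinder_sets s" by (rule cylinder_setsI)
      then show ?thesis by simp
    next
      case False
      have ev: "a \<in> events" "b \<in> events" using ab cylinder_sets_events by auto
      have "a \<in> null_sets M \<or> b \<in> null_sets M" using False ab by blast
      then have "a \<inter> b \<in> null_sets M" using null_set_Int1[OF _ ev(1)] null_set_Int2[OF _ ev(2)] by blast
      then show ?thesis by simp
    qed
  qed
  have st2: "Int_stable ?H"
  proof (rule Int_stableI)
    fix a b assume "a \<in> ?H" "b \<in> ?H"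
    then obtain C C' where "a = ?D -` C \<inter> space M" "C \<in> sets borel" "b = ?D -` C' \<inter> space M" "C' \<in> sets borel" by blast
    then have "a \<inter> b = ?D -` (C \<inter> C') \<inter> space M" "C \<inter> C' \<in> sets borel" by auto
    then show "a \<inter> b \<in> ?H" by blast
  qed
  have ind2: "indep_set (sigma_sets (space M) (cylinder_sets s \<union> null_sets M)) (sigma_sets (space M) ?H)"
    by (rule indep_set_sigma_sets[OF ind st1 st2])
  have sub: "sets (brownian_filtration M B s) \<subseteq> sigma_sets (space M) (cylinder_sets s \<union> null_sets M)"
    unfolding sets_brownian_filtration_eq
  proof (rule sigma_sets_mono')
    have "B r -` A \<inter> space M \<in> cylinder_sets s" if "r \<in> {0..s}" "A \<in> sets borel" for r A
      by (rule cylinder_setsI[of _ "{r}" "\<lambda>_. A"]) (use that in auto)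
    then show "(\<Union>s\<in>{0..s}. {B s -` A \<inter> space M |A. A \<in> sets borel}) \<union> null_sets M \<subseteq> cylinder_sets s \<union> null_sets M"
      by auto
  qed
  have "sigma_sets (space M) {X -` A \<inter> space M | A. A \<in> sets borel} \<subseteq> sets (brownian_filtration M B s)"
  proof -
    have "{X -` A \<inter> space M | A. A \<in> sets borel} \<subseteq> sets (brownian_filtration M B s)"
      using measurable_sets[OF X] by auto
    from sets.sigma_sets_subset[OF this] show ?thesis by simp
  qed
  then have "indep_set (sigma_sets (space M) {X -` A \<inter> space M | A. A \<in> sets borel}) (sigma_sets (space M) ?H)"
    using ind2 sub unfolding indep_sets2_eq by blast
  then show ?thesis unfolding indep_var_eq using D brownian_filtration_measurable[OF X] by auto
qed

lemma increment_moments: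
  assumes "0 \<le> s" "s < t"
  shows "integrable M (\<lambda>w. B t w - B s w)" "expectation (\<lambda>w. B t w - B s w) = 0"
    "integrable M (\<lambda>w. (B t w - B s w)\<^sup>2)" "expectation (\<lambda>w. (B t w - B s w)\<^sup>2) = t - s"
proof -
  have D: "distributed M lborel (\<lambda>w. B t w - B s w) (\<lambda>x. ennreal (normal_density 0 (sqrt (t - s)) x))"
    by (rule B_normal_increments[OF assms])
  have pos: "0 < sqrt (t - s)" using assms by simp
  show "integrable M (\<lambda>w. B t w - B s w)"
    using distributed_integrable[OF D, of "\<lambda>x. x"] integrable_normal_moment_nz_1[OF pos, of 0] by simp
  show e: "expectation (\<lambda>w. B t w - B s w) = 0"
    using normal_distributed_expectation[OF pos D] .
  show "integrable M (\<lambda>w. (B t w - B s w)\<^sup>2)"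
    using distributed_integrable[OF D, of "\<lambda>x. x\<^sup>2"] integrable_normal_moment[OF pos, of 0 2] by simp
  show "expectation (\<lambda>w. (B t w - B s w)\<^sup>2) = t - s"
    using normal_distributed_variance[OF pos D] assms unfolding e by simp
qed

lemma increment_orthogonal:
  assumes X: "X \<in> borel_measurable (brownian_filtration M B s)" "integrable M X" and s: "0 \<le> s" "s \<le> t"
  shows "integrable M (\<lambda>w. X w * (B t w - B s w))" "expectation (\<lambda>w. X w * (B t w - B s w)) = 0"
    "integrable M (\<lambda>w. X w * (B t w - B s w)\<^sup>2)"
    "expectation (\<lambda>w. X w * (B t w - B s w)\<^sup>2) = expectation X * (t - s)"
proof -
  have "integrable M (\<lambda>w. X w * (B t w - B s w)) \<and> expectation (\<lambda>w. X w * (B t w - B s w)) = 0 \<and>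
    integrable M (\<lambda>w. X w * (B t w - B s w)\<^sup>2) \<and>
    expectation (\<lambda>w. X w * (B t w - B s w)\<^sup>2) = expectation X * (t - s)"
  \<comment> \<open>The normal law of increments is available only for \<open>s < t\<close>; for
    \<open>s = t\<close> all expressions vanish.\<close>
  proof (cases "s = t")
    case False
    then have st: "s < t" using s by simp
    have iv: "indep_var borel X borel (\<lambda>w. B t w - B s w)" by (rule indep_increment[OF X(1) s(1) st])
    have iv2: "indep_var borel X borel (\<lambda>w. (B t w - B s w)\<^sup>2)"
      using indep_var_compose[OF iv, of "\<lambda>x. x" borel "\<lambda>x. x\<^sup>2" borel] by (simp add: comp_def)
    note m = increment_moments[OF s(1) st]
    show ?thesis using indep_var_integrable[OF iv X(2) m(1)] indep_var_lebesgue_integral[OF iv X(2) m(1)]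
      indep_var_integrable[OF iv2 X(2) m(3)] indep_var_lebesgue_integral[OF iv2 X(2) m(3)] m by simp
  qed simp
  then show "integrable M (\<lambda>w. X w * (B t w - B s w))" "expectation (\<lambda>w. X w * (B t w - B s w)) = 0"
    "integrable M (\<lambda>w. X w * (B t w - B s w)\<^sup>2)"
    "expectation (\<lambda>w. X w * (B t w - B s w)\<^sup>2) = expectation X * (t - s)" by auto
qed

end

section \<open>The Ito isometry\<close>

abbreviation time_measure :: "real \<Rightarrow> real measure" where
  "time_measure T \<equiv> restrict_space lborel {0..T}"

lemma finite_measure_time: "finite_measure (time_measure T)"
  by (intro finite_measureI) (simp add: emeasure_restrict_space space_restrict_space emeasure_lborel_Icc_eq)

lemma measure_Ioc_inter:
  fixes a b c d :: real
  shows "measure lborel ({a<..b} \<inter> {c<..d}) = max 0 (min b d - max a c)"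
proof -
  have "{a<..b} \<inter> {c<..d} = {max a c<..min b d}" by auto
  moreover have "measure lborel {u<..v} = max 0 (v - u)" for u v :: real
    by (cases "u \<le> v") simp_all
  ultimately show ?thesis by simp
qed

context brownian_space
begin

lemma integrable_bounded_mult:
  fixes f g :: "'a \<Rightarrow> real"
  assumes "f \<in> borel_measurable M" "\<And>w. w \<in> space M \<Longrightarrow> \<bar>f w\<bar> \<le> K" "integrable M g"
  shows "integrable M (\<lambda>w. f w * g w)"
proof (rule Bochner_Integration.integrable_bound)
  show "integrable M (\<lambda>w. K * g w)" using assms(3) by simp
  show "(\<lambda>w. f w * g w) \<in> borel_measurable M" using assms by measurable
  show "AE w in M. norm (f w * g w) \<le> norm (K * g w)"
  proof (intro AE_I2)
    fix w assume "w \<in> space M"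
    then have "\<bar>f w\<bar> \<le> \<bar>K\<bar>" using assms(2)[of w] by linarith
    then show "norm (f w * g w) \<le> norm (K * g w)" by (simp add: abs_mult mult_right_mono)
  qed
qed

lemma increment_integrable: "0 \<le> s \<Longrightarrow> s \<le> t \<Longrightarrow> integrable M (\<lambda>w. B t w - B s w)"
  using increment_moments(1)[of s t] by (cases "s = t") auto

lemma increment_adapted:
  "0 \<le> s \<Longrightarrow> s \<le> t \<Longrightarrow> t \<le> u \<Longrightarrow> (\<lambda>w. B t w - B s w) \<in> borel_measurable (brownian_filtration M B u)"
  by (intro borel_measurable_diff B_adapted) auto

text \<open>With \<open>a \<le> c\<close> the product of both coefficients is known at time
  \<open>c\<close>. If the time intervals do not overlap, everything except the later increment is
  known when that increment starts, and the expectation is 0; otherwise only the overlap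
  contributes, with the variance of its increment.\<close>

lemma increment_covariance_ordered:
  assumes xi: "\<xi> \<in> borel_measurable (brownian_filtration M B a)" "\<And>w. w \<in> space M \<Longrightarrow> \<bar>\<xi> w\<bar> \<le> K"
    and eta: "\<eta> \<in> borel_measurable (brownian_filtration M B c)" "\<And>w. w \<in> space M \<Longrightarrow> \<bar>\<eta> w\<bar> \<le> L"
    and le: "0 \<le> a" "a \<le> b" "c \<le> d" "a \<le> c"
  shows "integrable M (\<lambda>w. (\<xi> w * (B b w - B a w)) * (\<eta> w * (B d w - B c w))) \<and>
    expectation (\<lambda>w. (\<xi> w * (B b w - B a w)) * (\<eta> w * (B d w - B c w)))
      = expectation (\<lambda>w. \<xi> w * \<eta> w) * max 0 (min b d - max a c)"
proof -
  define x where "x w = \<xi> w * \<eta> w" for w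
  have xm: "x \<in> borel_measurable (brownian_filtration M B c)"
    unfolding x_def using brownian_filtration_mono[OF le(4) xi(1)] eta(1) by (rule borel_measurable_times)
  have xb: "\<bar>x w\<bar> \<le> \<bar>K\<bar> * \<bar>L\<bar>" if "w \<in> space M" for w
    unfolding x_def abs_mult using xi(2)[OF that] eta(2)[OF that] by (intro mult_mono) auto
  note xM = brownian_filtration_measurable[OF xm]
  have xi': "integrable M x" using integrable_bounded_mult[OF xM xb, of "\<lambda>_. 1"] by simp
  have XF: "(\<lambda>w. x w * (B v w - B u w)) \<in> borel_measurable (brownian_filtration M B y)"
    if "0 \<le> u" "u \<le> v" "v \<le> y" "c \<le> y" for u v y
    by (intro borel_measurable_times brownian_filtration_mono[OF that(4) xm] increment_adapted that)
  have XI: "integrable M (\<lambda>w. x w * (B v w - B u w))" if "0 \<le> u" "u \<le> v" for u v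
    by (rule integrable_bounded_mult[OF xM xb increment_integrable[OF that]])
  show ?thesis
  proof (cases "b \<le> c")
    case True
    have e: "(\<xi> w * (B b w - B a w)) * (\<eta> w * (B d w - B c w)) = (x w * (B b w - B a w)) * (B d w - B c w)" for w
      by (simp add: x_def)
    have "max 0 (min b d - max a c) = 0" using True le by auto
    moreover have "integrable M (\<lambda>w. (x w * (B b w - B a w)) * (B d w - B c w)) \<and>
      expectation (\<lambda>w. (x w * (B b w - B a w)) * (B d w - B c w)) = 0"
      using increment_orthogonal(1,2)[OF XF XI] le True by simp
    ultimately show ?thesis unfolding e by simp
  next
    case False
    define m where "m = min b d"
    define m' where "m' = max b d"
    have m: "c \<le> m" "m \<le> m'" "0 \<le> c" using False le by (auto simp: m_def m'_def)
    \<comment> \<open>The first interval is split at \<open>c\<close>, and the longer of the two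
      remaining pieces at the end \<open>m\<close> of the shorter one. The square over the overlap
      from \<open>c\<close> to \<open>m\<close> is the only term with nonzero mean.\<close>
    have e: "(\<xi> w * (B b w - B a w)) * (\<eta> w * (B d w - B c w)) = 
      (x w * (B c w - B a w)) * (B d w - B c w) + x w * (B m w - B c w)\<^sup>2 + (x w * (B m w - B c w)) * (B m' w - B m w)" for w
      by (simp add: x_def m_def m'_def min_def max_def power2_eq_square algebra_simps)
    have o1: "integrable M (\<lambda>w. (x w * (B c w - B a w)) * (B d w - B c w))"
      "expectation (\<lambda>w. (x w * (B c w - B a w)) * (B d w - B c w)) = 0"
      using increment_orthogonal(1,2)[OF XF XI] le m by auto
    note o2 = increment_orthogonal(3,4)[OF xm xi' m(3,1)]
    have o3: "integrable M (\<lambda>w. (x w * (B m w - B c w)) * (B m' w - B m w))"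
      "expectation (\<lambda>w. (x w * (B m w - B c w)) * (B m' w - B m w)) = 0"
      using increment_orthogonal(1,2)[OF XF XI] le m by auto
    have "max 0 (min b d - max a c) = m - c" using False le by (auto simp: m_def)
    then show ?thesis unfolding e using o1 o2 o3 le m by (simp add: x_def[symmetric] add.assoc)
  qed
qed

lemma increment_covariance:
  assumes xi: "\<xi> \<in> borel_measurable (brownian_filtration M B a)" "\<And>w. w \<in> space M \<Longrightarrow> \<bar>\<xi> w\<bar> \<le> K"
    and eta: "\<eta> \<in> borel_measurable (brownian_filtration M B c)" "\<And>w. w \<in> space M \<Longrightarrow> \<bar>\<eta> w\<bar> \<le> L"
    and le: "0 \<le> a" "a \<le> b" "0 \<le> c" "c \<le> d"
  shows "integrable M (\<lambda>w. (\<xi> w * (B b w - B a w)) * (\<eta> w * (B d w - B c w)))"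
    "expectation (\<lambda>w. (\<xi> w * (B b w - B a w)) * (\<eta> w * (B d w - B c w)))
      = expectation (\<lambda>w. \<xi> w * \<eta> w) * measure lborel ({a<..b} \<inter> {c<..d})"
proof -
  have "integrable M (\<lambda>w. (\<xi> w * (B b w - B a w)) * (\<eta> w * (B d w - B c w))) \<and>
    expectation (\<lambda>w. (\<xi> w * (B b w - B a w)) * (\<eta> w * (B d w - B c w)))
      = expectation (\<lambda>w. \<xi> w * \<eta> w) * max 0 (min b d - max a c)"
  proof (cases "a \<le> c")
    case True
    show ?thesis by (rule increment_covariance_ordered[OF xi eta]) (use le True in auto)
  next
    case False
    have "integrable M (\<lambda>w. (\<eta> w * (B d w - B c w)) * (\<xi> w * (B b w - B a w))) \<and>
      expectation (\<lambda>w. (\<eta> w * (B d w - B c w)) * (\<xi> w * (B b w - B a w)))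
        = expectation (\<lambda>w. \<eta> w * \<xi> w) * max 0 (min d b - max c a)"
      by (rule increment_covariance_ordered[OF eta xi]) (use le False in auto)
    then show ?thesis by (simp add: mult.commute min.commute max.commute)
  qed
  then show "integrable M (\<lambda>w. (\<xi> w * (B b w - B a w)) * (\<eta> w * (B d w - B c w)))"
    "expectation (\<lambda>w. (\<xi> w * (B b w - B a w)) * (\<eta> w * (B d w - B c w)))
      = expectation (\<lambda>w. \<xi> w * \<eta> w) * measure lborel ({a<..b} \<inter> {c<..d})"
    unfolding measure_Ioc_inter by blast+
qed

text \<open>The index set is an arbitrary finite set of intervals, neither ordered nor disjoint.
  This allows simple processes with unrelated partitions to be added without refining them: both
  squares expand into the same double sum over pairs of intervals.\<close>

lemma simple_isometry:
  assumes P: "finite P"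
    and ab: "\<And>p. p \<in> P \<Longrightarrow> 0 \<le> a p \<and> a p \<le> b p \<and> b p \<le> T"
    and xi: "\<And>p. p \<in> P \<Longrightarrow> \<xi> p \<in> borel_measurable (brownian_filtration M B (a p))"
    and bd: "\<And>p w. p \<in> P \<Longrightarrow> w \<in> space M \<Longrightarrow> \<bar>\<xi> p w\<bar> \<le> K p"
  shows "(\<integral>\<^sup>+w. ennreal ((\<Sum>p\<in>P. \<xi> p w * (B (b p) w - B (a p) w))\<^sup>2) \<partial>M)
    = (\<integral>\<^sup>+x. ennreal ((\<Sum>p\<in>P. \<xi> p (snd x) * indicator {a p<..b p} (fst x))\<^sup>2) \<partial>(time_measure T \<Otimes>\<^sub>M M))"
proof -
  interpret L: finite_measure "time_measure T" by (rule finite_measure_time)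
  interpret LM: pair_sigma_finite "time_measure T" M ..
  interpret LMf: finite_measure "time_measure T \<Otimes>\<^sub>M M"
    by (rule finite_measure_pair_measure[OF finite_measure_axioms L.finite_measure_axioms])
  let ?m = "\<lambda>p q. measure lborel ({a p<..b p} \<inter> {a q<..b q})"
  let ?S = "\<Sum>p\<in>P. \<Sum>q\<in>P. expectation (\<lambda>w. \<xi> p w * \<xi> q w) * ?m p q"
  let ?I = "\<lambda>p w. \<xi> p w * (B (b p) w - B (a p) w)"
  let ?H = "\<lambda>x. \<Sum>p\<in>P. \<xi> p (snd x) * indicator {a p<..b p} (fst x)"
  have xiM [measurable]: "\<xi> p \<in> borel_measurable M" if "p \<in> P" for p
    by (rule brownian_filtration_measurable[OF xi[OF that]])
  have cov: "integrable M (\<lambda>w. ?I p w * ?I q w)" "expectation (\<lambda>w. ?I p w * ?I q w) = expectation (\<lambda>w. \<xi> p w * \<xi> q w) * ?m p q"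
    if "p \<in> P" "q \<in> P" for p q
    using increment_covariance[OF xi[OF that(1)] bd[OF that(1)] xi[OF that(2)] bd[OF that(2)], of "b p" "b q"] ab[OF that(1)] ab[OF that(2)] by auto
  have sq: "(\<Sum>p\<in>P. f p)\<^sup>2 = (\<Sum>p\<in>P. \<Sum>q\<in>P. f p * f q)" for f :: "_ \<Rightarrow> real"
    by (simp add: power2_eq_square sum_product)
  have I1: "integrable M (\<lambda>w. (\<Sum>p\<in>P. ?I p w)\<^sup>2)" "expectation (\<lambda>w. (\<Sum>p\<in>P. ?I p w)\<^sup>2) = ?S"
    unfolding sq using cov by (auto simp: Bochner_Integration.integral_sum Bochner_Integration.integrable_sum)
  have "(\<integral>\<^sup>+w. ennreal ((\<Sum>p\<in>P. ?I p w)\<^sup>2) \<partial>M) = ennreal ?S"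
    using nn_integral_eq_integral[OF I1(1)] I1(2) by simp
  moreover have "(\<integral>\<^sup>+x. ennreal ((?H x)\<^sup>2) \<partial>(time_measure T \<Otimes>\<^sub>M M)) = ennreal ?S"
  proof -
    have ind: "(\<lambda>x. indicator {a p<..b p} (fst x) :: real) \<in> borel_measurable (time_measure T \<Otimes>\<^sub>M M)" for p
    proof -
      have "(\<lambda>t. indicator {a p<..b p} t :: real) \<in> borel_measurable (time_measure T)"
        by (intro measurable_restrict_space1) simp
      then show ?thesis by (rule measurable_compose[OF measurable_fst])
    qed
    have xi2: "(\<lambda>x. \<xi> p (snd x)) \<in> borel_measurable (time_measure T \<Otimes>\<^sub>M M)" if "p \<in> P" for p
      by (rule measurable_compose[OF measurable_snd xiM[OF that]])
    have Hm: "?H \<in> borel_measurable (time_measure T \<Otimes>\<^sub>M M)"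
      by (intro borel_measurable_sum borel_measurable_times xi2 ind)
    have Hint: "integrable (time_measure T \<Otimes>\<^sub>M M) (\<lambda>x. (?H x)\<^sup>2)"
    proof (rule LMf.integrable_const_bound[where B="(\<Sum>p\<in>P. \<bar>K p\<bar>)\<^sup>2"])
      show "AE x in time_measure T \<Otimes>\<^sub>M M. norm ((?H x)\<^sup>2) \<le> (\<Sum>p\<in>P. \<bar>K p\<bar>)\<^sup>2"
      proof (intro AE_I2)
        fix x assume "x \<in> space (time_measure T \<Otimes>\<^sub>M M)"
        then have x: "snd x \<in> space M" by (auto simp: space_pair_measure)
        have "\<bar>?H x\<bar> \<le> (\<Sum>p\<in>P. \<bar>K p\<bar>)"
          by (rule order_trans[OF sum_abs]) (use bd[OF _ x] in \<open>fastforce intro!: sum_mono simp: indicator_def\<close>)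
        then have "\<bar>?H x\<bar>\<^sup>2 \<le> (\<Sum>p\<in>P. \<bar>K p\<bar>)\<^sup>2" by (intro power_mono) auto
        then show "norm ((?H x)\<^sup>2) \<le> (\<Sum>p\<in>P. \<bar>K p\<bar>)\<^sup>2" by simp
      qed
    qed (use Hm in measurable)
    have inner: "(\<integral>t. (?H (t, w))\<^sup>2 \<partial>time_measure T) = (\<Sum>p\<in>P. \<Sum>q\<in>P. \<xi> p w * \<xi> q w * ?m p q)" for w
    proof -
      have "(\<integral>t. (?H (t, w))\<^sup>2 \<partial>time_measure T) = (\<integral>t. (\<Sum>p\<in>P. \<Sum>q\<in>P. \<xi> p w * \<xi> q w * indicator ({a p<..b p} \<inter> {a q<..b q}) t) \<partial>lborel)"
        unfolding integral_restrict_space[of "{0..T}" lborel, simplified] sq fst_conv snd_conv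
        unfolding scaleR_sum_right
      proof (intro Bochner_Integration.integral_cong refl sum.cong)
        fix t p q assume pq: "p \<in> P" "q \<in> P"
        show "indicat_real {0..T} t *\<^sub>R (\<xi> p w * indicat_real {a p<..b p} t * (\<xi> q w * indicat_real {a q<..b q} t))
          = \<xi> p w * \<xi> q w * indicat_real ({a p<..b p} \<inter> {a q<..b q}) t"
          using ab[OF pq(1)] by (auto simp: indicator_def)
      qed
      also have "\<dots> = (\<Sum>p\<in>P. \<Sum>q\<in>P. \<xi> p w * \<xi> q w * ?m p q)"
      proof -
        have fin: "emeasure lborel ({a p<..b p} \<inter> {a q<..b q}) < \<infinity>" for p q
        proof -
          have "emeasure lborel ({a p<..b p} \<inter> {a q<..b q}) \<le> emeasure lborel {a p..b p}"
            by (intro emeasure_mono) auto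
          also have "\<dots> < \<infinity>" by (simp add: emeasure_lborel_Icc_eq)
          finally show ?thesis .
        qed
        then have i: "integrable lborel (\<lambda>t. indicat_real ({a p<..b p} \<inter> {a q<..b q}) t)" for p q by auto
        show ?thesis using i by (subst Bochner_Integration.integral_sum) 
            (auto intro!: sum.cong Bochner_Integration.integrable_sum simp: Bochner_Integration.integral_sum)
      qed
      finally show ?thesis .
    qed
    have "(\<integral>x. (?H x)\<^sup>2 \<partial>(time_measure T \<Otimes>\<^sub>M M)) = expectation (\<lambda>w. \<integral>t. (?H (t, w))\<^sup>2 \<partial>time_measure T)"
    proof -
      have e: "(\<lambda>(t, w). (?H (t, w))\<^sup>2) = (\<lambda>x. (?H x)\<^sup>2)" by auto
      show ?thesis by (rule LM.integral_snd[of "\<lambda>t w. (?H (t, w))\<^sup>2", unfolded e, OF Hint, symmetric])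
    qed
    also have "\<dots> = expectation (\<lambda>w. \<Sum>p\<in>P. \<Sum>q\<in>P. \<xi> p w * \<xi> q w * ?m p q)" unfolding inner ..
    also have "\<dots> = ?S"
    proof -
      have i: "integrable M (\<lambda>w. \<xi> p w * \<xi> q w)" if "p \<in> P" "q \<in> P" for p q
      proof -
        have "integrable M (\<lambda>w. \<xi> q w * 1)" by (rule integrable_bounded_mult[OF xiM[OF that(2)] bd[OF that(2)]]) auto
        then show ?thesis using integrable_bounded_mult[OF xiM[OF that(1)] bd[OF that(1)], of "\<xi> q"] by simp
      qed
      show ?thesis using i by (subst Bochner_Integration.integral_sum) 
            (auto intro!: sum.cong Bochner_Integration.integrable_sum simp: Bochner_Integration.integral_sum)
    qed
    finally show ?thesis using nn_integral_eq_integral[OF Hint] by simp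
  qed
  ultimately show ?thesis by simp
qed

text \<open>Intervals that begin at or after \<open>t\<close> contribute nothing to the stopped
  integral and are dropped, the others are cut at \<open>t\<close>; only an inequality is left since
  the integrand after \<open>t\<close> is ignored on the left.\<close>

lemma simple_isometry_stopped:
  assumes P: "finite P"
    and ab: "\<And>p. p \<in> P \<Longrightarrow> 0 \<le> a p \<and> a p \<le> b p \<and> b p \<le> T"
    and xi: "\<And>p. p \<in> P \<Longrightarrow> \<xi> p \<in> borel_measurable (brownian_filtration M B (a p))"
    and bd: "\<And>p w. p \<in> P \<Longrightarrow> w \<in> space M \<Longrightarrow> \<bar>\<xi> p w\<bar> \<le> K p"
  shows "(\<integral>\<^sup>+w. ennreal ((\<Sum>p\<in>P. \<xi> p w * (B (min t (b p)) w - B (min t (a p)) w))\<^sup>2) \<partial>M)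
    \<le> (\<integral>\<^sup>+x. ennreal ((\<Sum>p\<in>P. \<xi> p (snd x) * indicator {a p<..b p} (fst x))\<^sup>2) \<partial>(time_measure T \<Otimes>\<^sub>M M))"
proof -
  define P' where "P' = {p\<in>P. a p < t}"
  have P': "finite P'" "P' \<subseteq> P" using P by (auto simp: P'_def)
  have 1: "(\<Sum>p\<in>P. \<xi> p w * (B (min t (b p)) w - B (min t (a p)) w)) = (\<Sum>p\<in>P'. \<xi> p w * (B (min t (b p)) w - B (a p) w))" for w
    using P ab by (intro sum.mono_neutral_cong_right) (fastforce simp: P'_def min_def)+
  have "(\<integral>\<^sup>+w. ennreal ((\<Sum>p\<in>P'. \<xi> p w * (B (min t (b p)) w - B (a p) w))\<^sup>2) \<partial>M)
    = (\<integral>\<^sup>+x. ennreal ((\<Sum>p\<in>P'. \<xi> p (snd x) * indicator {a p<..min t (b p)} (fst x))\<^sup>2) \<partial>(time_measure T \<Otimes>\<^sub>M M))"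
    by (rule simple_isometry[OF P'(1) _ _ bd]) (use P'(2) ab xi in \<open>auto simp: P'_def intro: min.coboundedI2\<close>)
  also have "\<dots> \<le> (\<integral>\<^sup>+x. ennreal ((\<Sum>p\<in>P. \<xi> p (snd x) * indicator {a p<..b p} (fst x))\<^sup>2) \<partial>(time_measure T \<Otimes>\<^sub>M M))"
  proof (intro nn_integral_mono ennreal_leI)
    fix x :: "real \<times> 'a"
    have "(\<Sum>p\<in>P'. \<xi> p (snd x) * indicator {a p<..min t (b p)} (fst x))
      = (if fst x \<le> t then (\<Sum>p\<in>P. \<xi> p (snd x) * indicator {a p<..b p} (fst x)) else 0)"
    proof (cases "fst x \<le> t")
      case True
      then show ?thesis
        by (simp, intro sum.mono_neutral_cong_left) (use P in \<open>auto simp: P'_def indicator_def\<close>)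
    qed (auto simp: indicator_def)
    then show "(\<Sum>p\<in>P'. \<xi> p (snd x) * indicator {a p<..min t (b p)} (fst x))\<^sup>2
      \<le> (\<Sum>p\<in>P. \<xi> p (snd x) * indicator {a p<..b p} (fst x))\<^sup>2" by simp
  qed
  finally show ?thesis unfolding 1 .
qed

section \<open>Passage from simple integrands to the limit\<close>

lemma nn_integral_time_measure:
  assumes "f \<in> borel_measurable (time_measure T \<Otimes>\<^sub>M M)"
  shows "(\<integral>\<^sup>+w. (\<integral>\<^sup>+t\<in>{0..T}. f (t, w) \<partial>lborel) \<partial>M) = (\<integral>\<^sup>+x. f x \<partial>(time_measure T \<Otimes>\<^sub>M M))"
proof -
  interpret L: finite_measure "time_measure T" by (rule finite_measure_time)
  interpret LM: pair_sigma_finite "time_measure T" M ..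
  have "(\<integral>\<^sup>+t\<in>{0..T}. f (t, w) \<partial>lborel) = (\<integral>\<^sup>+t. f (t, w) \<partial>time_measure T)" for w
    by (subst nn_integral_restrict_space) auto
  then show ?thesis using LM.nn_integral_snd[of f] assms by simp
qed

lemma ennreal_sum_square_le: "ennreal ((x + y)\<^sup>2) \<le> 2 * ennreal (x\<^sup>2) + 2 * ennreal (y\<^sup>2)"
proof -
  have "(x + y)\<^sup>2 \<le> 2 * x\<^sup>2 + 2 * y\<^sup>2" using sum_squares_bound[of x y] by (simp add: power2_sum)
  then have "ennreal ((x + y)\<^sup>2) \<le> ennreal (2 * x\<^sup>2 + 2 * y\<^sup>2)" by (rule ennreal_leI)
  then show ?thesis by (simp add: ennreal_plus ennreal_mult)
qed

lemma nn_integral_square_triangle: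
  assumes "f \<in> borel_measurable Q" "g \<in> borel_measurable Q"
  shows "(\<integral>\<^sup>+x. ennreal ((f x + g x)\<^sup>2) \<partial>Q) \<le> 2 * (\<integral>\<^sup>+x. ennreal ((f x)\<^sup>2) \<partial>Q) + 2 * (\<integral>\<^sup>+x. ennreal ((g x)\<^sup>2) \<partial>Q)"
proof -
  have "(\<integral>\<^sup>+x. ennreal ((f x + g x)\<^sup>2) \<partial>Q) \<le> (\<integral>\<^sup>+x. 2 * ennreal ((f x)\<^sup>2) + 2 * ennreal ((g x)\<^sup>2) \<partial>Q)"
    by (intro nn_integral_mono ennreal_sum_square_le)
  also have "\<dots> = 2 * (\<integral>\<^sup>+x. ennreal ((f x)\<^sup>2) \<partial>Q) + 2 * (\<integral>\<^sup>+x. ennreal ((g x)\<^sup>2) \<partial>Q)"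
    using assms by (simp add: nn_integral_add nn_integral_cmult)
  finally show ?thesis .
qed

text \<open>The Cauchy-Schwarz constant may grow with the number of terms. This is harmless, because
  the lemma is applied only to approximation errors that tend to 0.\<close>

lemma nn_integral_combination_le:
  fixes g :: "'i \<Rightarrow> 'b \<Rightarrow> real" and e :: "'i \<Rightarrow> real"
  assumes "\<And>i. i \<in> I \<Longrightarrow> g i \<in> borel_measurable Q"
  shows "(\<integral>\<^sup>+x. ennreal ((\<Sum>i\<in>I. e i * g i x)\<^sup>2) \<partial>Q)
    \<le> ennreal (\<Sum>i\<in>I. (e i)\<^sup>2) * (\<Sum>i\<in>I. \<integral>\<^sup>+x. ennreal ((g i x)\<^sup>2) \<partial>Q)"
proof -
  have "(\<integral>\<^sup>+x. ennreal ((\<Sum>i\<in>I. e i * g i x)\<^sup>2) \<partial>Q)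
    \<le> (\<integral>\<^sup>+x. ennreal (\<Sum>i\<in>I. (e i)\<^sup>2) * (\<Sum>i\<in>I. ennreal ((g i x)\<^sup>2)) \<partial>Q)"
  proof (intro nn_integral_mono)
    fix x
    have "(\<Sum>i\<in>I. e i * g i x)\<^sup>2 \<le> (\<Sum>i\<in>I. (e i)\<^sup>2) * (\<Sum>i\<in>I. (g i x)\<^sup>2)"
      by (rule Cauchy_Schwarz_ineq_sum)
    then have "ennreal ((\<Sum>i\<in>I. e i * g i x)\<^sup>2) \<le> ennreal ((\<Sum>i\<in>I. (e i)\<^sup>2) * (\<Sum>i\<in>I. (g i x)\<^sup>2))"
      by (rule ennreal_leI)
    then show "ennreal ((\<Sum>i\<in>I. e i * g i x)\<^sup>2) \<le> ennreal (\<Sum>i\<in>I. (e i)\<^sup>2) * (\<Sum>i\<in>I. ennreal ((g i x)\<^sup>2))"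
      by (simp add: ennreal_mult sum_nonneg)
  qed
  also have "\<dots> = ennreal (\<Sum>i\<in>I. (e i)\<^sup>2) * (\<Sum>i\<in>I. \<integral>\<^sup>+x. ennreal ((g i x)\<^sup>2) \<partial>Q)"
    using assms by (subst nn_integral_cmult) (auto simp: nn_integral_sum simp del: sum_ennreal)
  finally show ?thesis .
qed

lemma simple_integrand_times:
  assumes "simple_integrand F T n \<tau> \<xi>" "j < n"
  shows "0 \<le> \<tau> j" "\<tau> j \<le> \<tau> (Suc j)" "\<tau> (Suc j) \<le> T"
proof -
  have step: "\<And>i. i < n \<Longrightarrow> \<tau> i \<le> \<tau> (Suc i)" "0 \<le> \<tau> 0" "\<tau> n \<le> T" using assms(1) by (auto simp: simple_integrand_def)
  have up: "i \<le> n \<Longrightarrow> \<tau> 0 \<le> \<tau> i" for i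
  proof (induction i)
    case (Suc i) then show ?case using step(1)[of i] by simp
  qed simp
  have down: "i \<le> n \<Longrightarrow> \<tau> (n - i) \<le> \<tau> n" for i
  proof (induction i)
    case (Suc i)
    then have "\<tau> (n - Suc i) \<le> \<tau> (Suc (n - Suc i))" by (intro step) auto
    moreover have "Suc (n - Suc i) = n - i" using Suc.prems by simp
    ultimately show ?case using Suc by simp
  qed simp
  show "0 \<le> \<tau> j" "\<tau> j \<le> \<tau> (Suc j)" using up[of j] step assms(2) by auto
  show "\<tau> (Suc j) \<le> T" using down[of "n - Suc j"] step assms(2) by simp
qed

lemma simple_integrand_combination_bound:
  assumes I: "finite I"
    and s: "\<And>i. i \<in> I \<Longrightarrow> simple_integrand (brownian_filtration M B) T (n i) (\<tau> i) (\<xi> i)"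
  shows "(\<integral>\<^sup>+w. ennreal ((\<Sum>i\<in>I. e i * simple_ito_integral B (n i) (\<tau> i) (\<xi> i) t w)\<^sup>2) \<partial>M)
    \<le> (\<integral>\<^sup>+x. ennreal ((\<Sum>i\<in>I. e i * simple_process (n i) (\<tau> i) (\<xi> i) (fst x) (snd x))\<^sup>2) \<partial>(time_measure T \<Otimes>\<^sub>M M))"
proof -
  define P where "P = (SIGMA i:I. {..<n i})"
  have P: "finite P" using I by (auto simp: P_def)
  let ?x = "\<lambda>p w. e (fst p) * \<xi> (fst p) (snd p) w"
  let ?a = "\<lambda>p. \<tau> (fst p) (snd p)" and ?b = "\<lambda>p. \<tau> (fst p) (Suc (snd p))"
  have in_P: "fst p \<in> I" "snd p < n (fst p)" if "p \<in> P" for p using that by (auto simp: P_def)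
  have "\<exists>c. \<forall>w\<in>space M. \<bar>?x p w\<bar> \<le> c" if p: "p \<in> P" for p
  proof -
    obtain c where "\<forall>w\<in>space M. \<bar>\<xi> (fst p) (snd p) w\<bar> \<le> c"
      using s[OF in_P(1)[OF p]] in_P(2)[OF p] unfolding simple_integrand_def by auto
    then have "\<forall>w\<in>space M. \<bar>?x p w\<bar> \<le> \<bar>e (fst p)\<bar> * c" by (auto simp: abs_mult intro: mult_left_mono)
    then show ?thesis by blast
  qed
  then obtain K where K: "\<And>p w. p \<in> P \<Longrightarrow> w \<in> space M \<Longrightarrow> \<bar>?x p w\<bar> \<le> K p" by metis
  have 1: "(\<Sum>i\<in>I. e i * simple_ito_integral B (n i) (\<tau> i) (\<xi> i) t w)
    = (\<Sum>p\<in>P. ?x p w * (B (min t (?b p)) w - B (min t (?a p)) w))" for w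
    unfolding simple_ito_integral_def sum_distrib_left P_def using I by (subst sum.Sigma) (auto simp: mult.assoc split_def)
  have 2: "(\<Sum>i\<in>I. e i * simple_process (n i) (\<tau> i) (\<xi> i) (fst x) (snd x))
    = (\<Sum>p\<in>P. ?x p (snd x) * indicator {?a p<..?b p} (fst x))" for x
    unfolding simple_process_def sum_distrib_left P_def using I by (subst sum.Sigma) (auto simp: mult.assoc split_def)
  show ?thesis unfolding 1 2
  proof (rule simple_isometry_stopped[OF P _ _ K])
    fix p assume p: "p \<in> P"
    show "0 \<le> ?a p \<and> ?a p \<le> ?b p \<and> ?b p \<le> T" using simple_integrand_times[OF s[OF in_P(1)[OF p]] in_P(2)[OF p]] by auto
    show "?x p \<in> borel_measurable (brownian_filtration M B (?a p))"
      using s[OF in_P(1)[OF p]] in_P(2)[OF p] unfolding simple_integrand_def by auto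
  qed
qed

text \<open>The whole combination is estimated at once, not term by term, so that the constant does
  not depend on how many integrals are combined; otherwise projecting onto a sine mode would cost a
  power of \<open>N\<close>. The factor 4 in place of the exact 1 comes from two uses of
  \<open>ennreal_sum_square_le\<close>, once to replace \<open>J\<close> by its approximation and
  once to return from the approximation to \<open>Y\<close>.\<close>

lemma ito_combination_bound:
  assumes I: "finite I"
    and ito: "\<And>i. i \<in> I \<Longrightarrow> is_ito_integral M (brownian_filtration M B) B T (Y i) (J i)"
    and Ym: "\<And>i. i \<in> I \<Longrightarrow> (\<lambda>(t, w). Y i t w) \<in> borel_measurable (time_measure T \<Otimes>\<^sub>M M)"
    and t: "t \<in> {0..T}"
  shows "(\<integral>\<^sup>+w. ennreal ((\<Sum>i\<in>I. e i * J i t w)\<^sup>2) \<partial>M)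
    \<le> 4 * (\<integral>\<^sup>+x. ennreal ((\<Sum>i\<in>I. e i * Y i (fst x) (snd x))\<^sup>2) \<partial>(time_measure T \<Otimes>\<^sub>M M))"
proof -
  let ?L = "time_measure T \<Otimes>\<^sub>M M" and ?F = "brownian_filtration M B"
  define R where "R i n \<tau> \<xi> \<longleftrightarrow> (\<forall>k::nat. simple_integrand ?F T (n k) (\<tau> k) (\<xi> k)) \<and>
        (\<lambda>k. \<integral>\<^sup>+w. (\<integral>\<^sup>+t\<in>{0..T}. ennreal ((simple_process (n k) (\<tau> k) (\<xi> k) t w - Y i t w)\<^sup>2) \<partial>lborel) \<partial>M)
          \<longlonglongrightarrow> 0 \<and>
        (\<forall>t\<in>{0..T}.
          (\<lambda>k. \<integral>\<^sup>+w. ennreal ((simple_ito_integral B (n k) (\<tau> k) (\<xi> k) t w - J i t w)\<^sup>2) \<partial>M) \<longlonglongrightarrow> 0)"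
    for i n \<tau> \<xi>
  have "\<forall>i\<in>I. \<exists>n \<tau> \<xi>. R i n \<tau> \<xi>"
    using ito unfolding is_ito_integral_def R_def by (meson conjunct2)
  then obtain n \<tau> \<xi> where R: "\<And>i. i \<in> I \<Longrightarrow> R i (n i) (\<tau> i) (\<xi> i)" by metis
  have s: "\<And>i k. i \<in> I \<Longrightarrow> simple_integrand ?F T (n i k) (\<tau> i k) (\<xi> i k)"
    by (rule spec[OF conjunct1[OF R[unfolded R_def]]])
  have l1: "\<And>i. i \<in> I \<Longrightarrow> (\<lambda>k. \<integral>\<^sup>+w. (\<integral>\<^sup>+t\<in>{0..T}. ennreal ((simple_process (n i k) (\<tau> i k) (\<xi> i k) t w - Y i t w)\<^sup>2) \<partial>lborel) \<partial>M)
          \<longlonglongrightarrow> 0"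
    by (rule conjunct1[OF conjunct2[OF R[unfolded R_def]]])
  have l2: "\<And>i. i \<in> I \<Longrightarrow> (\<lambda>k. \<integral>\<^sup>+w. ennreal ((simple_ito_integral B (n i k) (\<tau> i k) (\<xi> i k) t w - J i t w)\<^sup>2) \<partial>M) \<longlonglongrightarrow> 0"
    by (rule bspec[OF conjunct2[OF conjunct2[OF R[unfolded R_def]]] t])
  have Jm: "J i t \<in> borel_measurable M" if "i \<in> I" for i using ito[OF that] t unfolding is_ito_integral_def by blast
  let ?s = "\<lambda>i k x. simple_process (n i k) (\<tau> i k) (\<xi> i k) (fst x) (snd x)"
  let ?j = "\<lambda>i k w. simple_ito_integral B (n i k) (\<tau> i k) (\<xi> i k) t w"
  have xiM: "\<xi> i k j \<in> borel_measurable M" if "i \<in> I" "j < n i k" for i k j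
    using s[OF that(1), of k] that(2) brownian_filtration_measurable unfolding simple_integrand_def by blast
  have sm: "?s i k \<in> borel_measurable ?L" if "i \<in> I" for i k
    unfolding simple_process_def
  proof (intro borel_measurable_sum borel_measurable_times)
    fix j assume "j \<in> {..<n i k}"
    then show "(\<lambda>x. \<xi> i k j (snd x)) \<in> borel_measurable ?L"
      using measurable_compose[OF measurable_snd xiM[OF that]] by auto
    have "(\<lambda>t. indicator {\<tau> i k j<..\<tau> i k (Suc j)} t :: real) \<in> borel_measurable (time_measure T)"
      by (intro measurable_restrict_space1) simp
    then show "(\<lambda>x. indicator {\<tau> i k j<..\<tau> i k (Suc j)} (fst x) :: real) \<in> borel_measurable ?L"
      by (rule measurable_compose[OF measurable_fst])
  qed
  have jm: "?j i k \<in> borel_measurable M" if "i \<in> I" for i k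
    unfolding simple_ito_integral_def
  proof (intro borel_measurable_sum borel_measurable_times borel_measurable_diff B_measurable)
    fix j assume j: "j \<in> {..<n i k}"
    then show "\<xi> i k j \<in> borel_measurable M" using xiM[OF that] by auto
    show "0 \<le> min t (\<tau> i k (Suc j))" "0 \<le> min t (\<tau> i k j)"
      using simple_integrand_times[OF s[OF that, of k], of j] j t by auto
  qed
  have Ym': "(\<lambda>x. Y i (fst x) (snd x)) \<in> borel_measurable ?L" if "i \<in> I" for i
    using Ym[OF that] by (simp add: case_prod_beta')
  define \<alpha> where "\<alpha> i k = (\<integral>\<^sup>+x. ennreal ((?s i k x - Y i (fst x) (snd x))\<^sup>2) \<partial>?L)" for i k
  define \<beta> where "\<beta> i k = (\<integral>\<^sup>+w. ennreal ((?j i k w - J i t w)\<^sup>2) \<partial>M)" for i k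
  have la: "\<alpha> i \<longlonglongrightarrow> 0" if "i \<in> I" for i
  proof -
    have "\<alpha> i k = (\<integral>\<^sup>+w. (\<integral>\<^sup>+t\<in>{0..T}. ennreal ((simple_process (n i k) (\<tau> i k) (\<xi> i k) t w - Y i t w)\<^sup>2) \<partial>lborel) \<partial>M)" for k
      unfolding \<alpha>_def
      using nn_integral_time_measure[of "\<lambda>x. ennreal ((?s i k x - Y i (fst x) (snd x))\<^sup>2)" T] sm[OF that, of k] Ym'[OF that] by simp
    then show ?thesis using l1[OF that] by presburger
  qed
  have lb: "\<beta> i \<longlonglongrightarrow> 0" if "i \<in> I" for i unfolding \<beta>_def using l2[OF that] .
  define c where "c = ennreal (\<Sum>i\<in>I. (e i)\<^sup>2)"
  let ?A = "\<integral>\<^sup>+x. ennreal ((\<Sum>i\<in>I. e i * Y i (fst x) (snd x))\<^sup>2) \<partial>?L"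
  have bound: "(\<integral>\<^sup>+w. ennreal ((\<Sum>i\<in>I. e i * J i t w)\<^sup>2) \<partial>M)
    \<le> 4 * ?A + (4 * (c * (\<Sum>i\<in>I. \<alpha> i k)) + 2 * (c * (\<Sum>i\<in>I. \<beta> i k)))" for k
  proof -
    have "(\<integral>\<^sup>+w. ennreal ((\<Sum>i\<in>I. e i * J i t w)\<^sup>2) \<partial>M)
      = (\<integral>\<^sup>+w. ennreal (((\<Sum>i\<in>I. e i * ?j i k w) + (\<Sum>i\<in>I. e i * (J i t w - ?j i k w)))\<^sup>2) \<partial>M)"
      by (intro nn_integral_cong) (simp add: sum.distrib[symmetric] algebra_simps)
    also have "\<dots> \<le> 2 * (\<integral>\<^sup>+w. ennreal ((\<Sum>i\<in>I. e i * ?j i k w)\<^sup>2) \<partial>M)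
       + 2 * (\<integral>\<^sup>+w. ennreal ((\<Sum>i\<in>I. e i * (J i t w - ?j i k w))\<^sup>2) \<partial>M)"
      using jm Jm by (intro nn_integral_square_triangle borel_measurable_sum borel_measurable_times borel_measurable_diff) auto
    also have "\<dots> \<le> 2 * (\<integral>\<^sup>+x. ennreal ((\<Sum>i\<in>I. e i * ?s i k x)\<^sup>2) \<partial>?L) + 2 * (c * (\<Sum>i\<in>I. \<beta> i k))"
    proof (intro add_mono mult_left_mono)
      show "(\<integral>\<^sup>+w. ennreal ((\<Sum>i\<in>I. e i * ?j i k w)\<^sup>2) \<partial>M) \<le> (\<integral>\<^sup>+x. ennreal ((\<Sum>i\<in>I. e i * ?s i k x)\<^sup>2) \<partial>?L)"
        by (rule simple_integrand_combination_bound[OF I s])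
      have "(\<integral>\<^sup>+w. ennreal ((\<Sum>i\<in>I. e i * (J i t w - ?j i k w))\<^sup>2) \<partial>M)
        \<le> c * (\<Sum>i\<in>I. \<integral>\<^sup>+w. ennreal ((J i t w - ?j i k w)\<^sup>2) \<partial>M)"
        unfolding c_def using jm Jm by (intro nn_integral_combination_le borel_measurable_diff) auto
      then show "(\<integral>\<^sup>+w. ennreal ((\<Sum>i\<in>I. e i * (J i t w - ?j i k w))\<^sup>2) \<partial>M) \<le> c * (\<Sum>i\<in>I. \<beta> i k)"
        unfolding \<beta>_def by (simp add: power2_commute)
    qed auto
    also have "(\<integral>\<^sup>+x. ennreal ((\<Sum>i\<in>I. e i * ?s i k x)\<^sup>2) \<partial>?L)
       = (\<integral>\<^sup>+x. ennreal (((\<Sum>i\<in>I. e i * Y i (fst x) (snd x)) + (\<Sum>i\<in>I. e i * (?s i k x - Y i (fst x) (snd x))))\<^sup>2) \<partial>?L)"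
      by (intro nn_integral_cong) (simp add: sum.distrib[symmetric] algebra_simps)
    also have "\<dots> \<le> 2 * ?A + 2 * (\<integral>\<^sup>+x. ennreal ((\<Sum>i\<in>I. e i * (?s i k x - Y i (fst x) (snd x)))\<^sup>2) \<partial>?L)"
      using sm Ym' by (intro nn_integral_square_triangle borel_measurable_sum borel_measurable_times borel_measurable_diff) auto
    also have "\<dots> \<le> 2 * ?A + 2 * (c * (\<Sum>i\<in>I. \<alpha> i k))"
      unfolding c_def \<alpha>_def using sm Ym'
      by (intro add_mono mult_left_mono nn_integral_combination_le borel_measurable_diff) auto
    finally have "(\<integral>\<^sup>+w. ennreal ((\<Sum>i\<in>I. e i * J i t w)\<^sup>2) \<partial>M)
      \<le> 2 * (2 * ?A + 2 * (c * (\<Sum>i\<in>I. \<alpha> i k))) + 2 * (c * (\<Sum>i\<in>I. \<beta> i k))"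
      by (simp add: mult_left_mono add_mono)
    also have "\<dots> = 4 * ?A + (4 * (c * (\<Sum>i\<in>I. \<alpha> i k)) + 2 * (c * (\<Sum>i\<in>I. \<beta> i k)))"
      by (simp add: distrib_left add.assoc mult.assoc[symmetric])
    finally show ?thesis .
  qed
  have "(\<lambda>k. 4 * ?A + (4 * (c * (\<Sum>i\<in>I. \<alpha> i k)) + 2 * (c * (\<Sum>i\<in>I. \<beta> i k)))) 
      \<longlonglongrightarrow> 4 * ?A + (4 * (c * (\<Sum>i\<in>I. 0)) + 2 * (c * (\<Sum>i\<in>I. 0)))"
    by (intro tendsto_add tendsto_const ennreal_tendsto_cmult tendsto_sum la lb) (auto simp: c_def)
  then have "(\<lambda>k. 4 * ?A + (4 * (c * (\<Sum>i\<in>I. \<alpha> i k)) + 2 * (c * (\<Sum>i\<in>I. \<beta> i k)))) \<longlonglongrightarrow> 4 * ?A" by simp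
  then show ?thesis by (rule LIMSEQ_le_const) (use bound in auto)
qed

end

section \<open>The discrete sine basis\<close>

text \<open>The Dirichlet kernel in multiplied form: each product of
  \<open>2 * sin (\<theta> / 2)\<close> with a cosine is a difference of sines at half-integer
  nodes, and the sum telescopes.\<close>

lemma cos_sum_closed:
  "2 * sin (\<theta> / 2) * (\<Sum>i=0..N. cos (real i * \<theta>)) = sin ((real N + 1 / 2) * \<theta>) + sin (\<theta> / 2)"
proof (induction N)
  case (Suc N)
  have "sin ((real N + 3 / 2) * \<theta>) - sin ((real N + 1 / 2) * \<theta>) = 2 * sin (\<theta> / 2) * cos ((real N + 1) * \<theta>)"
  proof -
    have e: "(real N + 3 / 2) * \<theta> = (real N + 1) * \<theta> + \<theta> / 2" "(real N + 1 / 2) * \<theta> = (real N + 1) * \<theta> - \<theta> / 2"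
      by (simp_all add: algebra_simps)
    show ?thesis unfolding e sin_add sin_diff by simp
  qed
  then show ?case using Suc by (simp add: algebra_simps)
qed simp

text \<open>The bound on \<open>m\<close> keeps \<open>\<theta> / 2\<close> strictly between -pi and
  pi, so the sine in the closed formula can be cancelled. The result depends only on the parity of
  \<open>m\<close>.\<close>

lemma cos_sum_lattice:
  fixes m :: int
  assumes "m \<noteq> 0" "\<bar>m\<bar> < 2 * (int N + 1)"
  shows "(\<Sum>i=0..N. cos (real i * (pi * of_int m / (real N + 1)))) = (1 - cos (pi * of_int m)) / 2"
proof -
  define \<theta> where "\<theta> = pi * of_int m / (real N + 1)"
  have "sin (\<theta> / 2) \<noteq> 0"
  proof -
    have "real_of_int \<bar>m\<bar> < real_of_int (2 * (int N + 1))" using assms(2) by (simp only: of_int_less_iff)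
    then have "\<bar>real_of_int m\<bar> < 2 * (real N + 1)" by simp
    then have "pi * \<bar>real_of_int m\<bar> < pi * (2 * (real N + 1))" by simp
    then have lt: "\<bar>\<theta> / 2\<bar> < pi" by (simp add: \<theta>_def abs_mult field_simps)
    have "\<theta> \<noteq> 0" using assms(1) by (simp add: \<theta>_def)
    then show ?thesis using lt sin_gt_zero[of "\<theta> / 2"] sin_gt_zero[of "- (\<theta> / 2)"] by (cases "\<theta> > 0") auto
  qed
  moreover have "sin ((real N + 1 / 2) * \<theta>) = - cos (pi * of_int m) * sin (\<theta> / 2)"
  proof -
    have "(real N + 1 / 2) * \<theta> = pi * of_int m - \<theta> / 2"
      by (simp add: \<theta>_def field_simps)
    then show ?thesis by (simp add: sin_diff)
  qed
  moreover have "2 * S = 1 - c" if "s \<noteq> 0" "2 * s * S = - c * s + s" for s S c :: real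
  proof -
    have "s * (2 * S) = s * (1 - c)" using that(2) by (simp add: algebra_simps)
    then show ?thesis using mult_left_cancel[OF that(1)] by blast
  qed
  ultimately have "2 * (\<Sum>i=0..N. cos (real i * \<theta>)) = 1 - cos (pi * of_int m)"
    using cos_sum_closed[of \<theta> N] by metis
  then show ?thesis unfolding \<theta>_def[symmetric] by simp
qed

text \<open>Normalised for the plain sum over the nodes, without the factor \<open>h\<close>; the
  matrix is then symmetric and orthogonal, hence its own inverse.\<close>

definition sine_mode :: "nat \<Rightarrow> nat \<Rightarrow> nat \<Rightarrow> real" where
  "sine_mode N k i = sqrt (2 / (real N + 1)) * sin (pi * real k * real i / (real N + 1))"

definition sine_eigenvalue :: "nat \<Rightarrow> nat \<Rightarrow> real" where
  "sine_eigenvalue N k = 2 * (1 - cos (pi * real k / (real N + 1))) * (real N + 1)\<^sup>2"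

lemma sine_mode_commute: "sine_mode N k i = sine_mode N i k"
  by (simp add: sine_mode_def mult_ac)

lemma sine_mode_boundary: "sine_mode N k 0 = 0" "sine_mode N k (Suc N) = 0"
proof -
  have "pi * real k * real (Suc N) / (real N + 1) = real k * pi" by (simp add: field_simps)
  then show "sine_mode N k (Suc N) = 0" by (simp add: sine_mode_def)
qed (simp add: sine_mode_def)

lemma sine_eigenvalue_nonneg: "0 \<le> sine_eigenvalue N k"
  by (simp add: sine_eigenvalue_def)

lemma laplacian_sine_mode:
  assumes "1 \<le> i"
  shows "laplacian (1 / (real N + 1)) (sine_mode N k) i = - sine_eigenvalue N k * sine_mode N k i"
proof -
  obtain j where j: "i = Suc j" using assms by (cases i) auto
  define x where "x = pi * real k * real i / (real N + 1)"
  define y where "y = pi * real k / (real N + 1)"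
  have 1: "pi * real k * real (Suc i) / (real N + 1) = x + y" "pi * real k * real (i - 1) / (real N + 1) = x - y"
    by (simp_all add: x_def y_def j algebra_simps add_divide_distrib diff_divide_distrib)
  have "sin (x + y) - 2 * sin x + sin (x - y) = - 2 * (1 - cos y) * sin x"
    by (simp add: sin_add sin_diff algebra_simps)
  then have "sine_mode N k (Suc i) - 2 * sine_mode N k i + sine_mode N k (i - 1)
     = sqrt (2 / (real N + 1)) * (- 2 * (1 - cos y) * sin x)"
    unfolding sine_mode_def 1 x_def[symmetric] by (simp only: mult.left_commute[of 2] flip: right_diff_distrib distrib_left)
  moreover have "laplacian (1 / (real N + 1)) (sine_mode N k) i
    = (sine_mode N k (Suc i) - 2 * sine_mode N k i + sine_mode N k (i - 1)) * (real N + 1)\<^sup>2"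
    by (simp add: laplacian_def power_divide)
  moreover have "sine_mode N k i = sqrt (2 / (real N + 1)) * sin x" by (simp only: sine_mode_def x_def)
  ultimately show ?thesis unfolding sine_eigenvalue_def y_def[symmetric]
    by (simp only:) (simp add: algebra_simps)
qed

text \<open>A product of sines becomes a difference of cosine sums at \<open>k - l\<close> and
  \<open>k + l\<close>. These integers have the same parity, so for distinct modes the two lattice
  sums coincide.\<close>

lemma sine_mode_orthonormal:
  assumes "k \<in> {1..N}" "l \<in> {1..N}"
  shows "(\<Sum>i=1..N. sine_mode N k i * sine_mode N l i) = (if k = l then 1 else 0)"
proof -
  define \<theta> where "\<theta> m = pi * of_int m / (real N + 1)" for m :: int
  define A where "A m = (\<Sum>i=0..N. cos (real i * \<theta> m))" for m
  have "sine_mode N k i * sine_mode N l i = 1 / (real N + 1) * (cos (real i * \<theta> (int k - int l)) - cos (real i * \<theta> (int k + int l)))" for i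
  proof -
    define a where "a = pi * real k * real i / (real N + 1)"
    define b where "b = pi * real l * real i / (real N + 1)"
    have "real i * \<theta> (int k - int l) = a - b" "real i * \<theta> (int k + int l) = a + b"
      by (simp_all add: \<theta>_def a_def b_def algebra_simps add_divide_distrib diff_divide_distrib)
    moreover have "cos (a - b) - cos (a + b) = 2 * (sin a * sin b)" by (simp add: cos_add cos_diff)
    moreover have "sqrt (2 / (real N + 1)) * sqrt (2 / (real N + 1)) = 2 / (real N + 1)" by simp
    moreover have "sine_mode N k i * sine_mode N l i = sqrt (2 / (real N + 1)) * sqrt (2 / (real N + 1)) * (sin a * sin b)"
      by (simp only: sine_mode_def a_def b_def mult_ac)
    ultimately show ?thesis by simp
  qed
  moreover have "(\<Sum>i=1..N. sine_mode N k i * sine_mode N l i) = (\<Sum>i=0..N. sine_mode N k i * sine_mode N l i)"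
    by (rule sum.mono_neutral_left) (auto simp: sine_mode_boundary not_less_eq_eq)
  ultimately have S: "(\<Sum>i=1..N. sine_mode N k i * sine_mode N l i) = 1 / (real N + 1) * (A (int k - int l) - A (int k + int l))"
    by (simp add: A_def sum_distrib_left sum_subtractf right_diff_distrib)
  have A2: "A (int k + int l) = (1 - cos (pi * of_int (int k + int l))) / 2"
    unfolding A_def \<theta>_def by (rule cos_sum_lattice) (use assms in auto)
  show ?thesis
  proof (cases "k = l")
    case True
    have "A (int k - int l) = real N + 1" by (simp add: A_def True \<theta>_def)
    moreover have "cos (pi * of_int (int k + int l)) = 1"
      using cos_int_2pin[of "int k"] by (simp add: True mult.commute mult.left_commute)
    ultimately show ?thesis using S A2 True by simp
  next
    case False
    have A1: "A (int k - int l) = (1 - cos (pi * of_int (int k - int l))) / 2"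
      unfolding A_def \<theta>_def by (rule cos_sum_lattice) (use assms False in auto)
    have "cos (pi * of_int (int k - int l)) = cos (pi * of_int (int k + int l))"
      by (simp add: distrib_left right_diff_distrib cos_add cos_diff)
    then show ?thesis using S A1 A2 False by simp
  qed
qed

text \<open>Completeness comes for free from the symmetry in mode and node: orthonormality of the
  rows is orthonormality of the columns.\<close>

lemma sine_mode_inversion:
  assumes "i \<in> {1..N}"
  shows "(\<Sum>k=1..N. sine_mode N k i * (\<Sum>j=1..N. sine_mode N k j * x j)) = x i"
proof -
  have "(\<Sum>k=1..N. sine_mode N k i * (\<Sum>j=1..N. sine_mode N k j * x j))
    = (\<Sum>k=1..N. \<Sum>j=1..N. sine_mode N k i * sine_mode N k j * x j)"
    by (simp add: sum_distrib_left mult.assoc)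
  also have "\<dots> = (\<Sum>j=1..N. \<Sum>k=1..N. sine_mode N k i * sine_mode N k j * x j)" by (rule sum.swap)
  also have "\<dots> = (\<Sum>j=1..N. (\<Sum>k=1..N. sine_mode N i k * sine_mode N j k) * x j)"
    unfolding sum_distrib_right
    by (intro sum.cong refl) (metis sine_mode_commute)
  also have "\<dots> = (\<Sum>j=1..N. (if i = j then 1 else 0) * x j)"
    by (intro sum.cong refl arg_cong2[where f="(*)"] sine_mode_orthonormal assms)
  also have "\<dots> = x i" using assms by (simp add: if_distrib[of "\<lambda>a. a * _"] cong: if_cong)
  finally show ?thesis .
qed

lemma sine_mode_parseval:
  "(\<Sum>k=1..N. (\<Sum>i=1..N. sine_mode N k i * x i)\<^sup>2) = (\<Sum>i=1..N. (x i)\<^sup>2)"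
proof -
  have "(\<Sum>k=1..N. (\<Sum>i=1..N. sine_mode N k i * x i)\<^sup>2)
    = (\<Sum>k=1..N. \<Sum>i=1..N. x i * (sine_mode N k i * (\<Sum>j=1..N. sine_mode N k j * x j)))"
    by (simp add: power2_eq_square sum_distrib_right mult_ac)
  also have "\<dots> = (\<Sum>i=1..N. x i * (\<Sum>k=1..N. sine_mode N k i * (\<Sum>j=1..N. sine_mode N k j * x j)))"
    by (subst sum.swap) (simp add: sum_distrib_left)
  also have "\<dots> = (\<Sum>i=1..N. (x i)\<^sup>2)"
    by (intro sum.cong refl) (simp only: sine_mode_inversion power2_eq_square)
  finally show ?thesis .
qed

lemma sine_mode_parseval':
  "(\<Sum>i=1..N. (\<Sum>k=1..N. sine_mode N k i * x k)\<^sup>2) = (\<Sum>k=1..N. (x k)\<^sup>2)"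
  using sine_mode_parseval[of N x] by (simp add: sine_mode_commute)

section \<open>Pathwise reduction\<close>

lemma set_integral_Icc_split:
  fixes f :: "real \<Rightarrow> real"
  assumes "set_integrable lborel {a..b} f" "a \<le> c" "c \<le> b"
  shows "(LINT t:{c..b}|lborel. f t) = (LINT t:{a..b}|lborel. f t) - (LINT t:{a..c}|lborel. f t)"
proof -
  have s: "set_integrable lborel {a..c} f" "set_integrable lborel {c..b} f"
    by (rule set_integrable_subset[OF assms(1)]; use assms in auto)+
  have "integral {a..c} f + integral {c..b} f = integral {a..b} f"
    by (intro Henstock_Kurzweil_Integration.integral_combine assms set_borel_integral_eq_integral(1)[OF assms(1)])
  then show ?thesis
    using set_borel_integral_eq_integral(2)[OF assms(1)] set_borel_integral_eq_integral(2)[OF s(1)]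
      set_borel_integral_eq_integral(2)[OF s(2)] by simp
qed

lemma set_integral_singleton: "(LINT t:{a..a::real}|lborel. f t) = (0::real)"
proof -
  have "(LINT t:{a..a}|lborel. f t) = (\<integral>t. 0 \<partial>lborel)"
    unfolding set_lebesgue_integral_def
  proof (rule integral_eq_zero_AE[THEN trans])
    show "AE t in lborel. indicat_real {a..a} t *\<^sub>R f t = 0"
      using AE_lborel_singleton[of a] by eventually_elim auto
  qed simp
  then show ?thesis by simp
qed

lemma has_primitive_integral:
  assumes "set_integrable lborel {0..T} f"
  shows "has_primitive T f (\<lambda>t. LINT s:{0..t}|lborel. f s)"
  unfolding has_primitive_def using assms set_integral_singleton[of 0 f] by simp

lemma ennreal_set_integral:
  fixes f :: "real \<Rightarrow> real"
  assumes "set_integrable lborel A f" "\<And>t. t \<in> A \<Longrightarrow> 0 \<le> f t"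
  shows "ennreal (LINT t:A|lborel. f t) = (\<integral>\<^sup>+t\<in>A. ennreal (f t) \<partial>lborel)"
proof -
  have "(\<integral>\<^sup>+t. ennreal (indicator A t *\<^sub>R f t) \<partial>lborel) = ennreal (LINT t:A|lborel. f t)"
    unfolding set_lebesgue_integral_def
    by (rule nn_integral_eq_integral) (use assms in \<open>auto simp: set_integrable_def indicator_def\<close>)
  moreover have "(\<integral>\<^sup>+t. ennreal (indicator A t *\<^sub>R f t) \<partial>lborel) = (\<integral>\<^sup>+t\<in>A. ennreal (f t) \<partial>lborel)"
    by (intro nn_integral_cong) (auto simp: indicator_def)
  ultimately show ?thesis by simp
qed

definition sine_coefficient :: "nat \<Rightarrow> (nat \<Rightarrow> real \<Rightarrow> real) \<Rightarrow> nat \<Rightarrow> real \<Rightarrow> real" where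
  "sine_coefficient N D k t = (\<Sum>i=1..N. sine_mode N k i * D i t)"

text \<open>The integral that remains when the stochastic convolution of one mode is integrated by
  parts; the factor \<open>sine_eigenvalue\<close> is the derivative of the kernel. The boundary
  term at the lower limit is the subtracted coefficient in \<open>corrector\<close>, the one at
  \<open>T\<close> vanishes with \<open>D\<close>.\<close>

definition convolved_coefficient :: "nat \<Rightarrow> real \<Rightarrow> (nat \<Rightarrow> real \<Rightarrow> real) \<Rightarrow> nat \<Rightarrow> real \<Rightarrow> real" where
  "convolved_coefficient N T D k t = sine_eigenvalue N k *
     (LINT s:{t..T}|lborel. exp (- sine_eigenvalue N k * (s - t)) * sine_coefficient N D k s)"

definition corrector :: "nat \<Rightarrow> real \<Rightarrow> (nat \<Rightarrow> real \<Rightarrow> real) \<Rightarrow> nat \<Rightarrow> real \<Rightarrow> real" where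
  "corrector N T D i t = (\<Sum>k=1..N. sine_mode N k i * (convolved_coefficient N T D k t - sine_coefficient N D k t))"

text \<open>The eigenvalues grow like the inverse square of \<open>h\<close>, but the kernel keeps
  mass at most 1; this makes the bound on the corrector uniform in the mesh.\<close>

lemma exponential_kernel_mass:
  fixes l t T :: real
  assumes "t \<le> T" "0 \<le> l"
  shows "(\<integral>\<^sup>+s\<in>{t..T}. ennreal (l * exp (- l * (s - t))) \<partial>lborel) \<le> 1"
proof -
  have "(\<integral>\<^sup>+s\<in>{t..T}. ennreal (l * exp (- l * (s - t))) \<partial>lborel) = ennreal (- exp (- l * (T - t)) - - exp (- l * (t - t)))"
    by (rule nn_integral_FTC_Icc) (use assms in \<open>auto intro!: derivative_eq_intros\<close>)
  also have "\<dots> \<le> 1" by (simp add: ennreal_le_1)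
  finally show ?thesis .
qed

text \<open>The kernel separates into a function of \<open>t\<close> times a function of
  \<open>s\<close>, so the integral is \<open>exp (l * t)\<close> times a difference of primitives
  and the product rule applies.\<close>

lemma convolved_coefficient_primitive:
  assumes "continuous_on {0..T} (sine_coefficient N D k)" and T: "0 \<le> T"
  shows "has_primitive T (\<lambda>t. sine_eigenvalue N k * (convolved_coefficient N T D k t - sine_coefficient N D k t))
    (convolved_coefficient N T D k)"
proof -
  define l where "l = sine_eigenvalue N k"
  define d where "d = sine_coefficient N D k"
  define f where "f s = exp (- l * s) * d s" for s
  have fi: "set_integrable lborel {0..T} f"
    unfolding f_def d_def by (intro set_integrable_continuous continuous_intros assms)
  define F where "F t = (LINT s:{0..t}|lborel. f s)" for t
  have F: "has_primitive T f F" unfolding F_def by (rule has_primitive_integral[OF fi])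
  have c: "convolved_coefficient N T D k t = l * (exp (l * t) * (F T - F t))" if t: "t \<in> {0..T}" for t
  proof -
    have "(LINT s:{t..T}|lborel. exp (- l * (s - t)) * d s) = (LINT s:{t..T}|lborel. exp (l * t) * f s)"
      by (intro set_lebesgue_integral_cong) (auto simp: f_def algebra_simps mult_exp_exp)
    also have "\<dots> = exp (l * t) * (F T - F t)"
      unfolding F_def using set_integral_Icc_split[OF fi, of t] t by simp
    finally show ?thesis by (simp add: convolved_coefficient_def l_def d_def)
  qed
  have e: "has_primitive T (\<lambda>s. l * exp (l * s)) (\<lambda>s. exp (l * s))"
    by (rule has_primitive_C1) (auto intro!: derivative_eq_intros continuous_intros)
  have "has_primitive T (\<lambda>t. l * ((l * exp (l * t)) * (F T + (-1) * F t) + (0 + (-1) * f t) * exp (l * t)))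
     (\<lambda>t. l * (exp (l * t) * (F T + (-1) * F t)))"
    by (intro has_primitive_cmult has_primitive_mult e has_primitive_add has_primitive_const F)
  then show ?thesis
  proof (rule has_primitive_cong[OF _ T])
    fix t assume t: "t \<in> {0..T}"
    show "l * (exp (l * t) * (F T + (-1) * F t)) = convolved_coefficient N T D k t" using c[OF t] by simp
    have "f t * exp (l * t) = d t" by (simp add: f_def mult_ac mult_exp_exp)
    then show "l * ((l * exp (l * t)) * (F T + (-1) * F t) + (0 + (-1) * f t) * exp (l * t))
      = sine_eigenvalue N k * (convolved_coefficient N T D k t - sine_coefficient N D k t)"
      unfolding l_def[symmetric] d_def[symmetric] c[OF t] by (simp add: algebra_simps)
  qed
qed

lemma corrector_continuous:
  assumes "\<And>i. i \<in> {1..N} \<Longrightarrow> continuous_on {0..T} (D i)" "0 \<le> T"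
  shows "continuous_on {0..T} (corrector N T D i)"
proof -
  have dc: "continuous_on {0..T} (sine_coefficient N D k)" for k
    unfolding sine_coefficient_def by (intro continuous_intros assms) auto
  show ?thesis unfolding corrector_def
    by (intro continuous_intros has_primitive_continuous[OF convolved_coefficient_primitive[OF dc assms(2)]] dc)
qed

text \<open>Jensen's inequality for a kernel of mass at most 1, obtained by integrating
  \<open>2 * I * d \<le> d\<^sup>2 + I\<^sup>2\<close> against the kernel with \<open>I\<close> the
  convolution itself.\<close>

lemma convolved_coefficient_square_le:
  assumes c: "continuous_on {0..T} (sine_coefficient N D k)" and t: "t \<in> {0..T}"
  shows "ennreal ((convolved_coefficient N T D k t)\<^sup>2)
    \<le> (\<integral>\<^sup>+s\<in>{t..T}. ennreal (sine_eigenvalue N k * exp (- sine_eigenvalue N k * (s - t)) * (sine_coefficient N D k s)\<^sup>2) \<partial>lborel)"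
proof -
  define l where "l = sine_eigenvalue N k"
  have l: "0 \<le> l" by (simp add: l_def sine_eigenvalue_nonneg)
  define d where "d = sine_coefficient N D k"
  define \<phi> where "\<phi> s = l * exp (- l * (s - t))" for s
  define I where "I = convolved_coefficient N T D k t"
  have dc: "continuous_on {t..T} d" unfolding d_def by (rule continuous_on_subset[OF c]) (use t in auto)
  have pc: "continuous_on {t..T} \<phi>" unfolding \<phi>_def by (intro continuous_intros)
  have i1: "set_integrable lborel {t..T} \<phi>" by (rule set_integrable_continuous[OF pc])
  have i2: "set_integrable lborel {t..T} (\<lambda>s. \<phi> s * d s)" by (intro set_integrable_continuous continuous_intros pc dc)
  have i3: "set_integrable lborel {t..T} (\<lambda>s. \<phi> s * (d s)\<^sup>2)" by (intro set_integrable_continuous continuous_intros pc dc)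
  have I: "I = (LINT s:{t..T}|lborel. \<phi> s * d s)"
    by (simp add: I_def convolved_coefficient_def l_def d_def \<phi>_def mult.assoc)
  have phi0: "0 \<le> \<phi> s" for s using l by (simp add: \<phi>_def)
  have mass: "(LINT s:{t..T}|lborel. \<phi> s) \<le> 1"
  proof -
    have "ennreal (LINT s:{t..T}|lborel. \<phi> s) \<le> 1"
      unfolding ennreal_set_integral[OF i1 phi0] unfolding \<phi>_def using t l by (intro exponential_kernel_mass) auto
    then show ?thesis by (simp add: ennreal_le_1)
  qed
  have "2 * I * I = (LINT s:{t..T}|lborel. 2 * I * (\<phi> s * d s))" using I by simp
  also have "\<dots> \<le> (LINT s:{t..T}|lborel. \<phi> s * (d s)\<^sup>2 + I\<^sup>2 * \<phi> s)"
  proof (rule set_integral_mono)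
    fix s
    have "\<phi> s * (2 * I * d s) \<le> \<phi> s * ((d s)\<^sup>2 + I\<^sup>2)"
      using sum_squares_bound[of I "d s"] phi0 by (intro mult_left_mono) (auto simp: algebra_simps)
    then show "2 * I * (\<phi> s * d s) \<le> \<phi> s * (d s)\<^sup>2 + I\<^sup>2 * \<phi> s" by (simp add: algebra_simps)
  qed (use i1 i2 i3 in \<open>auto intro: set_integral_add\<close>)
  also have "\<dots> = (LINT s:{t..T}|lborel. \<phi> s * (d s)\<^sup>2) + I\<^sup>2 * (LINT s:{t..T}|lborel. \<phi> s)"
    using i1 i3 by (subst set_integral_add) auto
  also have "\<dots> \<le> (LINT s:{t..T}|lborel. \<phi> s * (d s)\<^sup>2) + I\<^sup>2 * 1"
    using mass by (intro add_left_mono mult_left_mono) auto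
  finally have "I\<^sup>2 \<le> (LINT s:{t..T}|lborel. \<phi> s * (d s)\<^sup>2)" by (simp add: power2_eq_square)
  then have "ennreal (I\<^sup>2) \<le> ennreal (LINT s:{t..T}|lborel. \<phi> s * (d s)\<^sup>2)" by (rule ennreal_leI)
  also have "\<dots> = (\<integral>\<^sup>+s\<in>{t..T}. ennreal (\<phi> s * (d s)\<^sup>2) \<partial>lborel)"
    by (rule ennreal_set_integral[OF i3]) (simp add: phi0)
  finally show ?thesis by (simp add: I_def \<phi>_def l_def d_def)
qed

lemma laplacian_diff: "laplacian h (\<lambda>j. p j - q j) i = laplacian h p i - laplacian h q i"
  by (simp add: laplacian_def diff_divide_distrib add_divide_distrib algebra_simps)

lemma laplacian_sum: "laplacian h (\<lambda>j. \<Sum>k\<in>I. c k * e k j) i = (\<Sum>k\<in>I. c k * laplacian h (e k) i)"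
  by (simp add: laplacian_def sum_distrib_left sum.distrib sum_subtractf sum_divide_distrib
      algebra_simps add_divide_distrib diff_divide_distrib)

text \<open>With \<open>J = D(0) - D\<close>, \<open>corrector\<close> is the solution \<open>q\<close> of \<open>dq + D\<^sub>h\<^sup>2 q dt = dJ\<close>, \<open>q(T) = 0\<close>, written
  without stochastic integrals by an integration by parts in each sine mode.\<close>

lemma pathwise_observability:
  fixes \<zeta> Z \<alpha> \<beta> D :: "nat \<Rightarrow> real \<Rightarrow> real"
  assumes h: "h = 1 / (real N + 1)" and T: "0 < T" and K: "0 \<le> K" and C: "0 \<le> C"
    and det: "\<And>p G f. backward_heat N h T K p G f \<Longrightarrow> (\<Sum>i=1..N. (p i 0)\<^sup>2)
     \<le> C * ((LINT t:{0..T}|lborel. (\<Sum>i=1..N. (f i t)\<^sup>2))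
        + (LINT t:{0..T}|lborel. (\<Sum>i\<in>A. (p i t)\<^sup>2))
        + E * (\<Sum>i=1..N. (p i T)\<^sup>2))"
    and A: "A \<subseteq> {1..N}" and E: "0 \<le> E"
    and z0: "\<And>i t. i \<notin> {1..N} \<Longrightarrow> \<zeta> i t = 0"
    and zc: "\<And>i. i \<in> {1..N} \<Longrightarrow> continuous_on {0..T} (\<zeta> i)"
    and Dc: "\<And>i. i \<in> {1..N} \<Longrightarrow> continuous_on {0..T} (D i)"
    and DT: "\<And>i. i \<in> {1..N} \<Longrightarrow> D i T = 0"
    and Zm: "\<And>i. i \<in> {1..N} \<Longrightarrow> set_integrable lborel {0..T} (Z i)"
    and Z2: "\<And>i. i \<in> {1..N} \<Longrightarrow> set_integrable lborel {0..T} (\<lambda>t. (Z i t)\<^sup>2)"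
    and ab: "\<And>i t. \<bar>\<alpha> i t\<bar> \<le> K" "\<And>i t. \<bar>\<beta> i t\<bar> \<le> K"
    and eq: "\<And>i. i \<in> {1..N} \<Longrightarrow> has_primitive T
        (\<lambda>t. - (laplacian h (\<lambda>j. \<zeta> j t) i + \<alpha> i t * \<zeta> i t + \<beta> i t * Z i t)) (\<lambda>t. \<zeta> i t + D i t)"
  shows "(\<Sum>i=1..N. (\<zeta> i 0)\<^sup>2) \<le> (4 * C * (K\<^sup>2 + 1) + 2) *
     ((LINT t:{0..T}|lborel. (\<Sum>i=1..N. (Z i t)\<^sup>2)) + (LINT t:{0..T}|lborel. (\<Sum>i\<in>A. (\<zeta> i t)\<^sup>2))
      + E * (\<Sum>i=1..N. (\<zeta> i T)\<^sup>2)
      + (LINT t:{0..T}|lborel. (\<Sum>i=1..N. (corrector N T D i t)\<^sup>2)) + (\<Sum>i=1..N. (corrector N T D i 0)\<^sup>2))"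
proof -
  let ?q = "corrector N T D"
  let ?e = "sine_mode N" and ?l = "sine_eigenvalue N"
  let ?d = "sine_coefficient N D" and ?r = "convolved_coefficient N T D"
  have dc: "continuous_on {0..T} (?d k)" for k
    unfolding sine_coefficient_def by (intro continuous_intros Dc) auto
  have rp: "has_primitive T (\<lambda>t. ?l k * (?r k t - ?d k t)) (?r k)" for k
    by (rule convolved_coefficient_primitive[OF dc]) (use T in simp)
  have qc: "continuous_on {0..T} (?q i)" for i
    by (rule corrector_continuous[OF Dc]) (use T in simp_all)
  define r where "r i t = (\<Sum>k=1..N. ?e k i * ?r k t)" for i t
  have q_eq: "?q i t = r i t - D i t" if "i \<in> {1..N}" for i t
  proof -
    have "(\<Sum>k=1..N. ?e k i * ?d k t) = D i t" unfolding sine_coefficient_def by (rule sine_mode_inversion[OF that])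
    then show ?thesis by (simp add: corrector_def r_def right_diff_distrib sum_subtractf)
  qed
  have q_lap: "laplacian h (\<lambda>j. ?q j t) i = - (\<Sum>k=1..N. ?e k i * (?l k * (?r k t - ?d k t)))" if "i \<in> {1..N}" for i t
  proof -
    have "laplacian h (\<lambda>j. ?q j t) i = laplacian h (\<lambda>j. \<Sum>k=1..N. (?r k t - ?d k t) * ?e k j) i"
      by (simp add: corrector_def mult.commute)
    also have "\<dots> = (\<Sum>k=1..N. (?r k t - ?d k t) * laplacian h (?e k) i)" by (rule laplacian_sum)
    also have "\<dots> = (\<Sum>k=1..N. (?r k t - ?d k t) * (- ?l k * ?e k i))"
      using that unfolding h by (simp add: laplacian_sine_mode)
    finally show ?thesis by (simp add: sum_negf mult_ac)
  qed
  have q_bd: "?q 0 t = 0" "?q (Suc N) t = 0" for t by (simp_all add: corrector_def sine_mode_boundary)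
  define G where "G i t = \<alpha> i t * \<zeta> i t + \<beta> i t * Z i t" for i t
  \<comment> \<open>In terms of \<open>p = \<zeta> - q\<close>, the coefficient acting on
    \<open>\<zeta>\<close> gives the part \<open>K * \<bar>p\<bar>\<close> of the bound, and its
    action on \<open>q\<close> becomes part of the source.\<close>
  define f where "f i t = K * (\<bar>?q i t\<bar> + \<bar>Z i t\<bar>)" for i t
  have f2: "(f i t)\<^sup>2 \<le> 2 * K\<^sup>2 * ((?q i t)\<^sup>2 + (Z i t)\<^sup>2)" for i t
  proof -
    have "(\<bar>?q i t\<bar> + \<bar>Z i t\<bar>)\<^sup>2 \<le> 2 * ((?q i t)\<^sup>2 + (Z i t)\<^sup>2)"
      using sum_squares_bound[of "\<bar>?q i t\<bar>" "\<bar>Z i t\<bar>"] by (simp add: power2_sum)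
    then have "K\<^sup>2 * (\<bar>?q i t\<bar> + \<bar>Z i t\<bar>)\<^sup>2 \<le> K\<^sup>2 * (2 * ((?q i t)\<^sup>2 + (Z i t)\<^sup>2))" by (intro mult_left_mono) auto
    then show ?thesis by (simp only: f_def power_mult_distrib mult.assoc mult.left_commute[of "K\<^sup>2" 2])
  qed
  define p where "p i t = (if i \<in> {1..N} then \<zeta> i t - ?q i t else 0)" for i t
  have p_lap: "laplacian h (\<lambda>j. p j t) i = laplacian h (\<lambda>j. \<zeta> j t) i - laplacian h (\<lambda>j. ?q j t) i" if "i \<in> {1..N}" for i t
  proof -
    have "p j t = \<zeta> j t - ?q j t" if j: "j \<le> Suc N" for j
    proof -
      consider "j \<in> {1..N}" | "j = 0" | "j = Suc N" using j by force
      then show ?thesis using q_bd z0 by cases (auto simp: p_def)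
    qed
    moreover have "i - 1 \<le> Suc N" "i \<le> Suc N" "Suc i \<le> Suc N" using that by auto
    ultimately have "laplacian h (\<lambda>j. p j t) i = laplacian h (\<lambda>j. \<zeta> j t - ?q j t) i"
      unfolding laplacian_def by presburger
    then show ?thesis by (simp add: laplacian_diff)
  qed
  have q2: "set_integrable lborel {0..T} (\<lambda>t. (?q i t)\<^sup>2)" for i
    by (intro set_integrable_continuous continuous_intros qc)
  have f_L2: "set_integrable lborel {0..T} (\<lambda>t. (f i t)\<^sup>2)" if i: "i \<in> {1..N}" for i
    unfolding set_integrable_def
  proof (rule Bochner_Integration.integrable_bound)
    show "integrable lborel (\<lambda>t. 2 * K\<^sup>2 * (indicator {0..T} t *\<^sub>R (?q i t)\<^sup>2 + indicator {0..T} t *\<^sub>R (Z i t)\<^sup>2))"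
      using q2[of i] Z2[OF i] unfolding set_integrable_def by simp
    have m: "(\<lambda>t. indicator {0..T} t *\<^sub>R ?q i t) \<in> borel_measurable lborel" "(\<lambda>t. indicator {0..T} t *\<^sub>R Z i t) \<in> borel_measurable lborel"
      using set_integrable_continuous[OF qc[of i]] Zm[OF i] unfolding set_integrable_def by auto
    have e: "indicator {0..T} t *\<^sub>R (f i t)\<^sup>2 = (K * (\<bar>indicator {0..T} t *\<^sub>R ?q i t\<bar> + \<bar>indicator {0..T} t *\<^sub>R Z i t\<bar>))\<^sup>2" for t
      by (auto simp: indicator_def f_def)
    show "(\<lambda>t. indicator {0..T} t *\<^sub>R (f i t)\<^sup>2) \<in> borel_measurable lborel"
      unfolding e by (intro borel_measurable_power borel_measurable_times borel_measurable_add borel_measurable_abs m borel_measurable_const)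
    show "AE t in lborel. norm (indicator {0..T} t *\<^sub>R (f i t)\<^sup>2)
        \<le> norm (2 * K\<^sup>2 * (indicator {0..T} t *\<^sub>R (?q i t)\<^sup>2 + indicator {0..T} t *\<^sub>R (Z i t)\<^sup>2))"
      using f2[of i] by (intro AE_I2) (auto simp: indicator_def)
  qed
  have bh: "backward_heat N h T K p G f"
  proof unfold_locales
    show "0 < h" "real (Suc N) * h = 1" by (auto simp: h)
    show "p 0 t = 0" "p (Suc N) t = 0" for t by (auto simp: p_def)
    fix i assume i: "i \<in> {1..N}"
    show "set_integrable lborel {0..T} (\<lambda>t. (f i t)\<^sup>2)" by (rule f_L2[OF i])
    \<comment> \<open>Neither \<open>\<zeta>\<close> nor \<open>q\<close> is absolutely continuous,
      but their rough parts agree: \<open>\<zeta> + D\<close> and \<open>r = q + D\<close> both have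
      densities, and \<open>p\<close> is the difference of the two.\<close>
    have "has_primitive T (\<lambda>t. - (laplacian h (\<lambda>j. \<zeta> j t) i + \<alpha> i t * \<zeta> i t + \<beta> i t * Z i t)
       + (-1) * (\<Sum>k=1..N. ?e k i * (?l k * (?r k t - ?d k t)))) (\<lambda>t. (\<zeta> i t + D i t) + (-1) * (\<Sum>k=1..N. ?e k i * ?r k t))"
      by (intro has_primitive_add has_primitive_cmult has_primitive_sum rp eq[OF i]) auto
    then show "has_primitive T (\<lambda>t. - (laplacian h (\<lambda>j. p j t) i + G i t)) (p i)"
      by (rule has_primitive_cong) (use T i q_eq[OF i] p_lap[OF i] q_lap[OF i] in \<open>auto simp: p_def r_def G_def\<close>)
    fix t assume "t \<in> {0..T}"
    have "\<bar>G i t\<bar> \<le> K * \<bar>\<zeta> i t\<bar> + K * \<bar>Z i t\<bar>"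
      unfolding G_def using ab[of i t]
      by (intro order_trans[OF abs_triangle_ineq] add_mono) (auto simp: abs_mult intro: mult_right_mono)
    also have "\<dots> \<le> K * (\<bar>p i t\<bar> + \<bar>?q i t\<bar>) + K * \<bar>Z i t\<bar>"
      using i K by (intro add_right_mono mult_left_mono) (auto simp: p_def)
    finally show "\<bar>G i t\<bar> \<le> K * \<bar>p i t\<bar> + f i t" by (simp add: f_def algebra_simps)
  qed (use T K in \<open>auto simp: f_def\<close>)
  have sq: "(a - b)\<^sup>2 \<le> 2 * a\<^sup>2 + 2 * b\<^sup>2" for a b :: real
    using zero_le_power2[of "a + b"] by (simp add: power2_eq_square algebra_simps)
  let ?ZZ = "LINT t:{0..T}|lborel. (\<Sum>i=1..N. (Z i t)\<^sup>2)" and ?N = "LINT t:{0..T}|lborel. (\<Sum>i\<in>A. (\<zeta> i t)\<^sup>2)"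
    and ?X = "E * (\<Sum>i=1..N. (\<zeta> i T)\<^sup>2)" and ?Q = "LINT t:{0..T}|lborel. (\<Sum>i=1..N. (?q i t)\<^sup>2)" and ?R = "\<Sum>i=1..N. (?q i 0)\<^sup>2"
  have zi: "set_integrable lborel {0..T} (\<lambda>t. (\<zeta> i t)\<^sup>2)" if "i \<in> {1..N}" for i
    by (intro set_integrable_continuous continuous_intros zc that)
  have iZ: "set_integrable lborel {0..T} (\<lambda>t. \<Sum>i=1..N. (Z i t)\<^sup>2)" by (intro set_integrable_sum Z2)
  have iQ: "set_integrable lborel {0..T} (\<lambda>t. \<Sum>i=1..N. (?q i t)\<^sup>2)" by (intro set_integrable_sum q2)
  have iN: "set_integrable lborel {0..T} (\<lambda>t. \<Sum>i\<in>A. (\<zeta> i t)\<^sup>2)" using A by (intro set_integrable_sum zi) auto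
  have nn: "0 \<le> ?ZZ" "0 \<le> ?N" "0 \<le> ?Q" "0 \<le> ?R" "0 \<le> ?X"
    using E by (auto simp: set_lebesgue_integral_def intro!: Bochner_Integration.integral_nonneg sum_nonneg mult_nonneg_nonneg)
  have 1: "(LINT t:{0..T}|lborel. (\<Sum>i=1..N. (f i t)\<^sup>2)) \<le> 2 * K\<^sup>2 * (?Q + ?ZZ)"
  proof -
    have "(LINT t:{0..T}|lborel. (\<Sum>i=1..N. (f i t)\<^sup>2)) \<le> (LINT t:{0..T}|lborel. 2 * K\<^sup>2 * ((\<Sum>i=1..N. (?q i t)\<^sup>2) + (\<Sum>i=1..N. (Z i t)\<^sup>2)))"
    proof (rule set_integral_mono)
      show "(\<Sum>i=1..N. (f i t)\<^sup>2) \<le> 2 * K\<^sup>2 * ((\<Sum>i=1..N. (?q i t)\<^sup>2) + (\<Sum>i=1..N. (Z i t)\<^sup>2))" for t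
        unfolding sum.distrib[symmetric] sum_distrib_left by (rule sum_mono) (rule f2)
    qed (use iQ iZ in \<open>auto intro!: set_integrable_sum f_L2 set_integral_add\<close>)
    then show ?thesis using iQ iZ by (simp add: set_integral_add)
  qed
  have 2: "(LINT t:{0..T}|lborel. (\<Sum>i\<in>A. (p i t)\<^sup>2)) \<le> 2 * (?N + ?Q)"
  proof -
    have "(LINT t:{0..T}|lborel. (\<Sum>i\<in>A. (p i t)\<^sup>2)) \<le> (LINT t:{0..T}|lborel. 2 * ((\<Sum>i\<in>A. (\<zeta> i t)\<^sup>2) + (\<Sum>i=1..N. (?q i t)\<^sup>2)))"
    proof (rule set_integral_mono)
      show "set_integrable lborel {0..T} (\<lambda>t. \<Sum>i\<in>A. (p i t)\<^sup>2)"
      proof (intro set_integrable_sum set_integrable_continuous continuous_intros)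
        fix i assume "i \<in> A"
        then have i: "i \<in> {1..N}" using A by blast
        then have "p i = (\<lambda>t. \<zeta> i t - ?q i t)" by (auto simp: p_def)
        then show "continuous_on {0..T} (p i)" using zc[OF i] qc[of i] by (simp add: continuous_on_diff)
      qed
      show "(\<Sum>i\<in>A. (p i t)\<^sup>2) \<le> 2 * ((\<Sum>i\<in>A. (\<zeta> i t)\<^sup>2) + (\<Sum>i=1..N. (?q i t)\<^sup>2))" for t
      proof -
        have "(\<Sum>i\<in>A. (p i t)\<^sup>2) \<le> (\<Sum>i\<in>A. 2 * (\<zeta> i t)\<^sup>2 + 2 * (?q i t)\<^sup>2)"
          using A sq by (intro sum_mono) (auto simp: p_def)
        also have "\<dots> = 2 * (\<Sum>i\<in>A. (\<zeta> i t)\<^sup>2) + 2 * (\<Sum>i\<in>A. (?q i t)\<^sup>2)" by (simp add: sum.distrib sum_distrib_left)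
        also have "(\<Sum>i\<in>A. (?q i t)\<^sup>2) \<le> (\<Sum>i=1..N. (?q i t)\<^sup>2)" using A by (intro sum_mono2) auto
        finally show ?thesis by simp
      qed
    qed (use iQ iN in \<open>auto intro!: set_integral_add\<close>)
    then show ?thesis using iQ iN by (simp add: set_integral_add)
  qed
  have 3: "p i T = \<zeta> i T" if i: "i \<in> {1..N}" for i
  proof -
    \<comment> \<open>The corrector vanishes at \<open>T\<close>, so \<open>p\<close> has the same
      terminal value as \<open>\<zeta>\<close>.\<close>
    have "?d k T = 0" for k using DT by (simp add: sine_coefficient_def)
    moreover have "?r k T = 0" for k unfolding convolved_coefficient_def set_integral_singleton by simp
    ultimately show ?thesis using i by (simp add: p_def corrector_def)
  qed
  have P0: "(\<Sum>i=1..N. (p i 0)\<^sup>2) \<le> C * (2 * K\<^sup>2 * (?Q + ?ZZ) + 2 * (?N + ?Q) + ?X)"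
  proof -
    have "(\<Sum>i=1..N. (p i T)\<^sup>2) = (\<Sum>i=1..N. (\<zeta> i T)\<^sup>2)" using 3 by (intro sum.cong) auto
    then have "(LINT t:{0..T}|lborel. (\<Sum>i=1..N. (f i t)\<^sup>2)) + (LINT t:{0..T}|lborel. (\<Sum>i\<in>A. (p i t)\<^sup>2)) + E * (\<Sum>i=1..N. (p i T)\<^sup>2)
      \<le> 2 * K\<^sup>2 * (?Q + ?ZZ) + 2 * (?N + ?Q) + ?X" using 1 2 by simp
    from mult_left_mono[OF this C] show ?thesis using det[OF bh] by linarith
  qed
  have "(\<Sum>i=1..N. (\<zeta> i 0)\<^sup>2) \<le> (\<Sum>i=1..N. 2 * (p i 0)\<^sup>2 + 2 * (?q i 0)\<^sup>2)"
  proof (rule sum_mono)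
    fix i assume "i \<in> {1..N}"
    then have "\<zeta> i 0 = p i 0 - - ?q i 0" by (simp add: p_def)
    then show "(\<zeta> i 0)\<^sup>2 \<le> 2 * (p i 0)\<^sup>2 + 2 * (?q i 0)\<^sup>2" using sq[of "p i 0" "- ?q i 0"] by simp
  qed
  also have "\<dots> = 2 * (\<Sum>i=1..N. (p i 0)\<^sup>2) + 2 * ?R" by (simp add: sum.distrib sum_distrib_left)
  also have "\<dots> \<le> 2 * (C * (2 * K\<^sup>2 * (?Q + ?ZZ) + 2 * (?N + ?Q) + ?X)) + 2 * ?R"
    using P0 by simp
  also have "\<dots> \<le> 2 * (C * (2 * (K\<^sup>2 + 1) * (?ZZ + ?N + ?X + ?Q + ?R))) + 2 * (?ZZ + ?N + ?X + ?Q + ?R)"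
  proof (intro add_mono mult_left_mono C)
    have "0 \<le> K\<^sup>2 * ?N" "0 \<le> K\<^sup>2 * ?X" "0 \<le> K\<^sup>2 * ?R" using nn by auto
    then show "2 * K\<^sup>2 * (?Q + ?ZZ) + 2 * (?N + ?Q) + ?X \<le> 2 * (K\<^sup>2 + 1) * (?ZZ + ?N + ?X + ?Q + ?R)"
      using nn by (simp add: algebra_simps)
  qed (use nn in auto)
  also have "\<dots> = (4 * C * (K\<^sup>2 + 1) + 2) * (?ZZ + ?N + ?X + ?Q + ?R)" by (simp add: algebra_simps)
  finally show "(\<Sum>i=1..N. (\<zeta> i 0)\<^sup>2) \<le> (4 * C * (K\<^sup>2 + 1) + 2) * (?ZZ + ?N + ?X + ?Q + ?R)" .
qed

section \<open>Moment estimates for the stochastic equation\<close>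

lemma integrable_time_measure:
  fixes f :: "real \<Rightarrow> real"
  shows "integrable (time_measure T) f \<longleftrightarrow> set_integrable lborel {0..T} f"
  unfolding set_integrable_def by (subst integrable_restrict_space) auto

text \<open>The equation with nodes numbered and zero values outside \<open>{1..N}\<close>, so that
  the difference operator needs no boundary case. Adaptedness is present only inside
  \<open>is_ito_integral\<close>; everywhere else joint measurability suffices, since the corrector
  is not adapted anyway.\<close>

locale bsde_solution = brownian_space M B for M :: "'a measure" and B :: "real \<Rightarrow> 'a \<Rightarrow> real" +
  fixes T K h :: real and N :: nat and \<alpha> \<beta> \<zeta> Z :: "nat \<Rightarrow> real \<Rightarrow> 'a \<Rightarrow> real"
  assumes T_pos: "0 < T" and K_nonneg: "0 \<le> K" and h_eq: "h = 1 / (real N + 1)"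
    and alpha_m: "\<And>i. i \<in> {1..N} \<Longrightarrow> (\<lambda>x. \<alpha> i (fst x) (snd x)) \<in> borel_measurable (time_measure T \<Otimes>\<^sub>M M)"
    and beta_m: "\<And>i. i \<in> {1..N} \<Longrightarrow> (\<lambda>x. \<beta> i (fst x) (snd x)) \<in> borel_measurable (time_measure T \<Otimes>\<^sub>M M)"
    and alpha_bound: "\<And>i t w. \<bar>\<alpha> i t w\<bar> \<le> K" and beta_bound: "\<And>i t w. \<bar>\<beta> i t w\<bar> \<le> K"
    and zeta_m: "\<And>i. i \<in> {1..N} \<Longrightarrow> (\<lambda>x. \<zeta> i (fst x) (snd x)) \<in> borel_measurable (time_measure T \<Otimes>\<^sub>M M)"
    and zeta_0: "\<And>i t w. i \<notin> {1..N} \<Longrightarrow> \<zeta> i t w = 0"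
    and zeta_cont: "AE w in M. \<forall>i\<in>{1..N}. continuous_on {0..T} (\<lambda>t. \<zeta> i t w)"
    and Z_m: "\<And>i. i \<in> {1..N} \<Longrightarrow> (\<lambda>x. Z i (fst x) (snd x)) \<in> borel_measurable (time_measure T \<Otimes>\<^sub>M M)"
    and Z_L2: "\<And>i. i \<in> {1..N} \<Longrightarrow> (\<integral>\<^sup>+x. ennreal ((Z i (fst x) (snd x))\<^sup>2) \<partial>(time_measure T \<Otimes>\<^sub>M M)) < \<infinity>"
    and equation: "\<And>i. i \<in> {1..N} \<Longrightarrow> \<exists>J. is_ito_integral M (brownian_filtration M B) B T (Z i) J \<and>
        (\<forall>t\<in>{0..T}. AE w in M. \<zeta> i t w = \<zeta> i 0 w
           - (LINT s:{0..t}|lborel. laplacian h (\<lambda>j. \<zeta> j s w) i + \<alpha> i s w * \<zeta> i s w + \<beta> i s w * Z i s w) + J t w)"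
begin

abbreviation "LM \<equiv> time_measure T \<Otimes>\<^sub>M M"

sublocale L: finite_measure "time_measure T" by (rule finite_measure_time)
sublocale pair_sigma_finite "time_measure T" M ..

definition "g i s w = laplacian h (\<lambda>j. \<zeta> j s w) i + \<alpha> i s w * \<zeta> i s w + \<beta> i s w * Z i s w"
definition "I i t w = (LINT s:{0..t}|lborel. g i s w)"
text \<open>By the equation this is \<open>J T - J t\<close> almost surely for each fixed
  \<open>t\<close>. Defining it through \<open>\<zeta>\<close> and \<open>I\<close> gives continuous
  paths and joint measurability without choosing a continuous version of the Ito integral.\<close>

definition "D i t w = \<zeta> i T w - \<zeta> i t w + (I i T w - I i t w)"
definition "q i t w = corrector N T (\<lambda>i t. D i t w) i t"
definition "d k t w = sine_coefficient N (\<lambda>i t. D i t w) k t"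
definition "r k t w = convolved_coefficient N T (\<lambda>i t. D i t w) k t"

section \<open>Joint measurability of the pathwise quantities\<close>

lemma time_section:
  assumes "t \<in> {0..T}" "(\<lambda>x. f (fst x) (snd x)) \<in> borel_measurable LM"
  shows "(\<lambda>w. f t w :: real) \<in> borel_measurable M"
proof -
  have "(\<lambda>w. (t, w)) \<in> measurable M LM" using assms(1) by (intro measurable_Pair1') (simp add: space_restrict_space)
  from measurable_compose[OF this assms(2)] show ?thesis by simp
qed

lemma sample_section:
  assumes "w \<in> space M" "(\<lambda>x. f (fst x) (snd x)) \<in> borel_measurable LM"
  shows "(\<lambda>t. f t w :: real) \<in> borel_measurable (time_measure T)"
proof -
  have "(\<lambda>t. (t, w)) \<in> measurable (time_measure T) LM" using assms(1) by (rule measurable_Pair2')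
  from measurable_compose[OF this assms(2)] show ?thesis by simp
qed

lemma zeta_m': "(\<lambda>x. \<zeta> i (fst x) (snd x)) \<in> borel_measurable LM"
  using zeta_m[of i] zeta_0[of i] by (cases "i \<in> {1..N}") auto

lemma g_m: assumes "i \<in> {1..N}" shows "(\<lambda>x. g i (fst x) (snd x)) \<in> borel_measurable LM"
  unfolding g_def laplacian_def
  using zeta_m' alpha_m[OF assms] beta_m[OF assms] Z_m[OF assms] by measurable

lemma parametric_integral_measurable:
  assumes "(\<lambda>x. f (fst x) (snd x)) \<in> borel_measurable LM"
    and P: "Measurable.pred (LM \<Otimes>\<^sub>M time_measure T) (\<lambda>y. P (fst (fst y)) (snd y))"
    and c: "(\<lambda>y. c (fst (fst y)) (snd y)) \<in> borel_measurable (LM \<Otimes>\<^sub>M time_measure T)"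
  shows "(\<lambda>x. \<integral>s. (if P (fst x) s then c (fst x) s * f s (snd x) else 0 :: real) \<partial>time_measure T) \<in> borel_measurable LM"
proof (rule L.borel_measurable_lebesgue_integral)
  have "(\<lambda>y. (snd y, snd (fst y))) \<in> measurable (LM \<Otimes>\<^sub>M time_measure T) LM" by measurable
  from measurable_compose[OF this assms(1)]
  have "(\<lambda>y. f (snd y) (snd (fst y))) \<in> borel_measurable (LM \<Otimes>\<^sub>M time_measure T)" by simp
  then have "(\<lambda>y. if P (fst (fst y)) (snd y) then c (fst (fst y)) (snd y) * f (snd y) (snd (fst y)) else 0) \<in> borel_measurable (LM \<Otimes>\<^sub>M time_measure T)"
    using P c by measurable
  then show "(\<lambda>(x, s). if P (fst x) s then c (fst x) s * f s (snd x) else 0) \<in> borel_measurable (LM \<Otimes>\<^sub>M time_measure T)"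
    by (simp add: case_prod_beta')
qed

lemma time_measurable_id: "(\<lambda>t. t) \<in> borel_measurable (time_measure T)"
  by (intro measurable_restrict_space1) simp

lemma time_components:
  "(\<lambda>y. fst (fst y)) \<in> borel_measurable (LM \<Otimes>\<^sub>M time_measure T)"
  "(\<lambda>y. snd y) \<in> borel_measurable (LM \<Otimes>\<^sub>M time_measure T)"
proof -
  have "(\<lambda>y. fst (fst y)) \<in> measurable (LM \<Otimes>\<^sub>M time_measure T) (time_measure T)" by measurable
  from measurable_compose[OF this time_measurable_id] show "(\<lambda>y. fst (fst y)) \<in> borel_measurable (LM \<Otimes>\<^sub>M time_measure T)" .
  have "(\<lambda>y. snd y) \<in> measurable (LM \<Otimes>\<^sub>M time_measure T) (time_measure T)" by measurable
  from measurable_compose[OF this time_measurable_id] show "(\<lambda>y. snd y) \<in> borel_measurable (LM \<Otimes>\<^sub>M time_measure T)" .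
qed

lemma set_integral_time_measure:
  fixes f :: "real \<Rightarrow> real"
  assumes "A \<subseteq> {0..T}"
  shows "(LINT s:A|lborel. f s) = (\<integral>s. (if s \<in> A then f s else 0) \<partial>time_measure T)"
proof -
  have "(\<integral>s. (if s \<in> A then f s else 0) \<partial>time_measure T) = (\<integral>s. indicator {0..T} s *\<^sub>R (if s \<in> A then f s else 0) \<partial>lborel)"
    by (rule integral_restrict_space) simp
  also have "\<dots> = (LINT s:A|lborel. f s)" unfolding set_lebesgue_integral_def
    using assms by (intro Bochner_Integration.integral_cong) (auto simp: indicator_def)
  finally show ?thesis by simp
qed

lemma LM_time: "x \<in> space LM \<Longrightarrow> fst x \<in> {0..T} \<and> snd x \<in> space M"
  by (auto simp: space_pair_measure space_restrict_space)

lemma I_m: assumes i: "i \<in> {1..N}" shows "(\<lambda>x. I i (fst x) (snd x)) \<in> borel_measurable LM"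
proof -
  have "(\<lambda>x. \<integral>s. (if s \<le> fst x then 1 * g i s (snd x) else 0) \<partial>time_measure T) \<in> borel_measurable LM"
  proof (rule parametric_integral_measurable[OF g_m[OF i]])
    show "Measurable.pred (LM \<Otimes>\<^sub>M time_measure T) (\<lambda>y. snd y \<le> fst (fst y))"
      using time_components by measurable
  qed simp
  moreover have "I i (fst x) (snd x) = (\<integral>s. (if s \<le> fst x then 1 * g i s (snd x) else 0) \<partial>time_measure T)" if "x \<in> space LM" for x
  proof -
    have "I i (fst x) (snd x) = (\<integral>s. (if s \<in> {0..fst x} then g i s (snd x) else 0) \<partial>time_measure T)"
      unfolding I_def using LM_time[OF that] by (intro set_integral_time_measure) auto
    also have "\<dots> = (\<integral>s. (if s \<le> fst x then 1 * g i s (snd x) else 0) \<partial>time_measure T)"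
      by (intro Bochner_Integration.integral_cong) (auto simp: space_restrict_space)
    finally show ?thesis .
  qed
  ultimately show ?thesis by (subst measurable_cong) auto
qed

lemma D_m: assumes i: "i \<in> {1..N}" shows "(\<lambda>x. D i (fst x) (snd x)) \<in> borel_measurable LM"
proof -
  have T0: "T \<in> {0..T}" using T_pos by simp
  have a: "(\<lambda>x. \<zeta> i T (snd x)) \<in> borel_measurable LM"
    by (rule measurable_compose[OF measurable_snd time_section[OF T0 zeta_m']])
  have b: "(\<lambda>x. I i T (snd x)) \<in> borel_measurable LM"
    by (rule measurable_compose[OF measurable_snd time_section[OF T0 I_m[OF i]]])
  show ?thesis unfolding D_def using a b zeta_m'[of i] I_m[OF i] by measurable
qed

lemma d_m: "(\<lambda>x. d k (fst x) (snd x)) \<in> borel_measurable LM"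
  unfolding d_def sine_coefficient_def by (intro borel_measurable_sum borel_measurable_times borel_measurable_const D_m)

lemma r_m: "(\<lambda>x. r k (fst x) (snd x)) \<in> borel_measurable LM"
proof -
  let ?l = "sine_eigenvalue N k"
  have "(\<lambda>x. \<integral>s. (if fst x \<le> s then exp (- ?l * (s - fst x)) * d k s (snd x) else 0) \<partial>time_measure T) \<in> borel_measurable LM"
  proof (rule parametric_integral_measurable[OF d_m])
    show "Measurable.pred (LM \<Otimes>\<^sub>M time_measure T) (\<lambda>y. fst (fst y) \<le> snd y)"
      "(\<lambda>y. exp (- ?l * (snd y - fst (fst y)))) \<in> borel_measurable (LM \<Otimes>\<^sub>M time_measure T)"
      using time_components by measurable
  qed
  then have "(\<lambda>x. ?l * (\<integral>s. (if fst x \<le> s then exp (- ?l * (s - fst x)) * d k s (snd x) else 0) \<partial>time_measure T)) \<in> borel_measurable LM"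
    by simp
  moreover have "r k (fst x) (snd x) = ?l * (\<integral>s. (if fst x \<le> s then exp (- ?l * (s - fst x)) * d k s (snd x) else 0) \<partial>time_measure T)" if "x \<in> space LM" for x
  proof -
    have "(LINT s:{fst x..T}|lborel. exp (- ?l * (s - fst x)) * d k s (snd x))
      = (\<integral>s. (if s \<in> {fst x..T} then exp (- ?l * (s - fst x)) * d k s (snd x) else 0) \<partial>time_measure T)"
      using LM_time[OF that] by (intro set_integral_time_measure) auto
    also have "\<dots> = (\<integral>s. (if fst x \<le> s then exp (- ?l * (s - fst x)) * d k s (snd x) else 0) \<partial>time_measure T)"
      by (intro Bochner_Integration.integral_cong) (auto simp: space_restrict_space)
    finally show ?thesis by (simp add: r_def convolved_coefficient_def d_def)
  qed
  ultimately show ?thesis by (subst measurable_cong) auto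
qed

lemma q_m: "(\<lambda>x. q i (fst x) (snd x)) \<in> borel_measurable LM"
  unfolding q_def corrector_def d_def[symmetric] r_def[symmetric]
  by (intro borel_measurable_sum borel_measurable_times borel_measurable_diff borel_measurable_const d_m r_m)

text \<open>The increment of the Ito integral is split into its values at \<open>T\<close> and at
  \<open>t\<close>. Each contributes 2 times the factor 4 of \<open>ito_combination_bound\<close>,
  and the Ito integrals are combined over the nodes before anything is squared.\<close>

lemma d_second_moment:
  assumes t: "t \<in> {0..T}"
  shows "(\<integral>\<^sup>+w. ennreal ((d k t w)\<^sup>2) \<partial>M)
    \<le> 16 * (\<integral>\<^sup>+x. ennreal ((\<Sum>i=1..N. sine_mode N k i * Z i (fst x) (snd x))\<^sup>2) \<partial>LM)"
proof -
  have "\<forall>i\<in>{1..N}. \<exists>J. is_ito_integral M (brownian_filtration M B) B T (Z i) J \<and>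
        (\<forall>t\<in>{0..T}. AE w in M. \<zeta> i t w = \<zeta> i 0 w - I i t w + J t w)"
    using equation unfolding I_def g_def by blast
  then obtain J where J: "\<And>i. i \<in> {1..N} \<Longrightarrow> is_ito_integral M (brownian_filtration M B) B T (Z i) (J i)"
    and Je: "\<And>i t. i \<in> {1..N} \<Longrightarrow> t \<in> {0..T} \<Longrightarrow> AE w in M. \<zeta> i t w = \<zeta> i 0 w - I i t w + J i t w"
    by metis
  have T0: "T \<in> {0..T}" using T_pos by simp
  have Jm: "J i t \<in> borel_measurable M" if "i \<in> {1..N}" "t \<in> {0..T}" for i t
    using J[OF that(1)] that(2) unfolding is_ito_integral_def by blast
  have "AE w in M. \<forall>i\<in>{1..N}. D i t w = J i T w - J i t w"
  proof (rule AE_finite_allI)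
    fix i assume i: "i \<in> {1..N}"
    show "AE w in M. D i t w = J i T w - J i t w"
      using Je[OF i T0] Je[OF i t] by eventually_elim (simp add: D_def)
  qed simp
  then have ae: "AE w in M. d k t w = (\<Sum>i=1..N. sine_mode N k i * J i T w) + (\<Sum>i=1..N. (- sine_mode N k i) * J i t w)"
  proof eventually_elim
    case (elim w)
    then have "d k t w = (\<Sum>i=1..N. sine_mode N k i * (J i T w - J i t w))"
      unfolding d_def sine_coefficient_def by (intro sum.cong) auto
    then show ?case by (simp add: right_diff_distrib sum_subtractf sum_negf)
  qed
  let ?A = "\<integral>\<^sup>+x. ennreal ((\<Sum>i=1..N. sine_mode N k i * Z i (fst x) (snd x))\<^sup>2) \<partial>LM"
  have Zm: "(\<lambda>(t, w). Z i t w) \<in> borel_measurable LM" if "i \<in> {1..N}" for i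
    using Z_m[OF that] by (simp add: case_prod_beta')
  have neg: "(\<Sum>i=1..N. - sine_mode N k i * Z i (fst x) (snd x))\<^sup>2 = (\<Sum>i=1..N. sine_mode N k i * Z i (fst x) (snd x))\<^sup>2" for x
    by (simp add: sum_negf)
  have "(\<integral>\<^sup>+w. ennreal ((d k t w)\<^sup>2) \<partial>M)
    = (\<integral>\<^sup>+w. ennreal (((\<Sum>i=1..N. sine_mode N k i * J i T w) + (\<Sum>i=1..N. (- sine_mode N k i) * J i t w))\<^sup>2) \<partial>M)"
    by (intro nn_integral_cong_AE) (use ae in \<open>eventually_elim, simp\<close>)
  also have "\<dots> \<le> 2 * (\<integral>\<^sup>+w. ennreal ((\<Sum>i=1..N. sine_mode N k i * J i T w)\<^sup>2) \<partial>M)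
     + 2 * (\<integral>\<^sup>+w. ennreal ((\<Sum>i=1..N. (- sine_mode N k i) * J i t w)\<^sup>2) \<partial>M)"
    by (intro nn_integral_square_triangle borel_measurable_sum borel_measurable_times borel_measurable_const Jm T0 t)
  also have "\<dots> \<le> 2 * (4 * ?A) + 2 * (4 * ?A)"
  proof (intro add_mono mult_left_mono)
    show "(\<integral>\<^sup>+w. ennreal ((\<Sum>i=1..N. sine_mode N k i * J i T w)\<^sup>2) \<partial>M) \<le> 4 * ?A"
      by (rule ito_combination_bound[OF _ J Zm T0]) auto
    show "(\<integral>\<^sup>+w. ennreal ((\<Sum>i=1..N. (- sine_mode N k i) * J i t w)\<^sup>2) \<partial>M) \<le> 4 * ?A"
      using ito_combination_bound[of "{1..N}" T Z J t "\<lambda>i. - sine_mode N k i", OF _ J Zm t] unfolding neg by simp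
  qed auto
  also have "\<dots> = 16 * ?A"
  proof -
    have "2 * (4 * a) + 2 * (4 * a) = 16 * a" for a :: ennreal
      by (simp add: mult.assoc[symmetric] flip: distrib_right)
    then show ?thesis .
  qed
  finally show ?thesis .
qed

section \<open>Paths to which the deterministic estimate applies\<close>

definition "good w \<longleftrightarrow> w \<in> space M \<and> (\<forall>i\<in>{1..N}. continuous_on {0..T} (\<lambda>t. \<zeta> i t w)
    \<and> set_integrable lborel {0..T} (\<lambda>t. Z i t w) \<and> set_integrable lborel {0..T} (\<lambda>t. (Z i t w)\<^sup>2))"

lemma AE_good: "AE w in M. good w"
proof -
  have "AE w in M. \<forall>i\<in>{1..N}. (\<integral>\<^sup>+t. ennreal ((Z i t w)\<^sup>2) \<partial>time_measure T) \<noteq> \<infinity>"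
  proof (rule AE_finite_allI)
    fix i assume i: "i \<in> {1..N}"
    have m: "(\<lambda>x. ennreal ((Z i (fst x) (snd x))\<^sup>2)) \<in> borel_measurable LM" using Z_m[OF i] by measurable
    show "AE w in M. (\<integral>\<^sup>+t. ennreal ((Z i t w)\<^sup>2) \<partial>time_measure T) \<noteq> \<infinity>"
    proof (rule nn_integral_PInf_AE)
      show "(\<lambda>w. \<integral>\<^sup>+t. ennreal ((Z i t w)\<^sup>2) \<partial>time_measure T) \<in> borel_measurable M"
        using L.borel_measurable_nn_integral[of "\<lambda>w t. ennreal ((Z i t w)\<^sup>2)" M] measurable_compose[OF measurable_pair_swap' m]
        by (simp add: case_prod_beta' split_def)
      show "(\<integral>\<^sup>+w. (\<integral>\<^sup>+t. ennreal ((Z i t w)\<^sup>2) \<partial>time_measure T) \<partial>M) \<noteq> \<infinity>"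
        using nn_integral_snd[of "\<lambda>x. ennreal ((Z i (fst x) (snd x))\<^sup>2)", OF m] Z_L2[OF i] by simp
    qed
  qed simp
  then show ?thesis using zeta_cont AE_space
  proof eventually_elim
    case (elim w)
    show ?case unfolding good_def
    proof (intro conjI ballI elim(3))
      fix i assume i: "i \<in> {1..N}"
      show "continuous_on {0..T} (\<lambda>t. \<zeta> i t w)" using elim(2) i by blast
      have m: "(\<lambda>t. Z i t w) \<in> borel_measurable (time_measure T)" by (rule sample_section[OF elim(3) Z_m[OF i]])
      have i2: "integrable (time_measure T) (\<lambda>t. (Z i t w)\<^sup>2)"
      proof (rule integrableI_nonneg)
        show "(\<integral>\<^sup>+t. ennreal ((Z i t w)\<^sup>2) \<partial>time_measure T) < \<infinity>" using elim(1) i by (simp add: less_top)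
      qed (use m in auto)
      then show "set_integrable lborel {0..T} (\<lambda>t. (Z i t w)\<^sup>2)" by (simp add: integrable_time_measure)
      have "integrable (time_measure T) (\<lambda>t. Z i t w)"
      proof (rule Bochner_Integration.integrable_bound)
        show "integrable (time_measure T) (\<lambda>t. 1 + (Z i t w)\<^sup>2)" using i2 by simp
        have "\<bar>x\<bar> \<le> 1 + x\<^sup>2" for x :: real using sum_squares_bound[of 1 "\<bar>x\<bar>"] by (simp add: power2_abs)
        then show "AE t in time_measure T. norm (Z i t w) \<le> norm (1 + (Z i t w)\<^sup>2)" by (intro AE_I2) simp
      qed (rule m)
      then show "set_integrable lborel {0..T} (\<lambda>t. Z i t w)" by (simp add: integrable_time_measure)
    qed
  qed
qed

context
  fixes w assumes w: "good w"
begin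

lemma good_space: "w \<in> space M" using w by (simp add: good_def)

lemma good_zeta: "continuous_on {0..T} (\<lambda>t. \<zeta> i t w)"
  using w zeta_0 by (cases "i \<in> {1..N}") (auto simp: good_def)

lemma good_g: assumes i: "i \<in> {1..N}" shows "set_integrable lborel {0..T} (\<lambda>t. g i t w)"
proof -
  have bd: "set_integrable lborel {0..T} (\<lambda>t. a t w * f t w)"
    if a: "(\<lambda>x. a (fst x) (snd x)) \<in> borel_measurable LM" "\<And>t. \<bar>a t w\<bar> \<le> K" 
      and f: "set_integrable lborel {0..T} (\<lambda>t. f t w)" for a f :: "real \<Rightarrow> 'a \<Rightarrow> real"
    unfolding integrable_time_measure[symmetric]
  proof (rule Bochner_Integration.integrable_bound)
    have fi: "integrable (time_measure T) (\<lambda>t. f t w)" using f by (simp add: integrable_time_measure)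
    then show "integrable (time_measure T) (\<lambda>t. K * f t w)" by simp
    show "(\<lambda>t. a t w * f t w) \<in> borel_measurable (time_measure T)"
      using sample_section[OF good_space a(1)] fi by (intro borel_measurable_times) auto
    show "AE t in time_measure T. norm (a t w * f t w) \<le> norm (K * f t w)"
      using a(2) K_nonneg by (intro AE_I2) (auto simp: abs_mult intro!: mult_right_mono)
  qed
  have "set_integrable lborel {0..T} (\<lambda>t. laplacian h (\<lambda>j. \<zeta> j t w) i)"
    unfolding laplacian_def using h_eq by (intro set_integrable_continuous continuous_intros good_zeta) auto
  moreover have "set_integrable lborel {0..T} (\<lambda>t. \<alpha> i t w * \<zeta> i t w)"
    by (intro bd alpha_m[OF i] alpha_bound set_integrable_continuous good_zeta)
  moreover have "set_integrable lborel {0..T} (\<lambda>t. \<beta> i t w * Z i t w)"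
    using w i by (intro bd[OF beta_m[OF i] beta_bound]) (auto simp: good_def)
  ultimately show ?thesis unfolding g_def by (intro set_integral_add)
qed

lemma good_I: "i \<in> {1..N} \<Longrightarrow> has_primitive T (\<lambda>t. g i t w) (\<lambda>t. I i t w)"
  unfolding I_def by (rule has_primitive_integral[OF good_g])

text \<open>In \<open>\<zeta> + D\<close> the value of \<open>\<zeta>\<close> at time
  \<open>t\<close> cancels; what remains is a constant minus \<open>I\<close>, so the noise has left
  the equation.\<close>

lemma good_D: assumes i: "i \<in> {1..N}" shows "continuous_on {0..T} (\<lambda>t. D i t w)" "D i T w = 0"
  "has_primitive T (\<lambda>t. - g i t w) (\<lambda>t. \<zeta> i t w + D i t w)"
proof -
  show "continuous_on {0..T} (\<lambda>t. D i t w)"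
    unfolding D_def by (intro continuous_intros good_zeta has_primitive_continuous[OF good_I[OF i]])
  show "D i T w = 0" by (simp add: D_def)
  have "has_primitive T (\<lambda>t. 0 + (-1) * g i t w) (\<lambda>t. (\<zeta> i T w + I i T w) + (-1) * I i t w)"
    by (intro has_primitive_add has_primitive_const has_primitive_cmult good_I i)
  then show "has_primitive T (\<lambda>t. - g i t w) (\<lambda>t. \<zeta> i t w + D i t w)"
    by (rule has_primitive_cong) (use T_pos in \<open>auto simp: D_def\<close>)
qed

lemma good_d: "continuous_on {0..T} (sine_coefficient N (\<lambda>i t. D i t w) k)"
  unfolding sine_coefficient_def by (intro continuous_intros good_D) auto

end

text \<open>Jensen path by path, then Fubini. The bound on \<open>d\<close> is uniform in time and
  the kernel has mass at most 1, so the constant 16 is not worsened.\<close>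

lemma r_second_moment:
  assumes t: "t \<in> {0..T}"
  shows "(\<integral>\<^sup>+w. ennreal ((r k t w)\<^sup>2) \<partial>M)
    \<le> 16 * (\<integral>\<^sup>+x. ennreal ((\<Sum>i=1..N. sine_mode N k i * Z i (fst x) (snd x))\<^sup>2) \<partial>LM)" (is "_ \<le> 16 * ?A")
proof -
  define \<phi> where "\<phi> s = ennreal (sine_eigenvalue N k * exp (- sine_eigenvalue N k * (s - t))) * indicator {t..T} s" for s
  have pm: "\<phi> \<in> borel_measurable (time_measure T)"
    unfolding \<phi>_def by (intro measurable_restrict_space1) simp
  have dm: "(\<lambda>x. ennreal ((d k (fst x) (snd x))\<^sup>2)) \<in> borel_measurable LM" using d_m[of k] by measurable
  have fm: "(\<lambda>x. \<phi> (fst x) * ennreal ((d k (fst x) (snd x))\<^sup>2)) \<in> borel_measurable LM"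
    by (intro borel_measurable_times_ennreal measurable_compose[OF measurable_fst pm] dm)
  have "(\<integral>\<^sup>+w. ennreal ((r k t w)\<^sup>2) \<partial>M) \<le> (\<integral>\<^sup>+w. (\<integral>\<^sup>+s. \<phi> s * ennreal ((d k s w)\<^sup>2) \<partial>time_measure T) \<partial>M)"
  proof (rule nn_integral_mono_AE)
    show "AE w in M. ennreal ((r k t w)\<^sup>2) \<le> (\<integral>\<^sup>+s. \<phi> s * ennreal ((d k s w)\<^sup>2) \<partial>time_measure T)"
      using AE_good
    proof eventually_elim
      case (elim w)
      have "ennreal ((r k t w)\<^sup>2) \<le> (\<integral>\<^sup>+s\<in>{t..T}. ennreal (sine_eigenvalue N k * exp (- sine_eigenvalue N k * (s - t)) * (d k s w)\<^sup>2) \<partial>lborel)"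
        unfolding r_def d_def by (rule convolved_coefficient_square_le[OF good_d[OF elim] t])
      also have "\<dots> = (\<integral>\<^sup>+s\<in>{0..T}. \<phi> s * ennreal ((d k s w)\<^sup>2) \<partial>lborel)"
        using t by (intro nn_integral_cong) (auto simp: \<phi>_def indicator_def ennreal_mult sine_eigenvalue_nonneg)
      also have "\<dots> = (\<integral>\<^sup>+s. \<phi> s * ennreal ((d k s w)\<^sup>2) \<partial>time_measure T)"
        by (subst nn_integral_restrict_space) auto
      finally show ?case .
    qed
  qed
  also have "\<dots> = (\<integral>\<^sup>+s. (\<integral>\<^sup>+w. \<phi> s * ennreal ((d k s w)\<^sup>2) \<partial>M) \<partial>time_measure T)"
    using Fubini[of "\<lambda>x. \<phi> (fst x) * ennreal ((d k (fst x) (snd x))\<^sup>2)"] fm by simp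
  also have "\<dots> \<le> (\<integral>\<^sup>+s. 16 * ?A * \<phi> s \<partial>time_measure T)"
  proof (rule nn_integral_mono)
    fix s assume "s \<in> space (time_measure T)"
    then have s: "s \<in> {0..T}" by (simp add: space_restrict_space)
    have "(\<lambda>w. d k s w) \<in> borel_measurable M" by (rule time_section[OF s d_m])
    then have "(\<integral>\<^sup>+w. \<phi> s * ennreal ((d k s w)\<^sup>2) \<partial>M) = \<phi> s * (\<integral>\<^sup>+w. ennreal ((d k s w)\<^sup>2) \<partial>M)"
      by (intro nn_integral_cmult) auto
    also have "\<dots> \<le> \<phi> s * (16 * ?A)" by (intro mult_left_mono d_second_moment[OF s]) auto
    finally show "(\<integral>\<^sup>+w. \<phi> s * ennreal ((d k s w)\<^sup>2) \<partial>M) \<le> 16 * ?A * \<phi> s" by (simp add: mult.commute)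
  qed
  also have "\<dots> = 16 * ?A * (\<integral>\<^sup>+s. \<phi> s \<partial>time_measure T)" by (rule nn_integral_cmult[OF pm])
  also have "\<dots> \<le> 16 * ?A * 1"
  proof (rule mult_left_mono)
    have "(\<integral>\<^sup>+s. \<phi> s \<partial>time_measure T) = (\<integral>\<^sup>+s\<in>{0..T}. \<phi> s \<partial>lborel)"
      by (rule nn_integral_restrict_space) simp
    also have "\<dots> = (\<integral>\<^sup>+s\<in>{t..T}. ennreal (sine_eigenvalue N k * exp (- sine_eigenvalue N k * (s - t))) \<partial>lborel)"
      using t by (intro nn_integral_cong) (auto simp: \<phi>_def indicator_def)
    also have "\<dots> \<le> 1" using t by (intro exponential_kernel_mass sine_eigenvalue_nonneg) auto
    finally show "(\<integral>\<^sup>+s. \<phi> s \<partial>time_measure T) \<le> 1" .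
  qed simp
  finally show ?thesis by simp
qed

text \<open>Parseval is used twice: to split \<open>q\<close> into modes, and to reassemble the
  modes of \<open>Z\<close> after each has been estimated. The 64 is twice 16 for each of the two
  parts of a mode.\<close>

lemma q_second_moment:
  assumes t: "t \<in> {0..T}"
  shows "(\<integral>\<^sup>+w. ennreal (\<Sum>i=1..N. (q i t w)\<^sup>2) \<partial>M) \<le> 64 * (\<integral>\<^sup>+x. ennreal (\<Sum>i=1..N. (Z i (fst x) (snd x))\<^sup>2) \<partial>LM)"
proof -
  define A where "A k = (\<integral>\<^sup>+x. ennreal ((\<Sum>i=1..N. sine_mode N k i * Z i (fst x) (snd x))\<^sup>2) \<partial>LM)" for k
  have rm: "(\<lambda>w. r k t w) \<in> borel_measurable M" for k by (rule time_section[OF t r_m])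
  have dm: "(\<lambda>w. d k t w) \<in> borel_measurable M" for k by (rule time_section[OF t d_m])
  have q: "(\<Sum>i=1..N. (q i t w)\<^sup>2) = (\<Sum>k=1..N. (r k t w + - d k t w)\<^sup>2)" for w
    unfolding q_def corrector_def sine_mode_parseval' by (simp add: r_def d_def)
  have "(\<integral>\<^sup>+w. ennreal (\<Sum>i=1..N. (q i t w)\<^sup>2) \<partial>M) = (\<Sum>k=1..N. \<integral>\<^sup>+w. ennreal ((r k t w + - d k t w)\<^sup>2) \<partial>M)"
    unfolding q using rm dm by (subst nn_integral_sum[symmetric]) (auto simp del: add_uminus_conv_diff)
  also have "\<dots> \<le> (\<Sum>k=1..N. 64 * A k)"
  proof (rule sum_mono)
    fix k
    have "(\<integral>\<^sup>+w. ennreal ((r k t w + - d k t w)\<^sup>2) \<partial>M) \<le> 2 * (\<integral>\<^sup>+w. ennreal ((r k t w)\<^sup>2) \<partial>M) + 2 * (\<integral>\<^sup>+w. ennreal ((- d k t w)\<^sup>2) \<partial>M)"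
      by (intro nn_integral_square_triangle borel_measurable_uminus rm dm)
    also have "\<dots> \<le> 2 * (16 * A k) + 2 * (16 * A k)"
      using r_second_moment[OF t, of k] d_second_moment[OF t, of k] by (intro add_mono mult_left_mono) (auto simp: A_def)
    also have "\<dots> = 64 * A k" by (simp add: mult.assoc[symmetric] flip: distrib_right)
    finally show "(\<integral>\<^sup>+w. ennreal ((r k t w + - d k t w)\<^sup>2) \<partial>M) \<le> 64 * A k" .
  qed
  also have "\<dots> = 64 * (\<Sum>k=1..N. A k)" by (simp add: sum_distrib_left)
  also have "(\<Sum>k=1..N. A k) = (\<integral>\<^sup>+x. ennreal (\<Sum>k=1..N. (\<Sum>i=1..N. sine_mode N k i * Z i (fst x) (snd x))\<^sup>2) \<partial>LM)"
  proof -
    have "(\<lambda>x. \<Sum>i=1..N. sine_mode N k i * Z i (fst x) (snd x)) \<in> borel_measurable LM" for k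
      by (intro borel_measurable_sum borel_measurable_times borel_measurable_const Z_m)
    then show ?thesis unfolding A_def by (subst nn_integral_sum[symmetric]) auto
  qed
  finally show ?thesis unfolding sine_mode_parseval .
qed

text \<open>In \<open>65 + 64 * T\<close> the 1 is for \<open>Z\<close> itself,
  \<open>64 * T\<close> for the corrector integrated over time, and 64 for the corrector at time 0.
  Nonnegative integrals are used so that no finiteness has to be known yet.\<close>

lemma expectation_observability:
  assumes C: "0 \<le> C"
    and det: "\<And>p G f. backward_heat N h T K p G f \<Longrightarrow> (\<Sum>i=1..N. (p i 0)\<^sup>2)
     \<le> C * ((LINT t:{0..T}|lborel. (\<Sum>i=1..N. (f i t)\<^sup>2))
        + (LINT t:{0..T}|lborel. (\<Sum>i\<in>A. (p i t)\<^sup>2))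
        + E * (\<Sum>i=1..N. (p i T)\<^sup>2))"
    and A: "A \<subseteq> {1..N}" and E: "0 \<le> E"
  shows "(\<integral>\<^sup>+w. ennreal (\<Sum>i=1..N. (\<zeta> i 0 w)\<^sup>2) \<partial>M) \<le> ennreal ((4 * C * (K\<^sup>2 + 1) + 2) * (65 + 64 * T)) *
     ((\<integral>\<^sup>+x. ennreal (\<Sum>i=1..N. (Z i (fst x) (snd x))\<^sup>2) \<partial>LM)
      + (\<integral>\<^sup>+x. ennreal (\<Sum>i\<in>A. (\<zeta> i (fst x) (snd x))\<^sup>2) \<partial>LM)
      + ennreal E * (\<integral>\<^sup>+w. ennreal (\<Sum>i=1..N. (\<zeta> i T w)\<^sup>2) \<partial>M))"
proof -
  define c where "c = 4 * C * (K\<^sup>2 + 1) + 2"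
  have c: "0 \<le> c" using C by (simp add: c_def)
  have t0: "0 \<in> {0..T}" "T \<in> {0..T}" using T_pos by auto
  define Zs where "Zs t w = (\<Sum>i=1..N. (Z i t w)\<^sup>2)" for t w
  define Ns where "Ns t w = (\<Sum>i\<in>A. (\<zeta> i t w)\<^sup>2)" for t w
  define Qs where "Qs t w = (\<Sum>i=1..N. (q i t w)\<^sup>2)" for t w
  define Ts where "Ts w = (\<Sum>i=1..N. (\<zeta> i T w)\<^sup>2)" for w
  have nn: "0 \<le> Zs t w" "0 \<le> Ns t w" "0 \<le> Qs t w" "0 \<le> Ts w" for t w
    by (auto simp: Zs_def Ns_def Qs_def Ts_def intro!: sum_nonneg)
  have m: "(\<lambda>x. Zs (fst x) (snd x)) \<in> borel_measurable LM" "(\<lambda>x. Ns (fst x) (snd x)) \<in> borel_measurable LM"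
    "(\<lambda>x. Qs (fst x) (snd x)) \<in> borel_measurable LM"
    unfolding Zs_def Ns_def Qs_def by (intro borel_measurable_sum borel_measurable_power Z_m zeta_m' q_m; assumption)+
  have mQ0: "(\<lambda>w. Qs 0 w) \<in> borel_measurable M" by (rule time_section[OF t0(1) m(3)])
  have mT: "Ts \<in> borel_measurable M" unfolding Ts_def
    by (intro borel_measurable_sum borel_measurable_power time_section[OF t0(2) zeta_m'])
  let ?in = "\<lambda>f w. \<integral>\<^sup>+t. ennreal (f t w) \<partial>time_measure T"
  have inm: "?in f \<in> borel_measurable M" if "(\<lambda>x. f (fst x) (snd x)) \<in> borel_measurable LM" for f :: "real \<Rightarrow> 'a \<Rightarrow> real"
  proof -
    have "(\<lambda>x. ennreal (f (fst x) (snd x))) \<in> borel_measurable LM" using that by measurable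
    from measurable_compose[OF measurable_pair_swap' this]
    show ?thesis using L.borel_measurable_nn_integral[of "\<lambda>w t. ennreal (f t w)" M] by (simp add: case_prod_beta' split_def)
  qed
  have int_in: "(\<integral>\<^sup>+w. ?in f w \<partial>M) = (\<integral>\<^sup>+x. ennreal (f (fst x) (snd x)) \<partial>LM)" if "(\<lambda>x. f (fst x) (snd x)) \<in> borel_measurable LM" for f :: "real \<Rightarrow> 'a \<Rightarrow> real"
  proof -
    have "(\<lambda>x. ennreal (f (fst x) (snd x))) \<in> borel_measurable LM" using that by measurable
    from nn_integral_snd[OF this] show ?thesis by simp
  qed
  have path: "AE w in M. ennreal (\<Sum>i=1..N. (\<zeta> i 0 w)\<^sup>2)
     \<le> ennreal c * (?in Zs w + ?in Ns w + ennreal E * ennreal (Ts w) + ?in Qs w + ennreal (Qs 0 w))"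
    using AE_good
  proof eventually_elim
    case (elim w)
    have Zi: "set_integrable lborel {0..T} (\<lambda>t. Z i t w)" "set_integrable lborel {0..T} (\<lambda>t. (Z i t w)\<^sup>2)" if "i \<in> {1..N}" for i
      using elim that by (auto simp: good_def)
    have ineq: "(\<Sum>i=1..N. (\<zeta> i 0 w)\<^sup>2) \<le> c * ((LINT t:{0..T}|lborel. Zs t w) + (LINT t:{0..T}|lborel. Ns t w) + E * Ts w
       + (LINT t:{0..T}|lborel. Qs t w) + Qs 0 w)"
      unfolding Zs_def Ns_def Qs_def Ts_def c_def q_def
    proof (rule pathwise_observability[where \<alpha>="\<lambda>i t. \<alpha> i t w" and \<beta>="\<lambda>i t. \<beta> i t w"])
      show "has_primitive T (\<lambda>t. - (laplacian h (\<lambda>j. \<zeta> j t w) i + \<alpha> i t w * \<zeta> i t w + \<beta> i t w * Z i t w)) (\<lambda>t. \<zeta> i t w + D i t w)"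
        if "i \<in> {1..N}" for i using good_D(3)[OF elim that] unfolding g_def .
    qed (fact h_eq T_pos K_nonneg C det A E zeta_0 | simp add: good_zeta[OF elim] good_D(1,2)[OF elim] Zi alpha_bound beta_bound)+
    have qc: "continuous_on {0..T} (\<lambda>t. q i t w)" for i
      unfolding q_def using T_pos by (intro corrector_continuous good_D(1)[OF elim]) auto
    have i: "set_integrable lborel {0..T} (\<lambda>t. Zs t w)" "set_integrable lborel {0..T} (\<lambda>t. Ns t w)" "set_integrable lborel {0..T} (\<lambda>t. Qs t w)"
    proof -
      show "set_integrable lborel {0..T} (\<lambda>t. Zs t w)" unfolding Zs_def by (intro set_integrable_sum Zi)
      show "set_integrable lborel {0..T} (\<lambda>t. Ns t w)" unfolding Ns_def
        by (intro set_integrable_continuous continuous_intros good_zeta[OF elim])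
      show "set_integrable lborel {0..T} (\<lambda>t. Qs t w)" unfolding Qs_def
        by (intro set_integrable_continuous continuous_intros qc)
    qed
    have conv: "ennreal (LINT t:{0..T}|lborel. f t w) = ?in f w" 
      if "set_integrable lborel {0..T} (\<lambda>t. f t w)" "\<And>t. 0 \<le> f t w" for f :: "real \<Rightarrow> 'a \<Rightarrow> real"
      unfolding ennreal_set_integral[OF that] by (subst nn_integral_restrict_space) auto
    have pos: "0 \<le> (LINT t:{0..T}|lborel. f t w)" if "\<And>t. 0 \<le> f t w" for f :: "real \<Rightarrow> 'a \<Rightarrow> real"
      using that by (auto simp: set_lebesgue_integral_def intro!: Bochner_Integration.integral_nonneg)
    have "ennreal (\<Sum>i=1..N. (\<zeta> i 0 w)\<^sup>2) \<le> ennreal (c * ((LINT t:{0..T}|lborel. Zs t w) + (LINT t:{0..T}|lborel. Ns t w) + E * Ts w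
       + (LINT t:{0..T}|lborel. Qs t w) + Qs 0 w))" by (rule ennreal_leI[OF ineq])
    also have "\<dots> = ennreal c * (ennreal (LINT t:{0..T}|lborel. Zs t w) + ennreal (LINT t:{0..T}|lborel. Ns t w) + ennreal E * ennreal (Ts w)
       + ennreal (LINT t:{0..T}|lborel. Qs t w) + ennreal (Qs 0 w))"
      using c nn pos[of Zs] pos[of Ns] pos[of Qs] E by (simp add: ennreal_mult ennreal_plus)
    finally show ?case using conv[of Zs, OF i(1)] conv[of Ns, OF i(2)] conv[of Qs, OF i(3)] nn by simp
  qed
  let ?Z = "\<integral>\<^sup>+x. ennreal (Zs (fst x) (snd x)) \<partial>LM" and ?N = "\<integral>\<^sup>+x. ennreal (Ns (fst x) (snd x)) \<partial>LM"
    and ?X = "ennreal E * (\<integral>\<^sup>+w. ennreal (Ts w) \<partial>M)"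
  have Q0: "(\<integral>\<^sup>+w. ennreal (Qs 0 w) \<partial>M) \<le> 64 * ?Z" unfolding Qs_def Zs_def by (rule q_second_moment[OF t0(1)])
  have Q: "(\<integral>\<^sup>+w. ?in Qs w \<partial>M) \<le> ennreal (64 * T) * ?Z"
  proof -
    have "(\<lambda>x. ennreal (Qs (fst x) (snd x))) \<in> borel_measurable LM" using m(3) by measurable
    from Fubini[OF this] have "(\<integral>\<^sup>+w. ?in Qs w \<partial>M) = (\<integral>\<^sup>+t. (\<integral>\<^sup>+w. ennreal (Qs t w) \<partial>M) \<partial>time_measure T)" by simp
    also have "\<dots> \<le> (\<integral>\<^sup>+t. 64 * ?Z \<partial>time_measure T)"
      unfolding Qs_def Zs_def by (intro nn_integral_mono q_second_moment) (simp add: space_restrict_space)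
    also have "\<dots> = 64 * ?Z * ennreal T"
      using T_pos by (simp add: emeasure_restrict_space space_restrict_space emeasure_lborel_Icc_eq)
    finally show ?thesis using T_pos by (simp add: ennreal_mult mult_ac)
  qed
  have "(\<integral>\<^sup>+w. ennreal (\<Sum>i=1..N. (\<zeta> i 0 w)\<^sup>2) \<partial>M) 
    \<le> (\<integral>\<^sup>+w. ennreal c * (?in Zs w + ?in Ns w + ennreal E * ennreal (Ts w) + ?in Qs w + ennreal (Qs 0 w)) \<partial>M)"
    by (rule nn_integral_mono_AE[OF path])
  also have "\<dots> = ennreal c * (?Z + ?N + ?X + (\<integral>\<^sup>+w. ?in Qs w \<partial>M) + (\<integral>\<^sup>+w. ennreal (Qs 0 w) \<partial>M))"
    using inm[OF m(1)] inm[OF m(2)] inm[OF m(3)] mT mQ0 int_in[OF m(1)] int_in[OF m(2)]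
    by (simp add: nn_integral_cmult nn_integral_add)
  also have "\<dots> \<le> ennreal c * (?Z + ?N + ?X + ennreal (64 * T) * ?Z + 64 * ?Z)"
    by (intro mult_left_mono add_mono Q Q0) auto
  also have "\<dots> \<le> ennreal c * (ennreal (65 + 64 * T) * (?Z + ?N + ?X))"
  proof (intro mult_left_mono)
    have "?Z + ?N + ?X + ennreal (64 * T) * ?Z + 64 * ?Z = ennreal (65 + 64 * T) * ?Z + (?N + ?X)"
    proof -
      have "ennreal (65 + 64 * T) = ennreal (1 + 64 * T + 64)" by (simp add: algebra_simps)
      also have "\<dots> = ennreal 1 + ennreal (64 * T) + ennreal 64" using T_pos by (simp only: ennreal_plus)
      finally have "ennreal (65 + 64 * T) = 1 + ennreal (64 * T) + 64" by simp
      then show ?thesis by (simp only: distrib_right mult_1_left add_ac)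
    qed
    also have "\<dots> \<le> ennreal (65 + 64 * T) * ?Z + ennreal (65 + 64 * T) * (?N + ?X)"
    proof (intro add_left_mono)
      have "ennreal 1 \<le> ennreal (65 + 64 * T)" using T_pos by (intro ennreal_leI) simp
      then have "1 * (?N + ?X) \<le> ennreal (65 + 64 * T) * (?N + ?X)"
        unfolding ennreal_1 by (intro mult_right_mono) auto
      then show "?N + ?X \<le> ennreal (65 + 64 * T) * (?N + ?X)" by simp
    qed
    finally show "?Z + ?N + ?X + ennreal (64 * T) * ?Z + 64 * ?Z \<le> ennreal (65 + 64 * T) * (?Z + ?N + ?X)"
      by (simp add: distrib_left add.assoc)
  qed auto
  also have "\<dots> = ennreal (c * (65 + 64 * T)) * (?Z + ?N + ?X)" using c T_pos by (simp add: ennreal_mult mult.assoc)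
  finally show ?thesis unfolding c_def Zs_def Ns_def Ts_def .
qed

end

section \<open>Observability of the backward equation\<close>

lemma mesh_sum:
  fixes f :: "real \<Rightarrow> real"
  shows "(\<Sum>x\<in>mesh N. f x) = (\<Sum>i=1..N. f (real i * mesh_size N))"
proof -
  have "inj_on (\<lambda>i. real i * mesh_size N) {1..N}"
    by (rule inj_onI) (simp add: mesh_size_def)
  then show ?thesis unfolding mesh_def by (simp add: sum.reindex)
qed

lemma mesh_integral_eq:
  "mesh_integral N (mesh N) u = mesh_size N * (\<Sum>i=1..N. u (real i * mesh_size N))"
  by (simp add: mesh_integral_def mesh_sum)

lemma finite_mesh: "finite (mesh N)"
  by (simp add: mesh_def)

lemma mesh_size_pos: "0 < mesh_size N"
  by (simp add: mesh_size_def)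

lemma mesh_node: "i \<in> {1..N} \<Longrightarrow> real i * mesh_size N \<in> mesh N"
  by (auto simp: mesh_def)

lemma mesh_node_range: "i \<in> {1..N} \<Longrightarrow> 0 < real i * mesh_size N \<and> real i * mesh_size N < 1"
  by (auto simp: mesh_size_def)

lemma mesh_integral_nonneg:
  assumes "\<And>x. 0 \<le> u x" shows "0 \<le> mesh_integral N W u"
  unfolding mesh_integral_def using mesh_size_pos[of N] assms by (intro mult_nonneg_nonneg sum_nonneg) auto

context brownian_space
begin

text \<open>Needed because the final statement is about Bochner integrals, for which Tonelli
  requires finiteness first.\<close>

lemma ennreal_double_integral:
  assumes m: "(\<lambda>x. f (fst x) (snd x)) \<in> borel_measurable (time_measure T \<Otimes>\<^sub>M M)"
    and nonneg: "\<And>t w. 0 \<le> f t w"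
    and fin: "(\<integral>\<^sup>+x. ennreal (f (fst x) (snd x)) \<partial>(time_measure T \<Otimes>\<^sub>M M)) < \<infinity>"
  shows "ennreal (\<integral>w. (LINT t:{0..T}|lborel. f t w) \<partial>M) = (\<integral>\<^sup>+x. ennreal (f (fst x) (snd x)) \<partial>(time_measure T \<Otimes>\<^sub>M M))"
proof -
  interpret L: finite_measure "time_measure T" by (rule finite_measure_time)
  interpret LM: pair_sigma_finite "time_measure T" M ..
  have i: "integrable (time_measure T \<Otimes>\<^sub>M M) (\<lambda>x. f (fst x) (snd x))"
    by (rule integrableI_nonneg[OF m _ fin]) (use nonneg in auto)
  have "(LINT t:{0..T}|lborel. f t w) = (\<integral>t. f t w \<partial>time_measure T)" for w
    unfolding set_lebesgue_integral_def by (subst integral_restrict_space) auto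
  then have "(\<integral>w. (LINT t:{0..T}|lborel. f t w) \<partial>M) = (\<integral>x. f (fst x) (snd x) \<partial>(time_measure T \<Otimes>\<^sub>M M))"
    using LM.integral_snd[of f] i by (simp add: case_prod_beta')
  then show ?thesis using nn_integral_eq_integral[OF i] nonneg by simp
qed

text \<open>The coefficients are truncated to \<open>[-K, K]\<close> because the bound on the sampled coefficients holds only
  almost everywhere; the truncation does not change the integrals in the equation.\<close>

lemma backward_solution_bsde:
  assumes T: "0 < T" and K: "0 \<le> K"
    and a1: "Linf_coefficient M (brownian_filtration M B) T a1" "mesh_coefficient_bound M T K a1"
    and a2: "Linf_coefficient M (brownian_filtration M B) T a2" "mesh_coefficient_bound M T K a2"
    and sol: "backward_solution M (brownian_filtration M B) B T N a1 a2 zT z Z"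
  shows "bsde_solution M B T K (mesh_size N) N
    (\<lambda>i t w. max (- K) (min K (a1 t w (real i * mesh_size N))))
    (\<lambda>i t w. max (- K) (min K (a2 t w (real i * mesh_size N))))
    (\<lambda>i t w. if i \<in> {1..N} then z t w (real i * mesh_size N) else 0)
    (\<lambda>i t w. Z t w (real i * mesh_size N))"
proof -
  let ?F = "brownian_filtration M B" and ?LM = "time_measure T \<Otimes>\<^sub>M M"
  interpret L: finite_measure "time_measure T" by (rule finite_measure_time)
  interpret LM: pair_sigma_finite "time_measure T" M ..
  define h where "h = mesh_size N"
  have h: "0 < h" "real (Suc N) * h = 1" by (auto simp: h_def mesh_size_def)
  define x where "x i = real i * h" for i :: nat
  have xm: "x i \<in> mesh N" if "i \<in> {1..N}" for i using mesh_node[OF that] by (simp add: x_def h_def)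
  define cl where "cl u = max (- K) (min K u)" for u :: real
  define \<zeta> where "\<zeta> i t w = (if i \<in> {1..N} then z t w (x i) else 0)" for i t w
  have am: "(\<lambda>y. a (fst y) (snd y) (x i)) \<in> borel_measurable ?LM" if a: "Linf_coefficient M ?F T a" and i: "i \<in> {1..N}" for a i
  proof -
    have 1: "(\<lambda>((t, w), x). a t w x) \<in> borel_measurable (?LM \<Otimes>\<^sub>M restrict_space lborel {0<..<1})"
      using a unfolding Linf_coefficient_def by (rule conjunct1)
    have 2: "(\<lambda>y. (y, x i)) \<in> measurable ?LM (?LM \<Otimes>\<^sub>M restrict_space lborel {0<..<1})"
      using mesh_node_range[OF i] by (intro measurable_Pair2') (simp add: space_restrict_space x_def h_def)
    from measurable_compose[OF 2 1] show ?thesis by (simp add: case_prod_beta')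
  qed
  have adm: "(\<lambda>y. f (fst y) (snd y)) \<in> borel_measurable ?LM" if "adapted_process M ?F T f" for f
    using that unfolding adapted_process_def by (simp add: case_prod_beta')
  note sol' = sol[unfolded backward_solution_def]
  have sol_z: "L2_continuous_process M ?F T N z" by (rule conjunct1[OF sol'])
  have sol_Z: "L2_process M ?F T N Z" by (rule conjunct1[OF conjunct2[OF sol']])
  have sol_0: "z t w 0 = 0 \<and> z t w 1 = 0" if "t \<in> {0..T}" "w \<in> space M" for t w
    using conjunct1[OF conjunct2[OF conjunct2[OF sol']]] that by blast
  note sol_eq = bspec[OF conjunct1[OF conjunct2[OF conjunct2[OF conjunct2[OF sol']]]]]
  have zm: "(\<lambda>y. z (fst y) (snd y) (x i)) \<in> borel_measurable ?LM" if "i \<in> {1..N}" for i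
    using sol_z xm[OF that] unfolding L2_continuous_process_def by (intro adm) auto
  have zetam: "(\<lambda>y. \<zeta> i (fst y) (snd y)) \<in> borel_measurable ?LM" for i
    using zm[of i] by (cases "i \<in> {1..N}") (auto simp: \<zeta>_def)
  have Zm: "(\<lambda>y. Z (fst y) (snd y) (x i)) \<in> borel_measurable ?LM" if "i \<in> {1..N}" for i
    using sol_Z xm[OF that] unfolding L2_process_def by (intro adm) auto
  have path_m: "(\<lambda>t. f t w) \<in> borel_measurable (time_measure T)" if "(\<lambda>y. f (fst y) (snd y)) \<in> borel_measurable ?LM" "w \<in> space M" for f :: "real \<Rightarrow> 'a \<Rightarrow> real" and w
  proof -
    have "(\<lambda>t. (t, w)) \<in> measurable (time_measure T) ?LM" using that(2) by (rule measurable_Pair2')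
    from measurable_compose[OF this that(1)] show ?thesis by simp
  qed
  \<comment> \<open>The bound holds almost everywhere on the product, with time as first factor,
    while the equation is read path by path; the order of the two quantifiers has to be exchanged,
    which needs measurability of the exceptional set.\<close>
  have clip: "AE w in M. AE t in time_measure T. cl (a t w (x i)) = a t w (x i)"
    if a: "Linf_coefficient M ?F T a" "mesh_coefficient_bound M T K a" and i: "i \<in> {1..N}" for a i
  proof -
    have "AE y in ?LM. case y of (t, w) \<Rightarrow> \<forall>x\<in>mesh N. \<bar>a t w x\<bar> \<le> K"
      using a(2) unfolding mesh_coefficient_bound_def by blast
    then have "AE y in ?LM. cl (a (fst y) (snd y) (x i)) = a (fst y) (snd y) (x i)"
      by eventually_elim (use xm[OF i] in \<open>auto simp: cl_def abs_le_iff max_def min_def split: prod.splits\<close>)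
    then have "AE t in time_measure T. AE w in M. cl (a t w (x i)) = a t w (x i)"
      by (rule LM.AE_pair[THEN AE_mp]) simp
    moreover have "{y \<in> space ?LM. cl (a (fst y) (snd y) (x i)) = a (fst y) (snd y) (x i)} \<in> sets ?LM"
      unfolding cl_def using am[OF a(1) i] by measurable
    ultimately show ?thesis
      using LM.AE_commute[of "\<lambda>t w. cl (a t w (x i)) = a t w (x i)"] by simp
  qed
  have equation: "\<exists>J. is_ito_integral M ?F B T (\<lambda>t w. Z t w (x i)) J \<and>
        (\<forall>t\<in>{0..T}. AE w in M. \<zeta> i t w = \<zeta> i 0 w
           - (LINT s:{0..t}|lborel. laplacian h (\<lambda>j. \<zeta> j s w) i + cl (a1 s w (x i)) * \<zeta> i s w + cl (a2 s w (x i)) * Z s w (x i)) + J t w)"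
    if i: "i \<in> {1..N}" for i
  proof -
    obtain J where J: "is_ito_integral M ?F B T (\<lambda>t w. Z t w (x i)) J"
      and Je: "\<And>t. t \<in> {0..T} \<Longrightarrow> AE w in M.
           z t w (x i) = z 0 w (x i)
             - (LINT s:{0..t}|lborel. mesh_D2 N (z s w) (x i) + a1 s w (x i) * z s w (x i) + a2 s w (x i) * Z s w (x i))
             + J t w"
      using sol_eq[OF xm[OF i]] by blast
    have lap: "mesh_D2 N (z s w) (x i) = laplacian h (\<lambda>j. \<zeta> j s w) i" if s: "s \<in> {0..T}" "w \<in> space M" for s w
    proof -
      \<comment> \<open>The nodes 0 and \<open>Suc N\<close> lie exactly at 0 and 1, so the
        Dirichlet condition of the solution matches the zero extension of
        \<open>\<zeta>\<close>.\<close>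
      have node: "z s w (x j) = \<zeta> j s w" if "j \<le> Suc N" for j
      proof -
        have "j \<in> {1..N} \<or> j = 0 \<or> j = Suc N" using that by force
        then show ?thesis using sol_0[OF s] h by (auto simp: \<zeta>_def x_def)
      qed
      have "x i + mesh_size N = x (Suc i)" "x i - mesh_size N = x (i - 1)"
        using i by (cases i; simp add: x_def h_def algebra_simps)+
      moreover have "i - 1 \<le> Suc N" "i \<le> Suc N" "Suc i \<le> Suc N" using i by auto
      ultimately show ?thesis unfolding mesh_D2_def laplacian_def h_def[symmetric] by (simp only: node)
    qed
    have "AE w in M. \<zeta> i t w = \<zeta> i 0 w
           - (LINT s:{0..t}|lborel. laplacian h (\<lambda>j. \<zeta> j s w) i + cl (a1 s w (x i)) * \<zeta> i s w + cl (a2 s w (x i)) * Z s w (x i)) + J t w"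
      if t: "t \<in> {0..T}" for t
      using Je[OF t] clip[OF a1 i] clip[OF a2 i] AE_space
    proof eventually_elim
      case (elim w)
      let ?f = "\<lambda>s. mesh_D2 N (z s w) (x i) + a1 s w (x i) * z s w (x i) + a2 s w (x i) * Z s w (x i)"
      let ?f' = "\<lambda>s. laplacian h (\<lambda>j. \<zeta> j s w) i + a1 s w (x i) * \<zeta> i s w + a2 s w (x i) * Z s w (x i)"
      let ?g = "\<lambda>s. laplacian h (\<lambda>j. \<zeta> j s w) i + cl (a1 s w (x i)) * \<zeta> i s w + cl (a2 s w (x i)) * Z s w (x i)"
      have int: "(LINT s:{0..t}|lborel. u s) = (\<integral>s. indicator {0..t} s * u s \<partial>time_measure T)" for u :: "real \<Rightarrow> real"
      proof -
        have "(\<integral>s. indicator {0..t} s * u s \<partial>time_measure T) = (\<integral>s. indicator {0..T} s *\<^sub>R (indicator {0..t} s * u s) \<partial>lborel)"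
          by (rule integral_restrict_space) simp
        also have "\<dots> = (LINT s:{0..t}|lborel. u s)" unfolding set_lebesgue_integral_def
          using t by (intro Bochner_Integration.integral_cong) (auto simp: indicator_def)
        finally show ?thesis by simp
      qed
      have "(LINT s:{0..t}|lborel. ?f s) = (LINT s:{0..t}|lborel. ?f' s)"
        using t i lap[OF _ elim(4)] by (intro set_lebesgue_integral_cong) (auto simp: \<zeta>_def)
      also have "\<dots> = (LINT s:{0..t}|lborel. ?g s)"
        unfolding int
      proof (rule integral_cong_AE)
        have ind: "(\<lambda>s. indicator {0..t} s :: real) \<in> borel_measurable (time_measure T)"
          by (intro measurable_restrict_space1) simp
        have lapm: "(\<lambda>s. laplacian h (\<lambda>j. \<zeta> j s w) i) \<in> borel_measurable (time_measure T)"
          unfolding laplacian_def using path_m[OF zetam elim(4)] by measurable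
        have cm: "(\<lambda>s. cl (a s w (x i))) \<in> borel_measurable (time_measure T)" if "(\<lambda>s. a s w (x i)) \<in> borel_measurable (time_measure T)" for a
          unfolding cl_def using that by measurable
        note s1 = path_m[OF am[OF a1(1) i] elim(4)] and s2 = path_m[OF am[OF a2(1) i] elim(4)]
        show "(\<lambda>s. indicator {0..t} s * ?f' s) \<in> borel_measurable (time_measure T)"
          by (intro borel_measurable_times borel_measurable_add ind lapm s1 s2 path_m[OF zetam elim(4)] path_m[OF Zm[OF i] elim(4)])
        show "(\<lambda>s. indicator {0..t} s * ?g s) \<in> borel_measurable (time_measure T)"
          by (intro borel_measurable_times borel_measurable_add ind lapm cm s1 s2 path_m[OF zetam elim(4)] path_m[OF Zm[OF i] elim(4)])
        show "AE s in time_measure T. indicator {0..t} s * ?f' s = indicator {0..t} s * ?g s"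
          using elim(2,3) by eventually_elim simp
      qed
      finally show ?case using elim(1) i by (simp add: \<zeta>_def)
    qed
    then show ?thesis using J by blast
  qed
  have Z2: "(\<integral>\<^sup>+y. ennreal ((Z (fst y) (snd y) (x i))\<^sup>2) \<partial>?LM) < \<infinity>" if i: "i \<in> {1..N}" for i
  proof -
    let ?m = "\<lambda>y. mesh_integral N (mesh N) (\<lambda>x. (Z (fst y) (snd y) x)\<^sup>2)"
    have mm: "(\<lambda>y. ennreal (?m y)) \<in> borel_measurable ?LM"
      unfolding mesh_integral_eq h_def[symmetric] x_def[symmetric]
      by (intro measurable_compose[OF _ measurable_ennreal] borel_measurable_times borel_measurable_sum borel_measurable_power borel_measurable_const Zm)
    have fin: "(\<integral>\<^sup>+y. ennreal (?m y) \<partial>?LM) < \<infinity>"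
      using nn_integral_time_measure[OF mm] sol_Z unfolding L2_process_def by simp
    have "(\<integral>\<^sup>+y. ennreal ((Z (fst y) (snd y) (x i))\<^sup>2) \<partial>?LM) \<le> (\<integral>\<^sup>+y. ennreal (1 / h) * ennreal (?m y) \<partial>?LM)"
    proof (rule nn_integral_mono)
      fix y
      have "(Z (fst y) (snd y) (x i))\<^sup>2 \<le> (\<Sum>i=1..N. (Z (fst y) (snd y) (x i))\<^sup>2)"
        using i by (intro member_le_sum) auto
      also have "\<dots> = 1 / h * ?m y" unfolding mesh_integral_eq h_def[symmetric] x_def[symmetric] using h by simp
      finally show "ennreal ((Z (fst y) (snd y) (x i))\<^sup>2) \<le> ennreal (1 / h) * ennreal (?m y)"
        using h mesh_integral_nonneg[of "\<lambda>x. (Z (fst y) (snd y) x)\<^sup>2" N "mesh N"]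
        by (subst ennreal_mult[symmetric]) (auto intro: ennreal_leI)
    qed
    also have "\<dots> = ennreal (1 / h) * (\<integral>\<^sup>+y. ennreal (?m y) \<partial>?LM)" by (rule nn_integral_cmult[OF mm])
    also have "\<dots> < \<infinity>" using fin by (simp add: ennreal_mult_less_top)
    finally show ?thesis .
  qed
  have clm: "(\<lambda>y. cl (a (fst y) (snd y) (x i))) \<in> borel_measurable ?LM" if "Linf_coefficient M ?F T a" "i \<in> {1..N}" for a i
    unfolding cl_def using am[OF that] by measurable
  have "bsde_solution M B T K h N (\<lambda>i t w. cl (a1 t w (x i))) (\<lambda>i t w. cl (a2 t w (x i))) \<zeta> (\<lambda>i t w. Z t w (x i))"
  proof unfold_locales
    show "0 < T" "0 \<le> K" by fact+
    show "h = 1 / (real N + 1)" by (simp add: h_def mesh_size_def)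
    show "(\<lambda>y. cl (a1 (fst y) (snd y) (x i))) \<in> borel_measurable ?LM" "(\<lambda>y. cl (a2 (fst y) (snd y) (x i))) \<in> borel_measurable ?LM"
      if "i \<in> {1..N}" for i using clm[OF a1(1) that] clm[OF a2(1) that] .
    show "\<bar>cl (a1 t w (x i))\<bar> \<le> K" "\<bar>cl (a2 t w (x i))\<bar> \<le> K" for i t w using K by (auto simp: cl_def)
    show "(\<lambda>y. \<zeta> i (fst y) (snd y)) \<in> borel_measurable ?LM" for i by (rule zetam)
    show "\<zeta> i t w = 0" if "i \<notin> {1..N}" for i t w using that by (auto simp: \<zeta>_def)
    have "AE w in M. \<forall>x\<in>mesh N. continuous_on {0..T} (\<lambda>t. z t w x)"
      using sol_z unfolding L2_continuous_process_def by blast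
    then show "AE w in M. \<forall>i\<in>{1..N}. continuous_on {0..T} (\<lambda>t. \<zeta> i t w)"
      by eventually_elim (use xm in \<open>auto simp: \<zeta>_def\<close>)
    show "(\<lambda>y. Z (fst y) (snd y) (x i)) \<in> borel_measurable ?LM" if "i \<in> {1..N}" for i by (rule Zm[OF that])
  qed (fact Z2 equation)+
  then show ?thesis unfolding \<zeta>_def x_def h_def cl_def .
qed

end

theorem theorem4p1:
  fixes M :: "'a measure" and B :: "real \<Rightarrow> 'a \<Rightarrow> real"
    and T K :: real and \<omega> :: "real set"
  assumes "brownian_space M B"
    and "T > 0"
    and "open \<omega>" and "\<omega> \<noteq> {}" and "\<omega> \<subseteq> {0<..<1}"
  shows "\<exists>h0 C C1. h0 > 0 \<and> C > 0 \<and> C1 > 0 \<and>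
    (\<forall>a1 a2.
       Linf_coefficient M (brownian_filtration M B) T a1 \<longrightarrow> mesh_coefficient_bound M T K a1 \<longrightarrow>
       Linf_coefficient M (brownian_filtration M B) T a2 \<longrightarrow> mesh_coefficient_bound M T K a2 \<longrightarrow>
       (\<forall>N zT z Z. mesh_size N \<le> h0 \<longrightarrow>
          L2_rv M (brownian_filtration M B T) N zT \<longrightarrow>
          backward_solution M (brownian_filtration M B) B T N a1 a2 zT z Z \<longrightarrow>
          (\<integral>w. mesh_integral N (mesh N) (\<lambda>x. (z 0 w x)\<^sup>2) \<partial>M)
            \<le> C * ((\<integral>w. (LINT t:{0..T}|lborel. mesh_integral N (mesh N) (\<lambda>x. (Z t w x)\<^sup>2)) \<partial>M)
                 + (\<integral>w. (LINT t:{0..T}|lborel. mesh_integral N (\<omega> \<inter> mesh N) (\<lambda>x. (z t w x)\<^sup>2)) \<partial>M)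
                 + exp (- C1 / mesh_size N)
                     * (\<integral>w. mesh_integral N (mesh N) (\<lambda>x. (zT w x)\<^sup>2) \<partial>M))))"
proof -
  interpret brownian_space M B by fact
  \<comment> \<open>No sign is assumed for \<open>K\<close>, while the estimates need a nonnegative
    bound.\<close>
  define K' where "K' = \<bar>K\<bar>"
  have K': "0 \<le> K'" "K \<le> K'" by (auto simp: K'_def)
  obtain m where m: "m \<in> \<omega>" using assms(4) by blast
  obtain e where e: "0 < e" "ball m e \<subseteq> \<omega>" using assms(3) m open_contains_ball by blast
  \<comment> \<open>The closed interval of radius \<open>4 * r = e / 2\<close> around
    \<open>m\<close> then lies inside the ball contained in \<open>\<omega>\<close>.\<close>
  define r where "r = e / 8"
  have r: "0 < r" using e by (simp add: r_def)
  have near: "x \<in> \<omega>" if "\<bar>x - m\<bar> \<le> 4 * r" for x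
    using that e by (intro subsetD[OF e(2)]) (auto simp: r_def dist_real_def abs_minus_commute)
  have "m - 4 * r \<in> \<omega>" "m + 4 * r \<in> \<omega>" using r by (auto intro!: near)
  then have mr: "0 < m - 4 * r" "m + 4 * r < 1" using assms(5) by auto
  obtain C h0 where C: "C > 0" "h0 > 0" and det: "\<And>N h p G f. backward_heat N h T K' p G f \<Longrightarrow> h \<le> h0 \<Longrightarrow>
    (\<Sum>i=1..N. (p i 0)\<^sup>2)
     \<le> C * ((LINT t:{0..T}|lborel. (\<Sum>i=1..N. (f i t)\<^sup>2))
        + (LINT t:{0..T}|lborel. (\<Sum>i | i \<in> {1..N} \<and> \<bar>real i * h - m\<bar> \<le> 4 * r. (p i t)\<^sup>2))
        + exp (- 1 / h) * (\<Sum>i=1..N. (p i T)\<^sup>2))"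
    using backward_heat_observability[OF assms(2) K'(1) r mr] by blast
  define C' where "C' = (4 * C * (K'\<^sup>2 + 1) + 2) * (65 + 64 * T)"
  have C': "0 < C'" unfolding C'_def using C assms(2) by (intro mult_pos_pos add_nonneg_pos) auto
  have main: "(\<integral>w. mesh_integral N (mesh N) (\<lambda>x. (z 0 w x)\<^sup>2) \<partial>M)
      \<le> C' * ((\<integral>w. (LINT t:{0..T}|lborel. mesh_integral N (mesh N) (\<lambda>x. (Z t w x)\<^sup>2)) \<partial>M)
           + (\<integral>w. (LINT t:{0..T}|lborel. mesh_integral N (\<omega> \<inter> mesh N) (\<lambda>x. (z t w x)\<^sup>2)) \<partial>M)
           + exp (- 1 / mesh_size N) * (\<integral>w. mesh_integral N (mesh N) (\<lambda>x. (zT w x)\<^sup>2) \<partial>M))"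
    if a1: "Linf_coefficient M (brownian_filtration M B) T a1" "mesh_coefficient_bound M T K a1"
      and a2: "Linf_coefficient M (brownian_filtration M B) T a2" "mesh_coefficient_bound M T K a2"
      and N: "mesh_size N \<le> h0" and zT: "L2_rv M (brownian_filtration M B T) N zT"
      and sol: "backward_solution M (brownian_filtration M B) B T N a1 a2 zT z Z"
    for a1 a2 N zT z Z
  proof -
    let ?F = "brownian_filtration M B" and ?LM = "time_measure T \<Otimes>\<^sub>M M"
    define h where "h = mesh_size N"
    have h: "0 < h" by (simp add: h_def mesh_size_pos)
    have mono: "mesh_coefficient_bound M T K' a" if "mesh_coefficient_bound M T K a" for a
      unfolding mesh_coefficient_bound_def
    proof
      fix n
      have "AE (t, w) in ?LM. \<forall>x\<in>mesh n. \<bar>a t w x\<bar> \<le> K" using that unfolding mesh_coefficient_bound_def by blast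
      then show "AE (t, w) in ?LM. \<forall>x\<in>mesh n. \<bar>a t w x\<bar> \<le> K'"
        by eventually_elim (use K' in force)
    qed
    interpret S: bsde_solution M B T K' "mesh_size N" N
      "\<lambda>i t w. max (- K') (min K' (a1 t w (real i * mesh_size N)))"
      "\<lambda>i t w. max (- K') (min K' (a2 t w (real i * mesh_size N)))"
      "\<lambda>i t w. if i \<in> {1..N} then z t w (real i * mesh_size N) else 0"
      "\<lambda>i t w. Z t w (real i * mesh_size N)"
      by (rule backward_solution_bsde[OF assms(2) K'(1) a1(1) mono[OF a1(2)] a2(1) mono[OF a2(2)] sol])
    define A where "A = {i. i \<in> {1..N} \<and> \<bar>real i * h - m\<bar> \<le> 4 * r}"
    define E where "E = exp (- 1 / h)"
    have E: "0 \<le> E" by (simp add: E_def)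
    define Zf where "Zf t w = mesh_integral N (mesh N) (\<lambda>x. (Z t w x)\<^sup>2)" for t w
    define Nf where "Nf t w = mesh_integral N (\<omega> \<inter> mesh N) (\<lambda>x. (z t w x)\<^sup>2)" for t w
    define U where "U w = mesh_integral N (mesh N) (\<lambda>x. (z 0 w x)\<^sup>2)" for w
    define V where "V w = mesh_integral N (mesh N) (\<lambda>x. (zT w x)\<^sup>2)" for w
    have nn: "0 \<le> Zf t w" "0 \<le> Nf t w" "0 \<le> U w" "0 \<le> V w" for t w
      unfolding Zf_def Nf_def U_def V_def by (auto intro: mesh_integral_nonneg)
    note sol' = sol[unfolded backward_solution_def]
    note solz = conjunct1[OF sol', unfolded L2_continuous_process_def]
    note solZ = conjunct1[OF conjunct2[OF sol'], unfolded L2_process_def]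
    have adm: "(\<lambda>y. f (fst y) (snd y)) \<in> borel_measurable ?LM" if "adapted_process M ?F T f" for f
      using that unfolding adapted_process_def by (simp add: case_prod_beta')
    have zm: "(\<lambda>y. z (fst y) (snd y) x) \<in> borel_measurable ?LM" if "x \<in> mesh N" for x
      by (rule adm) (rule bspec[OF conjunct1[OF solz] that])
    have Zm: "(\<lambda>y. Z (fst y) (snd y) x) \<in> borel_measurable ?LM" if "x \<in> mesh N" for x
      by (rule adm) (rule bspec[OF conjunct1[OF solZ] that])
    have Zfm: "(\<lambda>y. Zf (fst y) (snd y)) \<in> borel_measurable ?LM"
      unfolding Zf_def mesh_integral_def by (intro borel_measurable_times borel_measurable_const borel_measurable_sum borel_measurable_power Zm)
    have Nfm: "(\<lambda>y. Nf (fst y) (snd y)) \<in> borel_measurable ?LM"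
      unfolding Nf_def mesh_integral_def by (intro borel_measurable_times borel_measurable_const borel_measurable_sum borel_measurable_power zm) auto
    have t0: "0 \<in> {0..T}" "T \<in> {0..T}" using assms(2) by auto
    have zmt: "(\<lambda>w. z t w x) \<in> borel_measurable M" if "t \<in> {0..T}" "x \<in> mesh N" for t x
      by (rule S.time_section[OF that(1) zm[OF that(2)]])
    have Um: "U \<in> borel_measurable M"
      unfolding U_def mesh_integral_def by (intro borel_measurable_times borel_measurable_const borel_measurable_sum borel_measurable_power zmt t0)
    have Vm: "V \<in> borel_measurable M" unfolding V_def mesh_integral_def
    proof (intro borel_measurable_times borel_measurable_const borel_measurable_sum borel_measurable_power)
      fix x assume "x \<in> mesh N"
      then have "(\<lambda>w. zT w x) \<in> borel_measurable (?F T)" using zT unfolding L2_rv_def by blast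
      then show "(\<lambda>w. zT w x) \<in> borel_measurable M" by (rule brownian_filtration_measurable)
    qed
    \<comment> \<open>A Bochner integral of a nonintegrable function is 0, so a divergent right side
      would turn the estimate into a stronger claim. Finiteness is therefore proved for every term;
      for those containing \<open>z\<close> it comes from this supremum.\<close>
    define Sp where "Sp w = (SUP t\<in>{0..T}. ennreal (mesh_integral N (mesh N) (\<lambda>x. (z t w x)\<^sup>2)))" for w
    have Spfin: "(\<integral>\<^sup>+w. Sp w \<partial>M) < \<infinity>" unfolding Sp_def by (rule conjunct2[OF conjunct2[OF solz]])
    have Zfin: "(\<integral>\<^sup>+y. ennreal (Zf (fst y) (snd y)) \<partial>?LM) < \<infinity>"
      using nn_integral_time_measure[of "\<lambda>y. ennreal (Zf (fst y) (snd y))" T] Zfm conjunct2[OF solZ] by (simp add: Zf_def)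
    have Ufin: "(\<integral>\<^sup>+w. ennreal (U w) \<partial>M) < \<infinity>"
    proof (rule le_less_trans[OF nn_integral_mono Spfin])
      show "ennreal (U w) \<le> Sp w" for w unfolding U_def Sp_def by (rule SUP_upper[OF t0(1)])
    qed
    have Vfin: "(\<integral>\<^sup>+w. ennreal (V w) \<partial>M) < \<infinity>" using zT unfolding L2_rv_def V_def by blast
    have Nfin: "(\<integral>\<^sup>+y. ennreal (Nf (fst y) (snd y)) \<partial>?LM) < \<infinity>"
    proof -
      have fm: "(\<lambda>y. ennreal (Nf (fst y) (snd y) / T)) \<in> borel_measurable ?LM" using Nfm by measurable
      have "(\<integral>\<^sup>+y. ennreal (Nf (fst y) (snd y) / T) \<partial>?LM) = (\<integral>\<^sup>+w. (\<integral>\<^sup>+t\<in>{0..T}. ennreal (Nf t w / T) \<partial>lborel) \<partial>M)"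
        using nn_integral_time_measure[OF fm] by simp
      also have "\<dots> \<le> (\<integral>\<^sup>+w. Sp w \<partial>M)"
      proof (rule nn_integral_mono)
        fix w
        have "(\<integral>\<^sup>+t\<in>{0..T}. ennreal (Nf t w / T) \<partial>lborel) \<le> (\<integral>\<^sup>+t. ennreal (1 / T) * Sp w * indicator {0..T} t \<partial>lborel)"
        proof (rule nn_integral_mono)
          fix t :: real
          show "ennreal (Nf t w / T) * indicator {0..T} t \<le> ennreal (1 / T) * Sp w * indicator {0..T} t"
          proof (cases "t \<in> {0..T}")
            case True
            have "Nf t w \<le> mesh_integral N (mesh N) (\<lambda>x. (z t w x)\<^sup>2)"
              unfolding Nf_def mesh_integral_def using mesh_size_pos[of N] finite_mesh by (intro mult_left_mono sum_mono2) auto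
            then have "ennreal (Nf t w) \<le> Sp w" unfolding Sp_def
              by (intro order_trans[OF ennreal_leI SUP_upper[OF True]])
            then have "ennreal (1 / T) * ennreal (Nf t w) \<le> ennreal (1 / T) * Sp w" by (intro mult_left_mono) auto
            moreover have "ennreal (Nf t w / T) = ennreal (1 / T) * ennreal (Nf t w)"
              using assms(2) nn(2) by (simp add: ennreal_mult[symmetric])
            ultimately show ?thesis by (simp add: mult_right_mono)
          qed simp
        qed
        also have "\<dots> = ennreal (1 / T) * Sp w * ennreal T"
          using assms(2) by (simp add: nn_integral_cmult_indicator)
        also have "\<dots> = Sp w"
        proof -
          have "ennreal (1 / T) * ennreal T = 1" using assms(2) by (simp add: ennreal_mult[symmetric])
          then show ?thesis by (metis mult.commute mult.assoc mult.right_neutral)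
        qed
        finally show "(\<integral>\<^sup>+t\<in>{0..T}. ennreal (Nf t w / T) \<partial>lborel) \<le> Sp w" .
      qed
      finally have fin: "(\<integral>\<^sup>+y. ennreal (Nf (fst y) (snd y) / T) \<partial>?LM) < \<infinity>" using Spfin by (rule le_less_trans)
      have "(\<integral>\<^sup>+y. ennreal (Nf (fst y) (snd y)) \<partial>?LM) = (\<integral>\<^sup>+y. ennreal T * ennreal (Nf (fst y) (snd y) / T) \<partial>?LM)"
        using assms(2) nn(2) by (intro nn_integral_cong) (simp add: ennreal_mult[symmetric])
      also have "\<dots> = ennreal T * (\<integral>\<^sup>+y. ennreal (Nf (fst y) (snd y) / T) \<partial>?LM)" by (rule nn_integral_cmult[OF fm])
      finally show ?thesis using fin by (simp add: ennreal_mult_less_top)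
    qed
    have scale: "ennreal h * (\<integral>\<^sup>+y. ennreal (f y) \<partial>Q) = (\<integral>\<^sup>+y. ennreal (h * f y) \<partial>Q)"
      if "f \<in> borel_measurable Q" "\<And>y. 0 \<le> f y" for f :: "'b \<Rightarrow> real" and Q
      using that h by (subst nn_integral_cmult[symmetric]) (auto simp: ennreal_mult)
    let ?\<zeta> = "\<lambda>i t w. if i \<in> {1..N} then z t w (real i * mesh_size N) else 0"
    have node: "real i * h \<in> mesh N" if "i \<in> {1..N}" for i using mesh_node[OF that] by (simp add: h_def)
    have key: "(\<integral>\<^sup>+w. ennreal (\<Sum>i=1..N. (z 0 w (real i * h))\<^sup>2) \<partial>M) \<le> ennreal C' *
     ((\<integral>\<^sup>+y. ennreal (\<Sum>i=1..N. (Z (fst y) (snd y) (real i * h))\<^sup>2) \<partial>?LM)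
      + (\<integral>\<^sup>+y. ennreal (\<Sum>i\<in>A. (z (fst y) (snd y) (real i * h))\<^sup>2) \<partial>?LM)
      + ennreal E * (\<integral>\<^sup>+w. ennreal (\<Sum>i=1..N. (z T w (real i * h))\<^sup>2) \<partial>M))"
    proof -
      have s1: "(\<Sum>i=1..N. (?\<zeta> i t w)\<^sup>2) = (\<Sum>i=1..N. (z t w (real i * h))\<^sup>2)" for t w
        by (intro sum.cong) (auto simp: h_def)
      have s2: "(\<Sum>i\<in>A. (?\<zeta> i t w)\<^sup>2) = (\<Sum>i\<in>A. (z t w (real i * h))\<^sup>2)" for t w
        by (intro sum.cong) (auto simp: h_def A_def)
      have "A \<subseteq> {1..N}" by (auto simp: A_def)
      moreover have "(\<Sum>i=1..N. (p i 0)\<^sup>2)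
        \<le> C * ((LINT t:{0..T}|lborel. (\<Sum>i=1..N. (f i t)\<^sup>2)) + (LINT t:{0..T}|lborel. (\<Sum>i\<in>A. (p i t)\<^sup>2))
        + E * (\<Sum>i=1..N. (p i T)\<^sup>2))" if "backward_heat N (mesh_size N) T K' p G f" for p G f
        using det[OF that N] unfolding A_def E_def h_def .
      ultimately show ?thesis
        using S.expectation_observability[of C A E] C E unfolding s1 s2 C'_def h_def by simp
    qed
    have U: "(\<integral>\<^sup>+w. ennreal (U w) \<partial>M) = ennreal h * (\<integral>\<^sup>+w. ennreal (\<Sum>i=1..N. (z 0 w (real i * h))\<^sup>2) \<partial>M)"
      unfolding U_def mesh_integral_eq h_def[symmetric]
      by (rule scale[symmetric]) (auto intro!: borel_measurable_sum borel_measurable_power zmt t0 node sum_nonneg)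
    have Zs: "ennreal h * (\<integral>\<^sup>+y. ennreal (\<Sum>i=1..N. (Z (fst y) (snd y) (real i * h))\<^sup>2) \<partial>?LM) = (\<integral>\<^sup>+y. ennreal (Zf (fst y) (snd y)) \<partial>?LM)"
      unfolding Zf_def mesh_integral_eq h_def[symmetric]
      by (rule scale) (auto intro!: borel_measurable_sum borel_measurable_power Zm node sum_nonneg)
    \<comment> \<open>The estimate observes only the nodes within \<open>4 * r\<close> of
      \<open>m\<close>; enlarging them to all mesh points in \<open>\<omega>\<close> increases the
      integral.\<close>
    have Ns: "ennreal h * (\<integral>\<^sup>+y. ennreal (\<Sum>i\<in>A. (z (fst y) (snd y) (real i * h))\<^sup>2) \<partial>?LM) \<le> (\<integral>\<^sup>+y. ennreal (Nf (fst y) (snd y)) \<partial>?LM)"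
    proof -
      have "ennreal h * (\<integral>\<^sup>+y. ennreal (\<Sum>i\<in>A. (z (fst y) (snd y) (real i * h))\<^sup>2) \<partial>?LM)
        = (\<integral>\<^sup>+y. ennreal (h * (\<Sum>i\<in>A. (z (fst y) (snd y) (real i * h))\<^sup>2)) \<partial>?LM)"
        by (rule scale) (auto intro!: borel_measurable_sum borel_measurable_power zm node sum_nonneg simp: A_def)
      also have "\<dots> \<le> (\<integral>\<^sup>+y. ennreal (Nf (fst y) (snd y)) \<partial>?LM)"
      proof (intro nn_integral_mono ennreal_leI)
        fix y
        have inj: "inj_on (\<lambda>i. real i * h) A" using h by (intro inj_onI) simp
        have "(\<Sum>i\<in>A. (z (fst y) (snd y) (real i * h))\<^sup>2) = (\<Sum>x\<in>(\<lambda>i. real i * h) ` A. (z (fst y) (snd y) x)\<^sup>2)"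
          by (simp add: sum.reindex[OF inj])
        also have "\<dots> \<le> (\<Sum>x\<in>\<omega> \<inter> mesh N. (z (fst y) (snd y) x)\<^sup>2)"
          using finite_mesh near node by (intro sum_mono2) (auto simp: A_def)
        finally show "h * (\<Sum>i\<in>A. (z (fst y) (snd y) (real i * h))\<^sup>2) \<le> Nf (fst y) (snd y)"
          unfolding Nf_def mesh_integral_def h_def[symmetric] using h by (intro mult_left_mono) auto
      qed
      finally show ?thesis .
    qed
    have Vs: "ennreal h * (\<integral>\<^sup>+w. ennreal (\<Sum>i=1..N. (z T w (real i * h))\<^sup>2) \<partial>M) = (\<integral>\<^sup>+w. ennreal (V w) \<partial>M)"
    proof -
      have "ennreal h * (\<integral>\<^sup>+w. ennreal (\<Sum>i=1..N. (z T w (real i * h))\<^sup>2) \<partial>M)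
        = (\<integral>\<^sup>+w. ennreal (h * (\<Sum>i=1..N. (z T w (real i * h))\<^sup>2)) \<partial>M)"
        by (rule scale) (auto intro!: borel_measurable_sum borel_measurable_power zmt t0 node sum_nonneg)
      also have "\<dots> = (\<integral>\<^sup>+w. ennreal (V w) \<partial>M)"
      proof (rule nn_integral_cong_AE)
        have "\<forall>x\<in>mesh N. AE w in M. z T w x = zT w x" using sol' by blast
        then have "AE w in M. \<forall>x\<in>mesh N. z T w x = zT w x" using finite_mesh by (intro AE_finite_allI) auto
        then show "AE w in M. ennreal (h * (\<Sum>i=1..N. (z T w (real i * h))\<^sup>2)) = ennreal (V w)"
        proof eventually_elim
          case (elim w)
          then have "(\<Sum>i=1..N. (z T w (real i * h))\<^sup>2) = (\<Sum>i=1..N. (zT w (real i * h))\<^sup>2)"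
            using node by (intro sum.cong) auto
          then show ?case unfolding V_def mesh_integral_eq h_def[symmetric] by simp
        qed
      qed
      finally show ?thesis .
    qed
    define ZI where "ZI = (\<integral>w. (LINT t:{0..T}|lborel. Zf t w) \<partial>M)"
    define NI where "NI = (\<integral>w. (LINT t:{0..T}|lborel. Nf t w) \<partial>M)"
    have ZI: "ennreal ZI = (\<integral>\<^sup>+y. ennreal (Zf (fst y) (snd y)) \<partial>?LM)"
      unfolding ZI_def by (rule ennreal_double_integral[OF Zfm nn(1) Zfin])
    have NI: "ennreal NI = (\<integral>\<^sup>+y. ennreal (Nf (fst y) (snd y)) \<partial>?LM)"
      unfolding NI_def by (rule ennreal_double_integral[OF Nfm nn(2) Nfin])
    have real: "(\<integral>\<^sup>+w. ennreal (f w) \<partial>M) = ennreal (\<integral>w. f w \<partial>M)"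
      if "f \<in> borel_measurable M" "\<And>w. 0 \<le> f w" "(\<integral>\<^sup>+w. ennreal (f w) \<partial>M) < \<infinity>" for f
      by (rule nn_integral_eq_integral) (use that in \<open>auto intro: integrableI_nonneg\<close>)
    have pos: "0 \<le> ZI" "0 \<le> NI" "0 \<le> (\<integral>w. V w \<partial>M)"
      using nn unfolding ZI_def NI_def set_lebesgue_integral_def
      by (auto intro!: Bochner_Integration.integral_nonneg)
    have "ennreal (\<integral>w. U w \<partial>M) \<le> ennreal h * (ennreal C' *
       ((\<integral>\<^sup>+y. ennreal (\<Sum>i=1..N. (Z (fst y) (snd y) (real i * h))\<^sup>2) \<partial>?LM)
        + (\<integral>\<^sup>+y. ennreal (\<Sum>i\<in>A. (z (fst y) (snd y) (real i * h))\<^sup>2) \<partial>?LM)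
        + ennreal E * (\<integral>\<^sup>+w. ennreal (\<Sum>i=1..N. (z T w (real i * h))\<^sup>2) \<partial>M)))"
      unfolding real[OF Um nn(3) Ufin, symmetric] U by (intro mult_left_mono key) auto
    also have "\<dots> = ennreal C' *
       (ennreal h * (\<integral>\<^sup>+y. ennreal (\<Sum>i=1..N. (Z (fst y) (snd y) (real i * h))\<^sup>2) \<partial>?LM)
        + ennreal h * (\<integral>\<^sup>+y. ennreal (\<Sum>i\<in>A. (z (fst y) (snd y) (real i * h))\<^sup>2) \<partial>?LM)
        + ennreal E * (ennreal h * (\<integral>\<^sup>+w. ennreal (\<Sum>i=1..N. (z T w (real i * h))\<^sup>2) \<partial>M)))"
      by (simp only: distrib_left mult_ac)
    also have "\<dots> \<le> ennreal C' * (ennreal ZI + ennreal NI + ennreal E * ennreal (\<integral>w. V w \<partial>M))"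
      unfolding Zs Vs ZI NI real[OF Vm nn(4) Vfin, symmetric] by (intro mult_left_mono add_mono Ns order_refl) auto
    also have "\<dots> = ennreal (C' * (ZI + NI + E * (\<integral>w. V w \<partial>M)))"
      using pos E C' by (simp add: ennreal_mult ennreal_plus)
    finally have "(\<integral>w. U w \<partial>M) \<le> C' * (ZI + NI + E * (\<integral>w. V w \<partial>M))"
      using pos E C' by (subst (asm) ennreal_le_iff) (auto intro!: mult_nonneg_nonneg add_nonneg_nonneg)
    then show ?thesis unfolding U_def ZI_def NI_def V_def Zf_def Nf_def E_def h_def .
  qed
  show ?thesis
    \<comment> \<open>\<open>C1 = 1\<close> is the rate left after one of the two factors
      \<open>exp (- 1 / h)\<close> was spent on the powers of \<open>h\<close> at the end
      times.\<close>
    by (rule exI[of _ h0], rule exI[of _ C'], rule exI[of _ 1]) (use C C' main in simp)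
qed

end
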